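(* Let $X$ be a connected, locally compact, $\sigma$-compact metrizable space with a good base $K$ (a base of relatively compact, simply connected open subsets, ordered under inclusion), and let $(\mathcal{A},\jmath)_K$ be a net of $\mathrm{C}^*$-algebras over $K$ with associated $C_0(X)$-algebra $\mathscr{A}$. Then any Fredholm $(\mathcal{A},\jmath)_K$-module $(\pi,U;F)$ defines a cycle in the representable $K$-homology $RK^0(\mathscr{A})$: the pair $(\pi^\tau,\widehat{F})$ is a Kasparov $\mathscr{A}$-$C_0(X)$-bimodule (with grading on the Hilbert $C_0(X)$-module given by $\widehat\Gamma$ in the even case).
   Context: Nets. A net of $\mathrm{C}^*$-algebras $(\mathcal{A},\jmath)_K$ is a family of unital $\mathrm{C}^*$-algebras $\mathcal{A}_Y$, $Y\in K$, with unital $*$-monomorphisms $\jmath_{Y'Y}:\mathcal{A}_Y\to\mathcal{A}_{Y'}$ for $Y\subseteq Y'$ such that $\jmath_{Y''Y'}\circ\jmath_{Y'Y}=\jmath_{Y''Y}$. A morphism of nets $\phi:(\mathcal{A},\jmath)_K\to(\mathcal{B},y)_K$ is a family of $*$-morphisms $\phi_Y:\mathcal{A}_Y\to\mathcal{B}_Y$ with $\phi_{Y'}\circ\jmath_{Y'Y}=y_{Y'Y}\circ\phi_Y$. A Hilbert net bundle $(\mathcal{H},U)_K$ is a family of Hilbert spaces $\mathcal{H}_Y$ with unitaries $U_{Y'Y}:\mathcal{H}_Y\to\mathcal{H}_{Y'}$, $Y\subseteq Y'$, satisfying $U_{Y''Y'}U_{Y'Y}=U_{Y''Y}$; $(\mathcal{BH},\mathrm{ad}U)_K$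 is the net with fibres $B(\mathcal{H}_Y)$ and inclusions $\mathrm{ad}U_{Y'Y}$. A representation of $(\mathcal{A},\jmath)_K$ on $(\mathcal{H},U)_K$ is a morphism of nets $\pi:(\mathcal{A},\jmath)_K\to(\mathcal{BH},\mathrm{ad}U)_K$. A section of a net is a family $T=\{T_Y\in\mathcal{A}_Y\}$ with $T_{Y'}=\jmath_{Y'Y}(T_Y)$ for $Y\subseteq Y'$. Fredholm modules. $(\mathcal{A},\jmath)_K$ is graded if endowed with a net automorphism $\beta$ of period 2; $(\mathcal{H},U)_K$ is graded if endowed with a section $\Gamma=\{\Gamma_Y\}$ of $(\mathcal{BH},\mathrm{ad}U)_K$ by self-adjoint unitaries, and then $\gamma_Y:=\mathrm{ad}\Gamma_Y$; $\pi$ is graded if $\gamma_Y\circ\pi_Y=\pi_Y\circ\beta_Y$ for all $Y$. An even (resp. odd) Fredholm module over the graded (resp. ungraded) net $(\mathcal{A},\jmath)_K$ is a triple $(\pi,U;F)$ where (i) $\pi$ is a nondegenerate graded (resp. ungraded) representation on a Hilbert net bundle $(\mathcal{H},U)_K$, having a grading $\Gamma$ in the even case; (ii) $F=\{F_Y\}$ is a section of $(\mathcal{BH},\mathrm{ad}U)_K$ with, in the even case, $\gamma_Y(F_Y)=-F_Y$, and such that $F_Y=F_Y^*$ and $F_Y^2-1_Y$, $[F_Y,\pi_Y(t)]\in K(\mathcal{H}_Y)$ (compact operators) for all $Y\in K$, $t\in\mathcal{A}_Y$. The algebra $\mathscr{A}$. A $C_0(X)$-algebra is a $\mathrm{C}^*$-algebra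 $\mathscr{B}$ with a nondegenerate $*$-morphism from $C_0(X)$ to the centre of $M\mathscr{B}$; a $C_0(X)$-morphism is a $C_0(X)$-linear $*$-morphism. For $x\in X$ let $\omega_x:=\{Y\in K:x\in Y\}$ and let $\mathcal{A}_x$ be the universal $\mathrm{C}^*$-algebra of $(\mathcal{A},\jmath)_{\omega_x}$: it has $*$-morphisms $\epsilon^x_Y:\mathcal{A}_Y\to\mathcal{A}_x$, $Y\in\omega_x$, with $\epsilon^x_{Y'}\circ\jmath_{Y'Y}=\epsilon^x_Y$, through which every compatible family of $*$-morphisms from the $\mathcal{A}_Y$, $Y\in\omega_x$, into a $\mathrm{C}^*$-algebra factors uniquely. For $t\in\mathcal{A}_Y$ let $\widehat{\epsilon}_Y(t)\in\prod_x\mathcal{A}_x$ (bounded fields, sup-norm) be $\epsilon^x_Y(t)$ at $x\in Y$ and $0$ elsewhere. $\mathscr{A}$ is the norm closure of the $*$-algebra generated by the fields $f\,\widehat{\epsilon}_Y(t)$, $Y\in K$, $f\in C_0(Y)$, $t\in\mathcal{A}_Y$; it is a $C_0(X)$-algebra under pointwise multiplication. A net morphism $\phi:(\mathcal{A},\jmath)_K\to(\mathcal{B},y)_K$ induces a $C_0(X)$-morphism $\phi^\tau:\mathscr{A}\to\mathscr{B}$ between the associated $C_0(X)$-algebras, determined by $\phi^\tau(f\,\widehat{\epsilon}_Y(t))=f\,\widehat{\epsilon'}_Y(\phi_Y(t))$, where $\widehat{\epsilon'}$ refers to $\mathscr{B}$. In particular $\beta^\tau$ is a grading of $\mathscr{A}$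 in the even case. The Hilbert module. A Hilbert net bundle $(\mathcal{H},U)_K$ defines a locally constant Hilbert bundle $\mathscr{H}\to X$: its fibre $\mathscr{H}_x$ has unitaries $V^x_Y:\mathcal{H}_Y\to\mathscr{H}_x$, $Y\in\omega_x$, with $V^x_{Y'}U_{Y'Y}=V^x_Y$ for $Y\subseteq Y'$, and the topology is such that for each $Y\in K$ the map $Y\times\mathcal{H}_Y\ni(x,h)\mapsto V^x_Yh$ is a local trivialization. Let $\tilde{\mathscr{H}}$ be the Hilbert $C_0(X)$-module of continuous sections of $\mathscr{H}$ vanishing at infinity (with coinciding left and right $C_0(X)$-actions), $\mathscr{B}\tilde{\mathscr{H}}$ the $\mathrm{C}^*$-algebra of its adjointable operators, $\mathscr{K}\tilde{\mathscr{H}}$ the ideal of compact module operators, and $\mathscr{BH}:=C_0(X)\mathscr{B}\tilde{\mathscr{H}}$. The $C_0(X)$-algebra associated with the net $(\mathcal{BH},\mathrm{ad}U)_K$ is identified with $\mathscr{BH}$, with $\epsilon'^x_Y=\mathrm{ad}V^x_Y:B(\mathcal{H}_Y)\to B(\mathscr{H}_x)$. So $\pi$ induces $\pi^\tau:\mathscr{A}\to\mathscr{BH}\subseteq\mathscr{B}\tilde{\mathscr{H}}$. A section $T$ of $(\mathcal{BH},\mathrm{ad}U)_K$ defines the operator $\widehat T\in\mathscr{B}\tilde{\mathscr{H}}$ acting fibrewise by $\widehat T_x:=\epsilon'^x_Y(T_Y)$, independently of $Y\in\omega_x$; this defines $\widehat F$ and $\widehat\Gamma$. Kasparov bimodules.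 A grading on a $C_0(X)$-algebra is a $C_0(X)$-automorphism of period 2 (possibly trivial); $C_0(X)$ is trivially graded. A Hilbert $C_0(X)$-module $H$ is graded by a linear map $\Gamma:H\to H$ with $\Gamma(vb)=(\Gamma v)b$ and $(\Gamma v,\Gamma w)=(v,w)$ (possibly trivial); $B(H)$ is then graded by $\mathrm{ad}\Gamma$. A Kasparov $\mathscr{A}$-$C_0(X)$-bimodule is a pair $(\eta,\phi)$ where $\eta:\mathscr{A}\to B(H)$ is a graded representation (i.e. intertwining the gradings) by adjointable operators on a graded Hilbert $C_0(X)$-bimodule $H$, with $\eta(fa)vb=\eta(a)v(fb)$ for $v\in H$, $a\in\mathscr{A}$, $b,f\in C_0(X)$, and $\phi\in B(H)$ satisfies $(\phi-\phi^* )\eta(t),\ (\phi^2-1)\eta(t),\ [\phi,\eta(t)]\in K(H)$ for all $t\in\mathscr{A}$, $K(H)$ being the compact module operators. $RK^0(\mathscr{A}):=RKK(X;\mathscr{A},C_0(X))$ is the group of homotopy classes of Kasparov $\mathscr{A}$-$C_0(X)$-bimodules, and a cycle is such a bimodule. *)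

theory Defs
  imports "HOL-Analysis.Analysis" "HOL-Algebra.Module"
begin

section \<open>Normed complex vector spaces on carriers\<close>

text \<open>
  The members of a net (and the fibres of a bundle) are distinct algebras or Hilbert spaces, so all
  objects are carrier-based. Complex vector spaces are modules over \<open>complex_ring\<close> in the sense of
  HOL-Algebra; as usual there, the multiplicative fields of the record of a mere vector space are
  irrelevant.
\<close>

definition complex_ring :: "complex ring" where
  "complex_ring = \<lparr>carrier = UNIV, monoid.mult = (*), one = 1, zero = 0, add = (+)\<rparr>"

lemma complex_ring_cring: "cring complex_ring"
  by (intro cringI abelian_groupI comm_monoidI)
     (auto simp: complex_ring_def algebra_simps intro: exI[of _ "- _"] add.left_inverse)

record 'a star_alg = "(complex, 'a) module" +
  star :: "'a \<Rightarrow> 'a"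
  nrm :: "'a \<Rightarrow> real"

record ('b, 'h) ip_module = "(complex, 'h) module" +
  ip :: "'h \<Rightarrow> 'h \<Rightarrow> 'b"

record ('b, 'h) ip_bimodule = "('b, 'h) ip_module" +
  ract :: "'h \<Rightarrow> 'b \<Rightarrow> 'h"
  lact :: "'b \<Rightarrow> 'h \<Rightarrow> 'h"

text \<open>Cut off outside the carrier, because \<^locale>\<open>Metric_space\<close> asks for symmetry and
  nonnegativity on the whole type.\<close>

definition norm_dist :: "('r, 'a, 'm) module_scheme \<Rightarrow> ('a \<Rightarrow> real) \<Rightarrow> 'a \<Rightarrow> 'a \<Rightarrow> real" where
  "norm_dist M n x y = (if x \<in> carrier M \<and> y \<in> carrier M then n (x \<ominus>\<^bsub>M\<^esub> y) else 0)"

definition norm_topology :: "('r, 'a, 'm) module_scheme \<Rightarrow> ('a \<Rightarrow> real) \<Rightarrow> 'a topology" where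
  "norm_topology M n = Metric_space.mtopology (carrier M) (norm_dist M n)"

definition norm_complete :: "('r, 'a, 'm) module_scheme \<Rightarrow> ('a \<Rightarrow> real) \<Rightarrow> bool" where
  "norm_complete M n \<longleftrightarrow> Metric_space.mcomplete (carrier M) (norm_dist M n)"

definition lin_span :: "(complex, 'a, 'm) module_scheme \<Rightarrow> 'a set \<Rightarrow> 'a set" where
  "lin_span M S = \<Inter> {W. submodule W complex_ring M \<and> S \<subseteq> W}"

definition closed_span :: "(complex, 'a, 'm) module_scheme \<Rightarrow> ('a \<Rightarrow> real) \<Rightarrow> 'a set \<Rightarrow> 'a set" where
  "closed_span M n S = norm_topology M n closure_of lin_span M S"

definition linear_map ::
    "(complex, 'a, 'm) module_scheme \<Rightarrow> (complex, 'b, 'n) module_scheme \<Rightarrow> ('a \<Rightarrow> 'b) \<Rightarrow> bool" where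
  "linear_map M N T \<longleftrightarrow> T \<in> carrier M \<rightarrow> carrier N \<and>
     (\<forall>x\<in>carrier M. \<forall>y\<in>carrier M. T (x \<oplus>\<^bsub>M\<^esub> y) = T x \<oplus>\<^bsub>N\<^esub> T y) \<and>
     (\<forall>c. \<forall>x\<in>carrier M. T (c \<odot>\<^bsub>M\<^esub> x) = c \<odot>\<^bsub>N\<^esub> T x)"


section \<open>C*-algebras\<close>

locale cstar_algebra = Module.module complex_ring A
  for A :: "('a, 'm) star_alg_scheme" (structure) +
  assumes mult_closed: "\<lbrakk>x \<in> carrier A; y \<in> carrier A\<rbrakk> \<Longrightarrow> x \<otimes> y \<in> carrier A"
    and mult_assoc: "\<lbrakk>x \<in> carrier A; y \<in> carrier A; z \<in> carrier A\<rbrakk>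
          \<Longrightarrow> (x \<otimes> y) \<otimes> z = x \<otimes> (y \<otimes> z)"
    and mult_add_left: "\<lbrakk>x \<in> carrier A; y \<in> carrier A; z \<in> carrier A\<rbrakk>
          \<Longrightarrow> (x \<oplus> y) \<otimes> z = (x \<otimes> z) \<oplus> (y \<otimes> z)"
    and mult_add_right: "\<lbrakk>x \<in> carrier A; y \<in> carrier A; z \<in> carrier A\<rbrakk>
          \<Longrightarrow> z \<otimes> (x \<oplus> y) = (z \<otimes> x) \<oplus> (z \<otimes> y)"
    and smult_mult_left: "\<lbrakk>x \<in> carrier A; y \<in> carrier A\<rbrakk> \<Longrightarrow> (c \<odot> x) \<otimes> y = c \<odot> (x \<otimes> y)"
    and smult_mult_right: "\<lbrakk>x \<in> carrier A; y \<in> carrier A\<rbrakk> \<Longrightarrow> x \<otimes> (c \<odot> y) = c \<odot> (x \<otimes> y)"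
    and star_closed: "x \<in> carrier A \<Longrightarrow> star A x \<in> carrier A"
    and star_star: "x \<in> carrier A \<Longrightarrow> star A (star A x) = x"
    and star_add: "\<lbrakk>x \<in> carrier A; y \<in> carrier A\<rbrakk> \<Longrightarrow> star A (x \<oplus> y) = star A x \<oplus> star A y"
    and star_smult: "x \<in> carrier A \<Longrightarrow> star A (c \<odot> x) = cnj c \<odot> star A x"
    and star_mult: "\<lbrakk>x \<in> carrier A; y \<in> carrier A\<rbrakk> \<Longrightarrow> star A (x \<otimes> y) = star A y \<otimes> star A x"
    and nrm_nonneg: "x \<in> carrier A \<Longrightarrow> 0 \<le> nrm A x"
    and nrm_eq_0: "x \<in> carrier A \<Longrightarrow> nrm A x = 0 \<longleftrightarrow> x = \<zero>"
    and nrm_triangle: "\<lbrakk>x \<in> carrier A; y \<in> carrier A\<rbrakk> \<Longrightarrow> nrm A (x \<oplus> y) \<le> nrm A x + nrm A y"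
    and nrm_smult: "x \<in> carrier A \<Longrightarrow> nrm A (c \<odot> x) = cmod c * nrm A x"
    and nrm_mult: "\<lbrakk>x \<in> carrier A; y \<in> carrier A\<rbrakk> \<Longrightarrow> nrm A (x \<otimes> y) \<le> nrm A x * nrm A y"
    and cstar_identity: "x \<in> carrier A \<Longrightarrow> nrm A (star A x \<otimes> x) = (nrm A x)\<^sup>2"
    and complete: "norm_complete A (nrm A)"

locale unital_cstar_algebra = cstar_algebra +
  assumes one_closed: "\<one> \<in> carrier A"
    and one_left: "x \<in> carrier A \<Longrightarrow> \<one> \<otimes> x = x"
    and one_right: "x \<in> carrier A \<Longrightarrow> x \<otimes> \<one> = x"

definition star_hom ::
    "('a, 'm) star_alg_scheme \<Rightarrow> ('b, 'n) star_alg_scheme \<Rightarrow> ('a \<Rightarrow> 'b) \<Rightarrow> bool" where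
  "star_hom A B \<phi> \<longleftrightarrow> linear_map A B \<phi> \<and>
     (\<forall>x\<in>carrier A. \<forall>y\<in>carrier A. \<phi> (x \<otimes>\<^bsub>A\<^esub> y) = \<phi> x \<otimes>\<^bsub>B\<^esub> \<phi> y) \<and>
     (\<forall>x\<in>carrier A. \<phi> (star A x) = star B (\<phi> x))"

definition star_subalgebra :: "'a set \<Rightarrow> ('a, 'm) star_alg_scheme \<Rightarrow> bool" where
  "star_subalgebra S A \<longleftrightarrow> submodule S complex_ring A \<and>
     (\<forall>x\<in>S. \<forall>y\<in>S. x \<otimes>\<^bsub>A\<^esub> y \<in> S) \<and> (\<forall>x\<in>S. star A x \<in> S)"

definition generated_star_subalgebra :: "('a, 'm) star_alg_scheme \<Rightarrow> 'a set \<Rightarrow> 'a set" where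
  "generated_star_subalgebra A G = \<Inter> {S. star_subalgebra S A \<and> G \<subseteq> S}"

subsection \<open>Multipliers (double centralizers)\<close>

definition op_norm :: "'a set \<Rightarrow> ('a \<Rightarrow> real) \<Rightarrow> ('a \<Rightarrow> 'a) \<Rightarrow> real" where
  "op_norm S n T = Inf {c. 0 \<le> c \<and> (\<forall>x\<in>S. n (T x) \<le> c * n x)}"

definition multiplier_algebra ::
    "('a, 'm) star_alg_scheme \<Rightarrow> (('a \<Rightarrow> 'a) \<times> ('a \<Rightarrow> 'a)) star_alg" where
  "multiplier_algebra A = \<lparr>
     carrier = {(L, R). L \<in> carrier A \<rightarrow>\<^sub>E carrier A \<and> R \<in> carrier A \<rightarrow>\<^sub>E carrier A \<and>
                  (\<forall>a\<in>carrier A. \<forall>b\<in>carrier A. a \<otimes>\<^bsub>A\<^esub> L b = R a \<otimes>\<^bsub>A\<^esub> b)},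
     monoid.mult = (\<lambda>(L, R) (L', R'). (\<lambda>a\<in>carrier A. L (L' a), \<lambda>a\<in>carrier A. R' (R a))),
     one = (\<lambda>a\<in>carrier A. a, \<lambda>a\<in>carrier A. a),
     zero = (\<lambda>a\<in>carrier A. \<zero>\<^bsub>A\<^esub>, \<lambda>a\<in>carrier A. \<zero>\<^bsub>A\<^esub>),
     add = (\<lambda>(L, R) (L', R').
              (\<lambda>a\<in>carrier A. L a \<oplus>\<^bsub>A\<^esub> L' a, \<lambda>a\<in>carrier A. R a \<oplus>\<^bsub>A\<^esub> R' a)),
     smult = (\<lambda>c (L, R). (\<lambda>a\<in>carrier A. c \<odot>\<^bsub>A\<^esub> L a, \<lambda>a\<in>carrier A. c \<odot>\<^bsub>A\<^esub> R a)),
     star = (\<lambda>(L, R). (\<lambda>a\<in>carrier A. star A (R (star A a)), \<lambda>a\<in>carrier A. star A (L (star A a)))),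
     nrm = (\<lambda>(L, R). op_norm (carrier A) (nrm A) L)\<rparr>"

definition centre :: "('a, 'm) star_alg_scheme \<Rightarrow> 'a set" where
  "centre A = {z \<in> carrier A. \<forall>x\<in>carrier A. z \<otimes>\<^bsub>A\<^esub> x = x \<otimes>\<^bsub>A\<^esub> z}"

subsection \<open>Algebras over the continuous functions vanishing at infinity\<close>

text \<open>\<open>C0 Y\<close>, for open \<open>Y\<close>; its elements are extended by zero to the whole space.\<close>

definition C0 :: "'x::topological_space set \<Rightarrow> ('x \<Rightarrow> complex) set" where
  "C0 Y = {f. continuous_on Y f \<and>
              (\<forall>e>0. \<exists>C\<subseteq>Y. compact C \<and> (\<forall>x\<in>Y - C. cmod (f x) < e)) \<and>
              (\<forall>x. x \<notin> Y \<longrightarrow> f x = 0)}"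

definition C0_alg :: "('x::topological_space \<Rightarrow> complex) star_alg" where
  "C0_alg = \<lparr>carrier = C0 UNIV, monoid.mult = (\<lambda>f g x. f x * g x), one = (\<lambda>x. 1),
     zero = (\<lambda>x. 0), add = (\<lambda>f g x. f x + g x), smult = (\<lambda>c f x. c * f x),
     star = (\<lambda>f x. cnj (f x)), nrm = (\<lambda>f. SUP x. cmod (f x))\<rparr>"

text \<open>\<open>\<theta>\<close> is the structure morphism into the centre of the multiplier algebra, and \<open>fst (\<theta> f) a\<close>
  is the product of \<open>f\<close> and \<open>a\<close>.\<close>

definition C0_algebra ::
    "('a, 'm) star_alg_scheme \<Rightarrow> (('x::topological_space \<Rightarrow> complex) \<Rightarrow> ('a \<Rightarrow> 'a) \<times> ('a \<Rightarrow> 'a)) \<Rightarrow> bool"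
  where
  "C0_algebra A \<theta> \<longleftrightarrow> cstar_algebra A \<and>
     star_hom C0_alg (multiplier_algebra A) \<theta> \<and>
     (\<forall>f\<in>C0 UNIV. \<theta> f \<in> centre (multiplier_algebra A)) \<and>
     closed_span A (nrm A) {fst (\<theta> f) a | f a. f \<in> C0 UNIV \<and> a \<in> carrier A} = carrier A"

definition C0_morphism where
  "C0_morphism A (\<theta> :: ('x::topological_space \<Rightarrow> complex) \<Rightarrow> ('a \<Rightarrow> 'a) \<times> ('a \<Rightarrow> 'a)) B \<theta>' \<psi> \<longleftrightarrow>
     star_hom A B \<psi> \<and>
     (\<forall>f\<in>C0 UNIV. \<forall>a\<in>carrier A. \<psi> (fst (\<theta> f) a) = fst (\<theta>' f) (\<psi> a))"

definition C0_grading where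
  "C0_grading A \<theta> \<alpha> \<longleftrightarrow> C0_morphism A \<theta> A \<theta> \<alpha> \<and> bij_betw \<alpha> (carrier A) (carrier A) \<and>
     (\<forall>a\<in>carrier A. \<alpha> (\<alpha> a) = a)"


section \<open>Hilbert spaces and Hilbert modules\<close>

text \<open>Inner products are conjugate linear in the first and linear in the second variable.\<close>

definition hnorm :: "(complex, 'h, 'm) ip_module_scheme \<Rightarrow> 'h \<Rightarrow> real" where
  "hnorm H x = sqrt (Re (ip H x x))"

locale hilbert_space = Module.module complex_ring H
  for H :: "(complex, 'h, 'm) ip_module_scheme" (structure) +
  assumes ip_add: "\<lbrakk>x \<in> carrier H; y \<in> carrier H; z \<in> carrier H\<rbrakk>
          \<Longrightarrow> ip H x (y \<oplus> z) = ip H x y + ip H x z"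
    and ip_smult: "\<lbrakk>x \<in> carrier H; y \<in> carrier H\<rbrakk> \<Longrightarrow> ip H x (c \<odot> y) = c * ip H x y"
    and ip_cnj: "\<lbrakk>x \<in> carrier H; y \<in> carrier H\<rbrakk> \<Longrightarrow> ip H y x = cnj (ip H x y)"
    and ip_pos: "x \<in> carrier H \<Longrightarrow> 0 \<le> Re (ip H x x)"
    and ip_definite: "x \<in> carrier H \<Longrightarrow> ip H x x = 0 \<Longrightarrow> x = \<zero>"
    and complete: "norm_complete H (hnorm H)"

definition unitary_map where
  "unitary_map H H' U \<longleftrightarrow> linear_map H H' U \<and> U ` carrier H = carrier H' \<and>
     (\<forall>x\<in>carrier H. \<forall>y\<in>carrier H. ip H' (U x) (U y) = ip H x y)"

text \<open>Operators are extensional functions on the carrier, so that equality of operators is equality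
  of functions.\<close>

definition adjoint_op :: "('b, 'h, 'm) ip_module_scheme \<Rightarrow> ('h \<Rightarrow> 'h) \<Rightarrow> 'h \<Rightarrow> 'h" where
  "adjoint_op E T = (THE S. S \<in> carrier E \<rightarrow>\<^sub>E carrier E \<and>
     (\<forall>v\<in>carrier E. \<forall>w\<in>carrier E. ip E (T v) w = ip E v (S w)))"

definition operator_algebra ::
    "('b, 'h, 'm) ip_module_scheme \<Rightarrow> ('h \<Rightarrow> real) \<Rightarrow> ('h \<Rightarrow> 'h) set \<Rightarrow> ('h \<Rightarrow> 'h) star_alg" where
  "operator_algebra E n Ops = \<lparr>carrier = Ops,
     monoid.mult = (\<lambda>S T. \<lambda>v\<in>carrier E. S (T v)), one = (\<lambda>v\<in>carrier E. v),
     zero = (\<lambda>v\<in>carrier E. \<zero>\<^bsub>E\<^esub>), add = (\<lambda>S T. \<lambda>v\<in>carrier E. S v \<oplus>\<^bsub>E\<^esub> T v),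
     smult = (\<lambda>c T. \<lambda>v\<in>carrier E. c \<odot>\<^bsub>E\<^esub> T v),
     star = adjoint_op E, nrm = op_norm (carrier E) n\<rparr>"

definition bounded_operators :: "(complex, 'h, 'm) ip_module_scheme \<Rightarrow> ('h \<Rightarrow> 'h) star_alg" where
  "bounded_operators H = operator_algebra H (hnorm H)
     {T \<in> carrier H \<rightarrow>\<^sub>E carrier H. linear_map H H T \<and>
        (\<exists>c. \<forall>x\<in>carrier H. hnorm H (T x) \<le> c * hnorm H x)}"

definition compact_operators :: "(complex, 'h, 'm) ip_module_scheme \<Rightarrow> ('h \<Rightarrow> 'h) set" where
  "compact_operators H = {T \<in> carrier (bounded_operators H).
     compactin (norm_topology H (hnorm H))
       (norm_topology H (hnorm H) closure_of (T ` {x \<in> carrier H. hnorm H x \<le> 1}))}"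

definition ad :: "'h set \<Rightarrow> 'k set \<Rightarrow> ('h \<Rightarrow> 'k) \<Rightarrow> ('h \<Rightarrow> 'h) \<Rightarrow> 'k \<Rightarrow> 'k" where
  "ad S S' U T = (\<lambda>v\<in>S'. U (T (inv_into S U v)))"

definition module_norm ::
    "('b, 'm) star_alg_scheme \<Rightarrow> ('b, 'e, 'n) ip_module_scheme \<Rightarrow> 'e \<Rightarrow> real" where
  "module_norm B E v = sqrt (nrm B (ip E v v))"

locale hilbert_module = B: cstar_algebra B + Module.module complex_ring E
  for B :: "('b, 'm) star_alg_scheme" and E :: "('b, 'e, 'n) ip_bimodule_scheme" (structure) +
  assumes ract_closed: "\<lbrakk>v \<in> carrier E; b \<in> carrier B\<rbrakk> \<Longrightarrow> ract E v b \<in> carrier E"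
    and ract_assoc: "\<lbrakk>v \<in> carrier E; b \<in> carrier B; c \<in> carrier B\<rbrakk>
          \<Longrightarrow> ract E (ract E v b) c = ract E v (b \<otimes>\<^bsub>B\<^esub> c)"
    and ract_add_left: "\<lbrakk>v \<in> carrier E; w \<in> carrier E; b \<in> carrier B\<rbrakk>
          \<Longrightarrow> ract E (v \<oplus> w) b = ract E v b \<oplus> ract E w b"
    and ract_add_right: "\<lbrakk>v \<in> carrier E; b \<in> carrier B; c \<in> carrier B\<rbrakk>
          \<Longrightarrow> ract E v (b \<oplus>\<^bsub>B\<^esub> c) = ract E v b \<oplus> ract E v c"
    and ract_smult_left: "\<lbrakk>v \<in> carrier E; b \<in> carrier B\<rbrakk> \<Longrightarrow> ract E (z \<odot> v) b = z \<odot> ract E v b"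
    and ract_smult_right: "\<lbrakk>v \<in> carrier E; b \<in> carrier B\<rbrakk>
          \<Longrightarrow> ract E v (z \<odot>\<^bsub>B\<^esub> b) = z \<odot> ract E v b"
    and ip_closed: "\<lbrakk>v \<in> carrier E; w \<in> carrier E\<rbrakk> \<Longrightarrow> ip E v w \<in> carrier B"
    and ip_add: "\<lbrakk>u \<in> carrier E; v \<in> carrier E; w \<in> carrier E\<rbrakk>
          \<Longrightarrow> ip E u (v \<oplus> w) = ip E u v \<oplus>\<^bsub>B\<^esub> ip E u w"
    and ip_smult: "\<lbrakk>v \<in> carrier E; w \<in> carrier E\<rbrakk> \<Longrightarrow> ip E v (z \<odot> w) = z \<odot>\<^bsub>B\<^esub> ip E v w"
    and ip_ract: "\<lbrakk>v \<in> carrier E; w \<in> carrier E; b \<in> carrier B\<rbrakk>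
          \<Longrightarrow> ip E v (ract E w b) = ip E v w \<otimes>\<^bsub>B\<^esub> b"
    and ip_star: "\<lbrakk>v \<in> carrier E; w \<in> carrier E\<rbrakk> \<Longrightarrow> ip E w v = star B (ip E v w)"
    and ip_pos: "v \<in> carrier E \<Longrightarrow> \<exists>b\<in>carrier B. ip E v v = star B b \<otimes>\<^bsub>B\<^esub> b"
    and ip_definite: "v \<in> carrier E \<Longrightarrow> ip E v v = \<zero>\<^bsub>B\<^esub> \<Longrightarrow> v = \<zero>"
    and complete: "norm_complete E (module_norm B E)"

definition adjointable_operators ::
    "('b, 'm) star_alg_scheme \<Rightarrow> ('b, 'e, 'n) ip_module_scheme \<Rightarrow> ('e \<Rightarrow> 'e) star_alg" where
  "adjointable_operators B E = operator_algebra E (module_norm B E)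
     {T \<in> carrier E \<rightarrow>\<^sub>E carrier E. \<exists>S\<in>carrier E \<rightarrow> carrier E.
        \<forall>v\<in>carrier E. \<forall>w\<in>carrier E. ip E (T v) w = ip E v (S w)}"

definition rank_one :: "('b, 'e, 'n) ip_bimodule_scheme \<Rightarrow> 'e \<Rightarrow> 'e \<Rightarrow> 'e \<Rightarrow> 'e" where
  "rank_one E v w = (\<lambda>u\<in>carrier E. ract E v (ip E w u))"

definition compact_module_operators ::
    "('b, 'm) star_alg_scheme \<Rightarrow> ('b, 'e, 'n) ip_bimodule_scheme \<Rightarrow> ('e \<Rightarrow> 'e) set" where
  "compact_module_operators B E =
     closed_span (adjointable_operators B E) (nrm (adjointable_operators B E))
       {rank_one E v w | v w. v \<in> carrier E \<and> w \<in> carrier E}"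

definition hilbert_bimodule ::
    "('b, 'm) star_alg_scheme \<Rightarrow> ('b, 'e, 'n) ip_bimodule_scheme \<Rightarrow> bool" where
  "hilbert_bimodule B E \<longleftrightarrow> hilbert_module B E \<and>
     star_hom B (adjointable_operators B E) (\<lambda>b. \<lambda>v\<in>carrier E. lact E b v)"

text \<open>\<open>\<Gamma>\<close> is an involution, so that \<open>ad \<Gamma>\<close> is defined and of period 2.\<close>

definition module_grading ::
    "('b, 'm) star_alg_scheme \<Rightarrow> ('b, 'e, 'n) ip_bimodule_scheme \<Rightarrow> ('e \<Rightarrow> 'e) \<Rightarrow> bool" where
  "module_grading B E \<Gamma> \<longleftrightarrow> linear_map E E \<Gamma> \<and>
     (\<forall>v\<in>carrier E. \<Gamma> (\<Gamma> v) = v) \<and>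
     (\<forall>v\<in>carrier E. \<forall>b\<in>carrier B. \<Gamma> (ract E v b) = ract E (\<Gamma> v) b) \<and>
     (\<forall>v\<in>carrier E. \<forall>w\<in>carrier E. ip E (\<Gamma> v) (\<Gamma> w) = ip E v w)"

subsection \<open>Commutators\<close>

text \<open>In graded algebras \<open>[x, y]\<close> may be read as the plain commutator or, as is customary in KK-theory,
  as the graded one: \<open>x y - (-1)^(deg x deg y) y x\<close> on homogeneous elements, extended bilinearly,
  that is \<open>x y - y x + 2 y\<^sub>1 x\<^sub>1\<close> with \<open>x\<^sub>1\<close>, \<open>y\<^sub>1\<close> the odd parts. Both readings are covered: the
  convention is a parameter of the notions below. They agree when \<open>\<gamma>\<close> is the identity.\<close>

datatype commutator_convention = Plain | Graded

definition odd_part :: "('a, 'm) star_alg_scheme \<Rightarrow> ('a \<Rightarrow> 'a) \<Rightarrow> 'a \<Rightarrow> 'a" where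
  "odd_part A \<gamma> x = (1/2) \<odot>\<^bsub>A\<^esub> (x \<ominus>\<^bsub>A\<^esub> \<gamma> x)"

fun commutator ::
    "commutator_convention \<Rightarrow> ('a, 'm) star_alg_scheme \<Rightarrow> ('a \<Rightarrow> 'a) \<Rightarrow> 'a \<Rightarrow> 'a \<Rightarrow> 'a" where
  "commutator Plain A \<gamma> x y = x \<otimes>\<^bsub>A\<^esub> y \<ominus>\<^bsub>A\<^esub> y \<otimes>\<^bsub>A\<^esub> x"
| "commutator Graded A \<gamma> x y =
     (x \<otimes>\<^bsub>A\<^esub> y \<ominus>\<^bsub>A\<^esub> y \<otimes>\<^bsub>A\<^esub> x) \<oplus>\<^bsub>A\<^esub> 2 \<odot>\<^bsub>A\<^esub> (odd_part A \<gamma> y \<otimes>\<^bsub>A\<^esub> odd_part A \<gamma> x)"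

subsection \<open>Kasparov bimodules\<close>

definition kasparov_bimodule ::
    "commutator_convention \<Rightarrow> ('a, 'm) star_alg_scheme \<Rightarrow>
     (('x::topological_space \<Rightarrow> complex) \<Rightarrow> ('a \<Rightarrow> 'a) \<times> ('a \<Rightarrow> 'a)) \<Rightarrow> ('a \<Rightarrow> 'a) \<Rightarrow>
     ('x \<Rightarrow> complex, 'e, 'n) ip_bimodule_scheme \<Rightarrow> ('e \<Rightarrow> 'e) \<Rightarrow>
     ('a \<Rightarrow> 'e \<Rightarrow> 'e) \<Rightarrow> ('e \<Rightarrow> 'e) \<Rightarrow> bool" where
  "kasparov_bimodule cv A \<theta> \<alpha> E \<Gamma> \<eta> \<phi> \<longleftrightarrow>
     (let BE = adjointable_operators C0_alg E; KE = compact_module_operators C0_alg E;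
          \<gamma> = ad (carrier E) (carrier E) \<Gamma> in
      C0_algebra A \<theta> \<and> C0_grading A \<theta> \<alpha> \<and>
      hilbert_bimodule C0_alg E \<and> module_grading C0_alg E \<Gamma> \<and>
      star_hom A BE \<eta> \<and> (\<forall>a\<in>carrier A. \<gamma> (\<eta> a) = \<eta> (\<alpha> a)) \<and>
      (\<forall>f\<in>C0 UNIV. \<forall>b\<in>C0 UNIV. \<forall>a\<in>carrier A. \<forall>v\<in>carrier E.
         ract E (\<eta> (fst (\<theta> f) a) v) b = ract E (\<eta> a v) (f \<otimes>\<^bsub>C0_alg\<^esub> b)) \<and>
      \<phi> \<in> carrier BE \<and>
      (\<forall>t\<in>carrier A. (\<phi> \<ominus>\<^bsub>BE\<^esub> star BE \<phi>) \<otimes>\<^bsub>BE\<^esub> \<eta> t \<in> KE \<and>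
         (\<phi> \<otimes>\<^bsub>BE\<^esub> \<phi> \<ominus>\<^bsub>BE\<^esub> \<one>\<^bsub>BE\<^esub>) \<otimes>\<^bsub>BE\<^esub> \<eta> t \<in> KE \<and>
         commutator cv BE \<gamma> \<phi> (\<eta> t) \<in> KE))"


section \<open>Nets over a good base\<close>

definition good_base :: "'x::topological_space set set \<Rightarrow> bool" where
  "good_base K \<longleftrightarrow> topological_basis K \<and>
     (\<forall>Y\<in>K. compact (closure Y) \<and> simply_connected Y)"

definition sigma_compact :: "'x::topological_space set \<Rightarrow> bool" where
  "sigma_compact S \<longleftrightarrow> (\<exists>C :: nat \<Rightarrow> 'x set. (\<forall>n. compact (C n)) \<and> (\<Union>n. C n) = S)"

text \<open>\<open>j Y' Y\<close> is the inclusion of the algebra over \<open>Y\<close> into the one over \<open>Y'\<close>.\<close>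

definition cstar_net ::
    "'x set set \<Rightarrow> ('x set \<Rightarrow> 'a star_alg) \<Rightarrow> ('x set \<Rightarrow> 'x set \<Rightarrow> 'a \<Rightarrow> 'a) \<Rightarrow> bool" where
  "cstar_net K A j \<longleftrightarrow> (\<forall>Y\<in>K. unital_cstar_algebra (A Y)) \<and>
     (\<forall>Y\<in>K. \<forall>Y'\<in>K. Y \<subseteq> Y' \<longrightarrow> star_hom (A Y) (A Y') (j Y' Y) \<and>
        j Y' Y \<one>\<^bsub>A Y\<^esub> = \<one>\<^bsub>A Y'\<^esub> \<and> inj_on (j Y' Y) (carrier (A Y))) \<and>
     (\<forall>Y\<in>K. \<forall>Y'\<in>K. \<forall>Y''\<in>K. Y \<subseteq> Y' \<longrightarrow> Y' \<subseteq> Y'' \<longrightarrow>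
        (\<forall>t\<in>carrier (A Y). j Y'' Y' (j Y' Y t) = j Y'' Y t))"

definition net_morphism where
  "net_morphism K A j B y \<phi> \<longleftrightarrow> (\<forall>Y\<in>K. star_hom (A Y) (B Y) (\<phi> Y)) \<and>
     (\<forall>Y\<in>K. \<forall>Y'\<in>K. Y \<subseteq> Y' \<longrightarrow>
        (\<forall>t\<in>carrier (A Y). \<phi> Y' (j Y' Y t) = y Y' Y (\<phi> Y t)))"

definition net_grading where
  "net_grading K A j \<beta> \<longleftrightarrow> net_morphism K A j A j \<beta> \<and>
     (\<forall>Y\<in>K. bij_betw (\<beta> Y) (carrier (A Y)) (carrier (A Y)) \<and>
        (\<forall>t\<in>carrier (A Y). \<beta> Y (\<beta> Y t) = t))"

definition net_section where
  "net_section K A j T \<longleftrightarrow> (\<forall>Y\<in>K. T Y \<in> carrier (A Y)) \<and>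
     (\<forall>Y\<in>K. \<forall>Y'\<in>K. Y \<subseteq> Y' \<longrightarrow> T Y' = j Y' Y (T Y))"

subsection \<open>Hilbert net bundles and representations\<close>

definition hilbert_net_bundle ::
    "'x set set \<Rightarrow> ('x set \<Rightarrow> (complex, 'h) ip_module) \<Rightarrow> ('x set \<Rightarrow> 'x set \<Rightarrow> 'h \<Rightarrow> 'h) \<Rightarrow> bool"
  where
  "hilbert_net_bundle K H U \<longleftrightarrow> (\<forall>Y\<in>K. hilbert_space (H Y)) \<and>
     (\<forall>Y\<in>K. \<forall>Y'\<in>K. Y \<subseteq> Y' \<longrightarrow> unitary_map (H Y) (H Y') (U Y' Y)) \<and>
     (\<forall>Y\<in>K. \<forall>Y'\<in>K. \<forall>Y''\<in>K. Y \<subseteq> Y' \<longrightarrow> Y' \<subseteq> Y'' \<longrightarrow>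
        (\<forall>h\<in>carrier (H Y). U Y'' Y' (U Y' Y h) = U Y'' Y h))"

definition BH :: "('x set \<Rightarrow> (complex, 'h) ip_module) \<Rightarrow> 'x set \<Rightarrow> ('h \<Rightarrow> 'h) star_alg" where
  "BH H Y = bounded_operators (H Y)"

definition adU :: "('x set \<Rightarrow> (complex, 'h) ip_module) \<Rightarrow> ('x set \<Rightarrow> 'x set \<Rightarrow> 'h \<Rightarrow> 'h) \<Rightarrow>
    'x set \<Rightarrow> 'x set \<Rightarrow> ('h \<Rightarrow> 'h) \<Rightarrow> 'h \<Rightarrow> 'h" where
  "adU H U Y' Y = ad (carrier (H Y)) (carrier (H Y')) (U Y' Y)"

definition nondegenerate_net_rep where
  "nondegenerate_net_rep K A H \<pi> \<longleftrightarrow> (\<forall>Y\<in>K.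
     closed_span (H Y) (hnorm (H Y)) {\<pi> Y t h | t h. t \<in> carrier (A Y) \<and> h \<in> carrier (H Y)}
       = carrier (H Y))"

text \<open>The conditions common to even and odd Fredholm modules; \<open>\<gamma> Y\<close> is the grading of the bounded
  operators over \<open>Y\<close> (the identity in the odd case).\<close>

definition fredholm_conditions where
  "fredholm_conditions cv K A j H U \<gamma> \<pi> F \<longleftrightarrow>
     hilbert_net_bundle K H U \<and> net_morphism K A j (BH H) (adU H U) \<pi> \<and>
     nondegenerate_net_rep K A H \<pi> \<and> net_section K (BH H) (adU H U) F \<and>
     (\<forall>Y\<in>K. star (BH H Y) (F Y) = F Y \<and>
        F Y \<otimes>\<^bsub>BH H Y\<^esub> F Y \<ominus>\<^bsub>BH H Y\<^esub> \<one>\<^bsub>BH H Y\<^esub> \<in> compact_operators (H Y) \<and>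
        (\<forall>t\<in>carrier (A Y).
           commutator cv (BH H Y) (\<gamma> Y) (F Y) (\<pi> Y t) \<in> compact_operators (H Y)))"

definition odd_fredholm_module where
  "odd_fredholm_module cv K A j H U \<pi> F \<longleftrightarrow> fredholm_conditions cv K A j H U (\<lambda>Y. id) \<pi> F"

definition even_fredholm_module where
  "even_fredholm_module cv K A j \<beta> H U \<Gamma> \<pi> F \<longleftrightarrow>
     (let \<gamma> = (\<lambda>Y. ad (carrier (H Y)) (carrier (H Y)) (\<Gamma> Y)) in
      net_grading K A j \<beta> \<and>
      net_section K (BH H) (adU H U) \<Gamma> \<and>
      (\<forall>Y\<in>K. star (BH H Y) (\<Gamma> Y) = \<Gamma> Y \<and> unitary_map (H Y) (H Y) (\<Gamma> Y)) \<and>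
      (\<forall>Y\<in>K. \<forall>t\<in>carrier (A Y). \<gamma> Y (\<pi> Y t) = \<pi> Y (\<beta> Y t)) \<and>
      fredholm_conditions cv K A j H U \<gamma> \<pi> F \<and>
      (\<forall>Y\<in>K. \<gamma> Y (F Y) = \<ominus>\<^bsub>BH H Y\<^esub> F Y))"


section \<open>The algebra of fields associated with a net\<close>

definition omega :: "'x set set \<Rightarrow> 'x \<Rightarrow> 'x set set" where
  "omega K x = {Y \<in> K. x \<in> Y}"

text \<open>
  A universal property cannot quantify over types. A C*-algebra generated by the images of the
  algebras of the net has at most as many elements as there are sequences of noncommutative
  *-polynomials in elements of these algebras (choose for each element a sequence of *-polynomials
  converging to it). Hence up to isomorphism all these algebras, in particular the universal one,
  have their carrier in the type \<open>univ_carrier\<close>, and it suffices to consider target algebras there: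
  a compatible family into any C*-algebra takes its values in the C*-subalgebra it generates.
\<close>

datatype ('i, 'a) star_poly =
    PGen 'i 'a
  | PAdd "('i, 'a) star_poly" "('i, 'a) star_poly"
  | PMult "('i, 'a) star_poly" "('i, 'a) star_poly"
  | PScale complex "('i, 'a) star_poly"
  | PStar "('i, 'a) star_poly"

type_synonym ('i, 'a) univ_carrier = "nat \<Rightarrow> ('i, 'a) star_poly"

definition compatible_family where
  "compatible_family W A j B \<phi> \<longleftrightarrow> (\<forall>Y\<in>W. star_hom (A Y) B (\<phi> Y)) \<and>
     (\<forall>Y\<in>W. \<forall>Y'\<in>W. Y \<subseteq> Y' \<longrightarrow> (\<forall>t\<in>carrier (A Y). \<phi> Y' (j Y' Y t) = \<phi> Y t))"

definition universal_cstar_algebra ::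
    "'x set set \<Rightarrow> ('x set \<Rightarrow> 'a star_alg) \<Rightarrow> ('x set \<Rightarrow> 'x set \<Rightarrow> 'a \<Rightarrow> 'a) \<Rightarrow>
     ('x set, 'a) univ_carrier star_alg \<Rightarrow> ('x set \<Rightarrow> 'a \<Rightarrow> ('x set, 'a) univ_carrier) \<Rightarrow> bool" where
  "universal_cstar_algebra W A j C \<epsilon> \<longleftrightarrow> cstar_algebra C \<and> compatible_family W A j C \<epsilon> \<and>
     (\<forall>(B :: ('x set, 'a) univ_carrier star_alg) \<phi>.
        cstar_algebra B \<and> compatible_family W A j B \<phi> \<longrightarrow>
        (\<exists>!\<psi>. \<psi> \<in> extensional (carrier C) \<and> star_hom C B \<psi> \<and>
              (\<forall>Y\<in>W. \<forall>t\<in>carrier (A Y). \<psi> (\<epsilon> Y t) = \<phi> Y t)))"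

definition product_algebra :: "('x \<Rightarrow> 'c star_alg) \<Rightarrow> ('x \<Rightarrow> 'c) star_alg" where
  "product_algebra Ax = \<lparr>
     carrier = {a. (\<forall>x. a x \<in> carrier (Ax x)) \<and> bdd_above (range (\<lambda>x. nrm (Ax x) (a x)))},
     monoid.mult = (\<lambda>a b x. a x \<otimes>\<^bsub>Ax x\<^esub> b x), one = (\<lambda>x. \<one>\<^bsub>Ax x\<^esub>), zero = (\<lambda>x. \<zero>\<^bsub>Ax x\<^esub>),
     add = (\<lambda>a b x. a x \<oplus>\<^bsub>Ax x\<^esub> b x), smult = (\<lambda>c a x. c \<odot>\<^bsub>Ax x\<^esub> a x),
     star = (\<lambda>a x. star (Ax x) (a x)), nrm = (\<lambda>a. SUP x. nrm (Ax x) (a x))\<rparr>"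

definition elementary_field ::
    "('x \<Rightarrow> 'c star_alg) \<Rightarrow> ('x \<Rightarrow> 'x set \<Rightarrow> 'a \<Rightarrow> 'c) \<Rightarrow> ('x \<Rightarrow> complex) \<Rightarrow> 'x set \<Rightarrow> 'a \<Rightarrow> 'x \<Rightarrow> 'c"
  where
  "elementary_field Ax \<epsilon> f Y t =
     (\<lambda>x. f x \<odot>\<^bsub>Ax x\<^esub> (if x \<in> Y then \<epsilon> x Y t else \<zero>\<^bsub>Ax x\<^esub>))"

definition net_algebra :: "'x::topological_space set set \<Rightarrow> ('x set \<Rightarrow> 'a star_alg) \<Rightarrow>
    ('x \<Rightarrow> 'c star_alg) \<Rightarrow> ('x \<Rightarrow> 'x set \<Rightarrow> 'a \<Rightarrow> 'c) \<Rightarrow> ('x \<Rightarrow> 'c) star_alg" where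
  "net_algebra K A Ax \<epsilon> = (let P = product_algebra Ax in
     P\<lparr>carrier := norm_topology P (nrm P) closure_of
        generated_star_subalgebra P
          {elementary_field Ax \<epsilon> f Y t | f Y t. Y \<in> K \<and> f \<in> C0 Y \<and> t \<in> carrier (A Y)}\<rparr>)"

definition pointwise_action :: "('x \<Rightarrow> 'c star_alg) \<Rightarrow> ('x \<Rightarrow> 'c) star_alg \<Rightarrow> ('x \<Rightarrow> complex) \<Rightarrow>
    (('x \<Rightarrow> 'c) \<Rightarrow> 'x \<Rightarrow> 'c) \<times> (('x \<Rightarrow> 'c) \<Rightarrow> 'x \<Rightarrow> 'c)" where
  "pointwise_action Ax A f =
     (\<lambda>a\<in>carrier A. \<lambda>x. f x \<odot>\<^bsub>Ax x\<^esub> a x, \<lambda>a\<in>carrier A. \<lambda>x. f x \<odot>\<^bsub>Ax x\<^esub> a x)"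

definition induced_morphism where
  "induced_morphism K A Ax \<epsilon> B Bx \<epsilon>' \<phi> =
     (let AA = net_algebra K A Ax \<epsilon>; BB = net_algebra K B Bx \<epsilon>' in
      THE \<psi>. \<psi> \<in> extensional (carrier AA) \<and>
        C0_morphism AA (pointwise_action Ax AA) BB (pointwise_action Bx BB) \<psi> \<and>
        (\<forall>Y\<in>K. \<forall>f\<in>C0 Y. \<forall>t\<in>carrier (A Y).
           \<psi> (elementary_field Ax \<epsilon> f Y t) = elementary_field Bx \<epsilon>' f Y (\<phi> Y t)))"


section \<open>The Hilbert bundle and the Hilbert module of its sections\<close>

definition total_space :: "('x \<Rightarrow> (complex, 'k) ip_module) \<Rightarrow> 'x set \<Rightarrow> ('x \<times> 'k) set" where
  "total_space Hx Y = (SIGMA x:Y. carrier (Hx x))"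

definition associated_hilbert_bundle :: "'x::topological_space set set \<Rightarrow>
    ('x set \<Rightarrow> (complex, 'h) ip_module) \<Rightarrow> ('x set \<Rightarrow> 'x set \<Rightarrow> 'h \<Rightarrow> 'h) \<Rightarrow>
    ('x \<Rightarrow> (complex, 'k) ip_module) \<Rightarrow> ('x \<Rightarrow> 'x set \<Rightarrow> 'h \<Rightarrow> 'k) \<Rightarrow> ('x \<times> 'k) topology \<Rightarrow> bool" where
  "associated_hilbert_bundle K H U Hx V \<T> \<longleftrightarrow>
     (\<forall>x. hilbert_space (Hx x)) \<and>
     (\<forall>x. \<forall>Y\<in>omega K x. unitary_map (H Y) (Hx x) (V x Y)) \<and>
     (\<forall>x. \<forall>Y\<in>omega K x. \<forall>Y'\<in>omega K x. Y \<subseteq> Y' \<longrightarrow>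
        (\<forall>h\<in>carrier (H Y). V x Y' (U Y' Y h) = V x Y h)) \<and>
     topspace \<T> = total_space Hx UNIV \<and>
     (\<forall>Y\<in>K. openin \<T> (total_space Hx Y) \<and>
        homeomorphic_map (prod_topology (top_of_set Y) (norm_topology (H Y) (hnorm (H Y))))
          (subtopology \<T> (total_space Hx Y)) (\<lambda>(x, h). (x, V x Y h)))"

definition section_module :: "('x::topological_space \<Rightarrow> (complex, 'k) ip_module) \<Rightarrow>
    ('x \<times> 'k) topology \<Rightarrow> ('x \<Rightarrow> complex, 'x \<Rightarrow> 'k) ip_bimodule" where
  "section_module Hx \<T> = \<lparr>
     carrier = {v. (\<forall>x. v x \<in> carrier (Hx x)) \<and>
        continuous_map euclidean \<T> (\<lambda>x. (x, v x)) \<and>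
        (\<forall>e>0. \<exists>C. compact C \<and> (\<forall>x. x \<notin> C \<longrightarrow> hnorm (Hx x) (v x) < e))},
     monoid.mult = undefined, one = undefined,
     zero = (\<lambda>x. \<zero>\<^bsub>Hx x\<^esub>), add = (\<lambda>v w x. v x \<oplus>\<^bsub>Hx x\<^esub> w x), smult = (\<lambda>c v x. c \<odot>\<^bsub>Hx x\<^esub> v x),
     ip = (\<lambda>v w x. ip (Hx x) (v x) (w x)),
     ract = (\<lambda>v f x. f x \<odot>\<^bsub>Hx x\<^esub> v x), lact = (\<lambda>f v x. f x \<odot>\<^bsub>Hx x\<^esub> v x)\<rparr>"

definition adV :: "('x set \<Rightarrow> (complex, 'h) ip_module) \<Rightarrow> ('x \<Rightarrow> (complex, 'k) ip_module) \<Rightarrow>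
    ('x \<Rightarrow> 'x set \<Rightarrow> 'h \<Rightarrow> 'k) \<Rightarrow> 'x \<Rightarrow> 'x set \<Rightarrow> ('h \<Rightarrow> 'h) \<Rightarrow> 'k \<Rightarrow> 'k" where
  "adV H Hx V x Y = ad (carrier (H Y)) (carrier (Hx x)) (V x Y)"

definition fibrewise :: "('b, 'x \<Rightarrow> 'k, 'm) ip_module_scheme \<Rightarrow> ('x \<Rightarrow> 'k \<Rightarrow> 'k) \<Rightarrow>
    ('x \<Rightarrow> 'k) \<Rightarrow> 'x \<Rightarrow> 'k" where
  "fibrewise E b = (\<lambda>v\<in>carrier E. \<lambda>x. b x (v x))"

text \<open>The operator on sections defined by a section of the net of bounded operators; the choice of
  \<open>Y\<close> is irrelevant.\<close>

definition hat_operator where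
  "hat_operator K H Hx V \<T> T = fibrewise (section_module Hx \<T>)
     (\<lambda>x. let Y = (SOME Y. Y \<in> omega K x) in adV H Hx V x Y (T Y))"

text \<open>The representation induced by \<open>\<pi>\<close>: the morphism into the algebra of fields of operators
  associated with the net of bounded operators (whose fibres are the bounded operators on the fibres
  of the bundle), followed by the fibrewise action of such fields on sections.\<close>

definition induced_representation where
  "induced_representation K A Ax \<epsilon> H Hx V \<T> \<pi> = (\<lambda>a\<in>carrier (net_algebra K A Ax \<epsilon>).
     fibrewise (section_module Hx \<T>)
       (induced_morphism K A Ax \<epsilon> (BH H) (\<lambda>x. bounded_operators (Hx x)) (adV H Hx V) \<pi> a))"

end

theory Submission
  imports Defs
begin

text \<open>
  Everything is reduced to fields of operators on the fibres of the Hilbert bundle. Such a field is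
  called compact if it can be approximated, uniformly over the base, by finite rank fields
  \<open>\<xi> \<mapsto> \<Sum>i. v\<^sub>i(x) (w\<^sub>i(x), \<xi>)\<close> with sections \<open>v\<^sub>i\<close>, \<open>w\<^sub>i\<close>; it then acts on the Hilbert module as a compact
  operator. If \<open>T\<close> is a compact operator on the Hilbert space over \<open>Y\<close> and \<open>f \<in> C\<^sub>0(Y)\<close>, then
  \<open>f \<cdot> ad V(T)\<close> is compact: approximate \<open>T\<close> by finite rank operators, factor \<open>f\<close>, and use that the bundle
  is constant over \<open>Y\<close>.

  The fields \<open>a\<close> in the algebra of the net for which \<open>(F\<^sup>2 - 1) \<pi>(a)\<close>, respectively \<open>[F, \<pi>(a)]\<close>, is
  compact form a closed set that is stable under sums, multiples and products (the commutator is a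
  derivation), and they contain the generators \<open>f \<epsilon>\<^sub>Y(t)\<close> by the Fredholm conditions over \<open>Y\<close>; for the
  square one writes \<open>f = g h\<close> to absorb a factor. Since the base is connected, the operators of a
  section of the net have constant norm, so that \<open>F\<close> acts as a bounded field.

  Morphisms of nets induce morphisms between the fibre algebras by the universal property; these are
  contractive, hence act on the continuous fields, and identities between them need only be checked on
  generators.
\<close>

section \<open>Complex vector spaces and normed spaces on carriers\<close>

text \<open>Adjointable operators on sections are only required to have an adjoint, while their norm
  is an infimum over bounds; boundedness must come from the uniform boundedness principle before
  compact operators, a closed span in that norm, can be handled at all. The induced morphisms are
  definite descriptions: each is shown to be an explicit fibrewise map, and since the description
  mentions only the net morphism, two families of fibre maps over the same net morphism act equally
  on the fields of the algebra. This is how the grading is seen to be an involution and the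
  representation to be graded. Fibre maps pass to limits of fields because *-morphisms are
  contractive, which is derived from the C*-identity by an iteration. The graded commutator of an
  odd F with T is F T - \<gamma>(T) F, the plain one is F T - T F; on the image of the
  representation both have the form F \<pi>(a) - \<pi>(\<tau> a) F with a multiplicative twist
  \<tau>, so that one derivation argument covers both readings of the commutator.\<close>

lemma complex_ring_sel [simp]:
  "carrier complex_ring = UNIV" "mult complex_ring = (*)" "one complex_ring = 1"
  "zero complex_ring = 0" "add complex_ring = (+)"
  by (simp_all add: complex_ring_def)

locale complex_module = Module.module complex_ring M for M :: "(complex, 'a, 'm) module_scheme" (structure)
begin

lemma v_add [simp, intro]: "x \<in> carrier M \<Longrightarrow> y \<in> carrier M \<Longrightarrow> x \<oplus> y \<in> carrier M"
  by (rule M.a_closed)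

lemma v_smult [simp, intro]: "x \<in> carrier M \<Longrightarrow> c \<odot> x \<in> carrier M"
  using smult_closed[of c x] by simp

lemma v_zero [simp, intro]: "\<zero> \<in> carrier M"
  by (rule M.zero_closed)

lemma v_assoc: "\<lbrakk>x \<in> carrier M; y \<in> carrier M; z \<in> carrier M\<rbrakk> \<Longrightarrow> (x \<oplus> y) \<oplus> z = x \<oplus> (y \<oplus> z)"
  by (rule M.a_assoc)

lemma v_comm: "\<lbrakk>x \<in> carrier M; y \<in> carrier M\<rbrakk> \<Longrightarrow> x \<oplus> y = y \<oplus> x"
  by (rule M.a_comm)

lemma v_lcomm: "\<lbrakk>x \<in> carrier M; y \<in> carrier M; z \<in> carrier M\<rbrakk> \<Longrightarrow> x \<oplus> (y \<oplus> z) = y \<oplus> (x \<oplus> z)"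
  by (rule M.a_lcomm)

lemma v_rzero [simp]: "x \<in> carrier M \<Longrightarrow> x \<oplus> \<zero> = x"
  by (rule M.r_zero)

lemma v_add_smult: "x \<in> carrier M \<Longrightarrow> (c + d) \<odot> x = c \<odot> x \<oplus> d \<odot> x"
  using smult_l_distr[of c d x] by simp

lemma v_smult_add: "x \<in> carrier M \<Longrightarrow> y \<in> carrier M \<Longrightarrow> c \<odot> (x \<oplus> y) = c \<odot> x \<oplus> c \<odot> y"
  using smult_r_distr[of c x y] by simp

lemma v_smult_smult [simp]: "x \<in> carrier M \<Longrightarrow> c \<odot> (d \<odot> x) = (c * d) \<odot> x"
  using smult_assoc1[of c d x] by simp

lemma v_one [simp]: "x \<in> carrier M \<Longrightarrow> 1 \<odot> x = x"
  using smult_one[of x] by simp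

lemma v_zero_smult [simp]: "x \<in> carrier M \<Longrightarrow> 0 \<odot> x = \<zero>"
  using smult_l_null[of x] by simp

lemma v_smult_zero [simp]: "c \<odot> \<zero> = \<zero>"
  using smult_r_null[of c] by simp

lemma v_neg: "x \<in> carrier M \<Longrightarrow> \<ominus> x = (-1) \<odot> x"
  using smult_l_minus[of 1 x] R.minus_equality[of "- 1" 1] by simp

lemma v_minus: "x \<in> carrier M \<Longrightarrow> y \<in> carrier M \<Longrightarrow> x \<ominus> y = x \<oplus> (-1) \<odot> y"
  by (simp add: a_minus_def v_neg)

lemma v_minus_closed [simp, intro]: "x \<in> carrier M \<Longrightarrow> y \<in> carrier M \<Longrightarrow> x \<ominus> y \<in> carrier M"
  by (simp add: v_minus)

text \<open>Linear identities in five vectors are verified by comparing coefficients: \<open>L\<close> assigns to a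
  coefficient vector the corresponding linear combination.\<close>

lemma linear_combinations:
  assumes "x1 \<in> carrier M" "x2 \<in> carrier M" "x3 \<in> carrier M" "x4 \<in> carrier M" "x5 \<in> carrier M"
  obtains L where
    "x1 = L 1 0 0 0 0" "x2 = L 0 1 0 0 0" "x3 = L 0 0 1 0 0" "x4 = L 0 0 0 1 0" "x5 = L 0 0 0 0 (1::complex)"
    "\<zero> = L 0 0 0 0 0" "\<And>a b c d e. L a b c d e \<in> carrier M"
    "\<And>a b c d e a' b' c' d' e'. L a b c d e \<oplus> L a' b' c' d' e' = L (a+a') (b+b') (c+c') (d+d') (e+e')"
    "\<And>k a b c d e. k \<odot> L a b c d e = L (k*a) (k*b) (k*c) (k*d) (k*e)"
proof -
  define L where "L a b c d e = a \<odot> x1 \<oplus> (b \<odot> x2 \<oplus> (c \<odot> x3 \<oplus> (d \<odot> x4 \<oplus> e \<odot> x5)))" for a b c d e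
  show thesis
    by (rule that[of L]) (use assms in \<open>simp_all add: L_def v_add_smult v_smult_add v_assoc v_comm v_lcomm\<close>)
qed

lemma linear_combinations3:
  assumes "x1 \<in> carrier M" "x2 \<in> carrier M" "x3 \<in> carrier M"
  obtains L where
    "x1 = L 1 0 0" "x2 = L 0 1 0" "x3 = L 0 0 (1::complex)"
    "\<zero> = L 0 0 0" "\<And>a b c. L a b c \<in> carrier M"
    "\<And>a b c a' b' c'. L a b c \<oplus> L a' b' c' = L (a+a') (b+b') (c+c')"
    "\<And>k a b c. k \<odot> L a b c = L (k*a) (k*b) (k*c)"
proof -
  define L where "L a b c = a \<odot> x1 \<oplus> (b \<odot> x2 \<oplus> c \<odot> x3)" for a b c
  show thesis
    by (rule that[of L]) (use assms in \<open>simp_all add: L_def v_add_smult v_smult_add v_assoc v_comm v_lcomm\<close>)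
qed

lemma linear_combinations2:
  assumes "x1 \<in> carrier M" "x2 \<in> carrier M"
  obtains L where
    "x1 = L 1 0" "x2 = L 0 (1::complex)" "\<zero> = L 0 0" "\<And>a b. L a b \<in> carrier M"
    "\<And>a b a' b'. L a b \<oplus> L a' b' = L (a+a') (b+b')"
    "\<And>k a b. k \<odot> L a b = L (k*a) (k*b)"
proof -
  define L where "L a b = a \<odot> x1 \<oplus> b \<odot> x2" for a b
  show thesis
    by (rule that[of L]) (use assms in \<open>simp_all add: L_def v_add_smult v_smult_add v_assoc v_comm v_lcomm\<close>)
qed

lemma v_add_minus: "x \<in> carrier M \<Longrightarrow> y \<in> carrier M \<Longrightarrow> y \<oplus> (x \<ominus> y) = x"
  by (rule linear_combinations2[of x y], assumption+) (simp add: v_minus)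

lemma v_minus_self [simp]: "x \<in> carrier M \<Longrightarrow> x \<ominus> x = \<zero>"
  by (rule linear_combinations2[of x \<zero>], assumption, simp) (simp add: v_minus)

lemma v_minus_eq0: "x \<in> carrier M \<Longrightarrow> y \<in> carrier M \<Longrightarrow> x \<ominus> y = \<zero> \<longleftrightarrow> x = y"
  by (metis v_add_minus v_minus_self v_rzero)

lemma v_minus_trans:
  "x \<in> carrier M \<Longrightarrow> y \<in> carrier M \<Longrightarrow> z \<in> carrier M \<Longrightarrow> (x \<ominus> y) \<oplus> (y \<ominus> z) = x \<ominus> z"
  by (rule linear_combinations3[of x y z], assumption+) (simp add: v_minus)

lemma v_minus_swap: "x \<in> carrier M \<Longrightarrow> y \<in> carrier M \<Longrightarrow> y \<ominus> x = (-1) \<odot> (x \<ominus> y)"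
  by (rule linear_combinations2[of x y], assumption+) (simp add: v_minus)

lemma v_minus_zero [simp]: "x \<in> carrier M \<Longrightarrow> x \<ominus> \<zero> = x"
  by (simp add: v_minus)

lemma v_smult_minus:
  "x \<in> carrier M \<Longrightarrow> y \<in> carrier M \<Longrightarrow> c \<odot> (x \<ominus> y) = c \<odot> x \<ominus> c \<odot> y"
  by (simp add: v_minus v_smult_add mult.commute)

lemma v_add_minus_add:
  assumes "x \<in> carrier M" "y \<in> carrier M" "x' \<in> carrier M" "y' \<in> carrier M"
  shows "(x \<oplus> y) \<ominus> (x' \<oplus> y') = (x \<ominus> x') \<oplus> (y \<ominus> y')"
  using assms by (simp add: v_minus v_smult_add v_assoc v_comm v_lcomm)

lemma submodule_iff:
  "submodule W complex_ring M \<longleftrightarrow> W \<subseteq> carrier M \<and> \<zero> \<in> W \<and>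
     (\<forall>x\<in>W. \<forall>y\<in>W. x \<oplus> y \<in> W) \<and> (\<forall>c. \<forall>x\<in>W. c \<odot> x \<in> W)"
proof
  assume W: "submodule W complex_ring M"
  then interpret submodule W complex_ring M .
  show "W \<subseteq> carrier M \<and> \<zero> \<in> W \<and> (\<forall>x\<in>W. \<forall>y\<in>W. x \<oplus> y \<in> W) \<and> (\<forall>c. \<forall>x\<in>W. c \<odot> x \<in> W)"
    using subset m_closed one_closed smult_closed by auto
next
  assume W: "W \<subseteq> carrier M \<and> \<zero> \<in> W \<and> (\<forall>x\<in>W. \<forall>y\<in>W. x \<oplus> y \<in> W) \<and> (\<forall>c. \<forall>x\<in>W. c \<odot> x \<in> W)"
  show "submodule W complex_ring M"
    by (rule submoduleI) (use W in \<open>auto simp: v_neg subset_iff\<close>)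
qed

lemma lin_span_submodule: "S \<subseteq> carrier M \<Longrightarrow> submodule (lin_span M S) complex_ring M"
proof -
  assume S: "S \<subseteq> carrier M"
  have "submodule (carrier M) complex_ring M"
    by (simp add: submodule_iff)
  then show ?thesis
    using S unfolding lin_span_def submodule_iff by blast
qed

end

lemma lin_span_superset: "S \<subseteq> lin_span M S"
  by (auto simp: lin_span_def)

lemma lin_span_least: "submodule W complex_ring M \<Longrightarrow> S \<subseteq> W \<Longrightarrow> lin_span M S \<subseteq> W"
  by (auto simp: lin_span_def)

text \<open>No additive inverse has to be supplied: by additivity in the scalar, (-1) x is one as
  soon as 1 acts as the identity and 0 as zero.\<close>

lemma complex_moduleI:
  fixes M (structure)
  assumes "\<And>x y. x \<in> carrier M \<Longrightarrow> y \<in> carrier M \<Longrightarrow> x \<oplus> y \<in> carrier M"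
    and zc: "\<zero> \<in> carrier M"
    and sc: "\<And>c x. x \<in> carrier M \<Longrightarrow> c \<odot> x \<in> carrier M"
    and "\<And>x y z. x \<in> carrier M \<Longrightarrow> y \<in> carrier M \<Longrightarrow> z \<in> carrier M \<Longrightarrow> (x \<oplus> y) \<oplus> z = x \<oplus> (y \<oplus> z)"
    and "\<And>x y. x \<in> carrier M \<Longrightarrow> y \<in> carrier M \<Longrightarrow> x \<oplus> y = y \<oplus> x"
    and "\<And>x. x \<in> carrier M \<Longrightarrow> \<zero> \<oplus> x = x"
    and ad: "\<And>c d x. x \<in> carrier M \<Longrightarrow> (c + d) \<odot> x = c \<odot> x \<oplus> d \<odot> x"
    and "\<And>c x y. x \<in> carrier M \<Longrightarrow> y \<in> carrier M \<Longrightarrow> c \<odot> (x \<oplus> y) = c \<odot> x \<oplus> c \<odot> y"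
    and "\<And>c d x. x \<in> carrier M \<Longrightarrow> (c * d) \<odot> x = c \<odot> (d \<odot> x)"
    and one: "\<And>x. x \<in> carrier M \<Longrightarrow> 1 \<odot> x = x"
    and z: "\<And>x. x \<in> carrier M \<Longrightarrow> 0 \<odot> x = \<zero>"
  shows "complex_module M"
proof -
  have inv: "\<exists>y\<in>carrier M. y \<oplus> x = \<zero>" if "x \<in> carrier M" for x
    using ad[of x "-1" 1] one[of x] z[of x] sc[of x "-1"] that by (intro bexI[of _ "(-1) \<odot> x"]) auto
  have "Module.module complex_ring M"
    by (rule moduleI[OF complex_ring_cring]) (use assms inv in \<open>auto intro!: abelian_groupI\<close>)
  then show ?thesis
    by (simp add: complex_module_def)
qed

section \<open>Normed spaces: distances, limits of sequences and completeness\<close>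

locale normed_module = complex_module M
  for M :: "(complex, 'a, 'm) module_scheme" (structure) and n :: "'a \<Rightarrow> real" +
  assumes n_nonneg [simp]: "x \<in> carrier M \<Longrightarrow> 0 \<le> n x"
    and n_eq_0: "x \<in> carrier M \<Longrightarrow> n x = 0 \<longleftrightarrow> x = \<zero>"
    and n_triangle: "x \<in> carrier M \<Longrightarrow> y \<in> carrier M \<Longrightarrow> n (x \<oplus> y) \<le> n x + n y"
    and n_smult: "x \<in> carrier M \<Longrightarrow> n (c \<odot> x) = cmod c * n x"
begin

lemma n_zero [simp]: "n \<zero> = 0"
  by (simp add: n_eq_0)

lemma n_minus_commute: "x \<in> carrier M \<Longrightarrow> y \<in> carrier M \<Longrightarrow> n (x \<ominus> y) = n (y \<ominus> x)"
  by (simp add: v_minus_swap[of x y] n_smult)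

lemma n_minus_triangle:
  "x \<in> carrier M \<Longrightarrow> y \<in> carrier M \<Longrightarrow> z \<in> carrier M \<Longrightarrow> n (x \<ominus> z) \<le> n (x \<ominus> y) + n (y \<ominus> z)"
  using n_triangle[of "x \<ominus> y" "y \<ominus> z"] by (simp add: v_minus_trans)

lemma n_minus_le: "x \<in> carrier M \<Longrightarrow> y \<in> carrier M \<Longrightarrow> n (x \<ominus> y) \<le> n x + n y"
  using n_minus_triangle[of x \<zero> y] n_minus_commute[of \<zero> y] by simp

lemma n_le_add_minus: "x \<in> carrier M \<Longrightarrow> y \<in> carrier M \<Longrightarrow> n x \<le> n y + n (x \<ominus> y)"
  using n_triangle[of y "x \<ominus> y"] by (simp add: v_add_minus)

lemma n_abs_diff_le: "x \<in> carrier M \<Longrightarrow> y \<in> carrier M \<Longrightarrow> \<bar>n x - n y\<bar> \<le> n (x \<ominus> y)"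
  using n_le_add_minus[of x y] n_le_add_minus[of y x] n_minus_commute[of x y] by simp

lemma n_add_minus_add_le:
  assumes "x \<in> carrier M" "y \<in> carrier M" "x' \<in> carrier M" "y' \<in> carrier M"
  shows "n ((x \<oplus> y) \<ominus> (x' \<oplus> y')) \<le> n (x \<ominus> x') + n (y \<ominus> y')"
  using assms n_triangle[of "x \<ominus> x'" "y \<ominus> y'"] by (simp add: v_add_minus_add)

sublocale D: Metric_space "carrier M" "norm_dist M n"
proof
  show "norm_dist M n x y = norm_dist M n y x" for x y
    by (simp add: norm_dist_def n_minus_commute)
  show "norm_dist M n x z \<le> norm_dist M n x y + norm_dist M n y z"
    if "x \<in> carrier M" "y \<in> carrier M" "z \<in> carrier M" for x y z
    using that by (simp add: norm_dist_def n_minus_triangle)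
qed (auto simp: norm_dist_def n_eq_0 v_minus_eq0)

lemma mem_closure_iff:
  "x \<in> norm_topology M n closure_of S \<longleftrightarrow>
     x \<in> carrier M \<and> (\<forall>e>0. \<exists>y\<in>S. y \<in> carrier M \<and> n (x \<ominus> y) < e)"
  unfolding norm_topology_def D.metric_closure_of by (auto simp: norm_dist_def)

text \<open>Membership of all terms and of the limit is built in, so that every limit argument has
  its carrier facts at hand.\<close>

definition tends :: "(nat \<Rightarrow> 'a) \<Rightarrow> 'a \<Rightarrow> bool" where
  "tends s x \<longleftrightarrow> (\<forall>k. s k \<in> carrier M) \<and> x \<in> carrier M \<and> (\<lambda>k. n (s k \<ominus> x)) \<longlonglongrightarrow> 0"

lemma tends_unique: "tends s x \<Longrightarrow> tends s y \<Longrightarrow> x = y"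
proof -
  assume x: "tends s x" and y: "tends s y"
  have "(\<lambda>k. n (s k \<ominus> x) + n (s k \<ominus> y)) \<longlonglongrightarrow> 0 + 0"
    using x y by (intro tendsto_add) (auto simp: tends_def)
  moreover have "n (x \<ominus> y) \<le> n (s k \<ominus> x) + n (s k \<ominus> y)" for k
    using x y n_minus_triangle[of x "s k" y] n_minus_commute[of x "s k"] by (simp add: tends_def)
  ultimately have "n (x \<ominus> y) \<le> 0"
    by (metis (no_types, lifting) LIMSEQ_le_const add.right_neutral)
  moreover have m: "x \<in> carrier M" "y \<in> carrier M"
    using x y by (simp_all add: tends_def)
  ultimately have "n (x \<ominus> y) = 0"
    by (simp add: order_antisym)
  then show "x = y"
    using m by (simp add: n_eq_0 v_minus_eq0)
qed

lemma closure_tends: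
  assumes "x \<in> norm_topology M n closure_of S"
  shows "\<exists>s. (\<forall>k. s k \<in> S) \<and> tends s x"
proof -
  have "\<exists>y. y \<in> S \<and> y \<in> carrier M \<and> n (x \<ominus> y) < 1 / real (Suc k)" for k
  proof -
    have "0 < 1 / real (Suc k)"
      by simp
    then show ?thesis
      using assms unfolding mem_closure_iff by blast
  qed
  then obtain s where s: "\<And>k. s k \<in> S \<and> s k \<in> carrier M \<and> n (x \<ominus> s k) < 1 / real (Suc k)"
    by metis
  have "x \<in> carrier M"
    using assms mem_closure_iff by blast
  have "(\<lambda>k. n (s k \<ominus> x)) \<longlonglongrightarrow> 0"
  proof (rule tendsto_sandwich[OF _ _ tendsto_const])
    show "(\<lambda>k. 1 / real (Suc k)) \<longlonglongrightarrow> 0"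
      using LIMSEQ_inverse_real_of_nat by (simp add: inverse_eq_divide)
    show "\<forall>\<^sub>F k in sequentially. n (s k \<ominus> x) \<le> 1 / real (Suc k)"
      using s n_minus_commute \<open>x \<in> carrier M\<close> by (auto intro!: always_eventually simp: less_imp_le)
    show "\<forall>\<^sub>F k in sequentially. 0 \<le> n (s k \<ominus> x)"
      using s \<open>x \<in> carrier M\<close> by (intro always_eventually) simp
  qed
  then show ?thesis
    using s \<open>x \<in> carrier M\<close> by (auto simp: tends_def)
qed

lemma tends_closure:
  assumes "\<And>k. s k \<in> S" "tends s x"
  shows "x \<in> norm_topology M n closure_of S"
proof -
  have "\<exists>y\<in>S. y \<in> carrier M \<and> n (x \<ominus> y) < e" if "e > 0" for e
  proof -
    have "\<forall>\<^sub>F k in sequentially. n (s k \<ominus> x) < e"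
      using assms(2) that by (auto simp: tends_def order_tendsto_iff)
    then obtain k where "n (s k \<ominus> x) < e"
      by (auto simp: eventually_sequentially)
    then show ?thesis
      using assms by (intro bexI[of _ "s k"]) (auto simp: tends_def n_minus_commute)
  qed
  then show ?thesis
    using assms by (simp add: mem_closure_iff tends_def)
qed

lemma tends_const: "x \<in> carrier M \<Longrightarrow> tends (\<lambda>k. x) x"
  by (simp add: tends_def)

lemma tends_add: "tends s x \<Longrightarrow> tends t y \<Longrightarrow> tends (\<lambda>k. s k \<oplus> t k) (x \<oplus> y)"
proof -
  assume x: "tends s x" and y: "tends t y"
  have "(\<lambda>k. n ((s k \<oplus> t k) \<ominus> (x \<oplus> y))) \<longlonglongrightarrow> 0"
    by (rule real_tendsto_sandwich[OF _ _ tendsto_const tendsto_add_zero])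
      (use x y in \<open>auto simp: tends_def intro!: always_eventually n_add_minus_add_le\<close>)
  then show ?thesis
    using x y by (simp add: tends_def)
qed

lemma tends_smult: "tends s x \<Longrightarrow> tends (\<lambda>k. c \<odot> s k) (c \<odot> x)"
  using tendsto_mult_right_zero[of "\<lambda>k. n (s k \<ominus> x)" sequentially "cmod c"]
  by (simp add: tends_def n_smult v_smult_minus[symmetric])

lemma tends_norm: "tends s x \<Longrightarrow> (\<lambda>k. n (s k)) \<longlonglongrightarrow> n x"
proof -
  assume x: "tends s x"
  have "(\<lambda>k. n (s k) - n x) \<longlonglongrightarrow> 0"
    by (rule Lim_null_comparison[of _ "\<lambda>k. n (s k \<ominus> x)"])
      (use x in \<open>auto simp: tends_def n_abs_diff_le intro!: always_eventually\<close>)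
  then show ?thesis
    by (simp add: LIM_zero_iff)
qed

definition cauchy_seq :: "(nat \<Rightarrow> 'a) \<Rightarrow> bool" where
  "cauchy_seq s \<longleftrightarrow> (\<forall>k. s k \<in> carrier M) \<and> (\<forall>e>0. \<exists>N. \<forall>i\<ge>N. \<forall>j\<ge>N. n (s i \<ominus> s j) < e)"

text \<open>The increments from index i on are dominated by a geometric series. The explicit bound
  for the tail is stated as well, because the gliding hump argument needs its size and not only the
  Cauchy property.\<close>

lemma cauchy_seq_geometric:
  assumes s: "\<And>k. s k \<in> carrier M" and q: "0 \<le> q" "q < 1"
    and le: "\<And>k. n (s (Suc k) \<ominus> s k) \<le> C * q ^ k"
  shows "cauchy_seq s" "\<And>i m. n (s (i + m) \<ominus> s i) \<le> C * q ^ i / (1 - q)"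
proof -
  have C: "0 \<le> C"
    using order_trans[OF n_nonneg le[of 0]] s by simp
  \<comment> \<open>The factor 1 - q^m is what makes the induction close; it is estimated by 1
    afterwards.\<close>
  have b: "n (s (i + m) \<ominus> s i) \<le> C * q ^ i * (1 - q ^ m) / (1 - q)" for i m
  proof (induction m)
    case (Suc m)
    have "n (s (i + Suc m) \<ominus> s i) \<le> C * q ^ (i + m) + C * q ^ i * (1 - q ^ m) / (1 - q)"
      using n_minus_triangle[of "s (Suc (i + m))" "s (i + m)" "s i"] le[of "i + m"] Suc s by simp
    also have "\<dots> = C * q ^ i * (1 - q ^ Suc m) / (1 - q)"
      using q by (simp add: field_simps power_add)
    finally show ?case .
  qed (use s in simp)
  show *: "n (s (i + m) \<ominus> s i) \<le> C * q ^ i / (1 - q)" for i m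
  proof -
    have "C * q ^ i * (1 - q ^ m) \<le> C * q ^ i * 1"
      using C q by (intro mult_left_mono) auto
    then show ?thesis
      using order_trans[OF b[of i m] divide_right_mono] q by simp
  qed
  show "cauchy_seq s"
    unfolding cauchy_seq_def
  proof (intro conjI allI impI s)
    fix e :: real assume "e > 0"
    have "(\<lambda>i. C * q ^ i / (1 - q)) \<longlonglongrightarrow> C * 0 / (1 - q)"
      using q by (intro tendsto_intros LIMSEQ_realpow_zero) auto
    then have "(\<lambda>i. C * q ^ i / (1 - q)) \<longlonglongrightarrow> 0"
      by simp
    then have "\<forall>\<^sub>F i in sequentially. C * q ^ i / (1 - q) < e / 2"
      by (rule order_tendstoD) (use \<open>e > 0\<close> in simp)
    then obtain N d where d: "C * q ^ N / (1 - q) = d" and N: "d < e / 2"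
      unfolding eventually_sequentially by blast
    have "n (s i \<ominus> s j) < e" if "i \<ge> N" "j \<ge> N" for i j
    proof -
      have "n (s i \<ominus> s j) \<le> n (s i \<ominus> s N) + n (s j \<ominus> s N)"
        using n_minus_triangle[of "s i" "s N" "s j"] n_minus_commute[of "s j" "s N"] s by simp
      also have "\<dots> < e"
        using *[of N "i - N", unfolded d] *[of N "j - N", unfolded d] that N by simp
      finally show ?thesis .
    qed
    then show "\<exists>N. \<forall>i\<ge>N. \<forall>j\<ge>N. n (s i \<ominus> s j) < e"
      by blast
  qed
qed

lemma tends_Suc: "tends s x \<Longrightarrow> tends (\<lambda>k. s (Suc k)) x"
  using LIMSEQ_Suc[of "\<lambda>k. n (s k \<ominus> x)"] by (simp add: tends_def)

text \<open>Bridge from the completeness of a metric that is cut off outside the carrier to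
  sequences and norms of differences, with which all later limits are computed.\<close>

lemma norm_complete_iff: "norm_complete M n \<longleftrightarrow> (\<forall>s. cauchy_seq s \<longrightarrow> (\<exists>x. tends s x))"
proof -
  have 1: "D.MCauchy s \<longleftrightarrow> cauchy_seq s" for s
    unfolding D.MCauchy_def cauchy_seq_def by (auto simp: norm_dist_def image_subset_iff)
  have 2: "limitin D.mtopology s x sequentially \<longleftrightarrow> tends s x" if "\<And>k. s k \<in> carrier M" for s x
    using that by (auto simp: D.limitin_metric_dist_null tends_def norm_dist_def)
  show ?thesis
    unfolding norm_complete_def D.mcomplete_def 1 using 2 by (metis cauchy_seq_def)
qed

end

text \<open>Subtraction in HOL-Algebra goes through an inverse chosen in the carrier, so shrinking
  the carrier might change it. It does not, since in both structures the difference is x + (-1)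
  y.\<close>

lemma normed_module_sub:
  assumes "normed_module M n" and W: "submodule W complex_ring M"
  shows "normed_module (M\<lparr>carrier := W\<rparr>) n"
    and "\<And>x y. x \<in> W \<Longrightarrow> y \<in> W \<Longrightarrow> x \<ominus>\<^bsub>M\<lparr>carrier := W\<rparr>\<^esub> y = x \<ominus>\<^bsub>M\<^esub> y"
proof -
  interpret normed_module M n by fact
  have c: "complex_module (M\<lparr>carrier := W\<rparr>)"
    using submodule.submodule_is_module[OF W] module_axioms by (simp add: complex_module_def)
  interpret N: complex_module "M\<lparr>carrier := W\<rparr>" by (rule c)
  have sub: "W \<subseteq> carrier M"
    using W by (simp add: submodule_iff)
  show "normed_module (M\<lparr>carrier := W\<rparr>) n"
    by unfold_locales (use sub in \<open>auto simp: n_eq_0 n_triangle n_smult subset_iff\<close>)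
  show "x \<ominus>\<^bsub>M\<lparr>carrier := W\<rparr>\<^esub> y = x \<ominus>\<^bsub>M\<^esub> y" if "x \<in> W" "y \<in> W" for x y
    using N.v_minus[of x y] v_minus[of x y] that sub by (auto simp: subset_iff)
qed

lemma norm_complete_sub:
  assumes "normed_module M n" and W: "submodule W complex_ring M" and "norm_complete M n"
    and cl: "norm_topology M n closure_of W \<subseteq> W"
  shows "norm_complete (M\<lparr>carrier := W\<rparr>) n"
proof -
  interpret normed_module M n by fact
  interpret N: normed_module "M\<lparr>carrier := W\<rparr>" n by (rule normed_module_sub) fact+
  have sub: "W \<subseteq> carrier M"
    using W by (simp add: submodule_iff)
  show ?thesis
    unfolding N.norm_complete_iff
  proof safe
    fix s assume s: "N.cauchy_seq s"
    then have sW: "\<And>k. s k \<in> W"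
      by (simp add: N.cauchy_seq_def)
    have "cauchy_seq s"
      using s sW sub unfolding N.cauchy_seq_def cauchy_seq_def
      by (auto simp: normed_module_sub(2)[OF assms(1,2)])
    then obtain x where x: "tends s x"
      using \<open>norm_complete M n\<close> norm_complete_iff by blast
    then have "x \<in> W"
      using cl tends_closure[of s W x] sW by blast
    then show "\<exists>x. N.tends s x"
      using x sW unfolding N.tends_def tends_def
      by (auto simp: normed_module_sub(2)[OF assms(1,2)])
  qed
qed


section \<open>C*-algebras\<close>

context cstar_algebra
begin

sublocale complex_module A
  by unfold_locales

sublocale N: normed_module A "nrm A"
  by unfold_locales (auto simp: nrm_nonneg nrm_eq_0 nrm_triangle nrm_smult)

declare mult_closed [simp, intro] star_closed [simp, intro] star_star [simp]

lemma m_zero [simp]: "x \<in> carrier A \<Longrightarrow> x \<otimes> \<zero> = \<zero>"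
  using smult_mult_right[of x \<zero> 0] by simp

lemma zero_m [simp]: "x \<in> carrier A \<Longrightarrow> \<zero> \<otimes> x = \<zero>"
  using smult_mult_left[of \<zero> x 0] by simp

lemma star_zero [simp]: "star A \<zero> = \<zero>"
  using star_smult[of \<zero> 0] by simp

lemma mult_minus_left: "\<lbrakk>x \<in> carrier A; y \<in> carrier A; z \<in> carrier A\<rbrakk> \<Longrightarrow> (x \<ominus> y) \<otimes> z = (x \<otimes> z) \<ominus> (y \<otimes> z)"
  by (simp add: v_minus mult_add_left smult_mult_left)

lemma mult_minus_right: "\<lbrakk>x \<in> carrier A; y \<in> carrier A; z \<in> carrier A\<rbrakk> \<Longrightarrow> z \<otimes> (x \<ominus> y) = (z \<otimes> x) \<ominus> (z \<otimes> y)"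
  by (simp add: v_minus mult_add_right smult_mult_right)

lemma star_minus: "\<lbrakk>x \<in> carrier A; y \<in> carrier A\<rbrakk> \<Longrightarrow> star A (x \<ominus> y) = star A x \<ominus> star A y"
  by (simp add: v_minus star_add star_smult)

lemma star_eq_iff: "\<lbrakk>x \<in> carrier A; y \<in> carrier A\<rbrakk> \<Longrightarrow> star A x = star A y \<longleftrightarrow> x = y"
  by (metis star_star)

text \<open>The C*-identity and submultiplicativity give ||x||^2 \<le> ||x*|| ||x||, hence one
  inequality; the other is the same for x* in place of x.\<close>

lemma nrm_star: "x \<in> carrier A \<Longrightarrow> nrm A (star A x) = nrm A x"
proof -
  have le: "nrm A x \<le> nrm A (star A x)" if x: "x \<in> carrier A" for x
  proof -
    have "(nrm A x)\<^sup>2 \<le> nrm A (star A x) * nrm A x"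
      using cstar_identity[OF x] nrm_mult[of "star A x" x] x by simp
    then show ?thesis
      using nrm_nonneg[OF x] nrm_nonneg[OF star_closed[OF x]] by (cases "nrm A x = 0") (auto simp: power2_eq_square)
  qed
  show "x \<in> carrier A \<Longrightarrow> nrm A (star A x) = nrm A x"
    using le[of x] le[of "star A x"] by (simp add: order_antisym)
qed

lemma cstar_zero: "x \<in> carrier A \<Longrightarrow> star A x \<otimes> x = \<zero> \<Longrightarrow> x = \<zero>"
  using cstar_identity[of x] by (simp add: nrm_eq_0)

lemma tends_star: "N.tends s x \<Longrightarrow> N.tends (\<lambda>k. star A (s k)) (star A x)"
  by (simp add: N.tends_def star_minus[symmetric] nrm_star)

lemma nrm_mult_minus_mult_le:
  assumes "x \<in> carrier A" "y \<in> carrier A" "x' \<in> carrier A" "y' \<in> carrier A"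
  shows "nrm A ((x' \<otimes> y') \<ominus> (x \<otimes> y)) \<le> nrm A (x' \<ominus> x) * nrm A y' + nrm A x * nrm A (y' \<ominus> y)"
proof -
  have "(x' \<otimes> y') \<ominus> (x \<otimes> y) = (x' \<ominus> x) \<otimes> y' \<oplus> x \<otimes> (y' \<ominus> y)"
    using assms by (simp add: mult_minus_left mult_minus_right v_minus_trans)
  then show ?thesis
    using assms nrm_triangle[of "(x' \<ominus> x) \<otimes> y'" "x \<otimes> (y' \<ominus> y)"] nrm_mult[of "x' \<ominus> x" y']
      nrm_mult[of x "y' \<ominus> y"] by simp
qed

lemma tends_mult: "N.tends s x \<Longrightarrow> N.tends t y \<Longrightarrow> N.tends (\<lambda>k. s k \<otimes> t k) (x \<otimes> y)"
proof -
  assume s: "N.tends s x" and t: "N.tends t y"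
  have "(\<lambda>k. nrm A (s k \<ominus> x) * nrm A (t k) + nrm A x * nrm A (t k \<ominus> y)) \<longlonglongrightarrow> 0 * nrm A y + nrm A x * 0"
    using s t N.tends_norm[OF t] by (intro tendsto_intros) (auto simp: N.tends_def)
  then have "(\<lambda>k. nrm A (s k \<ominus> x) * nrm A (t k) + nrm A x * nrm A (t k \<ominus> y)) \<longlonglongrightarrow> 0"
    by simp
  then have "(\<lambda>k. nrm A (s k \<otimes> t k \<ominus> x \<otimes> y)) \<longlonglongrightarrow> 0"
    by (rule_tac real_tendsto_sandwich[OF _ _ tendsto_const])
      (use s t nrm_mult_minus_mult_le in \<open>auto simp: N.tends_def intro!: always_eventually\<close>)
  then show ?thesis
    using s t by (simp add: N.tends_def)
qed

lemma star_subalgebra_iff: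
  "star_subalgebra S A \<longleftrightarrow> S \<subseteq> carrier A \<and> \<zero> \<in> S \<and> (\<forall>x\<in>S. \<forall>y\<in>S. x \<oplus> y \<in> S) \<and>
     (\<forall>c. \<forall>x\<in>S. c \<odot> x \<in> S) \<and> (\<forall>x\<in>S. \<forall>y\<in>S. x \<otimes> y \<in> S) \<and> (\<forall>x\<in>S. star A x \<in> S)"
  by (simp add: star_subalgebra_def submodule_iff)

abbreviation "cls S \<equiv> norm_topology A (nrm A) closure_of S"

lemma cls_superset: "S \<subseteq> carrier A \<Longrightarrow> S \<subseteq> cls S"
  using N.D.topspace_mtopology by (simp add: norm_topology_def closure_of_subset)

lemma star_subalgebra_closure:
  assumes "star_subalgebra S A"
  shows "star_subalgebra (cls S) A"
proof -
  have S: "S \<subseteq> carrier A" "\<zero> \<in> S" "\<And>x y. x \<in> S \<Longrightarrow> y \<in> S \<Longrightarrow> x \<oplus> y \<in> S"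
    "\<And>x y. x \<in> S \<Longrightarrow> y \<in> S \<Longrightarrow> x \<otimes> y \<in> S" "\<And>c x. x \<in> S \<Longrightarrow> c \<odot> x \<in> S" "\<And>x. x \<in> S \<Longrightarrow> star A x \<in> S"
    using assms unfolding star_subalgebra_iff by auto
  have two: "x \<oplus> y \<in> cls S \<and> x \<otimes> y \<in> cls S" if xs: "x \<in> cls S" and ys: "y \<in> cls S" for x y
  proof -
    obtain s where s: "\<And>k. s k \<in> S" "N.tends s x"
      using N.closure_tends[OF xs] by blast
    obtain t where t: "\<And>k. t k \<in> S" "N.tends t y"
      using N.closure_tends[OF ys] by blast
    have "\<forall>k. s k \<oplus> t k \<in> S" "\<forall>k. s k \<otimes> t k \<in> S"
      using s(1) t(1) S by simp_all
    then show ?thesis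
      by (intro conjI N.tends_closure[OF _ N.tends_add[OF s(2) t(2)]] N.tends_closure[OF _ tends_mult[OF s(2) t(2)]]) simp_all
  qed
  have one: "c \<odot> x \<in> cls S \<and> star A x \<in> cls S" if xs: "x \<in> cls S" for c x
  proof -
    obtain s where s: "\<And>k. s k \<in> S" "N.tends s x"
      using N.closure_tends[OF xs] by blast
    have "\<forall>k. c \<odot> s k \<in> S" "\<forall>k. star A (s k) \<in> S"
      using s(1) S by simp_all
    then show ?thesis
      by (intro conjI N.tends_closure[OF _ N.tends_smult[OF s(2)]] N.tends_closure[OF _ tends_star[OF s(2)]]) simp_all
  qed
  show ?thesis
    unfolding star_subalgebra_iff using two one cls_superset[OF S(1)] S(2) by (auto simp: N.mem_closure_iff)
qed

lemma closed_star_subalgebra: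
  assumes S: "star_subalgebra S A" and cl: "cls S \<subseteq> S"
  shows "cstar_algebra (A\<lparr>carrier := S\<rparr>)"
proof -
  have W: "submodule S complex_ring A"
    using S by (simp add: star_subalgebra_def)
  interpret S: normed_module "A\<lparr>carrier := S\<rparr>" "nrm A"
    by (rule normed_module_sub(1)[OF N.normed_module_axioms W])
  have c: "norm_complete (A\<lparr>carrier := S\<rparr>) (nrm A)"
    by (rule norm_complete_sub[OF N.normed_module_axioms W complete cl])
  then have c': "norm_complete (A\<lparr>carrier := S\<rparr>) (nrm (A\<lparr>carrier := S\<rparr>))"
    by simp
  have S': "\<And>x. x \<in> S \<Longrightarrow> x \<in> carrier A" "\<And>x y. x \<in> S \<Longrightarrow> y \<in> S \<Longrightarrow> x \<otimes> y \<in> S"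
    "\<And>x. x \<in> S \<Longrightarrow> star A x \<in> S"
    using S unfolding star_subalgebra_iff by auto
  show ?thesis
    by (unfold_locales; (rule c')?)
      (simp_all add: S' mult_assoc mult_add_left mult_add_right smult_mult_left smult_mult_right star_add
         star_smult star_mult nrm_eq_0 nrm_triangle nrm_smult nrm_mult cstar_identity nrm_nonneg)
qed

lemma generated_star_subalgebra:
  assumes "G \<subseteq> carrier A"
  shows "star_subalgebra (generated_star_subalgebra A G) A" "G \<subseteq> generated_star_subalgebra A G"
proof -
  have "star_subalgebra (carrier A) A"
    by (simp add: star_subalgebra_iff)
  then have "carrier A \<in> {S. star_subalgebra S A \<and> G \<subseteq> S}"
    using assms by simp
  then show "star_subalgebra (generated_star_subalgebra A G) A"
    unfolding generated_star_subalgebra_def star_subalgebra_iff[of "\<Inter>_"]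
    by (intro conjI ballI allI InterI) (simp_all add: Inter_lower star_subalgebra_iff)
  show "G \<subseteq> generated_star_subalgebra A G"
    unfolding generated_star_subalgebra_def by blast
qed

lemma generated_star_subalgebra_least:
  "star_subalgebra S A \<Longrightarrow> G \<subseteq> S \<Longrightarrow> generated_star_subalgebra A G \<subseteq> S"
  by (auto simp: generated_star_subalgebra_def)

text \<open>No case for the adjoint: the elements that have the property together with their adjoints
  form a *-subalgebra.\<close>

lemma closure_generated_induct [consumes 3, case_names zero gen add smult mult lim]:
  assumes x: "x \<in> cls (generated_star_subalgebra A G)"
    and G: "G \<subseteq> carrier A" and Gs: "\<And>x. x \<in> G \<Longrightarrow> star A x \<in> G"
    and P0: "P \<zero>"
    and P: "\<And>x. x \<in> G \<Longrightarrow> P x"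
    "\<And>x y. \<lbrakk>x \<in> cls (generated_star_subalgebra A G); y \<in> cls (generated_star_subalgebra A G); P x; P y\<rbrakk> \<Longrightarrow> P (x \<oplus> y)"
    "\<And>c x. \<lbrakk>x \<in> cls (generated_star_subalgebra A G); P x\<rbrakk> \<Longrightarrow> P (c \<odot> x)"
    "\<And>x y. \<lbrakk>x \<in> cls (generated_star_subalgebra A G); y \<in> cls (generated_star_subalgebra A G); P x; P y\<rbrakk> \<Longrightarrow> P (x \<otimes> y)"
    "\<And>s x. \<lbrakk>\<And>k. s k \<in> cls (generated_star_subalgebra A G); \<And>k. P (s k); N.tends s x;
        x \<in> cls (generated_star_subalgebra A G)\<rbrakk> \<Longrightarrow> P x"
  shows "P x"
proof -
  let ?C = "cls (generated_star_subalgebra A G)"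
  note gs = generated_star_subalgebra[OF G]
  note C = star_subalgebra_closure[OF gs(1)]
  have C': "?C \<subseteq> carrier A" "\<zero> \<in> ?C" "\<And>x y. x \<in> ?C \<Longrightarrow> y \<in> ?C \<Longrightarrow> x \<oplus> y \<in> ?C"
    "\<And>x y. x \<in> ?C \<Longrightarrow> y \<in> ?C \<Longrightarrow> x \<otimes> y \<in> ?C" "\<And>c x. x \<in> ?C \<Longrightarrow> c \<odot> x \<in> ?C" "\<And>x. x \<in> ?C \<Longrightarrow> star A x \<in> ?C"
    using C unfolding star_subalgebra_iff by auto
  have GC: "G \<subseteq> ?C"
    using gs cls_superset[of "generated_star_subalgebra A G"] by (auto simp: star_subalgebra_iff)
  define S where "S = {x \<in> ?C. P x \<and> P (star A x)}"
  have z: "\<zero> \<in> S"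
    using P0 C' by (simp add: S_def)
  have "star_subalgebra S A"
    unfolding star_subalgebra_iff
  proof (intro conjI ballI allI)
    show "S \<subseteq> carrier A"
      using C' by (auto simp: S_def)
    show "x \<oplus> y \<in> S" "x \<otimes> y \<in> S" if "x \<in> S" "y \<in> S" for x y
      using that C' P(2)[of x y] P(2)[of "star A x" "star A y"] P(4)[of x y] P(4)[of "star A y" "star A x"]
      unfolding S_def by (auto simp: star_add star_mult subset_iff)
    show "c \<odot> x \<in> S" if "x \<in> S" for c x
      using that C' P(3)[of x c] P(3)[of "star A x" "cnj c"] unfolding S_def by (auto simp: star_smult subset_iff)
    show "star A x \<in> S" if "x \<in> S" for x
      using that C' unfolding S_def by (auto simp: subset_iff)
  qed (rule z)
  moreover have "G \<subseteq> S"
    using GC Gs P(1) by (auto simp: S_def)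
  ultimately have sub: "generated_star_subalgebra A G \<subseteq> S"
    by (rule generated_star_subalgebra_least)
  obtain s where s: "\<And>k. s k \<in> generated_star_subalgebra A G" "N.tends s x"
    using N.closure_tends[OF x] by blast
  show ?thesis
    by (rule P(5)[of s x]) (use s sub x in \<open>auto simp: S_def subset_iff\<close>)
qed

end

section \<open>Contractivity of *-morphisms\<close>

context cstar_algebra
begin

text \<open>\<open>k = 1 - sqrt (1 - h\<^sup>2)\<close> as the limit of the iteration \<open>k \<mapsto> (h\<^sup>2 + k\<^sup>2) / 2\<close>. The equation for \<open>k\<close> is
  preserved by *-morphisms and forces norm at most 1, so that contractivity needs no spectral theory.\<close>

lemma quasi_square_root:
  assumes h: "h \<in> carrier A" "star A h = h" "nrm A h < 1"
  shows "\<exists>k\<in>carrier A. star A k = k \<and> h \<otimes> k = k \<otimes> h \<and> h \<otimes> h = 2 \<odot> k \<ominus> k \<otimes> k"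
proof -
  define c where "c = h \<otimes> h"
  define q where "q = nrm A c"
  have c: "c \<in> carrier A" "star A c = c" "h \<otimes> c = c \<otimes> h"
    using h by (auto simp: c_def star_mult mult_assoc)
  have q: "0 \<le> q" "q < 1"
    using h cstar_identity[of h] nrm_nonneg[of h] c by (simp_all add: c_def q_def power_less_one_iff)
  define g where "g k = (1/2) \<odot> (c \<oplus> k \<otimes> k)" for k
  define s where "s i = (g ^^ i) \<zero>" for i
  have s_Suc: "s (Suc i) = g (s i)" and s0: "s 0 = \<zero>" for i
    by (simp_all add: s_def)
  have s: "s i \<in> carrier A \<and> star A (s i) = s i \<and> h \<otimes> s i = s i \<otimes> h \<and> nrm A (s i) \<le> q" for i
  proof (induction i)
    case 0
    then show ?case using q h by (simp add: s0)
  next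
    case (Suc i)
    then have i: "s i \<in> carrier A" "star A (s i) = s i" "h \<otimes> s i = s i \<otimes> h" "nrm A (s i) \<le> q"
      by auto
    have "h \<otimes> (s i \<otimes> s i) = (s i \<otimes> s i) \<otimes> h"
      using i h by (metis mult_assoc)
    moreover have "nrm A (c \<oplus> s i \<otimes> s i) \<le> q + q"
    proof -
      have "nrm A (s i \<otimes> s i) \<le> q * q"
        using nrm_mult[of "s i" "s i"] i q mult_mono[of "nrm A (s i)" q "nrm A (s i)" q] nrm_nonneg[of "s i"] by simp
      also have "\<dots> \<le> q"
        using q by (simp add: mult_left_le)
      finally show ?thesis
        using nrm_triangle[of c "s i \<otimes> s i"] i c by (simp add: q_def)
    qed
    ultimately show ?case
      using i h c by (simp add: s_Suc g_def star_smult star_add star_mult smult_mult_left smult_mult_right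
          mult_add_left mult_add_right nrm_smult)
  qed
  \<comment> \<open>All iterates stay in the ball of radius \<open>q\<close> < 1, and there
    \<open>g\<close> is Lipschitz with constant \<open>q\<close>: the difference of two squares
    costs at most 2 \<open>q\<close> times the distance, and \<open>g\<close> halves it.\<close>
  have step: "nrm A (s (Suc i) \<ominus> s i) \<le> 1 * q ^ i" for i
  proof (induction i)
    case 0
    then show ?case using s[of "Suc 0"] q by (simp add: s0)
  next
    case (Suc i)
    have gg: "g y \<ominus> g x = (1/2) \<odot> (y \<otimes> y \<ominus> x \<otimes> x)" if "x \<in> carrier A" "y \<in> carrier A" for x y
      unfolding g_def
      by (rule linear_combinations3[of c "y \<otimes> y" "x \<otimes> x"]) (use c that in \<open>simp_all add: v_minus\<close>)
    have "s (Suc (Suc i)) \<ominus> s (Suc i) = (1/2) \<odot> (s (Suc i) \<otimes> s (Suc i) \<ominus> s i \<otimes> s i)"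
      using gg[of "s i" "s (Suc i)"] s unfolding s_Suc[symmetric] by simp
    then have "nrm A (s (Suc (Suc i)) \<ominus> s (Suc i)) = (1/2) * nrm A (s (Suc i) \<otimes> s (Suc i) \<ominus> s i \<otimes> s i)"
      using s by (simp add: nrm_smult)
    also have "\<dots> \<le> (1/2) * (nrm A (s (Suc i) \<ominus> s i) * q + q * nrm A (s (Suc i) \<ominus> s i))"
      using nrm_mult_minus_mult_le[of "s i" "s i" "s (Suc i)" "s (Suc i)"] s[of i] s[of "Suc i"]
        mult_left_mono[of "nrm A (s (Suc i))" q "nrm A (s (Suc i) \<ominus> s i)"]
        mult_right_mono[of "nrm A (s i)" q "nrm A (s (Suc i) \<ominus> s i)"] nrm_nonneg[of "s (Suc i) \<ominus> s i"]
      by (simp add: ac_simps)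
    also have "\<dots> \<le> 1 * q ^ Suc i"
      using mult_left_mono[OF Suc q(1)] by (simp add: mult.commute)
    finally show ?case .
  qed
  have "N.cauchy_seq s"
    by (rule N.cauchy_seq_geometric(1)[OF _ q step]) (use s in blast)
  then obtain k where k: "N.tends s k"
    using complete N.norm_complete_iff by blast
  have kc: "k \<in> carrier A"
    using k by (simp add: N.tends_def)
  have "N.tends (\<lambda>i. star A (s i)) (star A k)"
    by (rule tends_star[OF k])
  then have 1: "star A k = k"
    using s k N.tends_unique by (metis (no_types, lifting) ext)
  have "N.tends (\<lambda>i. h \<otimes> s i) (h \<otimes> k)" "N.tends (\<lambda>i. s i \<otimes> h) (k \<otimes> h)"
    using tends_mult k N.tends_const h by blast+
  then have 2: "h \<otimes> k = k \<otimes> h"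
    using s N.tends_unique by (metis (no_types, lifting) ext)
  have "N.tends (\<lambda>i. s (Suc i)) (g k)"
    unfolding s_Suc g_def by (intro N.tends_smult N.tends_add N.tends_const tends_mult c k)
  then have 3: "k = g k"
    using N.tends_Suc[OF k] N.tends_unique by blast
  then have "2 \<odot> k = 2 \<odot> g k"
    by simp
  also have "\<dots> = c \<oplus> k \<otimes> k"
    using kc c by (simp add: g_def)
  finally have "2 \<odot> k \<ominus> k \<otimes> k = (c \<oplus> k \<otimes> k) \<ominus> k \<otimes> k"
    by simp
  also have "\<dots> = c"
    by (rule linear_combinations2[of c "k \<otimes> k"]) (use kc c in \<open>simp_all add: v_minus\<close>)
  finally have "c = 2 \<odot> k \<ominus> k \<otimes> k"
    by simp
  then show ?thesis
    using 1 2 kc by (auto simp: c_def)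
qed

text \<open>Formally \<open>b \<plusminus> \<i> (1 - l)\<close> is unitary and \<open>b\<close> is the mean of these two elements; multiplication by
  \<open>b\<close> keeps the argument inside a possibly nonunital algebra.\<close>

lemma nrm_le_1_if_quasi_square_root:
  assumes b: "b \<in> carrier A" "star A b = b" and l: "l \<in> carrier A" "star A l = l"
    and comm: "b \<otimes> l = l \<otimes> b" and eq: "b \<otimes> b = 2 \<odot> l \<ominus> l \<otimes> l"
  shows "nrm A b \<le> 1"
proof -
  define u where "u = b \<otimes> b"
  define w where "w = b \<ominus> l \<otimes> b"
  define t where "t = l \<otimes> u"
  have cl: "u \<in> carrier A" "w \<in> carrier A" "t \<in> carrier A"
    using b l by (auto simp: u_def w_def t_def)
  have e1: "b \<otimes> (l \<otimes> b) = t" "(l \<otimes> b) \<otimes> b = t"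
    using b l comm by (simp_all add: t_def u_def mult_assoc[symmetric])
  have e2: "(l \<otimes> b) \<otimes> (l \<otimes> b) = l \<otimes> t"
    using b l comm by (metis mult_assoc mult_closed t_def u_def)
  have ww: "w \<otimes> w = (u \<ominus> t) \<ominus> (t \<ominus> l \<otimes> t)"
    using b l by (simp add: w_def mult_minus_left mult_minus_right e1 e2) (simp add: u_def)
  have uu: "u \<otimes> u = 2 \<odot> t \<ominus> l \<otimes> t"
  proof -
    have "u \<otimes> u = (2 \<odot> l \<ominus> l \<otimes> l) \<otimes> u"
      by (simp add: eq[folded u_def])
    also have "\<dots> = 2 \<odot> t \<ominus> l \<otimes> t"
      using l cl by (simp add: mult_minus_left smult_mult_left t_def mult_assoc)
    finally show ?thesis .
  qed
  \<comment> \<open>The equation for \<open>l\<close> says b^2 + (1 - l)^2 = 1. Multiplied by b^2 it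
    becomes this one, with u = b^2 and w = (1 - l) b, and no unit is mentioned any more.\<close>
  have sum: "u \<otimes> u \<oplus> w \<otimes> w = u"
    unfolding uu ww by (rule linear_combinations3[of u t "l \<otimes> t"]) (use cl l in \<open>simp_all add: v_minus\<close>)
  have uw: "u \<otimes> w = w \<otimes> u"
  proof -
    have "u \<otimes> (l \<otimes> b) = (l \<otimes> b) \<otimes> u" "u \<otimes> b = b \<otimes> u"
      using b l comm unfolding u_def by (metis mult_assoc mult_closed)+
    then show ?thesis
      using b l cl by (simp add: w_def mult_minus_left mult_minus_right)
  qed
  have st: "star A u = u" "star A w = w"
    using b l comm by (simp_all add: u_def w_def star_mult star_minus)
  \<comment> \<open>For s = \<plusminus>\<i> the cross terms cancel because u and w commute, and u^2
    + w^2 = u = b* b is left; the C*-identity then gives the norm of b.\<close>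
  have p: "nrm A (u \<oplus> s \<odot> w) = nrm A b" if s: "cnj s = - s" "s * s = -1" for s
  proof -
    have "star A (u \<oplus> s \<odot> w) \<otimes> (u \<oplus> s \<odot> w) = u \<otimes> u \<oplus> w \<otimes> w"
      using cl st uw s
      by (simp add: star_add star_smult mult_add_left mult_add_right smult_mult_left smult_mult_right)
         (rule linear_combinations3[of "u \<otimes> u" "w \<otimes> u" "w \<otimes> w"]; simp)
    then have "(nrm A (u \<oplus> s \<odot> w))\<^sup>2 = (nrm A b)\<^sup>2"
      using cstar_identity[of "u \<oplus> s \<odot> w"] cstar_identity[of b] cl b sum by (simp add: u_def)
    then show ?thesis
      using cl b nrm_nonneg power2_eq_imp_eq by (metis v_add v_smult)
  qed
  have "2 \<odot> u = (u \<oplus> \<i> \<odot> w) \<oplus> (u \<oplus> (-\<i>) \<odot> w)"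
    by (rule linear_combinations2[of u w]) (use cl in simp_all)
  then have "2 * nrm A u \<le> nrm A (u \<oplus> \<i> \<odot> w) + nrm A (u \<oplus> (-\<i>) \<odot> w)"
    using nrm_triangle[of "u \<oplus> \<i> \<odot> w" "u \<oplus> (-\<i>) \<odot> w"] nrm_smult[of u 2] cl by simp
  also have "\<dots> = 2 * nrm A b"
    using p[of \<i>] p[of "-\<i>"] by simp
  finally have "nrm A b * nrm A b \<le> nrm A b"
    using cstar_identity[of b] b by (simp add: u_def power2_eq_square)
  then show ?thesis
    using nrm_nonneg[OF b(1)] by (cases "nrm A b = 0") auto
qed

end

lemma star_homD:
  assumes "star_hom A B \<phi>"
  shows "x \<in> carrier A \<Longrightarrow> \<phi> x \<in> carrier B"
    "x \<in> carrier A \<Longrightarrow> y \<in> carrier A \<Longrightarrow> \<phi> (x \<oplus>\<^bsub>A\<^esub> y) = \<phi> x \<oplus>\<^bsub>B\<^esub> \<phi> y"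
    "x \<in> carrier A \<Longrightarrow> \<phi> (c \<odot>\<^bsub>A\<^esub> x) = c \<odot>\<^bsub>B\<^esub> \<phi> x"
    "x \<in> carrier A \<Longrightarrow> y \<in> carrier A \<Longrightarrow> \<phi> (x \<otimes>\<^bsub>A\<^esub> y) = \<phi> x \<otimes>\<^bsub>B\<^esub> \<phi> y"
    "x \<in> carrier A \<Longrightarrow> \<phi> (star A x) = star B (\<phi> x)"
  using assms unfolding star_hom_def linear_map_def by auto

lemma star_homI:
  assumes "\<And>x. x \<in> carrier A \<Longrightarrow> \<phi> x \<in> carrier B"
    "\<And>x y. x \<in> carrier A \<Longrightarrow> y \<in> carrier A \<Longrightarrow> \<phi> (x \<oplus>\<^bsub>A\<^esub> y) = \<phi> x \<oplus>\<^bsub>B\<^esub> \<phi> y"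
    "\<And>c x. x \<in> carrier A \<Longrightarrow> \<phi> (c \<odot>\<^bsub>A\<^esub> x) = c \<odot>\<^bsub>B\<^esub> \<phi> x"
    "\<And>x y. x \<in> carrier A \<Longrightarrow> y \<in> carrier A \<Longrightarrow> \<phi> (x \<otimes>\<^bsub>A\<^esub> y) = \<phi> x \<otimes>\<^bsub>B\<^esub> \<phi> y"
    "\<And>x. x \<in> carrier A \<Longrightarrow> \<phi> (star A x) = star B (\<phi> x)"
  shows "star_hom A B \<phi>"
  using assms unfolding star_hom_def linear_map_def by auto

lemma star_hom_compose: "star_hom A B \<phi> \<Longrightarrow> star_hom B C \<psi> \<Longrightarrow> star_hom A C (\<lambda>x. \<psi> (\<phi> x))"
  by (rule star_homI) (simp_all add: star_homD)

lemma linear_map_zero_minus: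
  assumes "linear_map M M' T" "complex_module M" "complex_module M'"
  shows "T \<zero>\<^bsub>M\<^esub> = \<zero>\<^bsub>M'\<^esub>"
    "x \<in> carrier M \<Longrightarrow> y \<in> carrier M \<Longrightarrow> T (x \<ominus>\<^bsub>M\<^esub> y) = T x \<ominus>\<^bsub>M'\<^esub> T y"
proof -
  interpret M: complex_module M by fact
  interpret M': complex_module M' by fact
  have T: "T x \<in> carrier M'" "T (c \<odot>\<^bsub>M\<^esub> x) = c \<odot>\<^bsub>M'\<^esub> T x" if "x \<in> carrier M" for x c
    using assms(1) that by (auto simp: linear_map_def)
  show "T \<zero>\<^bsub>M\<^esub> = \<zero>\<^bsub>M'\<^esub>"
    using T(2)[of "\<zero>\<^bsub>M\<^esub>" 0] T(1)[of "\<zero>\<^bsub>M\<^esub>"] by simp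
  show "x \<in> carrier M \<Longrightarrow> y \<in> carrier M \<Longrightarrow> T (x \<ominus>\<^bsub>M\<^esub> y) = T x \<ominus>\<^bsub>M'\<^esub> T y"
    using assms(1) T by (simp add: linear_map_def M.v_minus M'.v_minus)
qed

text \<open>For a self-adjoint h of norm below 1, \<open>\<phi>\<close> carries the quasi square
  root along, and its equation keeps the norm of the image at most 1. Scaling covers all
  self-adjoint elements, and the C*-identity reduces an arbitrary a to a* a.\<close>

theorem star_hom_contractive:
  assumes "cstar_algebra A" "cstar_algebra B" and \<phi>: "star_hom A B \<phi>" and a: "a \<in> carrier A"
  shows "nrm B (\<phi> a) \<le> nrm A a"
proof -
  interpret A: cstar_algebra A by fact
  interpret B: cstar_algebra B by fact
  note \<phi>' = star_homD[OF \<phi>]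
  have minus: "\<phi> (x \<ominus>\<^bsub>A\<^esub> y) = \<phi> x \<ominus>\<^bsub>B\<^esub> \<phi> y" if "x \<in> carrier A" "y \<in> carrier A" for x y
    using \<phi> that linear_map_zero_minus(2)[OF _ A.complex_module_axioms B.complex_module_axioms] by (simp add: star_hom_def)
  have 1: "nrm B (\<phi> h) \<le> 1" if h: "h \<in> carrier A" "star A h = h" "nrm A h < 1" for h
  proof -
    obtain k where k: "k \<in> carrier A" "star A k = k" "h \<otimes>\<^bsub>A\<^esub> k = k \<otimes>\<^bsub>A\<^esub> h" "h \<otimes>\<^bsub>A\<^esub> h = 2 \<odot>\<^bsub>A\<^esub> k \<ominus>\<^bsub>A\<^esub> k \<otimes>\<^bsub>A\<^esub> k"
      using A.quasi_square_root[OF h] by blast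
    have "\<phi> h \<otimes>\<^bsub>B\<^esub> \<phi> h = 2 \<odot>\<^bsub>B\<^esub> \<phi> k \<ominus>\<^bsub>B\<^esub> \<phi> k \<otimes>\<^bsub>B\<^esub> \<phi> k"
      using arg_cong[OF k(4), of \<phi>] h(1) k(1) by (simp add: \<phi>' minus)
    moreover have "\<phi> h \<otimes>\<^bsub>B\<^esub> \<phi> k = \<phi> k \<otimes>\<^bsub>B\<^esub> \<phi> h"
      using arg_cong[OF k(3), of \<phi>] h(1) k(1) by (simp add: \<phi>')
    moreover have "star B (\<phi> h) = \<phi> h" "star B (\<phi> k) = \<phi> k"
      using \<phi>'(5)[of h] \<phi>'(5)[of k] h k by simp_all
    ultimately show ?thesis
      using B.nrm_le_1_if_quasi_square_root[of "\<phi> h" "\<phi> k"] h k by (simp add: \<phi>')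
  qed
  have 2: "nrm B (\<phi> h) \<le> nrm A h" if h: "h \<in> carrier A" "star A h = h" for h
  \<comment> \<open>The previous bound needs norm strictly below 1, so h is divided by an arbitrary
    c above its norm instead of by the norm itself; this also covers h = 0.\<close>
  proof (rule dense_ge)
    fix c assume c: "nrm A h < c"
    then have c0: "0 < c"
      using A.nrm_nonneg[OF h(1)] by simp
    have "nrm B (\<phi> (complex_of_real (1/c) \<odot>\<^bsub>A\<^esub> h)) \<le> 1"
      by (rule 1) (use h c c0 in \<open>simp_all add: A.star_smult A.nrm_smult norm_divide\<close>)
    then show "nrm B (\<phi> h) \<le> c"
      using h c0 by (simp add: \<phi>' B.nrm_smult norm_divide field_simps)
  qed
  have "(nrm B (\<phi> a))\<^sup>2 \<le> (nrm A a)\<^sup>2"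
    using 2[of "star A a \<otimes>\<^bsub>A\<^esub> a"] a A.cstar_identity[of a] B.cstar_identity[of "\<phi> a"] by (simp add: \<phi>' A.star_mult)
  then show ?thesis
    using A.nrm_nonneg[OF a] by (rule power2_le_imp_le)
qed

subsection \<open>Constructions\<close>

text \<open>Carries a C*-algebra along an injection into another type. The universal property
  quantifies over targets in one fixed type only, and this is how other targets get there.\<close>

lemma cstar_algebra_transport:
  fixes D :: "('d, 'm) star_alg_scheme" and g :: "'d \<Rightarrow> 'e"
  assumes "cstar_algebra D" and g: "inj_on g (carrier D)"
  obtains B :: "'e star_alg" where "cstar_algebra B" "carrier B = g ` carrier D" "star_hom D B g"
    "star_hom B D (inv_into (carrier D) g)"
proof -
  interpret D: cstar_algebra D by fact
  define i where "i = inv_into (carrier D) g"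
  have ig [simp]: "i (g x) = x" if "x \<in> carrier D" for x
    using g that by (simp add: i_def)
  define B :: "'e star_alg" where "B = \<lparr>carrier = g ` carrier D, monoid.mult = (\<lambda>x y. g (i x \<otimes>\<^bsub>D\<^esub> i y)),
     one = g \<zero>\<^bsub>D\<^esub>, zero = g \<zero>\<^bsub>D\<^esub>, add = (\<lambda>x y. g (i x \<oplus>\<^bsub>D\<^esub> i y)),
     smult = (\<lambda>c x. g (c \<odot>\<^bsub>D\<^esub> i x)), star = (\<lambda>x. g (star D (i x))), nrm = (\<lambda>x. nrm D (i x))\<rparr>"
  have B [simp]: "carrier B = g ` carrier D" "x \<otimes>\<^bsub>B\<^esub> y = g (i x \<otimes>\<^bsub>D\<^esub> i y)" "\<zero>\<^bsub>B\<^esub> = g \<zero>\<^bsub>D\<^esub>"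
    "x \<oplus>\<^bsub>B\<^esub> y = g (i x \<oplus>\<^bsub>D\<^esub> i y)" "c \<odot>\<^bsub>B\<^esub> x = g (c \<odot>\<^bsub>D\<^esub> i x)" "star B x = g (star D (i x))"
    "nrm B x = nrm D (i x)" for x y c
    by (simp_all add: B_def)
  interpret B: complex_module B
    by (rule complex_moduleI) (auto simp: D.v_assoc D.v_comm D.v_lcomm D.v_add_smult D.v_smult_add)
  have g_eq: "g x = g y \<longleftrightarrow> x = y" if "x \<in> carrier D" "y \<in> carrier D" for x y
    using g that by (auto dest: inj_onD)
  interpret B: normed_module B "nrm B"
    by unfold_locales (auto simp: D.nrm_nonneg D.nrm_eq_0 D.nrm_triangle D.nrm_smult g_eq)
  have minus: "g x \<ominus>\<^bsub>B\<^esub> g y = g (x \<ominus>\<^bsub>D\<^esub> y)" if "x \<in> carrier D" "y \<in> carrier D" for x y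
    using that by (subst B.v_minus) (auto simp: D.v_minus)
  have "norm_complete B (nrm B)"
    unfolding B.norm_complete_iff
  proof safe
    fix s assume s: "B.cauchy_seq s"
    define t where "t k = i (s k)" for k
    have t: "t k \<in> carrier D \<and> s k = g (t k)" for k
    proof -
      have "s k \<in> g ` carrier D"
        using s by (simp add: B.cauchy_seq_def)
      then show ?thesis
        by (auto simp: t_def)
    qed
    have st: "s = (\<lambda>k. g (t k))"
      using t by blast
    have "D.N.cauchy_seq t"
      using s t unfolding st B.cauchy_seq_def D.N.cauchy_seq_def by (simp add: minus)
    then obtain x where x: "D.N.tends t x"
      using D.complete D.N.norm_complete_iff by blast
    then have "B.tends s (g x)"
      unfolding st B.tends_def D.N.tends_def by (simp add: minus)
    then show "\<exists>x. B.tends s x"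
      by blast
  qed
  then have c: "cstar_algebra B"
    by unfold_locales
      (auto simp: D.nrm_nonneg D.nrm_eq_0 D.nrm_triangle D.nrm_smult D.nrm_mult D.cstar_identity g_eq
        D.mult_assoc D.mult_add_left D.mult_add_right D.smult_mult_left D.smult_mult_right D.star_add
        D.star_smult D.star_mult)
  show thesis
    by (rule that[OF c]) (auto intro!: star_homI simp: i_def[symmetric])
qed

text \<open>Completeness of the fibres gives pointwise limits, and letting j tend to infinity in the
  Cauchy estimate, whose bound does not depend on x, makes the convergence uniform. Both the bounded
  fields and the sections have norms that are suprema over the base, and both are complete for this
  reason.\<close>

lemma uniform_complete:
  fixes M :: "'x \<Rightarrow> (complex, 'a, 'm) module_scheme"
    and s :: "nat \<Rightarrow> 'x \<Rightarrow> 'a"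
  assumes M: "\<And>x. normed_module (M x) (n x)" and c: "\<And>x. norm_complete (M x) (n x)"
    and s: "\<And>k x. s k x \<in> carrier (M x)"
    and cauchy: "\<And>e. e > 0 \<Longrightarrow> \<exists>N. \<forall>i\<ge>N. \<forall>j\<ge>N. \<forall>x. n x (s i x \<ominus>\<^bsub>M x\<^esub> s j x) \<le> e"
  obtains a where "\<And>x. a x \<in> carrier (M x)"
    "\<And>e. e > 0 \<Longrightarrow> \<exists>N. \<forall>k\<ge>N. \<forall>x. n x (s k x \<ominus>\<^bsub>M x\<^esub> a x) \<le> e"
proof -
  have "\<exists>a. normed_module.tends (M x) (n x) (\<lambda>k. s k x) a" for x
  proof -
    interpret normed_module "M x" "n x" by (rule M)
    have "cauchy_seq (\<lambda>k. s k x)"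
      unfolding cauchy_seq_def
    proof (intro conjI allI impI s)
      fix e :: real assume "e > 0"
      then obtain N where N: "\<forall>i\<ge>N. \<forall>j\<ge>N. \<forall>x. n x (s i x \<ominus>\<^bsub>M x\<^esub> s j x) \<le> e / 2"
        using cauchy[of "e / 2"] by auto
      have "n x (s i x \<ominus>\<^bsub>M x\<^esub> s j x) < e" if "i \<ge> N" "j \<ge> N" for i j
      proof -
        have "n x (s i x \<ominus>\<^bsub>M x\<^esub> s j x) \<le> e / 2"
          using N that by blast
        then show ?thesis
          using \<open>e > 0\<close> by linarith
      qed
      then show "\<exists>N. \<forall>i\<ge>N. \<forall>j\<ge>N. n x (s i x \<ominus>\<^bsub>M x\<^esub> s j x) < e"
        by blast
    qed
    then show ?thesis
      using c[of x] unfolding norm_complete_iff by simp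
  qed
  then obtain a where a: "\<And>x. normed_module.tends (M x) (n x) (\<lambda>k. s k x) (a x)"
    by metis
  have ac: "a x \<in> carrier (M x)" for x
    using a[of x] normed_module.tends_def[OF M] by metis
  have "\<exists>N. \<forall>k\<ge>N. \<forall>x. n x (s k x \<ominus>\<^bsub>M x\<^esub> a x) \<le> e" if e: "e > 0" for e
  proof -
    obtain N where N: "\<forall>i\<ge>N. \<forall>j\<ge>N. \<forall>x. n x (s i x \<ominus>\<^bsub>M x\<^esub> s j x) \<le> e"
      using cauchy[OF e] by blast
    have "n x (s k x \<ominus>\<^bsub>M x\<^esub> a x) \<le> e" if "k \<ge> N" for k x
    proof -
      interpret normed_module "M x" "n x" by (rule M)
      have "(\<lambda>j. e + n x (s j x \<ominus>\<^bsub>M x\<^esub> a x)) \<longlonglongrightarrow> e + 0"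
        using a[of x] by (intro tendsto_intros) (auto simp: tends_def)
      moreover have "\<exists>N. \<forall>j\<ge>N. n x (s k x \<ominus>\<^bsub>M x\<^esub> a x) \<le> e + n x (s j x \<ominus>\<^bsub>M x\<^esub> a x)"
      proof (intro exI[of _ N] allI impI)
        fix j assume "j \<ge> N"
        then have "n x (s k x \<ominus>\<^bsub>M x\<^esub> s j x) \<le> e"
          using N that by blast
        then show "n x (s k x \<ominus>\<^bsub>M x\<^esub> a x) \<le> e + n x (s j x \<ominus>\<^bsub>M x\<^esub> a x)"
          using n_minus_triangle[of "s k x" "s j x" "a x"] s ac by simp
      qed
      ultimately have "n x (s k x \<ominus>\<^bsub>M x\<^esub> a x) \<le> e + 0"
        by (rule LIMSEQ_le_const)
      then show ?thesis by simp
    qed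
    then show ?thesis by blast
  qed
  then show thesis
    using that[of a] ac by blast
qed

section \<open>The C*-algebra of bounded fields over a family of C*-algebras\<close>

lemma product_algebra_sel [simp]:
  "mult (product_algebra Ax) = (\<lambda>a b x. a x \<otimes>\<^bsub>Ax x\<^esub> b x)" "add (product_algebra Ax) = (\<lambda>a b x. a x \<oplus>\<^bsub>Ax x\<^esub> b x)"
  "zero (product_algebra Ax) = (\<lambda>x. \<zero>\<^bsub>Ax x\<^esub>)" "smult (product_algebra Ax) = (\<lambda>c a x. c \<odot>\<^bsub>Ax x\<^esub> a x)"
  "star (product_algebra Ax) = (\<lambda>a x. star (Ax x) (a x))"
  by (simp_all add: product_algebra_def)

locale cstar_family =
  fixes Ax :: "'x \<Rightarrow> 'c star_alg"
  assumes fibre: "\<And>x. cstar_algebra (Ax x)"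
begin

sublocale F: cstar_algebra "Ax x" for x by (rule fibre)

abbreviation "P \<equiv> product_algebra Ax"

lemma P_carrier: "a \<in> carrier P \<longleftrightarrow> (\<forall>x. a x \<in> carrier (Ax x)) \<and> (\<exists>c. \<forall>x. nrm (Ax x) (a x) \<le> c)"
  by (auto simp: product_algebra_def bdd_above_def)

lemma P_nrm_upper: "a \<in> carrier P \<Longrightarrow> nrm (Ax x) (a x) \<le> nrm P a"
  using cSUP_upper[of x UNIV "\<lambda>x. nrm (Ax x) (a x)"] by (simp add: product_algebra_def)

lemma P_nrm_least: "(\<And>x. nrm (Ax x) (a x) \<le> c) \<Longrightarrow> nrm P a \<le> c"
  using cSUP_least[of UNIV "\<lambda>x. nrm (Ax x) (a x)" c] by (simp add: product_algebra_def)

lemma P_carrierI: "(\<And>x. a x \<in> carrier (Ax x)) \<Longrightarrow> (\<And>x. nrm (Ax x) (a x) \<le> c) \<Longrightarrow> a \<in> carrier P"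
  by (auto simp: P_carrier)

lemma P_fibre: "a \<in> carrier P \<Longrightarrow> a x \<in> carrier (Ax x)"
  by (simp add: P_carrier)

lemma P_nonneg: "a \<in> carrier P \<Longrightarrow> 0 \<le> nrm P a"
  by (rule order_trans[OF F.nrm_nonneg[OF P_fibre] P_nrm_upper])

lemma P_mult_bound:
  assumes "a \<in> carrier P" "b \<in> carrier P"
  shows "nrm (Ax x) (a x \<otimes>\<^bsub>Ax x\<^esub> b x) \<le> nrm P a * nrm P b"
  using F.nrm_mult[OF P_fibre P_fibre, OF assms, of x]
    mult_mono[OF P_nrm_upper P_nrm_upper, OF assms P_nonneg[OF assms(1)] F.nrm_nonneg[OF P_fibre[OF assms(2)]], of x]
  by (rule order_trans)

lemma P_add_bound:
  assumes "a \<in> carrier P" "b \<in> carrier P"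
  shows "nrm (Ax x) (a x \<oplus>\<^bsub>Ax x\<^esub> b x) \<le> nrm P a + nrm P b"
  using F.nrm_triangle[OF P_fibre P_fibre, OF assms, of x] add_mono[OF P_nrm_upper P_nrm_upper, OF assms, of x x]
  by (rule order_trans)

lemma P_module: "complex_module P"
proof (rule complex_moduleI)
  show "a \<oplus>\<^bsub>P\<^esub> b \<in> carrier P" if "a \<in> carrier P" "b \<in> carrier P" for a b
    by (rule P_carrierI[of _ "nrm P a + nrm P b"]) (use that P_add_bound P_fibre in auto)
  show "c \<odot>\<^bsub>P\<^esub> a \<in> carrier P" if "a \<in> carrier P" for a c
    by (rule P_carrierI[of _ "cmod c * nrm P a"]) (use that P_fibre[OF that] in \<open>auto simp: F.nrm_smult P_nrm_upper mult_left_mono\<close>)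
  show "\<zero>\<^bsub>P\<^esub> \<in> carrier P"
    by (rule P_carrierI[of _ 0]) auto
qed (simp_all add: F.v_assoc F.v_comm F.v_lcomm F.v_add_smult F.v_smult_add fun_eq_iff P_fibre)

sublocale PM: complex_module P by (rule P_module)

sublocale PN: normed_module P "nrm P"
proof
  show "0 \<le> nrm P a" if "a \<in> carrier P" for a
    using that by (rule P_nonneg)
  show "nrm P a = 0 \<longleftrightarrow> a = \<zero>\<^bsub>P\<^esub>" if a: "a \<in> carrier P" for a
  proof
    assume 0: "nrm P a = 0"
    have "a x = \<zero>\<^bsub>Ax x\<^esub>" for x
    proof -
      have "nrm (Ax x) (a x) = 0"
        using P_nrm_upper[OF a, of x] F.nrm_nonneg[OF P_fibre[OF a], of x] 0 by linarith
      then show ?thesis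
        using F.nrm_eq_0[OF P_fibre[OF a], of x] by simp
    qed
    then show "a = \<zero>\<^bsub>P\<^esub>"
      by (simp add: fun_eq_iff)
  next
    assume "a = \<zero>\<^bsub>P\<^esub>"
    then have "nrm P a \<le> 0"
      by (intro P_nrm_least) simp
    then show "nrm P a = 0"
      using P_nonneg[OF a] by linarith
  qed
  show "nrm P (a \<oplus>\<^bsub>P\<^esub> b) \<le> nrm P a + nrm P b" if "a \<in> carrier P" "b \<in> carrier P" for a b
    by (rule P_nrm_least) (use that P_add_bound P_fibre in auto)
  \<comment> \<open>Used for c and, to obtain the reverse inequality, for 1 / c applied to c
    a.\<close>
  have le: "nrm P (c \<odot>\<^bsub>P\<^esub> a) \<le> cmod c * nrm P a" if "a \<in> carrier P" for a c
    by (rule P_nrm_least) (use that P_fibre[OF that] in \<open>auto simp: F.nrm_smult P_nrm_upper mult_left_mono\<close>)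
  show "nrm P (c \<odot>\<^bsub>P\<^esub> a) = cmod c * nrm P a" if a: "a \<in> carrier P" for a c
  proof (cases "c = 0")
    case True
    then show ?thesis
      using le[OF a, of c] P_nonneg[OF PM.v_smult[OF a], of c] by (metis mult_zero_left norm_zero order_antisym)
  next
    case False
    have "nrm P ((1 / c) \<odot>\<^bsub>P\<^esub> (c \<odot>\<^bsub>P\<^esub> a)) \<le> cmod (1 / c) * nrm P (c \<odot>\<^bsub>P\<^esub> a)"
      by (rule le[OF PM.v_smult[OF a]])
    moreover have "(1 / c) \<odot>\<^bsub>P\<^esub> (c \<odot>\<^bsub>P\<^esub> a) = a"
      using PM.v_smult_smult[OF a, of "1 / c" c] PM.v_one[OF a] False by simp
    ultimately have "cmod c * nrm P a \<le> nrm P (c \<odot>\<^bsub>P\<^esub> a)"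
      using False by (simp add: norm_divide field_simps)
    then show ?thesis
      using le[OF a, of c] by simp
  qed
qed

lemma P_minus: "a \<in> carrier P \<Longrightarrow> b \<in> carrier P \<Longrightarrow> (a \<ominus>\<^bsub>P\<^esub> b) x = a x \<ominus>\<^bsub>Ax x\<^esub> b x"
  by (subst PM.v_minus) (simp_all add: F.v_minus P_fibre)

lemma P_complete: "norm_complete P (nrm P)"
  unfolding PN.norm_complete_iff
proof safe
  fix s assume s: "PN.cauchy_seq s"
  then have sP: "s k \<in> carrier P" for k
    by (simp add: PN.cauchy_seq_def)
  have c: "\<exists>N. \<forall>i\<ge>N. \<forall>j\<ge>N. \<forall>x. nrm (Ax x) (s i x \<ominus>\<^bsub>Ax x\<^esub> s j x) \<le> e" if e: "e > 0" for e
  proof -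
    obtain N where N: "\<forall>i\<ge>N. \<forall>j\<ge>N. nrm P (s i \<ominus>\<^bsub>P\<^esub> s j) < e"
      using s e by (auto simp: PN.cauchy_seq_def)
    have "nrm (Ax x) (s i x \<ominus>\<^bsub>Ax x\<^esub> s j x) \<le> e" if "i \<ge> N" "j \<ge> N" for i j x
    proof -
      have "nrm (Ax x) (s i x \<ominus>\<^bsub>Ax x\<^esub> s j x) \<le> nrm P (s i \<ominus>\<^bsub>P\<^esub> s j)"
        using P_nrm_upper[OF PM.v_minus_closed[OF sP sP], of x i j] by (simp add: P_minus[OF sP sP])
      also have "\<dots> < e"
        using N that by blast
      finally show ?thesis by simp
    qed
    then show ?thesis by blast
  qed
  obtain a where a: "\<And>x. a x \<in> carrier (Ax x)"
    "\<And>e. e > 0 \<Longrightarrow> \<exists>N. \<forall>k\<ge>N. \<forall>x. nrm (Ax x) (s k x \<ominus>\<^bsub>Ax x\<^esub> a x) \<le> e"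
    by (rule uniform_complete[of Ax "\<lambda>x. nrm (Ax x)" s]) (use F.N.normed_module_axioms F.complete P_fibre[OF sP] c in auto)
  have aP: "a \<in> carrier P"
  proof -
    obtain N where N: "\<And>x. nrm (Ax x) (s N x \<ominus>\<^bsub>Ax x\<^esub> a x) \<le> 1"
      using a(2)[of 1] by auto
    show ?thesis
    proof (rule P_carrierI[of _ "nrm P (s N) + 1"])
      show "nrm (Ax x) (a x) \<le> nrm P (s N) + 1" for x
        using F.N.n_le_add_minus[of "a x" x "s N x"] F.N.n_minus_commute[of "a x" x "s N x"] N[of x] a(1)[of x]
          P_nrm_upper[OF sP[of N], of x] P_fibre[OF sP[of N], of x] by simp
    qed (rule a)
  qed
  have "(\<lambda>k. nrm P (s k \<ominus>\<^bsub>P\<^esub> a)) \<longlonglongrightarrow> 0"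
  proof (rule LIMSEQ_I)
    fix r :: real assume "r > 0"
    then obtain N where N: "\<And>k x. k \<ge> N \<Longrightarrow> nrm (Ax x) (s k x \<ominus>\<^bsub>Ax x\<^esub> a x) \<le> r / 2"
      using a(2)[of "r / 2"] by auto
    have "norm (nrm P (s k \<ominus>\<^bsub>P\<^esub> a) - 0) < r" if "k \<ge> N" for k
    proof -
      have "nrm P (s k \<ominus>\<^bsub>P\<^esub> a) \<le> r / 2"
        by (rule P_nrm_least) (use N[OF that] in \<open>simp add: P_minus[OF sP aP]\<close>)
      then show ?thesis
        using P_nonneg[OF PM.v_minus_closed[OF sP aP], of k] \<open>r > 0\<close> by simp
    qed
    then show "\<exists>N. \<forall>k\<ge>N. norm (nrm P (s k \<ominus>\<^bsub>P\<^esub> a) - 0) < r"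
      by blast
  qed
  then show "\<exists>x. PN.tends s x"
    using sP aP by (auto simp: PN.tends_def)
qed

sublocale PA: cstar_algebra P
proof
  show "a \<otimes>\<^bsub>P\<^esub> b \<in> carrier P" if "a \<in> carrier P" "b \<in> carrier P" for a b
    by (rule P_carrierI[of _ "nrm P a * nrm P b"]) (use that P_mult_bound P_fibre in auto)
  show "nrm P (a \<otimes>\<^bsub>P\<^esub> b) \<le> nrm P a * nrm P b" if "a \<in> carrier P" "b \<in> carrier P" for a b
    by (rule P_nrm_least) (use that P_mult_bound P_fibre in auto)
  show st: "star P a \<in> carrier P" if "a \<in> carrier P" for a
    by (rule P_carrierI[of _ "nrm P a"]) (use that P_fibre[OF that] in \<open>auto simp: F.nrm_star P_nrm_upper\<close>)
  show "nrm P (star P a \<otimes>\<^bsub>P\<^esub> a) = (nrm P a)\<^sup>2" if a: "a \<in> carrier P" for a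
  proof (rule order_antisym)
    have c: "star P a \<otimes>\<^bsub>P\<^esub> a \<in> carrier P"
      by (rule P_carrierI[of _ "nrm P (star P a) * nrm P a"]) (use P_fibre[OF a] P_fibre[OF st[OF a]] P_mult_bound[OF st[OF a] a] in auto)
    show "nrm P (star P a \<otimes>\<^bsub>P\<^esub> a) \<le> (nrm P a)\<^sup>2"
      by (rule P_nrm_least) (use a in \<open>simp add: F.cstar_identity P_fibre P_nrm_upper power_mono F.nrm_nonneg\<close>)
    have "nrm P a \<le> sqrt (nrm P (star P a \<otimes>\<^bsub>P\<^esub> a))"
      by (rule P_nrm_least, rule real_le_rsqrt) (use P_nrm_upper[OF c] P_fibre[OF a] in \<open>simp add: F.cstar_identity\<close>)
    then show "(nrm P a)\<^sup>2 \<le> nrm P (star P a \<otimes>\<^bsub>P\<^esub> a)"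
      using P_nonneg[OF a] P_nonneg[OF c] by (metis power_mono real_sqrt_pow2)
  qed
  show "0 \<le> nrm P a" if "a \<in> carrier P" for a
    using that by (rule P_nonneg)
  show "nrm P a = 0 \<longleftrightarrow> a = \<zero>\<^bsub>P\<^esub>" if "a \<in> carrier P" for a
    using that by (rule PN.n_eq_0)
  show "nrm P (a \<oplus>\<^bsub>P\<^esub> b) \<le> nrm P a + nrm P b" if "a \<in> carrier P" "b \<in> carrier P" for a b
    using that by (rule PN.n_triangle)
  show "nrm P (c \<odot>\<^bsub>P\<^esub> a) = cmod c * nrm P a" if "a \<in> carrier P" for a c
    using that by (rule PN.n_smult)
  show "norm_complete P (nrm P)"
    by (rule P_complete)
qed (simp_all add: F.mult_assoc F.mult_add_left F.mult_add_right
    F.smult_mult_left F.smult_mult_right F.star_add F.star_smult F.star_mult fun_eq_iff P_fibre)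

end

subsection \<open>Functions vanishing at infinity\<close>

text \<open>With this fibre at every point, \<open>C0_alg\<close> becomes a closed *-subalgebra of
  an algebra of bounded fields, and its C*-axioms are inherited.\<close>

definition complex_algebra :: "complex star_alg" where
  "complex_algebra = \<lparr>carrier = UNIV, monoid.mult = (*), one = 1, zero = 0, add = (+), smult = (*),
     star = cnj, nrm = cmod\<rparr>"

lemma complex_algebra_sel [simp]:
  "carrier complex_algebra = UNIV" "mult complex_algebra = (*)" "zero complex_algebra = 0"
  "add complex_algebra = (+)" "smult complex_algebra = (*)" "star complex_algebra = cnj" "nrm complex_algebra = cmod"
  by (simp_all add: complex_algebra_def)

lemma complex_algebra_cstar: "cstar_algebra complex_algebra"
proof -
  interpret complex_module complex_algebra
    by (rule complex_moduleI) (auto simp: algebra_simps)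
  interpret N: normed_module complex_algebra cmod
    by unfold_locales (auto simp: norm_mult norm_triangle_ineq)
  have m: "x \<ominus>\<^bsub>complex_algebra\<^esub> y = x - y" for x y
    by (simp add: v_minus)
  have "norm_complete complex_algebra cmod"
    unfolding N.norm_complete_iff
  proof safe
    fix s assume s: "N.cauchy_seq s"
    have "Cauchy s"
      using s unfolding N.cauchy_seq_def Cauchy_def by (simp add: m dist_norm)
    then obtain x where "s \<longlonglongrightarrow> x"
      by (meson Cauchy_convergent convergentD)
    then have "N.tends s x"
      by (simp add: N.tends_def m LIM_zero tendsto_norm_zero)
    then show "\<exists>x. N.tends s x" ..
  qed
  then show ?thesis
    by unfold_locales
      (auto simp: norm_mult norm_triangle_ineq power2_eq_square algebra_simps)
qed

lemma complex_algebra_minus [simp]: "x \<ominus>\<^bsub>complex_algebra\<^esub> y = x - y"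
proof -
  interpret cstar_algebra complex_algebra by (rule complex_algebra_cstar)
  show ?thesis by (simp add: v_minus)
qed

lemma C0_iff:
  "f \<in> C0 UNIV \<longleftrightarrow> continuous_on UNIV f \<and> (\<forall>e>0. \<exists>C. compact C \<and> (\<forall>x. x \<notin> C \<longrightarrow> cmod (f x) < e))"
  by (simp add: C0_def Ball_def)

lemma C0_bounded: "f \<in> C0 UNIV \<Longrightarrow> \<exists>B>0. \<forall>x. cmod (f x) \<le> B"
proof -
  assume f: "f \<in> C0 UNIV"
  then obtain C where C: "compact C" "\<And>x. x \<notin> C \<Longrightarrow> cmod (f x) < 1"
    unfolding C0_iff by (meson zero_less_one)
  have "compact (f ` C)"
    using f C(1) by (intro compact_continuous_image) (auto simp: C0_iff intro: continuous_on_subset)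
  then obtain B where B: "\<And>x. x \<in> C \<Longrightarrow> cmod (f x) \<le> B"
    using compact_imp_bounded by (force simp: bounded_iff)
  have "cmod (f x) \<le> max B 1" for x
    using B[of x] C(2)[of x] by (cases "x \<in> C") auto
  then show ?thesis
    by (intro exI[of _ "max B 1"]) auto
qed

lemma C0_uniform_limit:
  assumes s: "\<And>k. s k \<in> C0 UNIV" and l: "\<And>e. e > 0 \<Longrightarrow> \<exists>N::nat. \<forall>k\<ge>N. \<forall>x. cmod (s k x - f x) \<le> e"
  shows "f \<in> C0 UNIV"
  unfolding C0_iff
proof (intro conjI allI impI)
  have "uniform_limit UNIV s f sequentially"
    unfolding uniform_limit_sequentially_iff
  proof safe
    fix e :: real assume "e > 0"
    then obtain N where "\<forall>k\<ge>N. \<forall>x. cmod (s k x - f x) \<le> e / 2"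
      using l[of "e / 2"] by auto
    then show "\<exists>N. \<forall>n\<ge>N. \<forall>x\<in>UNIV. dist (s n x) (f x) < e"
      using \<open>e > 0\<close> by (intro exI[of _ N]) (force simp: dist_norm intro: le_less_trans[of _ "e / 2"])
  qed
  then show "continuous_on UNIV f"
    by (rule uniform_limit_theorem[rotated]) (use s in \<open>auto simp: C0_iff\<close>)
  fix e :: real assume e: "e > 0"
  then obtain k where k: "\<And>x. cmod (s k x - f x) \<le> e / 2"
    using l[of "e / 2"] by auto
  obtain C where C: "compact C" "\<And>x. x \<notin> C \<Longrightarrow> cmod (s k x) < e / 2"
    using s[of k] e unfolding C0_iff by (meson half_gt_zero)
  have "cmod (f x) < e" if "x \<notin> C" for x
    using C(2)[OF that] k[of x] norm_triangle_ineq4[of "s k x" "s k x - f x"] by simp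
  then show "\<exists>C. compact C \<and> (\<forall>x. x \<notin> C \<longrightarrow> cmod (f x) < e)"
    using C(1) by blast
qed

lemma C0_dominated:
  assumes f: "continuous_on UNIV f" and g: "g \<in> C0 UNIV" and le: "\<And>x. cmod (f x) \<le> c * cmod (g x)"
  shows "f \<in> C0 UNIV"
  unfolding C0_iff
proof (intro conjI f allI impI)
  fix e :: real assume e: "e > 0"
  \<comment> \<open>The divisor is |c| + 1 so that it is positive whatever the sign of c.\<close>
  have "0 < e / (\<bar>c\<bar> + 1)"
    using e by simp
  then obtain C where C: "compact C" "\<And>x. x \<notin> C \<Longrightarrow> cmod (g x) < e / (\<bar>c\<bar> + 1)"
    using g unfolding C0_iff by meson
  have "cmod (f x) < e" if "x \<notin> C" for x
  proof -
    have "cmod (f x) \<le> (\<bar>c\<bar> + 1) * cmod (g x)"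
      by (rule order_trans[OF le mult_right_mono]) auto
    also have "\<dots> < e"
      using C(2)[OF that] by (simp add: field_simps)
    finally show ?thesis .
  qed
  then show "\<exists>C. compact C \<and> (\<forall>x. x \<notin> C \<longrightarrow> cmod (f x) < e)"
    using C(1) by blast
qed

lemma C0_add: "f \<in> C0 UNIV \<Longrightarrow> g \<in> C0 UNIV \<Longrightarrow> (\<lambda>x. f x + g x) \<in> C0 UNIV"
  unfolding C0_iff
proof (intro conjI allI impI)
  fix e :: real
  assume f: "continuous_on UNIV f \<and> (\<forall>e>0. \<exists>C. compact C \<and> (\<forall>x. x \<notin> C \<longrightarrow> cmod (f x) < e))"
    and g: "continuous_on UNIV g \<and> (\<forall>e>0. \<exists>C. compact C \<and> (\<forall>x. x \<notin> C \<longrightarrow> cmod (g x) < e))" and e: "e > 0"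
  obtain C where C: "compact C" "\<And>x. x \<notin> C \<Longrightarrow> cmod (f x) < e / 2"
    using f e by (meson half_gt_zero)
  obtain D where D: "compact D" "\<And>x. x \<notin> D \<Longrightarrow> cmod (g x) < e / 2"
    using g e by (meson half_gt_zero)
  have "cmod (f x + g x) < e" if "x \<notin> C \<union> D" for x
    using C(2)[of x] D(2)[of x] that norm_triangle_ineq[of "f x" "g x"] by simp
  then show "\<exists>C. compact C \<and> (\<forall>x. x \<notin> C \<longrightarrow> cmod (f x + g x) < e)"
    using compact_Un[OF C(1) D(1)] by blast
qed (auto intro: continuous_on_add)

lemma C0_continuous: "f \<in> C0 UNIV \<Longrightarrow> continuous_on UNIV f"
  by (simp add: C0_iff)

lemma C0_mult: "f \<in> C0 UNIV \<Longrightarrow> g \<in> C0 UNIV \<Longrightarrow> (\<lambda>x. f x * g x) \<in> C0 UNIV"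
proof -
  assume f: "f \<in> C0 UNIV" and g: "g \<in> C0 UNIV"
  obtain B where "\<And>x. cmod (f x) \<le> B"
    using C0_bounded[OF f] by blast
  then show ?thesis
    by (rule_tac c = B in C0_dominated[OF continuous_on_mult[OF C0_continuous[OF f] C0_continuous[OF g]] g])
      (simp add: norm_mult mult_right_mono)
qed

lemma C0_scale: "f \<in> C0 UNIV \<Longrightarrow> (\<lambda>x. c * f x) \<in> C0 UNIV"
  by (rule C0_dominated[of _ f "cmod c", OF continuous_on_mult_left[OF C0_continuous]]) (simp_all add: norm_mult)

lemma C0_cnj: "f \<in> C0 UNIV \<Longrightarrow> (\<lambda>x. cnj (f x)) \<in> C0 UNIV"
  by (rule C0_dominated[of _ f 1, OF continuous_on_cnj[OF C0_continuous]]) simp_all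

lemma C0_alg_eq: "C0_alg = (product_algebra (\<lambda>x::'x::topological_space. complex_algebra))\<lparr>carrier := C0 UNIV\<rparr>"
  by (simp add: C0_alg_def product_algebra_def complex_algebra_def)

lemma C0_alg_sel [simp]:
  "carrier C0_alg = C0 UNIV" "mult C0_alg = (\<lambda>f g x. f x * g x)" "zero C0_alg = (\<lambda>x. 0)"
  "add C0_alg = (\<lambda>f g x. f x + g x)" "smult C0_alg = (\<lambda>c f x. c * f x)" "star C0_alg = (\<lambda>f x. cnj (f x))"
  by (simp_all add: C0_alg_def)

lemma C0_alg_cstar: "cstar_algebra (C0_alg :: ('x::topological_space \<Rightarrow> complex) star_alg)"
proof -
  interpret cstar_family "\<lambda>x::'x. complex_algebra"
    by (rule cstar_family.intro, rule complex_algebra_cstar)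
  have C0P: "f \<in> carrier P" if f: "f \<in> C0 UNIV" for f
    using C0_bounded[OF f] by (auto intro!: P_carrierI)
  have "star_subalgebra (C0 UNIV) P"
    unfolding PA.star_subalgebra_iff
    by (auto intro!: C0P C0_add C0_mult C0_scale C0_cnj) (auto simp: C0_iff)
  moreover have "PA.cls (C0 UNIV) \<subseteq> C0 UNIV"
  proof
    fix f assume "f \<in> PA.cls (C0 UNIV)"
    then obtain s where s: "\<And>k. s k \<in> C0 UNIV" "PN.tends s f"
      using PN.closure_tends by blast
    show "f \<in> C0 UNIV"
    proof (rule C0_uniform_limit[of s, OF s(1)])
      fix e :: real assume e: "e > 0"
      have "\<forall>\<^sub>F k in sequentially. nrm P (s k \<ominus>\<^bsub>P\<^esub> f) < e"
        using s(2) unfolding PN.tends_def by (intro order_tendstoD(2)[OF _ e]) simp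
      then obtain N where N: "\<And>k. k \<ge> N \<Longrightarrow> nrm P (s k \<ominus>\<^bsub>P\<^esub> f) < e"
        unfolding eventually_sequentially by blast
      have "cmod (s k x - f x) \<le> e" if "k \<ge> N" for k x
      proof -
        have c: "s k \<in> carrier P" "f \<in> carrier P"
          using s(2) by (simp_all add: PN.tends_def)
        have "cmod (s k x - f x) \<le> nrm P (s k \<ominus>\<^bsub>P\<^esub> f)"
          using P_nrm_upper[OF PM.v_minus_closed[OF c], of x] by (simp add: P_minus[OF c])
        then show ?thesis
          using N[OF that] by linarith
      qed
      then show "\<exists>N. \<forall>k\<ge>N. \<forall>x. cmod (s k x - f x) \<le> e"
        by blast
    qed
  qed
  ultimately show ?thesis
    unfolding C0_alg_eq by (rule PA.closed_star_subalgebra)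
qed

lemma C0_nrm_upper: "f \<in> C0 UNIV \<Longrightarrow> cmod (f x) \<le> nrm C0_alg f"
  using C0_bounded[of f] cSUP_upper[of x UNIV "\<lambda>x. cmod (f x)"] by (auto simp: C0_alg_def bdd_above_def)

lemma C0_nrm_least: "(\<And>x. cmod (f x) \<le> c) \<Longrightarrow> nrm C0_alg f \<le> c"
  using cSUP_least[of UNIV "\<lambda>x. cmod (f x)" c] by (simp add: C0_alg_def)

lemma continuous_on_UNIV_iff_nhds: "continuous_on UNIV f \<longleftrightarrow> (\<forall>x. (f \<longlongrightarrow> f x) (nhds x))"
  by (simp add: continuous_on_def tendsto_at_iff_tendsto_nhds)

lemma tendsto_nhds_if_continuous_on:
  "continuous_on Y f \<Longrightarrow> open Y \<Longrightarrow> x \<in> Y \<Longrightarrow> (f \<longlongrightarrow> f x) (nhds x)"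
  by (metis at_within_open continuous_on_def tendsto_at_iff_tendsto_nhds)

text \<open>At a point outside \<open>Y\<close> continuity of the extension by zero is a question of
  size only: the compact set off which f is small lies in \<open>Y\<close>, and it is closed because
  the space is Hausdorff, so its complement is a neighbourhood of the point.\<close>

lemma C0_subset_C0_UNIV:
  assumes H: "Hausdorff_space (euclidean :: 'x::topological_space topology)" and Y: "open (Y :: 'x set)"
    and f: "f \<in> C0 Y"
  shows "f \<in> C0 UNIV"
proof -
  have f0: "f x = 0" if "x \<notin> Y" for x
    using f that by (simp add: C0_def)
  have C: "\<exists>C\<subseteq>Y. compact C \<and> (\<forall>x. x \<notin> C \<longrightarrow> cmod (f x) < e)" if "e > 0" for e
  proof -
    obtain C where "C \<subseteq> Y" "compact C" "\<forall>x\<in>Y - C. cmod (f x) < e"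
      using f \<open>e > 0\<close> by (auto simp: C0_def)
    then show ?thesis
      using f0 \<open>e > 0\<close> by (intro exI[of _ C]) (metis DiffI norm_zero)
  qed
  have "(f \<longlongrightarrow> f x) (nhds x)" for x
  proof (cases "x \<in> Y")
    case True
    then show ?thesis
      using f Y by (intro tendsto_nhds_if_continuous_on) (auto simp: C0_def)
  next
    case False
    show ?thesis
    proof (rule tendstoI)
      fix e :: real assume "e > 0"
      then obtain C where C: "C \<subseteq> Y" "compact C" "\<And>x. x \<notin> C \<Longrightarrow> cmod (f x) < e"
        using C by blast
      have "closed C"
        using compactin_imp_closedin[OF H, of C] C(2) by simp
      then have "\<forall>\<^sub>F y in nhds x. y \<notin> C"
        using False C(1) eventually_nhds_in_open[of "- C" x] by auto
      then show "\<forall>\<^sub>F y in nhds x. dist (f y) (f x) < e"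
        by (rule eventually_mono) (use C(3) f0[OF False] in \<open>simp add: dist_norm\<close>)
    qed
  qed
  moreover have "\<exists>C. compact C \<and> (\<forall>x. x \<notin> C \<longrightarrow> cmod (f x) < e)" if "e > 0" for e
    using C[OF that] by blast
  ultimately show ?thesis
    by (simp add: C0_iff continuous_on_UNIV_iff_nhds)
qed

lemma C0_mult_right:
  assumes f: "f \<in> C0 UNIV" and g: "g \<in> C0 Y"
  shows "(\<lambda>x. f x * g x) \<in> C0 Y"
proof -
  obtain B where B: "B > 0" "\<And>x. cmod (f x) \<le> B"
    using C0_bounded[OF f] by blast
  have "\<exists>C\<subseteq>Y. compact C \<and> (\<forall>x\<in>Y - C. cmod (f x * g x) < e)" if e: "e > 0" for e
  proof -
    have "0 < e / B"
      using e B(1) by simp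
    then obtain C where C: "C \<subseteq> Y" "compact C" "\<forall>x\<in>Y - C. cmod (g x) < e / B"
      using g unfolding C0_def mem_Collect_eq by blast
    have "cmod (f x * g x) < e" if "x \<in> Y - C" for x
    proof -
      have "cmod (f x) * cmod (g x) \<le> B * cmod (g x)"
        using B(2) by (intro mult_right_mono) auto
      also have "\<dots> < e"
        using C(3) that B(1) by (simp add: field_simps)
      finally show ?thesis
        by (simp add: norm_mult)
    qed
    then show ?thesis
      using C by blast
  qed
  moreover have "continuous_on Y (\<lambda>x. f x * g x)"
    using f g by (intro continuous_on_mult) (auto simp: C0_def intro: continuous_on_subset)
  ultimately show ?thesis
    using g by (simp add: C0_def)
qed

text \<open>h = sqrt |f| and g = f / sqrt |f|, both of modulus sqrt |f|. A real valued h can be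
  moved to the conjugate linear side of an inner product without change.\<close>

lemma C0_factor:
  assumes f: "f \<in> C0 Y"
  obtains g h where "g \<in> C0 Y" "h \<in> C0 Y" "\<And>x. f x = g x * h x" "\<And>x. cnj (h x) = h x"
proof -
  define h where "h x = complex_of_real (sqrt (cmod (f x)))" for x
  \<comment> \<open>Where f vanishes, division by zero yields 0, which is the value required
    there.\<close>
  define g where "g x = f x / h x" for x
  have ng: "cmod (g x) = sqrt (cmod (f x))" and nh: "cmod (h x) = sqrt (cmod (f x))" for x
  proof -
    show nh: "cmod (h x) = sqrt (cmod (f x))"
      by (simp add: h_def)
    show "cmod (g x) = sqrt (cmod (f x))"
      by (simp add: g_def norm_divide nh real_div_sqrt)
  qed
  have cf: "continuous_on Y f"
    using f by (simp add: C0_def)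
  then have ch: "continuous_on Y h"
    unfolding h_def by (intro continuous_intros)
  have cg: "continuous_on Y g"
    unfolding continuous_on_def
  proof
    fix x assume x: "x \<in> Y"
    have fx: "(f \<longlongrightarrow> f x) (at x within Y)" and hx: "(h \<longlongrightarrow> h x) (at x within Y)"
      using cf ch x by (auto simp: continuous_on_def)
    show "(g \<longlongrightarrow> g x) (at x within Y)"
    proof (cases "f x = 0")
      case False
      then have "h x \<noteq> 0"
        by (simp add: h_def)
      then show ?thesis
        unfolding g_def using fx hx by (intro tendsto_divide)
    next
      case True
      \<comment> \<open>At a zero of f the quotient rule fails, but the modulus sqrt |f| of g tends
        to 0.\<close>
      have "((\<lambda>y. cmod (g y)) \<longlongrightarrow> 0) (at x within Y)"
        unfolding ng using tendsto_real_sqrt[OF tendsto_norm[OF fx]] True by simp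
      then show ?thesis
        using True by (simp add: g_def[abs_def] tendsto_norm_zero_iff)
    qed
  qed
  have v: "\<exists>C\<subseteq>Y. compact C \<and> (\<forall>x\<in>Y - C. sqrt (cmod (f x)) < e)" if e: "e > 0" for e
  proof -
    have "e\<^sup>2 > 0"
      using e by simp
    then obtain C where C: "C \<subseteq> Y" "compact C" "\<forall>x\<in>Y - C. cmod (f x) < e\<^sup>2"
      using f unfolding C0_def by blast
    then show ?thesis
      using e by (intro exI[of _ C]) (auto intro!: real_less_lsqrt)
  qed
  show thesis
  proof
    have f0: "f x = 0" if "x \<notin> Y" for x
      using f that by (simp add: C0_def)
    show "g \<in> C0 Y"
      unfolding C0_def mem_Collect_eq ng by (intro conjI cg allI impI v) (simp_all add: g_def f0)
    show "h \<in> C0 Y"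
      unfolding C0_def mem_Collect_eq nh by (intro conjI ch allI impI v) (simp_all add: h_def f0)
    show "f x = g x * h x" for x
      by (simp add: g_def h_def)
    show "cnj (h x) = h x" for x
      by (simp add: h_def)
  qed
qed

section \<open>The algebra of fields of a net\<close>

text \<open>The multiplier c = (x - y)* turns the hypothesis into the C*-identity for x - y. In an
  algebra that may lack a unit this is how values of multipliers are compared.\<close>

lemma (in cstar_algebra) eq_if_mult_left_eq:
  assumes x: "x \<in> carrier A" and y: "y \<in> carrier A" and eq: "\<And>c. c \<in> carrier A \<Longrightarrow> c \<otimes> x = c \<otimes> y"
  shows "x = y"
proof -
  have "star A (x \<ominus> y) \<otimes> (x \<ominus> y) = \<zero>"
    using x y eq[of "star A (x \<ominus> y)"] by (simp add: mult_minus_right)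
  then show ?thesis
    using cstar_zero[of "x \<ominus> y"] x y by (simp add: v_minus_eq0)
qed

lemma (in cstar_algebra) eq_if_mult_right_eq:
  assumes x: "x \<in> carrier A" and y: "y \<in> carrier A" and eq: "\<And>c. c \<in> carrier A \<Longrightarrow> x \<otimes> c = y \<otimes> c"
  shows "x = y"
proof -
  have "star A x = star A y"
  proof (rule eq_if_mult_left_eq)
    fix c assume c: "c \<in> carrier A"
    show "c \<otimes> star A x = c \<otimes> star A y"
      using arg_cong[OF eq[of "star A c"], of "star A"] c x y by (simp add: star_mult)
  qed (use x y in auto)
  then show ?thesis
    using x y star_eq_iff by blast
qed

text \<open>The fibres are left open and \<open>\<epsilon>\<close> is only asked to consist of
  *-morphisms, so that the universal fibre algebras of a net and the operators on the fibres of a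
  Hilbert bundle are both instances.\<close>

locale net_fields = cstar_family Ax for Ax :: "'x::topological_space \<Rightarrow> 'c star_alg" +
  fixes K :: "'x set set" and A :: "'x set \<Rightarrow> 'a star_alg" and \<epsilon> :: "'x \<Rightarrow> 'x set \<Rightarrow> 'a \<Rightarrow> 'c"
  assumes Hausdorff: "Hausdorff_space (euclidean :: 'x topology)"
    and K_open: "Y \<in> K \<Longrightarrow> open Y"
    and A_cstar: "Y \<in> K \<Longrightarrow> cstar_algebra (A Y)"
    and \<epsilon>_hom: "Y \<in> K \<Longrightarrow> x \<in> Y \<Longrightarrow> star_hom (A Y) (Ax x) (\<epsilon> x Y)"
begin

abbreviation "AA \<equiv> net_algebra K A Ax \<epsilon>"
abbreviation "gens \<equiv> {elementary_field Ax \<epsilon> f Y t | f Y t. Y \<in> K \<and> f \<in> C0 Y \<and> t \<in> carrier (A Y)}"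

lemma AA_sel [simp]:
  "mult AA = mult P" "add AA = add P" "zero AA = zero P" "smult AA = smult P" "star AA = star P" "nrm AA = nrm P"
  by (simp_all add: net_algebra_def Let_def)

lemma AA_carrier: "carrier AA = PA.cls (generated_star_subalgebra P gens)"
  by (simp add: net_algebra_def Let_def)

lemma \<epsilon>_closed: "Y \<in> K \<Longrightarrow> x \<in> Y \<Longrightarrow> t \<in> carrier (A Y) \<Longrightarrow> \<epsilon> x Y t \<in> carrier (Ax x)"
  by (rule star_homD(1)[OF \<epsilon>_hom])

lemma C0_K: "Y \<in> K \<Longrightarrow> f \<in> C0 Y \<Longrightarrow> f \<in> C0 UNIV"
  by (rule C0_subset_C0_UNIV[OF Hausdorff K_open])

lemma elementary_field_closed:
  assumes "Y \<in> K" "f \<in> C0 Y" "t \<in> carrier (A Y)"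
  shows "elementary_field Ax \<epsilon> f Y t \<in> carrier P"
proof -
  obtain B where B: "B > 0" "\<And>x. cmod (f x) \<le> B"
    using C0_bounded[OF C0_K[OF assms(1,2)]] by blast
  interpret AY: cstar_algebra "A Y" by (rule A_cstar[OF assms(1)])
  show ?thesis
  proof (rule P_carrierI[of _ "B * nrm (A Y) t"])
    fix x
    show "elementary_field Ax \<epsilon> f Y t x \<in> carrier (Ax x)"
      using \<epsilon>_closed assms by (simp add: elementary_field_def)
    have "nrm (Ax x) (if x \<in> Y then \<epsilon> x Y t else \<zero>\<^bsub>Ax x\<^esub>) \<le> nrm (A Y) t"
      using star_hom_contractive[OF A_cstar fibre \<epsilon>_hom, of Y x t] assms AY.nrm_nonneg by auto
    then show "nrm (Ax x) (elementary_field Ax \<epsilon> f Y t x) \<le> B * nrm (A Y) t"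
      using B \<epsilon>_closed assms AY.nrm_nonneg
      by (auto simp: elementary_field_def F.nrm_smult intro!: mult_mono order_trans[OF B(2)])
  qed
qed

lemma gens_P: "gens \<subseteq> carrier P"
  by (auto intro: elementary_field_closed)

lemma star_elementary_field:
  assumes "Y \<in> K" "t \<in> carrier (A Y)"
  shows "star P (elementary_field Ax \<epsilon> f Y t) = elementary_field Ax \<epsilon> (\<lambda>x. cnj (f x)) Y (star (A Y) t)"
  using assms \<epsilon>_closed star_homD(5)[OF \<epsilon>_hom] by (auto simp: elementary_field_def F.star_smult fun_eq_iff)

lemma C0_cnj_set: "f \<in> C0 Y \<Longrightarrow> (\<lambda>x. cnj (f x)) \<in> C0 Y"
  by (auto simp: C0_def intro: continuous_on_cnj)

lemma gens_star: "a \<in> gens \<Longrightarrow> star P a \<in> gens"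
proof -
  assume "a \<in> gens"
  then obtain f Y t where a: "Y \<in> K" "f \<in> C0 Y" "t \<in> carrier (A Y)" "a = elementary_field Ax \<epsilon> f Y t"
    by blast
  have "star (A Y) t \<in> carrier (A Y)"
    by (rule cstar_algebra.star_closed[OF A_cstar[OF a(1)] a(3)])
  then show ?thesis
    unfolding a(4) star_elementary_field[OF a(1,3)] using a(1) C0_cnj_set[OF a(2)] by auto
qed

lemma AA_subalgebra: "star_subalgebra (carrier AA) P"
  unfolding AA_carrier by (rule PA.star_subalgebra_closure[OF PA.generated_star_subalgebra(1)[OF gens_P]])

lemma gens_AA: "gens \<subseteq> carrier AA"
  unfolding AA_carrier
  using PA.generated_star_subalgebra[OF gens_P] PA.cls_superset[of "generated_star_subalgebra P gens"]
  by (simp add: PA.star_subalgebra_iff del: product_algebra_sel)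

lemma AA_P: "a \<in> carrier AA \<Longrightarrow> a \<in> carrier P"
  using AA_subalgebra unfolding PA.star_subalgebra_iff by (elim conjE subsetD)

lemma AA_fibre: "a \<in> carrier AA \<Longrightarrow> a x \<in> carrier (Ax x)"
  by (rule P_fibre[OF AA_P])

lemma AA_eq: "AA = P\<lparr>carrier := carrier AA\<rparr>"
  by (simp add: net_algebra_def Let_def)

sublocale AA: cstar_algebra AA
proof -
  have "cstar_algebra (P\<lparr>carrier := carrier AA\<rparr>)"
    by (rule PA.closed_star_subalgebra[OF AA_subalgebra]) (simp add: AA_carrier)
  then show "cstar_algebra AA"
    unfolding AA_eq[symmetric] .
qed

lemma AA_minus: "a \<in> carrier AA \<Longrightarrow> b \<in> carrier AA \<Longrightarrow> (a \<ominus>\<^bsub>AA\<^esub> b) x = a x \<ominus>\<^bsub>Ax x\<^esub> b x"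
  by (subst AA.v_minus) (simp_all add: F.v_minus AA_fibre)

lemma AA_mem_closed:
  assumes a: "a \<in> carrier P" and ap: "\<And>e. e > 0 \<Longrightarrow> \<exists>b\<in>carrier AA. \<forall>x. nrm (Ax x) (a x \<ominus>\<^bsub>Ax x\<^esub> b x) \<le> e"
  shows "a \<in> carrier AA"
proof -
  have "a \<in> PA.cls (carrier AA)"
    unfolding PN.mem_closure_iff
  proof (intro conjI a allI impI)
    fix e :: real assume "e > 0"
    then obtain b where b: "b \<in> carrier AA" "\<And>x. nrm (Ax x) (a x \<ominus>\<^bsub>Ax x\<^esub> b x) \<le> e / 2"
      using ap[of "e / 2"] by auto
    have "nrm P (a \<ominus>\<^bsub>P\<^esub> b) \<le> e / 2"
      by (rule P_nrm_least) (use b(2) in \<open>simp add: P_minus[OF a AA_P[OF b(1)]]\<close>)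
    then show "\<exists>b\<in>carrier AA. b \<in> carrier P \<and> nrm P (a \<ominus>\<^bsub>P\<^esub> b) < e"
      using b(1) AA_P[OF b(1)] \<open>e > 0\<close> by (intro bexI[of _ b]) auto
  qed
  then show ?thesis
    by (simp add: AA_carrier)
qed

text \<open>The limit case speaks of uniform estimates in the fibres, the form in which fields are
  compared throughout. The involution has no case because the generators are stable under
  it.\<close>

lemma AA_induct [consumes 1, case_names zero gen add smult mult lim]:
  assumes a: "a \<in> carrier AA"
    and zero: "Q (\<lambda>x. \<zero>\<^bsub>Ax x\<^esub>)"
    and gen: "\<And>f Y t. Y \<in> K \<Longrightarrow> f \<in> C0 Y \<Longrightarrow> t \<in> carrier (A Y) \<Longrightarrow> Q (elementary_field Ax \<epsilon> f Y t)"
    and add: "\<And>a b. a \<in> carrier AA \<Longrightarrow> b \<in> carrier AA \<Longrightarrow> Q a \<Longrightarrow> Q b \<Longrightarrow> Q (\<lambda>x. a x \<oplus>\<^bsub>Ax x\<^esub> b x)"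
    and smult: "\<And>c a. a \<in> carrier AA \<Longrightarrow> Q a \<Longrightarrow> Q (\<lambda>x. c \<odot>\<^bsub>Ax x\<^esub> a x)"
    and mult: "\<And>a b. a \<in> carrier AA \<Longrightarrow> b \<in> carrier AA \<Longrightarrow> Q a \<Longrightarrow> Q b \<Longrightarrow> Q (\<lambda>x. a x \<otimes>\<^bsub>Ax x\<^esub> b x)"
    and lim: "\<And>a. a \<in> carrier AA \<Longrightarrow>
      (\<And>e. e > 0 \<Longrightarrow> \<exists>b\<in>carrier AA. Q b \<and> (\<forall>x. nrm (Ax x) (a x \<ominus>\<^bsub>Ax x\<^esub> b x) \<le> e)) \<Longrightarrow> Q a"
  shows "Q a"
proof (rule PA.closure_generated_induct[OF a[unfolded AA_carrier] gens_P, where P = Q, folded AA_carrier])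
  show "star P a \<in> gens" if "a \<in> gens" for a
    by (rule gens_star[OF that])
  show "Q \<zero>\<^bsub>P\<^esub>"
    using zero by simp
  show "Q a" if "a \<in> gens" for a
    using that gen by blast
  show "Q (a \<oplus>\<^bsub>P\<^esub> b)" if "a \<in> carrier AA" "b \<in> carrier AA" "Q a" "Q b" for a b
    using add[OF that] by simp
  show "Q (c \<odot>\<^bsub>P\<^esub> a)" if "a \<in> carrier AA" "Q a" for c a
    using smult[OF that] by simp
  show "Q (a \<otimes>\<^bsub>P\<^esub> b)" if "a \<in> carrier AA" "b \<in> carrier AA" "Q a" "Q b" for a b
    using mult[OF that] by simp
  fix s a assume s: "\<And>k. s k \<in> carrier AA" "\<And>k. Q (s k)" "PN.tends s a" "a \<in> carrier AA"
  show "Q a"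
  proof (rule lim[OF s(4)])
    fix e :: real assume e: "e > 0"
    have "\<forall>\<^sub>F k in sequentially. nrm P (s k \<ominus>\<^bsub>P\<^esub> a) < e"
      using s(3) unfolding PN.tends_def by (intro order_tendstoD(2)[OF _ e]) simp
    then obtain k where k: "nrm P (s k \<ominus>\<^bsub>P\<^esub> a) < e"
      by (auto simp: eventually_sequentially)
    have c: "s k \<in> carrier P" "a \<in> carrier P"
      using s(3) by (simp_all add: PN.tends_def)
    have "nrm (Ax x) (a x \<ominus>\<^bsub>Ax x\<^esub> s k x) \<le> e" for x
      using P_nrm_upper[OF PM.v_minus_closed[OF c(2,1)], of x] k PN.n_minus_commute[OF c]
      by (simp add: P_minus[OF c(2,1)])
    then show "\<exists>b\<in>carrier AA. Q b \<and> (\<forall>x. nrm (Ax x) (a x \<ominus>\<^bsub>Ax x\<^esub> b x) \<le> e)"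
      using s(1,2) by blast
  qed
qed

lemma smult_elementary_field:
  "Y \<in> K \<Longrightarrow> t \<in> carrier (A Y) \<Longrightarrow>
   (\<lambda>x. f x \<odot>\<^bsub>Ax x\<^esub> elementary_field Ax \<epsilon> g Y t x) = elementary_field Ax \<epsilon> (\<lambda>x. f x * g x) Y t"
  using \<epsilon>_closed by (auto simp: elementary_field_def fun_eq_iff)

lemma C0_action_bound:
  assumes f: "\<And>x. cmod (f x) \<le> B" and a: "a \<in> carrier P"
  shows "(\<lambda>x. f x \<odot>\<^bsub>Ax x\<^esub> a x) \<in> carrier P"
proof (rule P_carrierI[of _ "B * nrm P a"])
  fix x
  show "nrm (Ax x) (f x \<odot>\<^bsub>Ax x\<^esub> a x) \<le> B * nrm P a"
    using mult_mono[OF f[of x] P_nrm_upper[OF a, of x]] order_trans[OF norm_ge_zero f[of x]] F.nrm_nonneg[OF P_fibre[OF a]]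
    by (simp add: F.nrm_smult P_fibre[OF a])
qed (simp add: P_fibre[OF a])

text \<open>The function is absorbed into the coefficient of a generator and, in a product, into one
  factor; its boundedness handles uniform limits.\<close>

lemma C0_action_closed:
  assumes f: "f \<in> C0 UNIV" and a: "a \<in> carrier AA"
  shows "(\<lambda>x. f x \<odot>\<^bsub>Ax x\<^esub> a x) \<in> carrier AA"
  using a
proof (induction a rule: AA_induct)
  case zero
  then show ?case using AA.v_zero by simp
next
  case (gen g Y t)
  have "elementary_field Ax \<epsilon> (\<lambda>x. f x * g x) Y t \<in> gens"
    using gen C0_mult_right[OF f] by blast
  then show ?case
    using gens_AA gen by (auto simp: smult_elementary_field)
next
  case (add a b)
  then show ?case
    using AA.v_add[of "\<lambda>x. f x \<odot>\<^bsub>Ax x\<^esub> a x" "\<lambda>x. f x \<odot>\<^bsub>Ax x\<^esub> b x"] by (simp add: F.v_smult_add AA_fibre)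
next
  case (smult c a)
  then show ?case
    using AA.v_smult[of "\<lambda>x. f x \<odot>\<^bsub>Ax x\<^esub> a x" c] by (simp add: AA_fibre mult.commute)
next
  case (mult a b)
  then show ?case
    using AA.mult_closed[of "\<lambda>x. f x \<odot>\<^bsub>Ax x\<^esub> a x" b] by (simp add: AA_fibre F.smult_mult_left)
next
  case (lim a)
  obtain B where B: "B > 0" "\<And>x. cmod (f x) \<le> B"
    using C0_bounded[OF f] by blast
  show ?case
  proof (rule AA_mem_closed)
    show "(\<lambda>x. f x \<odot>\<^bsub>Ax x\<^esub> a x) \<in> carrier P"
      by (rule C0_action_bound[OF B(2) AA_P[OF lim(1)]])
    fix e :: real assume e: "e > 0"
    then obtain b where b: "b \<in> carrier AA" "(\<lambda>x. f x \<odot>\<^bsub>Ax x\<^esub> b x) \<in> carrier AA"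
      "\<And>x. nrm (Ax x) (a x \<ominus>\<^bsub>Ax x\<^esub> b x) \<le> e / B"
      using lim(2)[of "e / B"] B(1) by auto
    have "nrm (Ax x) (f x \<odot>\<^bsub>Ax x\<^esub> a x \<ominus>\<^bsub>Ax x\<^esub> f x \<odot>\<^bsub>Ax x\<^esub> b x) \<le> e" for x
    proof -
      have c: "a x \<in> carrier (Ax x)" "b x \<in> carrier (Ax x)"
        using AA_fibre lim(1) b(1) by auto
      have "cmod (f x) * nrm (Ax x) (a x \<ominus>\<^bsub>Ax x\<^esub> b x) \<le> B * (e / B)"
        by (rule mult_mono) (use B b(3) F.nrm_nonneg c in auto)
      then show ?thesis
        using B(1) c by (simp add: F.v_smult_minus[symmetric] F.nrm_smult)
    qed
    then show "\<exists>b\<in>carrier AA. \<forall>x. nrm (Ax x) (f x \<odot>\<^bsub>Ax x\<^esub> a x \<ominus>\<^bsub>Ax x\<^esub> b x) \<le> e"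
      using b(2) by (intro bexI[of _ "\<lambda>x. f x \<odot>\<^bsub>Ax x\<^esub> b x"]) auto
  qed
qed

end

section \<open>The functions vanishing at infinity as central multipliers\<close>

context net_fields
begin

abbreviation "act \<equiv> \<lambda>f a x. f x \<odot>\<^bsub>Ax x\<^esub> a x"

lemma act_mult:
  "f \<in> C0 UNIV \<Longrightarrow> a \<in> carrier AA \<Longrightarrow> b \<in> carrier AA \<Longrightarrow> a \<otimes>\<^bsub>AA\<^esub> act f b = act f (a \<otimes>\<^bsub>AA\<^esub> b)"
  "f \<in> C0 UNIV \<Longrightarrow> a \<in> carrier AA \<Longrightarrow> b \<in> carrier AA \<Longrightarrow> act f a \<otimes>\<^bsub>AA\<^esub> b = act f (a \<otimes>\<^bsub>AA\<^esub> b)"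
  by (simp_all add: AA_fibre F.smult_mult_left F.smult_mult_right)

text \<open>Factoring the coefficient, a generator is exactly of the form g a. The span L of all
  such products is also stable under right multiplication by the algebra, so in the induction only
  the left factor of a product has to be approximated from L.\<close>

lemma act_span:
  assumes a: "a \<in> carrier AA"
  shows "a \<in> closed_span AA (nrm AA) {fst (pointwise_action Ax AA f) a | f a. f \<in> C0 UNIV \<and> a \<in> carrier AA}"
proof -
  let ?S = "{fst (pointwise_action Ax AA f) a | f a. f \<in> C0 UNIV \<and> a \<in> carrier AA}"
  have S: "?S = {act f a | f a. f \<in> C0 UNIV \<and> a \<in> carrier AA}"
    by (auto simp: pointwise_action_def)
  have SA: "?S \<subseteq> carrier AA"
    unfolding S using C0_action_closed by blast
  define L where "L = lin_span AA ?S"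
  have L: "L \<subseteq> carrier AA" "\<zero>\<^bsub>AA\<^esub> \<in> L" "\<And>x y. x \<in> L \<Longrightarrow> y \<in> L \<Longrightarrow> x \<oplus>\<^bsub>AA\<^esub> y \<in> L" "\<And>c x. x \<in> L \<Longrightarrow> c \<odot>\<^bsub>AA\<^esub> x \<in> L"
    using AA.lin_span_submodule[OF SA] unfolding AA.submodule_iff L_def[symmetric] by (elim conjE, blast)+
  have SL: "?S \<subseteq> L"
    unfolding L_def by (rule lin_span_superset)
  have Lm: "x \<otimes>\<^bsub>AA\<^esub> b \<in> L" if x: "x \<in> L" and b: "b \<in> carrier AA" for x b
  proof -
    let ?W = "{x \<in> carrier AA. x \<otimes>\<^bsub>AA\<^esub> b \<in> L}"
    have "lin_span AA ?S \<subseteq> ?W"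
    proof (rule lin_span_least)
      show "submodule ?W complex_ring AA"
        unfolding AA.submodule_iff using b L(2-) by (auto simp: AA.mult_add_left AA.smult_mult_left simp del: AA_sel)
      show "?S \<subseteq> ?W"
      proof
        fix y assume "y \<in> ?S"
        then obtain f a where y: "y = act f a" "f \<in> C0 UNIV" "a \<in> carrier AA"
          unfolding S by blast
        have "y \<otimes>\<^bsub>AA\<^esub> b = act f (a \<otimes>\<^bsub>AA\<^esub> b)"
          unfolding y(1) by (rule act_mult(2)[OF y(2,3) b])
        moreover have "act f (a \<otimes>\<^bsub>AA\<^esub> b) \<in> ?S"
          unfolding S using y(2) AA.mult_closed[OF y(3) b] by blast
        ultimately show "y \<in> ?W"
          using SL C0_action_closed[OF y(2,3)] y(1) by auto
      qed
    qed
    then show ?thesis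
      using x unfolding L_def by blast
  qed
  have "\<forall>e>0. \<exists>b\<in>L. \<forall>x. nrm (Ax x) (a x \<ominus>\<^bsub>Ax x\<^esub> b x) \<le> e"
    using a
  proof (induction a rule: AA_induct)
    case zero
    then show ?case
      using L(2) by (intro allI impI bexI[of _ "\<lambda>x. \<zero>\<^bsub>Ax x\<^esub>"]) auto
  next
    case (gen f Y t)
    obtain g h where gh: "g \<in> C0 Y" "h \<in> C0 Y" "\<And>x. f x = g x * h x"
      using C0_factor[OF gen(2)] by metis
    have m: "elementary_field Ax \<epsilon> h Y t \<in> carrier AA"
      using gens_AA gen gh by blast
    have f: "f = (\<lambda>x. g x * h x)"
      using gh(3) by blast
    have "elementary_field Ax \<epsilon> f Y t = act g (elementary_field Ax \<epsilon> h Y t)"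
      unfolding f by (rule smult_elementary_field[OF gen(1,3), symmetric])
    then have "elementary_field Ax \<epsilon> f Y t \<in> L"
      using SL m C0_K[OF gen(1) gh(1)] unfolding S by blast
    then show ?case
      using L(1) by (intro allI impI bexI[of _ "elementary_field Ax \<epsilon> f Y t"]) (auto simp: AA_fibre)
  next
    case (add a b)
    show ?case
    proof (intro allI impI)
      fix e :: real assume e: "e > 0"
      obtain a' where a': "a' \<in> L" "\<And>x. nrm (Ax x) (a x \<ominus>\<^bsub>Ax x\<^esub> a' x) \<le> e / 2"
        using add(3) e by (meson half_gt_zero)
      obtain b' where b': "b' \<in> L" "\<And>x. nrm (Ax x) (b x \<ominus>\<^bsub>Ax x\<^esub> b' x) \<le> e / 2"
        using add(4) e by (meson half_gt_zero)
      have "nrm (Ax x) ((a x \<oplus>\<^bsub>Ax x\<^esub> b x) \<ominus>\<^bsub>Ax x\<^esub> (a' x \<oplus>\<^bsub>Ax x\<^esub> b' x)) \<le> e" for x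
        using F.N.n_add_minus_add_le[of "a x" x "b x" "a' x" "b' x"] a'(2)[of x] b'(2)[of x] add(1,2) a'(1) b'(1) L(1)
        by (simp add: AA_fibre subset_iff)
      then show "\<exists>c\<in>L. \<forall>x. nrm (Ax x) ((a x \<oplus>\<^bsub>Ax x\<^esub> b x) \<ominus>\<^bsub>Ax x\<^esub> c x) \<le> e"
        using L(3)[OF a'(1) b'(1)] by (intro bexI[of _ "a' \<oplus>\<^bsub>AA\<^esub> b'"]) simp_all
    qed
  next
    case (smult c a)
    show ?case
    proof (intro allI impI)
      fix e :: real assume e: "e > 0"
      then have "e / (cmod c + 1) > 0"
        by (simp add: add_nonneg_pos)
      then obtain a' where a': "a' \<in> L" "\<And>x. nrm (Ax x) (a x \<ominus>\<^bsub>Ax x\<^esub> a' x) \<le> e / (cmod c + 1)"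
        using smult(2) by meson
      have "nrm (Ax x) (c \<odot>\<^bsub>Ax x\<^esub> a x \<ominus>\<^bsub>Ax x\<^esub> c \<odot>\<^bsub>Ax x\<^esub> a' x) \<le> e" for x
      proof -
        have fc: "a x \<in> carrier (Ax x)" "a' x \<in> carrier (Ax x)"
          using smult(1) a'(1) L(1) AA_fibre by auto
        have "cmod c * nrm (Ax x) (a x \<ominus>\<^bsub>Ax x\<^esub> a' x) \<le> (cmod c + 1) * (e / (cmod c + 1))"
          by (rule mult_mono) (use a'(2) F.nrm_nonneg fc in auto)
        moreover have "cmod c + 1 \<noteq> 0"
          using norm_ge_zero[of c] by linarith
        ultimately show ?thesis
          using fc by (simp add: F.v_smult_minus[symmetric] F.nrm_smult)
      qed
      then show "\<exists>b\<in>L. \<forall>x. nrm (Ax x) (c \<odot>\<^bsub>Ax x\<^esub> a x \<ominus>\<^bsub>Ax x\<^esub> b x) \<le> e"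
        using L(4)[OF a'(1), of c] by (intro bexI[of _ "c \<odot>\<^bsub>AA\<^esub> a'"]) simp_all
    qed
  next
    case (mult a b)
    show ?case
    proof (intro allI impI)
      fix e :: real assume e: "e > 0"
      define B where "B = nrm P b + 1"
      have B: "B > 0"
        using P_nonneg[OF AA_P[OF mult(2)]] by (simp add: B_def)
      then obtain a' where a': "a' \<in> L" "\<And>x. nrm (Ax x) (a x \<ominus>\<^bsub>Ax x\<^esub> a' x) \<le> e / B"
        using mult(3) e by (meson divide_pos_pos)
      have "nrm (Ax x) (a x \<otimes>\<^bsub>Ax x\<^esub> b x \<ominus>\<^bsub>Ax x\<^esub> a' x \<otimes>\<^bsub>Ax x\<^esub> b x) \<le> e" for x
      proof -
        have fc: "a x \<in> carrier (Ax x)" "a' x \<in> carrier (Ax x)" "b x \<in> carrier (Ax x)"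
          using mult(1,2) a'(1) L(1) AA_fibre by auto
        have "nrm (Ax x) (b x) \<le> B"
          using P_nrm_upper[OF AA_P[OF mult(2)], of x] by (simp add: B_def)
        then have "nrm (Ax x) (a x \<ominus>\<^bsub>Ax x\<^esub> a' x) * nrm (Ax x) (b x) \<le> e / B * B"
          by (rule mult_mono[OF a'(2)]) (use B e F.nrm_nonneg fc in auto)
        then show ?thesis
          using F.nrm_mult[of "a x \<ominus>\<^bsub>Ax x\<^esub> a' x" x "b x"] fc B by (simp add: F.mult_minus_left)
      qed
      then show "\<exists>c\<in>L. \<forall>x. nrm (Ax x) (a x \<otimes>\<^bsub>Ax x\<^esub> b x \<ominus>\<^bsub>Ax x\<^esub> c x) \<le> e"
        using Lm[OF a'(1) mult(2)] by (intro bexI[of _ "a' \<otimes>\<^bsub>AA\<^esub> b"]) simp_all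
    qed
  next
    case (lim a)
    show ?case
    proof (intro allI impI)
      fix e :: real assume e: "e > 0"
      obtain b where b: "b \<in> carrier AA" "\<forall>e>0. \<exists>c\<in>L. \<forall>x. nrm (Ax x) (b x \<ominus>\<^bsub>Ax x\<^esub> c x) \<le> e"
        "\<And>x. nrm (Ax x) (a x \<ominus>\<^bsub>Ax x\<^esub> b x) \<le> e / 2"
        using lim(2)[of "e / 2"] e by (meson half_gt_zero)
      obtain c where c: "c \<in> L" "\<And>x. nrm (Ax x) (b x \<ominus>\<^bsub>Ax x\<^esub> c x) \<le> e / 2"
        using b(2) e by (meson half_gt_zero)
      have "nrm (Ax x) (a x \<ominus>\<^bsub>Ax x\<^esub> c x) \<le> e" for x
        using F.N.n_minus_triangle[of "a x" x "b x" "c x"] b(3)[of x] c(2)[of x] lim(1) b(1) c(1) L(1)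
        by (simp add: AA_fibre subset_iff)
      then show "\<exists>c\<in>L. \<forall>x. nrm (Ax x) (a x \<ominus>\<^bsub>Ax x\<^esub> c x) \<le> e"
        using c(1) by blast
    qed
  qed
  then have ap: "\<exists>b\<in>L. \<forall>x. nrm (Ax x) (a x \<ominus>\<^bsub>Ax x\<^esub> b x) \<le> e" if "e > 0" for e
    using that by blast
  show ?thesis
    unfolding closed_span_def L_def[symmetric] AA.N.mem_closure_iff
  proof (intro conjI a allI impI)
    fix e :: real assume e: "e > 0"
    then obtain b where b: "b \<in> L" "\<And>x. nrm (Ax x) (a x \<ominus>\<^bsub>Ax x\<^esub> b x) \<le> e / 2"
      using ap[of "e / 2"] by auto
    have bA: "b \<in> carrier AA"
      using b L by blast
    have "nrm P (a \<ominus>\<^bsub>AA\<^esub> b) \<le> e / 2"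
      by (rule P_nrm_least) (use b(2) in \<open>simp add: AA_minus[OF a bA]\<close>)
    then show "\<exists>y\<in>L. y \<in> carrier AA \<and> nrm AA (a \<ominus>\<^bsub>AA\<^esub> y) < e"
      using b(1) bA e by (intro bexI[of _ b]) auto
  qed
qed

theorem AA_C0_algebra: "C0_algebra AA (pointwise_action Ax AA)"
  unfolding C0_algebra_def
proof (intro conjI ballI)
  show "cstar_algebra AA" by (rule AA.cstar_algebra_axioms)
  have pa: "pointwise_action Ax AA f = (\<lambda>a\<in>carrier AA. act f a, \<lambda>a\<in>carrier AA. act f a)" for f
    by (simp add: pointwise_action_def)
  let ?M = "multiplier_algebra AA"
  have car: "pointwise_action Ax AA f \<in> carrier ?M" if f: "f \<in> C0 UNIV" for f
    using C0_action_closed[OF f] act_mult[OF f]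
    by (auto simp: multiplier_algebra_def pa simp del: AA_sel)
  show "star_hom C0_alg ?M (pointwise_action Ax AA)"
  proof (rule star_homI)
    show "pointwise_action Ax AA f \<in> carrier ?M" if "f \<in> carrier C0_alg" for f
      using that car by simp
    show "pointwise_action Ax AA (f \<oplus>\<^bsub>C0_alg\<^esub> g) = pointwise_action Ax AA f \<oplus>\<^bsub>?M\<^esub> pointwise_action Ax AA g" for f g
      by (auto simp: multiplier_algebra_def pa AA_fibre F.v_add_smult intro!: restrict_ext)
    show "pointwise_action Ax AA (c \<odot>\<^bsub>C0_alg\<^esub> f) = c \<odot>\<^bsub>?M\<^esub> pointwise_action Ax AA f" for c f
      by (auto simp: multiplier_algebra_def pa AA_fibre intro!: restrict_ext)
    show "pointwise_action Ax AA (f \<otimes>\<^bsub>C0_alg\<^esub> g) = pointwise_action Ax AA f \<otimes>\<^bsub>?M\<^esub> pointwise_action Ax AA g"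
      if "f \<in> carrier C0_alg" "g \<in> carrier C0_alg" for f g
      using that C0_action_closed
      by (auto simp: multiplier_algebra_def pa AA_fibre mult.commute intro!: restrict_ext)
    show "pointwise_action Ax AA (star C0_alg f) = star ?M (pointwise_action Ax AA f)" if "f \<in> carrier C0_alg" for f
    proof -
      have "act (star C0_alg f) a = star AA (act f (star AA a))" if "a \<in> carrier AA" for a
        using that by (simp add: F.star_smult AA_fibre)
      then show ?thesis
        using AA.star_closed by (auto simp: multiplier_algebra_def pa simp del: AA_sel intro!: restrict_ext)
    qed
  qed
  show "pointwise_action Ax AA f \<in> centre ?M" if f: "f \<in> C0 UNIV" for f
    unfolding centre_def
  proof (intro CollectI conjI ballI car f)
    fix m assume "m \<in> carrier ?M"
    then obtain L R where m: "m = (L, R)" "L \<in> carrier AA \<rightarrow>\<^sub>E carrier AA" "R \<in> carrier AA \<rightarrow>\<^sub>E carrier AA"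
      "\<And>a b. a \<in> carrier AA \<Longrightarrow> b \<in> carrier AA \<Longrightarrow> a \<otimes>\<^bsub>AA\<^esub> L b = R a \<otimes>\<^bsub>AA\<^esub> b"
      by (cases m) (auto simp: multiplier_algebra_def)
    have LR: "L a \<in> carrier AA" "R a \<in> carrier AA" if "a \<in> carrier AA" for a
      using m(2,3) that by auto
    note ac = C0_action_closed[OF f]
    \<comment> \<open>The relation c L(b) = R(c) b moves the action out of L past an arbitrary c,
      and an element is determined by its left multiples; \<open>R\<close> is treated with right
      multiples in the same way.\<close>
    have L: "L (act f a) = act f (L a)" if a: "a \<in> carrier AA" for a
    proof (rule AA.eq_if_mult_left_eq)
      fix c assume c: "c \<in> carrier AA"
      have "c \<otimes>\<^bsub>AA\<^esub> L (act f a) = R c \<otimes>\<^bsub>AA\<^esub> act f a"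
        by (rule m(4)[OF c ac[OF a]])
      also have "\<dots> = act f (R c \<otimes>\<^bsub>AA\<^esub> a)"
        by (rule act_mult(1)[OF f LR(2)[OF c] a])
      also have "\<dots> = act f (c \<otimes>\<^bsub>AA\<^esub> L a)"
        unfolding m(4)[OF c a] ..
      also have "\<dots> = c \<otimes>\<^bsub>AA\<^esub> act f (L a)"
        by (rule act_mult(1)[OF f c LR(1)[OF a], symmetric])
      finally show "c \<otimes>\<^bsub>AA\<^esub> L (act f a) = c \<otimes>\<^bsub>AA\<^esub> act f (L a)" .
    qed (use LR ac a in auto)
    have R: "R (act f a) = act f (R a)" if a: "a \<in> carrier AA" for a
    proof (rule AA.eq_if_mult_right_eq)
      fix c assume c: "c \<in> carrier AA"
      have "R (act f a) \<otimes>\<^bsub>AA\<^esub> c = act f a \<otimes>\<^bsub>AA\<^esub> L c"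
        by (rule m(4)[OF ac[OF a] c, symmetric])
      also have "\<dots> = act f (a \<otimes>\<^bsub>AA\<^esub> L c)"
        by (rule act_mult(2)[OF f a LR(1)[OF c]])
      also have "\<dots> = act f (R a \<otimes>\<^bsub>AA\<^esub> c)"
        unfolding m(4)[OF a c] ..
      also have "\<dots> = act f (R a) \<otimes>\<^bsub>AA\<^esub> c"
        by (rule act_mult(2)[OF f LR(2)[OF a] c, symmetric])
      finally show "R (act f a) \<otimes>\<^bsub>AA\<^esub> c = act f (R a) \<otimes>\<^bsub>AA\<^esub> c" .
    qed (use LR ac a in auto)
    show "pointwise_action Ax AA f \<otimes>\<^bsub>?M\<^esub> m = m \<otimes>\<^bsub>?M\<^esub> pointwise_action Ax AA f"
      using L R LR ac by (auto simp: multiplier_algebra_def pa m(1) intro!: restrict_ext)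
  qed
  show "closed_span AA (nrm AA) {fst (pointwise_action Ax AA f) a | f a. f \<in> C0 UNIV \<and> a \<in> carrier AA} = carrier AA"
    using act_span by (auto simp: closed_span_def AA.N.mem_closure_iff simp del: AA_sel)
qed

end

section \<open>Induced morphisms: fibrewise realisation and uniqueness\<close>

locale fibrewise_morphism = A: net_fields Ax K A \<epsilon> + B: net_fields Bx K B \<epsilon>'
  for Ax :: "'x::topological_space \<Rightarrow> 'c star_alg" and K :: "'x set set" and A :: "'x set \<Rightarrow> 'a star_alg"
    and \<epsilon> :: "'x \<Rightarrow> 'x set \<Rightarrow> 'a \<Rightarrow> 'c" and Bx :: "'x \<Rightarrow> 'd star_alg" and B :: "'x set \<Rightarrow> 'b star_alg"
    and \<epsilon>' :: "'x \<Rightarrow> 'x set \<Rightarrow> 'b \<Rightarrow> 'd" +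
  fixes \<phi> :: "'x set \<Rightarrow> 'a \<Rightarrow> 'b" and \<kappa> :: "'x \<Rightarrow> 'c \<Rightarrow> 'd"
  assumes \<phi>_hom: "Y \<in> K \<Longrightarrow> star_hom (A Y) (B Y) (\<phi> Y)"
    and \<kappa>_hom: "star_hom (Ax x) (Bx x) (\<kappa> x)"
    and \<kappa>_\<epsilon>: "Y \<in> K \<Longrightarrow> x \<in> Y \<Longrightarrow> t \<in> carrier (A Y) \<Longrightarrow> \<kappa> x (\<epsilon> x Y t) = \<epsilon>' x Y (\<phi> Y t)"
begin

definition \<Phi> :: "('x \<Rightarrow> 'c) \<Rightarrow> 'x \<Rightarrow> 'd" where
  "\<Phi> = (\<lambda>a\<in>carrier A.AA. \<lambda>x. \<kappa> x (a x))"

lemma \<Phi>_apply: "a \<in> carrier A.AA \<Longrightarrow> \<Phi> a x = \<kappa> x (a x)"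
  by (simp add: \<Phi>_def)

lemma \<kappa>_contractive: "a \<in> carrier (Ax x) \<Longrightarrow> nrm (Bx x) (\<kappa> x a) \<le> nrm (Ax x) a"
  by (rule star_hom_contractive[OF A.fibre B.fibre \<kappa>_hom])

lemma \<kappa>_zero: "\<kappa> x \<zero>\<^bsub>Ax x\<^esub> = \<zero>\<^bsub>Bx x\<^esub>"
  using \<kappa>_hom[of x] linear_map_zero_minus(1)[OF _ A.F.complex_module_axioms B.F.complex_module_axioms]
  by (simp add: star_hom_def)

lemma \<kappa>_minus: "a \<in> carrier (Ax x) \<Longrightarrow> b \<in> carrier (Ax x) \<Longrightarrow> \<kappa> x (a \<ominus>\<^bsub>Ax x\<^esub> b) = \<kappa> x a \<ominus>\<^bsub>Bx x\<^esub> \<kappa> x b"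
  using \<kappa>_hom[of x] linear_map_zero_minus(2)[OF _ A.F.complex_module_axioms B.F.complex_module_axioms]
  by (simp add: star_hom_def)

lemma \<Phi>_elementary_field:
  assumes "Y \<in> K" "f \<in> C0 Y" "t \<in> carrier (A Y)"
  shows "\<Phi> (elementary_field Ax \<epsilon> f Y t) = elementary_field Bx \<epsilon>' f Y (\<phi> Y t)"
proof -
  have "elementary_field Ax \<epsilon> f Y t \<in> carrier A.AA"
    using A.gens_AA assms by blast
  then show ?thesis
    using assms A.\<epsilon>_closed by (auto simp: fun_eq_iff \<Phi>_apply elementary_field_def star_homD(3)[OF \<kappa>_hom] \<kappa>_\<epsilon> \<kappa>_zero)
qed

text \<open>Generators go to generators, and contractivity of the fibre maps turns a uniform
  approximation of a field into one of its image.\<close>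

lemma \<Phi>_closed:
  assumes "a \<in> carrier A.AA"
  shows "\<Phi> a \<in> carrier B.AA"
proof -
  note \<kappa> = star_homD[OF \<kappa>_hom]
  have "(\<lambda>x. \<kappa> x (a x)) \<in> carrier B.AA"
    using assms
  proof (induction a rule: A.AA_induct)
    case zero
    then show ?case
      using B.AA.v_zero by (simp add: \<kappa>_zero)
  next
    case (gen f Y t)
    have "(\<lambda>x. \<kappa> x (elementary_field Ax \<epsilon> f Y t x)) = \<Phi> (elementary_field Ax \<epsilon> f Y t)"
      using A.gens_AA gen by (subst \<Phi>_def) (simp, blast)
    have "elementary_field Bx \<epsilon>' f Y (\<phi> Y t) \<in> B.gens"
      using gen star_homD(1)[OF \<phi>_hom[OF gen(1)] gen(3)] by blast
    then have "elementary_field Bx \<epsilon>' f Y (\<phi> Y t) \<in> carrier B.AA"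
      by (rule subsetD[OF B.gens_AA])
    with \<open>(\<lambda>x. \<kappa> x (elementary_field Ax \<epsilon> f Y t x)) = \<Phi> (elementary_field Ax \<epsilon> f Y t)\<close> show ?case
      unfolding \<Phi>_elementary_field[OF gen] by simp
  next
    case (add a b)
    then show ?case
      using B.AA.v_add[of "\<lambda>x. \<kappa> x (a x)" "\<lambda>x. \<kappa> x (b x)"] by (simp add: \<kappa> A.AA_fibre)
  next
    case (smult c a)
    then show ?case
      using B.AA.v_smult[of "\<lambda>x. \<kappa> x (a x)" c] by (simp add: \<kappa> A.AA_fibre)
  next
    case (mult a b)
    then show ?case
      using B.AA.mult_closed[of "\<lambda>x. \<kappa> x (a x)" "\<lambda>x. \<kappa> x (b x)"] by (simp add: \<kappa> A.AA_fibre)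
  next
    case (lim a)
    show ?case
    proof (rule B.AA_mem_closed)
      show "(\<lambda>x. \<kappa> x (a x)) \<in> carrier B.P"
      proof (rule B.P_carrierI[of _ "nrm A.P a"])
        show "\<kappa> x (a x) \<in> carrier (Bx x)" for x
          using A.AA_fibre[OF lim(1)] by (rule \<kappa>(1))
        show "nrm (Bx x) (\<kappa> x (a x)) \<le> nrm A.P a" for x
          using \<kappa>_contractive[OF A.AA_fibre[OF lim(1)]] A.P_nrm_upper[OF A.AA_P[OF lim(1)]] by (rule order_trans)
      qed
      fix e :: real assume "e > 0"
      then obtain b where b: "b \<in> carrier A.AA" "(\<lambda>x. \<kappa> x (b x)) \<in> carrier B.AA"
        "\<And>x. nrm (Ax x) (a x \<ominus>\<^bsub>Ax x\<^esub> b x) \<le> e"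
        using lim(2) by blast
      have "nrm (Bx x) (\<kappa> x (a x) \<ominus>\<^bsub>Bx x\<^esub> \<kappa> x (b x)) \<le> e" for x
        using order_trans[OF \<kappa>_contractive b(3)[of x]] A.AA_fibre[OF lim(1), of x] A.AA_fibre[OF b(1), of x]
        by (simp add: \<kappa>_minus)
      then show "\<exists>c\<in>carrier B.AA. \<forall>x. nrm (Bx x) (\<kappa> x (a x) \<ominus>\<^bsub>Bx x\<^esub> c x) \<le> e"
        using b(2) by (intro bexI[of _ "\<lambda>x. \<kappa> x (b x)"]) auto
    qed
  qed
  then show ?thesis
    using assms by (simp add: \<Phi>_def)
qed

lemma \<Phi>_hom: "star_hom A.AA B.AA \<Phi>"
proof (rule star_homI)
  note \<kappa> = star_homD[OF \<kappa>_hom]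
  show "\<Phi> a \<in> carrier B.AA" if "a \<in> carrier A.AA" for a
    by (rule \<Phi>_closed[OF that])
  show "\<Phi> (a \<oplus>\<^bsub>A.AA\<^esub> b) = \<Phi> a \<oplus>\<^bsub>B.AA\<^esub> \<Phi> b" if "a \<in> carrier A.AA" "b \<in> carrier A.AA" for a b
    using \<Phi>_apply[OF A.AA.v_add[OF that]] that by (simp add: fun_eq_iff \<Phi>_apply \<kappa> A.AA_fibre)
  show "\<Phi> (c \<odot>\<^bsub>A.AA\<^esub> a) = c \<odot>\<^bsub>B.AA\<^esub> \<Phi> a" if "a \<in> carrier A.AA" for c a
    using \<Phi>_apply[OF A.AA.v_smult[OF that]] that by (simp add: fun_eq_iff \<Phi>_apply \<kappa> A.AA_fibre)
  show "\<Phi> (a \<otimes>\<^bsub>A.AA\<^esub> b) = \<Phi> a \<otimes>\<^bsub>B.AA\<^esub> \<Phi> b" if "a \<in> carrier A.AA" "b \<in> carrier A.AA" for a b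
    using \<Phi>_apply[OF A.AA.mult_closed[OF that]] that by (simp add: fun_eq_iff \<Phi>_apply \<kappa> A.AA_fibre)
  show "\<Phi> (star A.AA a) = star B.AA (\<Phi> a)" if "a \<in> carrier A.AA" for a
    using \<Phi>_apply[OF A.AA.star_closed[OF that]] that by (simp add: fun_eq_iff \<Phi>_apply \<kappa> A.AA_fibre)
qed

lemma \<Phi>_C0_morphism: "C0_morphism A.AA (pointwise_action Ax A.AA) B.AA (pointwise_action Bx B.AA) \<Phi>"
  unfolding C0_morphism_def
proof (intro conjI ballI \<Phi>_hom)
  fix f :: "'x \<Rightarrow> complex" and a assume f: "f \<in> C0 UNIV" and a: "a \<in> carrier A.AA"
  show "\<Phi> (fst (pointwise_action Ax A.AA f) a) = fst (pointwise_action Bx B.AA f) (\<Phi> a)"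
    using a \<Phi>_closed[OF a] A.C0_action_closed[OF f a]
    by (auto simp: pointwise_action_def \<Phi>_apply fun_eq_iff A.AA_fibre star_homD(3)[OF \<kappa>_hom])
qed

text \<open>Agreement on generators spreads through the algebraic operations. For a limit, both
  morphisms are contractive, so the images of a and of a nearby b, where they agree, are close for
  either of them.\<close>

lemma \<Phi>_unique:
  assumes \<psi>: "star_hom A.AA B.AA \<psi>"
    and gen: "\<And>f Y t. Y \<in> K \<Longrightarrow> f \<in> C0 Y \<Longrightarrow> t \<in> carrier (A Y) \<Longrightarrow>
      \<psi> (elementary_field Ax \<epsilon> f Y t) = elementary_field Bx \<epsilon>' f Y (\<phi> Y t)"
    and a: "a \<in> carrier A.AA"
  shows "\<psi> a = \<Phi> a"
  using a
proof (induction a rule: A.AA_induct)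
  case zero
  have "\<psi> \<zero>\<^bsub>A.AA\<^esub> = \<zero>\<^bsub>B.AA\<^esub>" "\<Phi> \<zero>\<^bsub>A.AA\<^esub> = \<zero>\<^bsub>B.AA\<^esub>"
    using \<psi> \<Phi>_hom linear_map_zero_minus(1)[OF _ A.AA.complex_module_axioms B.AA.complex_module_axioms]
    unfolding star_hom_def by blast+
  then show ?case by simp
next
  case (gen f Y t)
  then show ?case by (simp add: \<Phi>_elementary_field assms(2))
next
  case (add a b)
  then show ?case using star_homD(2)[OF \<psi>, of a b] star_homD(2)[OF \<Phi>_hom, of a b] by simp
next
  case (smult c a)
  then show ?case using star_homD(3)[OF \<psi>, of a c] star_homD(3)[OF \<Phi>_hom, of a c] by simp
next
  case (mult a b)
  then show ?case using star_homD(4)[OF \<psi>, of a b] star_homD(4)[OF \<Phi>_hom, of a b] by simp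
next
  case (lim a)
  have c: "\<psi> a \<in> carrier B.AA" "\<Phi> a \<in> carrier B.AA"
    using star_homD(1)[OF \<psi> lim(1)] \<Phi>_closed[OF lim(1)] by auto
  have "nrm B.AA (\<psi> a \<ominus>\<^bsub>B.AA\<^esub> \<Phi> a) \<le> 0"
  proof (rule field_le_epsilon)
    fix e :: real assume e: "e > 0"
    then obtain b where b: "b \<in> carrier A.AA" "\<psi> b = \<Phi> b" "\<And>x. nrm (Ax x) (a x \<ominus>\<^bsub>Ax x\<^esub> b x) \<le> e / 2"
      using lim(2)[of "e / 2"] by auto
    have d: "a \<ominus>\<^bsub>A.AA\<^esub> b \<in> carrier A.AA"
      using lim(1) b(1) by (rule A.AA.v_minus_closed)
    have n: "nrm A.AA (a \<ominus>\<^bsub>A.AA\<^esub> b) \<le> e / 2"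
      unfolding A.AA_sel by (rule A.P_nrm_least) (use b(3) in \<open>simp add: A.AA_minus[OF lim(1) b(1)]\<close>)
    have "\<psi> (a \<ominus>\<^bsub>A.AA\<^esub> b) = \<psi> a \<ominus>\<^bsub>B.AA\<^esub> \<Phi> b" "\<Phi> (a \<ominus>\<^bsub>A.AA\<^esub> b) = \<Phi> a \<ominus>\<^bsub>B.AA\<^esub> \<Phi> b"
      using \<psi> \<Phi>_hom linear_map_zero_minus(2)[OF _ A.AA.complex_module_axioms B.AA.complex_module_axioms lim(1) b(1)] b(2)
      unfolding star_hom_def by auto
    then have "nrm B.AA (\<psi> a \<ominus>\<^bsub>B.AA\<^esub> \<Phi> b) \<le> e / 2" "nrm B.AA (\<Phi> a \<ominus>\<^bsub>B.AA\<^esub> \<Phi> b) \<le> e / 2"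
      using order_trans[OF star_hom_contractive[OF A.AA.cstar_algebra_axioms B.AA.cstar_algebra_axioms \<psi> d] n]
        order_trans[OF star_hom_contractive[OF A.AA.cstar_algebra_axioms B.AA.cstar_algebra_axioms \<Phi>_hom d] n]
      by simp_all
    then show "nrm B.AA (\<psi> a \<ominus>\<^bsub>B.AA\<^esub> \<Phi> a) \<le> 0 + e"
      using B.AA.N.n_minus_triangle[of "\<psi> a" "\<Phi> b" "\<Phi> a"] B.AA.N.n_minus_commute[of "\<Phi> a" "\<Phi> b"] c \<Phi>_closed[OF b(1)] by simp
  qed
  then have "nrm B.AA (\<psi> a \<ominus>\<^bsub>B.AA\<^esub> \<Phi> a) = 0"
    using B.AA.nrm_nonneg[OF B.AA.v_minus_closed[OF c]] by simp
  then show ?case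
    using B.AA.nrm_eq_0[OF B.AA.v_minus_closed[OF c]] B.AA.v_minus_eq0[OF c] by blast
qed

text \<open>Replaces the definite description by a formula. As the left-hand side depends on
  \<open>\<phi>\<close> only, it also shows that the choice of the fibre maps
  \<open>\<kappa>\<close> has no influence on \<open>\<Phi>\<close>.\<close>

theorem induced_morphism_eq: "induced_morphism K A Ax \<epsilon> B Bx \<epsilon>' \<phi> = \<Phi>"
  unfolding induced_morphism_def Let_def
proof (rule the_equality)
  show "\<Phi> \<in> extensional (carrier A.AA) \<and>
    C0_morphism A.AA (pointwise_action Ax A.AA) B.AA (pointwise_action Bx B.AA) \<Phi> \<and>
    (\<forall>Y\<in>K. \<forall>f\<in>C0 Y. \<forall>t\<in>carrier (A Y). \<Phi> (elementary_field Ax \<epsilon> f Y t) = elementary_field Bx \<epsilon>' f Y (\<phi> Y t))"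
    using \<Phi>_C0_morphism \<Phi>_elementary_field by (auto simp: \<Phi>_def)
  fix \<psi> assume \<psi>: "\<psi> \<in> extensional (carrier A.AA) \<and>
    C0_morphism A.AA (pointwise_action Ax A.AA) B.AA (pointwise_action Bx B.AA) \<psi> \<and>
    (\<forall>Y\<in>K. \<forall>f\<in>C0 Y. \<forall>t\<in>carrier (A Y). \<psi> (elementary_field Ax \<epsilon> f Y t) = elementary_field Bx \<epsilon>' f Y (\<phi> Y t))"
  show "\<psi> = \<Phi>"
  proof (rule extensionalityI[of _ "carrier A.AA"])
    show "\<psi> \<in> extensional (carrier A.AA)" "\<Phi> \<in> extensional (carrier A.AA)"
      using \<psi> by (simp_all add: \<Phi>_def)
    show "\<psi> a = \<Phi> a" if "a \<in> carrier A.AA" for a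
      by (rule \<Phi>_unique[OF _ _ that]) (use \<psi> in \<open>auto simp: C0_morphism_def\<close>)
  qed
qed

end

subsection \<open>The universal property for arbitrary targets\<close>

primrec star_poly_eval :: "('b, 'm) star_alg_scheme \<Rightarrow> ('i \<Rightarrow> 'a \<Rightarrow> 'b) \<Rightarrow> ('i, 'a) star_poly \<Rightarrow> 'b" where
  "star_poly_eval B \<phi> (PGen Y t) = \<phi> Y t"
| "star_poly_eval B \<phi> (PAdd p q) = star_poly_eval B \<phi> p \<oplus>\<^bsub>B\<^esub> star_poly_eval B \<phi> q"
| "star_poly_eval B \<phi> (PMult p q) = star_poly_eval B \<phi> p \<otimes>\<^bsub>B\<^esub> star_poly_eval B \<phi> q"
| "star_poly_eval B \<phi> (PScale c p) = c \<odot>\<^bsub>B\<^esub> star_poly_eval B \<phi> p"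
| "star_poly_eval B \<phi> (PStar p) = star B (star_poly_eval B \<phi> p)"

text \<open>Choosing a sequence of *-polynomials for each element transports the C*-subalgebra generated by the
  family to the type of the universal carriers.\<close>

theorem universal_map:
  fixes C :: "('x set, 'a) univ_carrier star_alg" and B :: "('b, 'm) star_alg_scheme"
  assumes U: "universal_cstar_algebra W A j C \<epsilon>" and B: "cstar_algebra B" and \<phi>: "compatible_family W A j B \<phi>"
  obtains \<psi> where "star_hom C B \<psi>" "\<And>Y t. Y \<in> W \<Longrightarrow> t \<in> carrier (A Y) \<Longrightarrow> \<psi> (\<epsilon> Y t) = \<phi> Y t"
proof -
  interpret B: cstar_algebra B by (rule B)
  \<comment> \<open>Generators that do not come from the family are sent to zero, so that every
    polynomial has a value in \<open>B\<close>.\<close>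
  define ev where "ev = star_poly_eval B (\<lambda>Y t. if Y \<in> W \<and> t \<in> carrier (A Y) then \<phi> Y t else \<zero>\<^bsub>B\<^esub>)"
  have \<phi>_hom: "star_hom (A Y) B (\<phi> Y)" if "Y \<in> W" for Y
    using \<phi> that by (simp add: compatible_family_def)
  have ev_B: "ev p \<in> carrier B" for p
    by (induction p) (auto simp: ev_def star_homD(1)[OF \<phi>_hom])
  have ev: "ev p \<oplus>\<^bsub>B\<^esub> ev q = ev (PAdd p q)" "ev p \<otimes>\<^bsub>B\<^esub> ev q = ev (PMult p q)" "c \<odot>\<^bsub>B\<^esub> ev p = ev (PScale c p)"
    "star B (ev p) = ev (PStar p)" for p q c
    by (simp_all add: ev_def)
  \<comment> \<open>\<open>undefined\<close> stands for any polynomial here: scaled by 0 it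
    represents zero.\<close>
  have "\<zero>\<^bsub>B\<^esub> = ev (PScale 0 undefined)"
    using ev(3)[of 0 undefined] ev_B by simp
  then have "star_subalgebra (range ev) B"
    unfolding B.star_subalgebra_iff using ev_B by (auto simp: ev)
  then have D: "star_subalgebra (B.cls (range ev)) B"
    by (rule B.star_subalgebra_closure)
  define D where "D = B\<lparr>carrier := B.cls (range ev)\<rparr>"
  have Dc: "carrier D = B.cls (range ev)"
    by (simp add: D_def)
  have D_cstar: "cstar_algebra D"
    unfolding D_def by (rule B.closed_star_subalgebra[OF D]) simp
  have D_sub: "carrier D \<subseteq> carrier B"
    using D unfolding B.star_subalgebra_iff Dc by (rule conjunct1)
  define g where "g d = (SOME s. B.N.tends (\<lambda>k. ev (s k)) d)" for d
  have g: "B.N.tends (\<lambda>k. ev (g d k)) d" if d: "d \<in> carrier D" for d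
  proof -
    obtain s where s: "\<And>k. s k \<in> range ev" "B.N.tends s d"
      using B.N.closure_tends[of d "range ev"] d Dc by auto
    have "\<forall>k. \<exists>p. s k = ev p"
      using s(1) by blast
    then obtain p where p: "\<And>k. s k = ev (p k)"
      by metis
    have "s = (\<lambda>k. ev (p k))"
      using p by blast
    then have "B.N.tends (\<lambda>k. ev (p k)) d"
      using s(2) by simp
    then show ?thesis
      unfolding g_def by (rule someI[of "\<lambda>s. B.N.tends (\<lambda>k. ev (s k)) d"])
  qed
  \<comment> \<open>The chosen sequence of polynomials determines the element as its limit.\<close>
  have inj: "inj_on g (carrier D)"
  proof (rule inj_onI)
    fix d d' assume "d \<in> carrier D" "d' \<in> carrier D" "g d = g d'"
    then show "d = d'"
      using g[of d] g[of d'] B.N.tends_unique by metis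
  qed
  obtain B' :: "('x set, 'a) univ_carrier star_alg" where B': "cstar_algebra B'" "carrier B' = g ` carrier D"
    "star_hom D B' g" "star_hom B' D (inv_into (carrier D) g)"
    by (rule cstar_algebra_transport[OF D_cstar inj])
  have \<phi>D: "\<phi> Y t \<in> carrier D" if "Y \<in> W" "t \<in> carrier (A Y)" for Y t
  proof -
    have "ev (PGen Y t) = \<phi> Y t"
      using that by (simp add: ev_def)
    moreover have "range ev \<subseteq> carrier D"
      unfolding Dc using ev_B by (intro B.cls_superset) blast
    ultimately show ?thesis
      by (metis range_subsetD)
  qed
  have "star_hom (A Y) D (\<phi> Y)" if Y: "Y \<in> W" for Y
    using star_homD[OF \<phi>_hom[OF Y]] \<phi>D[OF Y] by (intro star_homI) (simp_all add: D_def)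
  then have "star_hom (A Y) B' (\<lambda>t. g (\<phi> Y t))" if "Y \<in> W" for Y
    using star_hom_compose B'(3) that by blast
  then have "compatible_family W A j B' (\<lambda>Y t. g (\<phi> Y t))"
    using \<phi> unfolding compatible_family_def by simp
  then obtain \<psi> where \<psi>: "star_hom C B' \<psi>" "\<And>Y t. Y \<in> W \<Longrightarrow> t \<in> carrier (A Y) \<Longrightarrow> \<psi> (\<epsilon> Y t) = g (\<phi> Y t)"
    using U B'(1) unfolding universal_cstar_algebra_def by blast
  have "star_hom D B (\<lambda>x. x)"
    using D_sub by (intro star_homI) (auto simp: D_def)
  from star_hom_compose[OF star_hom_compose[OF \<psi>(1) B'(4)] this]
  have "star_hom C B (\<lambda>x. inv_into (carrier D) g (\<psi> x))" .
  moreover have "inv_into (carrier D) g (\<psi> (\<epsilon> Y t)) = \<phi> Y t" if "Y \<in> W" "t \<in> carrier (A Y)" for Y t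
    using \<psi>(2)[OF that] inv_into_f_f[OF inj \<phi>D[OF that]] by simp
  ultimately show thesis
    by (rule that)
qed

section \<open>Operators and Hilbert spaces\<close>

lemma operator_algebra_sel [simp]:
  "carrier (operator_algebra E n Ops) = Ops" "mult (operator_algebra E n Ops) = (\<lambda>S T. \<lambda>v\<in>carrier E. S (T v))"
  "one (operator_algebra E n Ops) = (\<lambda>v\<in>carrier E. v)" "zero (operator_algebra E n Ops) = (\<lambda>v\<in>carrier E. \<zero>\<^bsub>E\<^esub>)"
  "add (operator_algebra E n Ops) = (\<lambda>S T. \<lambda>v\<in>carrier E. S v \<oplus>\<^bsub>E\<^esub> T v)"
  "smult (operator_algebra E n Ops) = (\<lambda>c T. \<lambda>v\<in>carrier E. c \<odot>\<^bsub>E\<^esub> T v)"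
  "star (operator_algebra E n Ops) = adjoint_op E" "nrm (operator_algebra E n Ops) = op_norm (carrier E) n"
  by (simp_all add: operator_algebra_def)

text \<open>What bounded operators on a Hilbert space and adjointable operators on a Hilbert module
  have in common. The adjoint stays outside, since it comes from the Riesz theorem in the first case
  and from the definition in the second.\<close>

locale operator_space = normed_module M n
  for M :: "('b, 'h, 'm) ip_module_scheme" (structure) and n +
  fixes Ops :: "('h \<Rightarrow> 'h) set"
  assumes O_fun: "T \<in> Ops \<Longrightarrow> T \<in> carrier M \<rightarrow>\<^sub>E carrier M"
    and O_linear: "T \<in> Ops \<Longrightarrow> linear_map M M T"
    and O_bounded: "T \<in> Ops \<Longrightarrow> \<exists>c. \<forall>x\<in>carrier M. n (T x) \<le> c * n x"
    and O_zero: "(\<lambda>v\<in>carrier M. \<zero>) \<in> Ops"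
    and O_add: "S \<in> Ops \<Longrightarrow> T \<in> Ops \<Longrightarrow> (\<lambda>v\<in>carrier M. S v \<oplus> T v) \<in> Ops"
    and O_smult: "T \<in> Ops \<Longrightarrow> (\<lambda>v\<in>carrier M. c \<odot> T v) \<in> Ops"
    and O_mult: "S \<in> Ops \<Longrightarrow> T \<in> Ops \<Longrightarrow> (\<lambda>v\<in>carrier M. S (T v)) \<in> Ops"
begin

abbreviation "OA \<equiv> operator_algebra M n Ops"
abbreviation "opn \<equiv> op_norm (carrier M) n"

lemma O_closed: "T \<in> Ops \<Longrightarrow> x \<in> carrier M \<Longrightarrow> T x \<in> carrier M"
  using O_fun[of T] by auto

lemma O_smult_apply: "T \<in> Ops \<Longrightarrow> x \<in> carrier M \<Longrightarrow> T (c \<odot> x) = c \<odot> T x"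
  using O_linear[of T] by (simp add: linear_map_def)

lemma O_eqI: "S \<in> Ops \<Longrightarrow> T \<in> Ops \<Longrightarrow> (\<And>x. x \<in> carrier M \<Longrightarrow> S x = T x) \<Longrightarrow> S = T"
  by (rule PiE_ext[OF O_fun O_fun])

lemma opn_least: "0 \<le> c \<Longrightarrow> (\<And>x. x \<in> carrier M \<Longrightarrow> n (T x) \<le> c * n x) \<Longrightarrow> opn T \<le> c"
  unfolding op_norm_def by (intro cInf_lower bdd_belowI[of _ 0]) auto

lemma O_bounded_nonneg:
  assumes "T \<in> Ops"
  shows "\<exists>c\<ge>0. \<forall>x\<in>carrier M. n (T x) \<le> c * n x"
proof -
  obtain c where c: "\<And>x. x \<in> carrier M \<Longrightarrow> n (T x) \<le> c * n x"
    using O_bounded[OF assms] by blast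
  have "n (T x) \<le> \<bar>c\<bar> * n x" if "x \<in> carrier M" for x
    by (rule order_trans[OF c[OF that] mult_right_mono]) (use that in auto)
  then show ?thesis
    by (intro exI[of _ "\<bar>c\<bar>"]) simp
qed

lemma opn_nonneg: "T \<in> Ops \<Longrightarrow> 0 \<le> opn T"
  unfolding op_norm_def using O_bounded_nonneg[of T] by (intro cInf_greatest) auto

lemma opn_upper: "T \<in> Ops \<Longrightarrow> x \<in> carrier M \<Longrightarrow> n (T x) \<le> opn T * n x"
proof (cases "n x = 0")
  case True
  assume T: "T \<in> Ops" and x: "x \<in> carrier M"
  obtain c where "n (T x) \<le> c * n x"
    using O_bounded[OF T] x by blast
  then show ?thesis
    using True by simp
next
  case False
  assume T: "T \<in> Ops" and x: "x \<in> carrier M"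
  have pos: "n x > 0"
    using n_nonneg[OF x] False by linarith
  have "n (T x) / n x \<le> opn T"
    unfolding op_norm_def
  proof (rule cInf_greatest)
    show "{c. 0 \<le> c \<and> (\<forall>x\<in>carrier M. n (T x) \<le> c * n x)} \<noteq> {}"
      using O_bounded_nonneg[OF T] by auto
  qed (use x pos in \<open>auto simp: field_simps\<close>)
  then show ?thesis
    using pos by (simp add: field_simps)
qed

sublocale OM: complex_module OA
proof (rule complex_moduleI)
  fix S T R assume STR: "S \<in> carrier OA" "T \<in> carrier OA" "R \<in> carrier OA"
  then have c: "S x \<in> carrier M" "T x \<in> carrier M" "R x \<in> carrier M" if "x \<in> carrier M" for x
    using O_closed that by auto
  show "(S \<oplus>\<^bsub>OA\<^esub> T) \<oplus>\<^bsub>OA\<^esub> R = S \<oplus>\<^bsub>OA\<^esub> (T \<oplus>\<^bsub>OA\<^esub> R)"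
    unfolding operator_algebra_sel by (rule restrict_ext) (simp add: c v_assoc)
next
  fix S T assume ST: "S \<in> carrier OA" "T \<in> carrier OA"
  then have c: "S x \<in> carrier M" "T x \<in> carrier M" if "x \<in> carrier M" for x
    using O_closed that by auto
  show "S \<oplus>\<^bsub>OA\<^esub> T \<in> carrier OA"
    using ST O_add by simp
  show "S \<oplus>\<^bsub>OA\<^esub> T = T \<oplus>\<^bsub>OA\<^esub> S"
    unfolding operator_algebra_sel by (rule restrict_ext) (simp add: c v_comm)
  fix a b :: complex
  show "a \<odot>\<^bsub>OA\<^esub> (S \<oplus>\<^bsub>OA\<^esub> T) = a \<odot>\<^bsub>OA\<^esub> S \<oplus>\<^bsub>OA\<^esub> a \<odot>\<^bsub>OA\<^esub> T"
    unfolding operator_algebra_sel by (rule restrict_ext) (simp add: c v_smult_add)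
  show "(a + b) \<odot>\<^bsub>OA\<^esub> S = a \<odot>\<^bsub>OA\<^esub> S \<oplus>\<^bsub>OA\<^esub> b \<odot>\<^bsub>OA\<^esub> S"
    unfolding operator_algebra_sel by (rule restrict_ext) (simp add: c v_add_smult)
  show "(a * b) \<odot>\<^bsub>OA\<^esub> S = a \<odot>\<^bsub>OA\<^esub> (b \<odot>\<^bsub>OA\<^esub> S)"
    unfolding operator_algebra_sel by (rule restrict_ext) (simp add: c)
next
  fix T assume T: "T \<in> carrier OA"
  then have c: "T x \<in> carrier M" if "x \<in> carrier M" for x
    using O_closed that by auto
  show "a \<odot>\<^bsub>OA\<^esub> T \<in> carrier OA" for a
    using T O_smult by simp
  have "S = T" if "S = restrict S (carrier M)" "\<And>x. x \<in> carrier M \<Longrightarrow> S x = T x" for S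
  proof -
    have "T = restrict T (carrier M)"
      using O_fun[of T] T by (simp add: PiE_restrict)
    then show ?thesis
      using that by (metis restrict_ext)
  qed
  from this[of "\<zero>\<^bsub>OA\<^esub> \<oplus>\<^bsub>OA\<^esub> T"] this[of "1 \<odot>\<^bsub>OA\<^esub> T"]
  show "\<zero>\<^bsub>OA\<^esub> \<oplus>\<^bsub>OA\<^esub> T = T" "1 \<odot>\<^bsub>OA\<^esub> T = T"
    using c by simp_all
  show "0 \<odot>\<^bsub>OA\<^esub> T = \<zero>\<^bsub>OA\<^esub>"
    unfolding operator_algebra_sel by (rule restrict_ext) (simp add: c)
qed (simp add: O_zero)

lemma OA_minus: "S \<in> Ops \<Longrightarrow> T \<in> Ops \<Longrightarrow> S \<ominus>\<^bsub>OA\<^esub> T = (\<lambda>v\<in>carrier M. S v \<ominus> T v)"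
  by (subst OM.v_minus, simp_all, rule restrict_ext, simp add: v_minus O_closed)

lemma OA_minus_apply: "S \<in> Ops \<Longrightarrow> T \<in> Ops \<Longrightarrow> x \<in> carrier M \<Longrightarrow> (S \<ominus>\<^bsub>OA\<^esub> T) x = S x \<ominus> T x"
  by (simp add: OA_minus)

lemma opn_add: "S \<in> Ops \<Longrightarrow> T \<in> Ops \<Longrightarrow> opn (\<lambda>v\<in>carrier M. S v \<oplus> T v) \<le> opn S + opn T"
proof (rule opn_least)
  fix x assume ST: "S \<in> Ops" "T \<in> Ops" and x: "x \<in> carrier M"
  show "n ((\<lambda>v\<in>carrier M. S v \<oplus> T v) x) \<le> (opn S + opn T) * n x"
    using n_triangle[of "S x" "T x"] opn_upper[of S x] opn_upper[of T x] ST x by (simp add: O_closed algebra_simps)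
qed (simp add: opn_nonneg)

lemma opn_smult_le: "T \<in> Ops \<Longrightarrow> opn (\<lambda>v\<in>carrier M. c \<odot> T v) \<le> cmod c * opn T"
  by (rule opn_least) (auto simp: opn_nonneg n_smult O_closed mult.assoc intro!: mult_left_mono opn_upper)

lemma opn_mult: "S \<in> Ops \<Longrightarrow> T \<in> Ops \<Longrightarrow> opn (\<lambda>v\<in>carrier M. S (T v)) \<le> opn S * opn T"
proof (rule opn_least)
  fix x assume ST: "S \<in> Ops" "T \<in> Ops" and x: "x \<in> carrier M"
  have "n (S (T x)) \<le> opn S * n (T x)"
    by (rule opn_upper[OF ST(1) O_closed[OF ST(2) x]])
  also have "\<dots> \<le> opn S * (opn T * n x)"
    by (rule mult_left_mono[OF opn_upper[OF ST(2) x] opn_nonneg[OF ST(1)]])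
  finally show "n ((\<lambda>v\<in>carrier M. S (T v)) x) \<le> opn S * opn T * n x"
    using x by (simp add: mult.assoc)
qed (simp add: opn_nonneg)

sublocale ON: normed_module OA opn
proof
  fix T assume T: "T \<in> carrier OA"
  show "0 \<le> opn T"
    using T by (simp add: opn_nonneg)
  show "opn T = 0 \<longleftrightarrow> T = \<zero>\<^bsub>OA\<^esub>"
  proof
    assume 0: "opn T = 0"
    show "T = \<zero>\<^bsub>OA\<^esub>"
    proof (rule O_eqI)
      fix x assume x: "x \<in> carrier M"
      have "n (T x) = 0"
        using opn_upper[of T x] n_nonneg[of "T x"] T x 0 by (simp add: O_closed order_antisym)
      then show "T x = \<zero>\<^bsub>OA\<^esub> x"
        using T x by (simp add: n_eq_0 O_closed)
    qed (use T O_zero in simp_all)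
  next
    assume "T = \<zero>\<^bsub>OA\<^esub>"
    then have "opn T \<le> 0"
      by (intro opn_least) auto
    then show "opn T = 0"
      using opn_nonneg[of T] T by simp
  qed
  show "opn (c \<odot>\<^bsub>OA\<^esub> T) = cmod c * opn T" for c
  proof (cases "c = 0")
    case True
    have "opn (c \<odot>\<^bsub>OA\<^esub> T) \<le> 0"
      using opn_smult_le[of T c] T True by simp
    then show ?thesis
      using opn_nonneg[of "c \<odot>\<^bsub>OA\<^esub> T"] OM.v_smult[OF T, of c] True by simp
  next
    case False
    have "opn ((1 / c) \<odot>\<^bsub>OA\<^esub> (c \<odot>\<^bsub>OA\<^esub> T)) \<le> cmod (1 / c) * opn (c \<odot>\<^bsub>OA\<^esub> T)"
      using opn_smult_le[of "c \<odot>\<^bsub>OA\<^esub> T" "1 / c"] OM.v_smult[OF T, of c] by simp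
    moreover have "(1 / c) \<odot>\<^bsub>OA\<^esub> (c \<odot>\<^bsub>OA\<^esub> T) = T"
      using OM.v_smult_smult[OF T, of "1 / c" c] OM.v_one[OF T] False by simp
    ultimately have "cmod c * opn T \<le> opn (c \<odot>\<^bsub>OA\<^esub> T)"
      using False by (simp add: norm_divide field_simps del: operator_algebra_sel)
    then show ?thesis
      using opn_smult_le[of T c] T by simp
  qed
next
  fix S T assume "S \<in> carrier OA" "T \<in> carrier OA"
  then show "opn (S \<oplus>\<^bsub>OA\<^esub> T) \<le> opn S + opn T"
    using opn_add[of S T] by simp
qed

end

text \<open>Nondegeneracy of the inner product makes the adjoint unique, so that the definite
  description can be evaluated at any candidate.\<close>

lemma adjoint_op_eq:
  assumes S: "S \<in> carrier E \<rightarrow>\<^sub>E carrier E"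
    and adj: "\<And>v w. v \<in> carrier E \<Longrightarrow> w \<in> carrier E \<Longrightarrow> ip E (T v) w = ip E v (S w)"
    and nondeg: "\<And>x y. x \<in> carrier E \<Longrightarrow> y \<in> carrier E \<Longrightarrow> (\<And>v. v \<in> carrier E \<Longrightarrow> ip E v x = ip E v y) \<Longrightarrow> x = y"
  shows "adjoint_op E T = S"
  unfolding adjoint_op_def
proof (rule the_equality)
  show "S \<in> carrier E \<rightarrow>\<^sub>E carrier E \<and> (\<forall>v\<in>carrier E. \<forall>w\<in>carrier E. ip E (T v) w = ip E v (S w))"
    using S adj by blast
  fix R assume R: "R \<in> carrier E \<rightarrow>\<^sub>E carrier E \<and> (\<forall>v\<in>carrier E. \<forall>w\<in>carrier E. ip E (T v) w = ip E v (R w))"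
  show "R = S"
  proof (rule PiE_ext)
    show "R \<in> carrier E \<rightarrow>\<^sub>E carrier E" "S \<in> carrier E \<rightarrow>\<^sub>E carrier E"
      using R S by blast+
    fix w assume w: "w \<in> carrier E"
    show "R w = S w"
    proof (rule nondeg)
      fix v assume v: "v \<in> carrier E"
      show "ip E v (R w) = ip E v (S w)"
        using R adj[OF v w] v w by simp
    qed (use R S w in auto)
  qed
qed

section \<open>Geometry of the inner product\<close>

context hilbert_space
begin

sublocale complex_module H by unfold_locales

lemma ip_add_left: "\<lbrakk>x \<in> carrier H; y \<in> carrier H; z \<in> carrier H\<rbrakk> \<Longrightarrow> ip H (y \<oplus> z) x = ip H y x + ip H z x"
  using ip_cnj[of x "y \<oplus> z"] ip_cnj[of x y] ip_cnj[of x z] by (simp add: ip_add)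

lemma ip_smult_left: "\<lbrakk>x \<in> carrier H; y \<in> carrier H\<rbrakk> \<Longrightarrow> ip H (c \<odot> y) x = cnj c * ip H y x"
  using ip_cnj[of x "c \<odot> y"] ip_cnj[of x y] by (simp add: ip_smult)

lemma ip_zero [simp]: "x \<in> carrier H \<Longrightarrow> ip H x \<zero> = 0" "x \<in> carrier H \<Longrightarrow> ip H \<zero> x = 0"
  using ip_smult[of x \<zero> 0] ip_smult_left[of x \<zero> 0] by simp_all

lemma ip_minus: "\<lbrakk>x \<in> carrier H; y \<in> carrier H; z \<in> carrier H\<rbrakk> \<Longrightarrow> ip H x (y \<ominus> z) = ip H x y - ip H x z"
  by (simp add: v_minus ip_add ip_smult)

lemma ip_minus_left: "\<lbrakk>x \<in> carrier H; y \<in> carrier H; z \<in> carrier H\<rbrakk> \<Longrightarrow> ip H (y \<ominus> z) x = ip H y x - ip H z x"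
  by (simp add: v_minus ip_add_left ip_smult_left)

lemma hnorm_sq: "x \<in> carrier H \<Longrightarrow> (hnorm H x)\<^sup>2 = Re (ip H x x)"
  by (simp add: hnorm_def ip_pos)

lemma hnorm_nonneg: "x \<in> carrier H \<Longrightarrow> 0 \<le> hnorm H x"
  by (simp add: hnorm_def ip_pos)

lemma ip_self: "x \<in> carrier H \<Longrightarrow> ip H x x = complex_of_real ((hnorm H x)\<^sup>2)"
  using ip_cnj[of x x] hnorm_sq[of x] by (simp add: complex_eq_iff)

lemma cauchy_schwarz:
  assumes x: "x \<in> carrier H" and y: "y \<in> carrier H"
  shows "cmod (ip H x y) \<le> hnorm H x * hnorm H y"
proof (cases "ip H y y = 0")
  case True
  then have "y = \<zero>"
    using ip_definite y by blast
  then show ?thesis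
    using x hnorm_nonneg[OF x] by (simp add: hnorm_def)
next
  case False
  define B where "B = (hnorm H y)\<^sup>2"
  define a where "a = ip H y x"
  have yy: "ip H y y = complex_of_real B"
    using ip_self[OF y] by (simp add: B_def)
  have B: "B > 0"
    using False yy by (simp add: B_def)
  \<comment> \<open>With this coefficient x + k y is the component of x orthogonal to y, and its
    square norm is nonnegative.\<close>
  define k where "k = - (a / B)"
  have e1: "ip H (x \<oplus> k \<odot> y) (x \<oplus> k \<odot> y) = ip H x x + k * cnj a + (cnj k * a + cnj k * k * B)"
    using x y by (simp add: ip_add ip_add_left ip_smult ip_smult_left yy a_def ip_cnj[of y x] algebra_simps)
  have e2: "k * cnj a + (cnj k * a + cnj k * k * B) = - (complex_of_real ((cmod a)\<^sup>2) / B)"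
    using B unfolding complex_norm_square by (simp add: k_def field_simps power2_eq_square)
  have "Re (ip H (x \<oplus> k \<odot> y) (x \<oplus> k \<odot> y)) = (hnorm H x)\<^sup>2 - (cmod a)\<^sup>2 / B"
    unfolding e1 add.assoc[of "ip H x x"] e2 by (simp add: ip_self[OF x])
  then have "(cmod a)\<^sup>2 \<le> (hnorm H x)\<^sup>2 * B"
    using mult_nonneg_nonneg[OF less_imp_le[OF B] ip_pos[of "x \<oplus> k \<odot> y"]] x y B by (simp add: field_simps)
  then have "(cmod a)\<^sup>2 \<le> (hnorm H x * hnorm H y)\<^sup>2"
    by (simp add: B_def power_mult_distrib)
  then have "cmod a \<le> hnorm H x * hnorm H y"
    by (rule power2_le_imp_le) (simp add: hnorm_nonneg x y)
  then show ?thesis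
    using ip_cnj[OF y x] by (simp add: a_def)
qed

lemma hnorm_add_sq:
  "x \<in> carrier H \<Longrightarrow> y \<in> carrier H \<Longrightarrow> (hnorm H (x \<oplus> y))\<^sup>2 = (hnorm H x)\<^sup>2 + (hnorm H y)\<^sup>2 + 2 * Re (ip H x y)"
  using ip_cnj[of x y] by (simp add: hnorm_sq ip_add ip_add_left)

lemma hnorm_minus_sq:
  "x \<in> carrier H \<Longrightarrow> y \<in> carrier H \<Longrightarrow> (hnorm H (x \<ominus> y))\<^sup>2 = (hnorm H x)\<^sup>2 + (hnorm H y)\<^sup>2 - 2 * Re (ip H x y)"
  using ip_cnj[of x y] by (simp add: hnorm_sq ip_minus ip_minus_left)

lemma hnorm_smult: "x \<in> carrier H \<Longrightarrow> hnorm H (c \<odot> x) = cmod c * hnorm H x"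
proof -
  assume x: "x \<in> carrier H"
  have "ip H (c \<odot> x) (c \<odot> x) = complex_of_real ((cmod c * hnorm H x)\<^sup>2)"
    using x ip_self[OF x] complex_norm_square[of c] by (simp add: ip_smult ip_smult_left power_mult_distrib mult_ac)
  then have "(hnorm H (c \<odot> x))\<^sup>2 = (cmod c * hnorm H x)\<^sup>2"
    using x by (simp add: hnorm_sq)
  then show ?thesis
    by (rule power2_eq_imp_eq) (simp_all add: x hnorm_nonneg)
qed

sublocale N: normed_module H "hnorm H"
proof
  fix x assume x: "x \<in> carrier H"
  show "0 \<le> hnorm H x"
    by (rule hnorm_nonneg[OF x])
  show "hnorm H x = 0 \<longleftrightarrow> x = \<zero>"
    using ip_self[OF x] ip_definite[OF x] by (auto simp: hnorm_def)
  show "hnorm H (c \<odot> x) = cmod c * hnorm H x" for c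
    by (rule hnorm_smult[OF x])
  fix y assume y: "y \<in> carrier H"
  have "Re (ip H x y) \<le> hnorm H x * hnorm H y"
    using cauchy_schwarz[OF x y] complex_Re_le_cmod order_trans by blast
  then have "(hnorm H (x \<oplus> y))\<^sup>2 \<le> (hnorm H x + hnorm H y)\<^sup>2"
    by (simp add: hnorm_add_sq x y power2_sum)
  then show "hnorm H (x \<oplus> y) \<le> hnorm H x + hnorm H y"
    by (rule power2_le_imp_le) (simp add: hnorm_nonneg x y)
qed

lemma ip_eqI:
  assumes "x \<in> carrier H" "y \<in> carrier H" "\<And>v. v \<in> carrier H \<Longrightarrow> ip H v x = ip H v y"
  shows "x = y"
proof -
  have "ip H (x \<ominus> y) (x \<ominus> y) = 0"
    using assms assms(3)[of "x \<ominus> y"] ip_minus[of "x \<ominus> y" x y] by simp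
  then show ?thesis
    using ip_definite[of "x \<ominus> y"] assms v_minus_eq0 by blast
qed

end

section \<open>Riesz representation, adjoints and the C*-algebra of bounded operators\<close>

context hilbert_space
begin

text \<open>The representing vector minimises \<open>\<parallel>x\<parallel>\<^sup>2 - 2 Re (f x)\<close>; the parallelogram law makes every minimising
  sequence Cauchy.\<close>

theorem riesz:
  assumes f_add: "\<And>x y. x \<in> carrier H \<Longrightarrow> y \<in> carrier H \<Longrightarrow> f (x \<oplus> y) = f x + f y"
    and f_smult: "\<And>c x. x \<in> carrier H \<Longrightarrow> f (c \<odot> x) = c * f x"
    and bd: "\<And>x. x \<in> carrier H \<Longrightarrow> cmod (f x) \<le> C * hnorm H x"
  shows "\<exists>u\<in>carrier H. \<forall>x\<in>carrier H. f x = ip H u x"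
proof -
  have f_minus: "f (x \<ominus> y) = f x - f y" if "x \<in> carrier H" "y \<in> carrier H" for x y
    using that by (simp add: v_minus f_add f_smult)
  define J where "J x = (hnorm H x)\<^sup>2 - 2 * Re (f x)" for x
  have J_low: "- C\<^sup>2 \<le> J x" if x: "x \<in> carrier H" for x
  proof -
    have "Re (f x) \<le> C * hnorm H x"
      using bd[OF x] complex_Re_le_cmod[of "f x"] by linarith
    then show ?thesis
      using zero_le_power2[of "hnorm H x - C"] by (simp add: J_def power2_diff algebra_simps)
  qed
  define m where "m = Inf (J ` carrier H)"
  have bdd: "bdd_below (J ` carrier H)"
    by (rule bdd_belowI[of _ "- C\<^sup>2"]) (use J_low in auto)
  have m_le: "m \<le> J x" if "x \<in> carrier H" for x
    unfolding m_def by (rule cInf_lower[OF _ bdd]) (use that in auto)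
  have "\<exists>x\<in>carrier H. J x < m + 1 / real (Suc k)" for k
    using cInf_less_iff[of "J ` carrier H" "m + 1 / real (Suc k)"] bdd by (auto simp: m_def[symmetric])
  then obtain s where s: "\<And>k. s k \<in> carrier H" "\<And>k. J (s k) < m + 1 / real (Suc k)"
    by metis
  \<comment> \<open>The parallelogram law, with the value of \<open>J\<close> at the midpoint (x +
    y) / 2 estimated below by \<open>m\<close>.\<close>
  have par: "(hnorm H (x \<ominus> y))\<^sup>2 \<le> 2 * J x + 2 * J y - 4 * m" if x: "x \<in> carrier H" and y: "y \<in> carrier H" for x y
  proof -
    have "4 * J ((1/2) \<odot> (x \<oplus> y)) = (hnorm H (x \<oplus> y))\<^sup>2 - 4 * Re (f x) - 4 * Re (f y)"
      using x y by (simp add: J_def hnorm_smult f_smult f_add power_mult_distrib power_divide add_divide_distrib)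
    then show ?thesis
      using m_le[of "(1/2) \<odot> (x \<oplus> y)"] x y hnorm_add_sq[OF x y] hnorm_minus_sq[OF x y] by (simp add: J_def)
  qed
  have "N.cauchy_seq s"
    unfolding N.cauchy_seq_def
  proof (intro conjI allI impI s(1))
    fix e :: real assume e: "e > 0"
    obtain n where n: "4 / e\<^sup>2 < real (Suc n)"
      using reals_Archimedean2 less_trans[of _ "real _" "real (Suc _)"] by (metis lessI of_nat_less_iff)
    have "hnorm H (s i \<ominus> s j) < e" if "i \<ge> n" "j \<ge> n" for i j
    proof -
      have sm: "1 / real (Suc i) \<le> 1 / real (Suc n)" "1 / real (Suc j) \<le> 1 / real (Suc n)"
        using that by (auto intro!: divide_left_mono)
      have "4 * (1 / real (Suc n)) < e\<^sup>2"
        using n e by (simp add: field_simps)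
      then have "(hnorm H (s i \<ominus> s j))\<^sup>2 < e\<^sup>2"
        using par[OF s(1) s(1), of i j] s(2)[of i] s(2)[of j] sm by linarith
      then show ?thesis
        by (rule power2_less_imp_less) (use e in simp)
    qed
    then show "\<exists>N. \<forall>i\<ge>N. \<forall>j\<ge>N. hnorm H (s i \<ominus> s j) < e"
      by blast
  qed
  then obtain u where u: "N.tends s u"
    using complete N.norm_complete_iff by auto
  then have uc: "u \<in> carrier H"
    by (simp add: N.tends_def)
  have "(\<lambda>k. f (s k) - f u) \<longlonglongrightarrow> 0"
  proof (rule Lim_null_comparison[of _ "\<lambda>k. C * hnorm H (s k \<ominus> u)"])
    show "\<forall>\<^sub>F k in sequentially. norm (f (s k) - f u) \<le> C * hnorm H (s k \<ominus> u)"
      using bd[of "s _ \<ominus> u"] s(1) uc by (simp add: f_minus)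
    show "(\<lambda>k. C * hnorm H (s k \<ominus> u)) \<longlonglongrightarrow> 0"
      using u by (auto simp: N.tends_def intro: tendsto_mult_right_zero)
  qed
  then have "(\<lambda>k. f (s k)) \<longlonglongrightarrow> f u"
    by (simp add: LIM_zero_iff)
  then have "(\<lambda>k. J (s k)) \<longlonglongrightarrow> J u"
    unfolding J_def by (intro tendsto_intros N.tends_norm u)
  moreover have "(\<lambda>k. m + 1 / real (Suc k)) \<longlonglongrightarrow> m + 0"
    using LIMSEQ_inverse_real_of_nat by (intro tendsto_intros) (simp add: inverse_eq_divide)
  ultimately have Ju: "J u \<le> m + 0"
    by (rule LIMSEQ_le) (use s(2) less_imp_le in blast)
  have re: "Re (ip H u x) = Re (f x)" if x: "x \<in> carrier H" for x
  proof -
    define r where "r = Re (ip H u x) - Re (f x)"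
    \<comment> \<open>Moving from u by t x changes \<open>J\<close> by -t^2 (||x||^2 + 2) for this
      t, so minimality of u forces t = 0 and hence r = 0. The summand 1 keeps the divisor
      positive.\<close>
    define t where "t = - r / ((hnorm H x)\<^sup>2 + 1)"
    have p: "(hnorm H x)\<^sup>2 + 1 > 0"
      by (simp add: add_nonneg_pos)
    have "J (u \<oplus> complex_of_real t \<odot> x) = J u + 2 * t * r + t\<^sup>2 * (hnorm H x)\<^sup>2"
      using x uc by (simp add: J_def hnorm_add_sq f_add f_smult hnorm_smult ip_smult power_mult_distrib r_def algebra_simps)
    then have "0 \<le> 2 * t * r + t\<^sup>2 * (hnorm H x)\<^sup>2"
      using m_le[of "u \<oplus> complex_of_real t \<odot> x"] x uc Ju by simp
    moreover have "r = - t * ((hnorm H x)\<^sup>2 + 1)"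
      using p by (simp add: t_def)
    ultimately have "t\<^sup>2 * ((hnorm H x)\<^sup>2 + 2) \<le> 0"
      by (simp add: power2_eq_square algebra_simps)
    moreover have "t\<^sup>2 * ((hnorm H x)\<^sup>2 + 2) \<ge> t\<^sup>2"
      using mult_left_mono[of 1 "(hnorm H x)\<^sup>2 + 2" "t\<^sup>2"] by simp
    ultimately have "t\<^sup>2 \<le> 0"
      by linarith
    then have "t = 0"
      by simp
    then show ?thesis
      using p by (simp add: t_def r_def)
  qed
  \<comment> \<open>The imaginary part at x is read off from the real part at \<i> x.\<close>
  have "f x = ip H u x" if x: "x \<in> carrier H" for x
    using re[OF x] re[of "\<i> \<odot> x"] x uc by (simp add: complex_eq_iff ip_smult f_smult)
  then show ?thesis
    using uc by blast
qed

definition BOps :: "('h \<Rightarrow> 'h) set" where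
  "BOps = {T \<in> carrier H \<rightarrow>\<^sub>E carrier H. linear_map H H T \<and> (\<exists>c. \<forall>x\<in>carrier H. hnorm H (T x) \<le> c * hnorm H x)}"

lemma bounded_operators_eq: "bounded_operators H = operator_algebra H (hnorm H) BOps"
  by (simp add: bounded_operators_def BOps_def)

lemma BOpsI:
  assumes "\<And>x. x \<in> carrier H \<Longrightarrow> T x \<in> carrier H"
    and "\<And>x y. x \<in> carrier H \<Longrightarrow> y \<in> carrier H \<Longrightarrow> T (x \<oplus> y) = T x \<oplus> T y"
    and "\<And>c x. x \<in> carrier H \<Longrightarrow> T (c \<odot> x) = c \<odot> T x"
    and "\<And>x. x \<in> carrier H \<Longrightarrow> hnorm H (T x) \<le> C * hnorm H x"
  shows "(\<lambda>v\<in>carrier H. T v) \<in> BOps"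
  using assms unfolding BOps_def linear_map_def by (intro CollectI conjI) (auto intro: exI[of _ C])

lemma BOpsD:
  assumes "T \<in> BOps"
  shows "T \<in> carrier H \<rightarrow>\<^sub>E carrier H" "linear_map H H T" "x \<in> carrier H \<Longrightarrow> T x \<in> carrier H"
    "x \<in> carrier H \<Longrightarrow> y \<in> carrier H \<Longrightarrow> T (x \<oplus> y) = T x \<oplus> T y"
    "x \<in> carrier H \<Longrightarrow> T (c \<odot> x) = c \<odot> T x"
    "\<exists>c\<ge>0. \<forall>x\<in>carrier H. hnorm H (T x) \<le> c * hnorm H x"
proof -
  show "T \<in> carrier H \<rightarrow>\<^sub>E carrier H" "linear_map H H T"
    using assms by (simp_all add: BOps_def)
  then show "x \<in> carrier H \<Longrightarrow> T x \<in> carrier H"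
    "x \<in> carrier H \<Longrightarrow> y \<in> carrier H \<Longrightarrow> T (x \<oplus> y) = T x \<oplus> T y"
    "x \<in> carrier H \<Longrightarrow> T (c \<odot> x) = c \<odot> T x"
    by (auto simp: linear_map_def)
  obtain c where c: "\<And>x. x \<in> carrier H \<Longrightarrow> hnorm H (T x) \<le> c * hnorm H x"
    using assms by (auto simp: BOps_def)
  have "hnorm H (T x) \<le> \<bar>c\<bar> * hnorm H x" if "x \<in> carrier H" for x
    by (rule order_trans[OF c[OF that] mult_right_mono]) (simp_all add: that hnorm_nonneg)
  then show "\<exists>c\<ge>0. \<forall>x\<in>carrier H. hnorm H (T x) \<le> c * hnorm H x"
    by (intro exI[of _ "\<bar>c\<bar>"]) simp
qed

sublocale B: operator_space H "hnorm H" BOps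
proof
  show "T \<in> carrier H \<rightarrow>\<^sub>E carrier H" "linear_map H H T" if "T \<in> BOps" for T
    using BOpsD[OF that] by auto
  show "\<exists>c. \<forall>x\<in>carrier H. hnorm H (T x) \<le> c * hnorm H x" if "T \<in> BOps" for T
    using BOpsD(6)[OF that] by blast
  show "(\<lambda>v\<in>carrier H. \<zero>) \<in> BOps"
    by (rule BOpsI[of _ 0]) auto
  fix S T assume S: "S \<in> BOps" and T: "T \<in> BOps"
  obtain c d where c: "c \<ge> 0" "\<forall>x\<in>carrier H. hnorm H (S x) \<le> c * hnorm H x"
    and d: "d \<ge> 0" "\<forall>x\<in>carrier H. hnorm H (T x) \<le> d * hnorm H x"
    using BOpsD(6)[OF S] BOpsD(6)[OF T] by blast
  note S' = BOpsD(3-5)[OF S] and T' = BOpsD(3-5)[OF T]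
  show "(\<lambda>v\<in>carrier H. S v \<oplus> T v) \<in> BOps"
  proof (rule BOpsI[of _ "c + d"])
    fix x assume x: "x \<in> carrier H"
    show "hnorm H (S x \<oplus> T x) \<le> (c + d) * hnorm H x"
      using N.n_triangle[of "S x" "T x"] c(2) d(2) x by (simp add: S' T' distrib_right) (meson add_mono order_trans)
  qed (simp_all add: S' T' v_smult_add v_assoc v_lcomm)
  show "(\<lambda>v\<in>carrier H. S (T v)) \<in> BOps"
  proof (rule BOpsI[of _ "c * d"])
    fix x assume x: "x \<in> carrier H"
    have "hnorm H (S (T x)) \<le> c * hnorm H (T x)"
      using c(2) T'(1)[OF x] by blast
    also have "\<dots> \<le> c * (d * hnorm H x)"
      using c(1) d(2) x by (intro mult_left_mono) auto
    finally show "hnorm H (S (T x)) \<le> c * d * hnorm H x"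
      by (simp add: mult.assoc)
  qed (simp_all add: S' T')
next
  fix T c assume T: "T \<in> BOps"
  obtain d where d: "d \<ge> 0" "\<forall>x\<in>carrier H. hnorm H (T x) \<le> d * hnorm H x"
    using BOpsD(6)[OF T] by blast
  note T' = BOpsD(3-5)[OF T]
  show "(\<lambda>v\<in>carrier H. c \<odot> T v) \<in> BOps"
  proof (rule BOpsI[of _ "cmod c * d"])
    fix x assume x: "x \<in> carrier H"
    show "hnorm H (c \<odot> T x) \<le> cmod c * d * hnorm H x"
      using d(2) x by (simp add: T' hnorm_smult mult.assoc mult_left_mono)
  qed (simp_all add: T' v_smult_add mult.commute)
qed

text \<open>For fixed w the functional v \<mapsto> <w, T v> is bounded and has a representing vector
  S w. Linearity of S follows from nondegeneracy, and its bound from ||S w||^2 = Re <T (S w), w> by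
  Cauchy-Schwarz.\<close>

lemma adjoint_exists:
  assumes T: "T \<in> BOps"
  shows "\<exists>S\<in>BOps. \<forall>v\<in>carrier H. \<forall>w\<in>carrier H. ip H (T v) w = ip H v (S w)"
proof -
  note T' = BOpsD(3-5)[OF T]
  obtain d where d: "d \<ge> 0" "\<And>x. x \<in> carrier H \<Longrightarrow> hnorm H (T x) \<le> d * hnorm H x"
    using BOpsD(6)[OF T] by blast
  have "\<exists>u\<in>carrier H. \<forall>v\<in>carrier H. ip H w (T v) = ip H u v" if w: "w \<in> carrier H" for w
  proof (rule riesz[of "\<lambda>v. ip H w (T v)" "hnorm H w * d"])
    fix v assume v: "v \<in> carrier H"
    have "cmod (ip H w (T v)) \<le> hnorm H w * hnorm H (T v)"
      by (rule cauchy_schwarz[OF w T'(1)[OF v]])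
    also have "\<dots> \<le> hnorm H w * (d * hnorm H v)"
      by (rule mult_left_mono[OF d(2)[OF v] hnorm_nonneg[OF w]])
    finally show "cmod (ip H w (T v)) \<le> hnorm H w * d * hnorm H v"
      by (simp add: mult.assoc)
  qed (use w in \<open>simp_all add: T' ip_add ip_smult\<close>)
  then obtain S where S: "\<And>w. w \<in> carrier H \<Longrightarrow> S w \<in> carrier H"
    "\<And>v w. w \<in> carrier H \<Longrightarrow> v \<in> carrier H \<Longrightarrow> ip H w (T v) = ip H (S w) v"
    by metis
  have adj: "ip H (T v) w = ip H v (S w)" if "v \<in> carrier H" "w \<in> carrier H" for v w
    using S(2)[OF that(2,1)] ip_cnj[OF that(2) T'(1)[OF that(1)]] ip_cnj[OF S(1)[OF that(2)] that(1)] by simp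
  have "(\<lambda>v\<in>carrier H. S v) \<in> BOps"
  proof (rule BOpsI[of _ d])
    fix x y c assume x: "x \<in> carrier H"
    show "S x \<in> carrier H"
      by (rule S(1)[OF x])
    show "S (c \<odot> x) = c \<odot> S x"
      by (rule ip_eqI) (use x in \<open>simp_all add: S(1) adj[symmetric] ip_smult T'\<close>)
    show "S (x \<oplus> y) = S x \<oplus> S y" if y: "y \<in> carrier H"
      by (rule ip_eqI) (use x y in \<open>simp_all add: S(1) adj[symmetric] ip_add T'\<close>)
    have "(hnorm H (S x))\<^sup>2 = Re (ip H (T (S x)) x)"
      using adj[OF S(1)[OF x] x] hnorm_sq[OF S(1)[OF x]] by simp
    also have "\<dots> \<le> hnorm H (T (S x)) * hnorm H x"
      using cauchy_schwarz[OF T'(1)[OF S(1)[OF x]] x] complex_Re_le_cmod order_trans by blast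
    also have "\<dots> \<le> (d * hnorm H (S x)) * hnorm H x"
      by (rule mult_right_mono[OF d(2)[OF S(1)[OF x]] hnorm_nonneg[OF x]])
    finally have "hnorm H (S x) * hnorm H (S x) \<le> hnorm H (S x) * (d * hnorm H x)"
      by (simp add: power2_eq_square mult_ac)
    then show "hnorm H (S x) \<le> d * hnorm H x"
      using hnorm_nonneg[OF S(1)[OF x]] d(1) hnorm_nonneg[OF x] by (cases "hnorm H (S x) = 0") auto
  qed
  then show ?thesis
    using adj by (intro bexI[of _ "\<lambda>v\<in>carrier H. S v"]) simp_all
qed

lemma adjoint_BOps:
  assumes T: "T \<in> BOps"
  shows "adjoint_op H T \<in> BOps"
    "v \<in> carrier H \<Longrightarrow> w \<in> carrier H \<Longrightarrow> ip H (T v) w = ip H v (adjoint_op H T w)"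
proof -
  obtain S where S: "S \<in> BOps" "\<And>v w. v \<in> carrier H \<Longrightarrow> w \<in> carrier H \<Longrightarrow> ip H (T v) w = ip H v (S w)"
    using adjoint_exists[OF T] by blast
  have "adjoint_op H T = S"
    by (rule adjoint_op_eq[OF BOpsD(1)[OF S(1)] S(2) ip_eqI])
  then show "adjoint_op H T \<in> BOps"
    "v \<in> carrier H \<Longrightarrow> w \<in> carrier H \<Longrightarrow> ip H (T v) w = ip H v (adjoint_op H T w)"
    using S by auto
qed

lemma adjoint_eqI:
  assumes "S \<in> BOps" "\<And>v w. v \<in> carrier H \<Longrightarrow> w \<in> carrier H \<Longrightarrow> ip H (T v) w = ip H v (S w)"
  shows "adjoint_op H T = S"
  by (rule adjoint_op_eq[OF BOpsD(1)[OF assms(1)] assms(2) ip_eqI])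

lemma adjoint_swap:
  assumes T: "T \<in> BOps" and "v \<in> carrier H" "w \<in> carrier H"
  shows "ip H (adjoint_op H T v) w = ip H v (T w)"
  using adjoint_BOps(2)[OF T assms(3,2)] ip_cnj[of w "adjoint_op H T v"] ip_cnj[of "T w" v]
    BOpsD(3)[OF T] BOpsD(3)[OF adjoint_BOps(1)[OF T]] assms by simp

text \<open>From ||T x||^2 = <x, T* T x> \<le> ||x|| ||T* T x||; the square root of the norm of T* T
  is therefore an admissible constant for T.\<close>

lemma opn_adjoint_mult_ge: "T \<in> BOps \<Longrightarrow> (B.opn T)\<^sup>2 \<le> B.opn (\<lambda>v\<in>carrier H. adjoint_op H T (T v))"
proof -
  assume T: "T \<in> BOps"
  let ?S = "\<lambda>v\<in>carrier H. adjoint_op H T (T v)"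
  have S: "?S \<in> BOps"
    by (rule B.O_mult[OF adjoint_BOps(1)[OF T] T])
  have "B.opn T \<le> sqrt (B.opn ?S)"
  proof (rule B.opn_least)
    show "0 \<le> sqrt (B.opn ?S)"
      using B.opn_nonneg[OF S] by simp
    fix x assume x: "x \<in> carrier H"
    have Tx: "T x \<in> carrier H" "?S x \<in> carrier H"
      using BOpsD(3)[OF T x] BOpsD(3)[OF S x] by auto
    have "(hnorm H (T x))\<^sup>2 = Re (ip H x (?S x))"
      using adjoint_BOps(2)[OF T x Tx(1)] hnorm_sq[OF Tx(1)] x by simp
    also have "\<dots> \<le> hnorm H x * hnorm H (?S x)"
      using cauchy_schwarz[OF x Tx(2)] complex_Re_le_cmod order_trans by blast
    also have "\<dots> \<le> hnorm H x * (B.opn ?S * hnorm H x)"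
      by (rule mult_left_mono[OF B.opn_upper[OF S x] hnorm_nonneg[OF x]])
    also have "\<dots> = (sqrt (B.opn ?S) * hnorm H x)\<^sup>2"
      using B.opn_nonneg[OF S] by (simp add: power_mult_distrib) (simp add: power2_eq_square)
    finally show "hnorm H (T x) \<le> sqrt (B.opn ?S) * hnorm H x"
      by (rule power2_le_imp_le) (simp add: B.opn_nonneg[OF S] hnorm_nonneg[OF x])
  qed
  from power_mono[OF this B.opn_nonneg[OF T], of 2] show ?thesis
    using B.opn_nonneg[OF S] by simp
qed

lemma opn_adjoint_le: "T \<in> BOps \<Longrightarrow> B.opn (adjoint_op H T) \<le> B.opn T"
proof -
  assume T: "T \<in> BOps"
  note T' = adjoint_BOps(1)[OF T]
  show ?thesis
  proof (rule B.opn_least[OF B.opn_nonneg[OF T]])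
    fix x assume x: "x \<in> carrier H"
    let ?y = "adjoint_op H T x"
    have y: "?y \<in> carrier H"
      by (rule BOpsD(3)[OF T' x])
    have "(hnorm H ?y)\<^sup>2 = Re (ip H (T ?y) x)"
      using adjoint_BOps(2)[OF T y x] hnorm_sq[OF y] by simp
    also have "\<dots> \<le> hnorm H (T ?y) * hnorm H x"
      using cauchy_schwarz[OF BOpsD(3)[OF T y] x] complex_Re_le_cmod order_trans by blast
    also have "\<dots> \<le> (B.opn T * hnorm H ?y) * hnorm H x"
      by (rule mult_right_mono[OF B.opn_upper[OF T y] hnorm_nonneg[OF x]])
    finally have "hnorm H ?y * hnorm H ?y \<le> hnorm H ?y * (B.opn T * hnorm H x)"
      by (simp add: power2_eq_square mult_ac)
    then show "hnorm H ?y \<le> B.opn T * hnorm H x"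
      using hnorm_nonneg[OF y] B.opn_nonneg[OF T] hnorm_nonneg[OF x] by (cases "hnorm H ?y = 0") auto
  qed
qed

lemma BOps_complete: "norm_complete B.OA B.opn"
  unfolding B.ON.norm_complete_iff
proof safe
  fix s assume s: "B.ON.cauchy_seq s"
  then have sB: "s k \<in> BOps" for k
    by (simp add: B.ON.cauchy_seq_def)
  have sc: "s k x \<in> carrier H" if "x \<in> carrier H" for k x
    by (rule BOpsD(3)[OF sB that])
  have minus: "s i \<ominus>\<^bsub>B.OA\<^esub> s j \<in> BOps" for i j
    using B.OM.v_minus_closed[of "s i" "s j"] sB by simp
  have le: "hnorm H (s i x \<ominus> s j x) \<le> B.opn (s i \<ominus>\<^bsub>B.OA\<^esub> s j) * hnorm H x" if "x \<in> carrier H" for i j x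
    using B.opn_upper[OF minus that, of i j] by (simp add: B.OA_minus_apply[OF sB sB that])
  have cau: "\<exists>N. \<forall>i\<ge>N. \<forall>j\<ge>N. B.opn (s i \<ominus>\<^bsub>B.OA\<^esub> s j) < e" if "e > 0" for e
    using s that by (auto simp: B.ON.cauchy_seq_def)
  have "\<exists>y. N.tends (\<lambda>k. s k x) y" if x: "x \<in> carrier H" for x
  proof -
    have "N.cauchy_seq (\<lambda>k. s k x)"
      unfolding N.cauchy_seq_def
    proof (intro conjI allI impI sc x)
      fix e :: real assume e: "e > 0"
      have p: "hnorm H x + 1 > 0"
        using hnorm_nonneg[OF x] by linarith
      then obtain N where N: "\<And>i j. i \<ge> N \<Longrightarrow> j \<ge> N \<Longrightarrow> B.opn (s i \<ominus>\<^bsub>B.OA\<^esub> s j) < e / (hnorm H x + 1)"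
        using cau[of "e / (hnorm H x + 1)"] e by auto
      have "hnorm H (s i x \<ominus> s j x) < e" if "i \<ge> N" "j \<ge> N" for i j
      proof -
        have "B.opn (s i \<ominus>\<^bsub>B.OA\<^esub> s j) * hnorm H x \<le> B.opn (s i \<ominus>\<^bsub>B.OA\<^esub> s j) * (hnorm H x + 1)"
          using B.opn_nonneg[OF minus] by (intro mult_left_mono) auto
        also have "\<dots> < e"
          using N[OF that] p by (simp add: field_simps)
        finally show ?thesis
          using le[OF x, of i j] by linarith
      qed
      then show "\<exists>N. \<forall>i\<ge>N. \<forall>j\<ge>N. hnorm H (s i x \<ominus> s j x) < e"
        by blast
    qed
    then show ?thesis
      using complete N.norm_complete_iff by auto
  qed
  then obtain T where T: "\<And>x. x \<in> carrier H \<Longrightarrow> N.tends (\<lambda>k. s k x) (T x)"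
    by metis
  have Tc: "T x \<in> carrier H" if "x \<in> carrier H" for x
    using T[OF that] by (simp add: N.tends_def)
  \<comment> \<open>Letting j tend to infinity in the Cauchy estimate keeps a bound of the form e
    ||x||, so the convergence is in operator norm and not merely pointwise.\<close>
  have lim: "hnorm H (s i x \<ominus> T x) \<le> e * hnorm H x"
    if i: "\<And>j. j \<ge> i \<Longrightarrow> B.opn (s i \<ominus>\<^bsub>B.OA\<^esub> s j) \<le> e" and x: "x \<in> carrier H" for i e x
  proof -
    have "(\<lambda>j. e * hnorm H x + hnorm H (s j x \<ominus> T x)) \<longlonglongrightarrow> e * hnorm H x + 0"
      using T[OF x] by (intro tendsto_intros) (simp add: N.tends_def)
    moreover have "\<exists>N. \<forall>j\<ge>N. hnorm H (s i x \<ominus> T x) \<le> e * hnorm H x + hnorm H (s j x \<ominus> T x)"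
    proof (intro exI[of _ i] allI impI)
      fix j assume j: "j \<ge> i"
      have "hnorm H (s i x \<ominus> s j x) \<le> e * hnorm H x"
        by (rule order_trans[OF le[OF x] mult_right_mono[OF i[OF j] hnorm_nonneg[OF x]]])
      then show "hnorm H (s i x \<ominus> T x) \<le> e * hnorm H x + hnorm H (s j x \<ominus> T x)"
        using N.n_minus_triangle[OF sc[OF x, of i] sc[OF x, of j] Tc[OF x]] by linarith
    qed
    ultimately have "hnorm H (s i x \<ominus> T x) \<le> e * hnorm H x + 0"
      by (rule LIMSEQ_le_const)
    then show ?thesis by simp
  qed
  have TB: "(\<lambda>v\<in>carrier H. T v) \<in> BOps"
  proof -
    obtain i where i: "\<And>j. j \<ge> i \<Longrightarrow> B.opn (s i \<ominus>\<^bsub>B.OA\<^esub> s j) \<le> 1"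
      using cau[of 1] by (auto intro: less_imp_le)
    show ?thesis
    proof (rule BOpsI[of _ "1 + B.opn (s i)"])
      fix x assume x: "x \<in> carrier H"
      show "hnorm H (T x) \<le> (1 + B.opn (s i)) * hnorm H x"
        using N.n_le_add_minus[OF Tc[OF x] sc[OF x, of i]] N.n_minus_commute[OF Tc[OF x] sc[OF x, of i]] lim[OF i x]
          B.opn_upper[OF sB x, of i] by (simp add: distrib_right)
      show "T (c \<odot> x) = c \<odot> T x" for c
        using N.tends_unique[OF T[of "c \<odot> x"] N.tends_smult[OF T[OF x], of c, folded BOpsD(5)[OF sB x]]] x by simp
      show "T (x \<oplus> y) = T x \<oplus> T y" if y: "y \<in> carrier H" for y
        using N.tends_unique[OF T[of "x \<oplus> y"] N.tends_add[OF T[OF x] T[OF y], folded BOpsD(4)[OF sB x y]]] x y by simp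
    qed (rule Tc)
  qed
  have "(\<lambda>k. B.opn (s k \<ominus>\<^bsub>B.OA\<^esub> (\<lambda>v\<in>carrier H. T v))) \<longlonglongrightarrow> 0"
  proof (rule LIMSEQ_I)
    fix r :: real assume r: "r > 0"
    obtain N where N: "\<And>i j. i \<ge> N \<Longrightarrow> j \<ge> N \<Longrightarrow> B.opn (s i \<ominus>\<^bsub>B.OA\<^esub> s j) < r / 2"
      using cau[of "r / 2"] r by auto
    have "norm (B.opn (s k \<ominus>\<^bsub>B.OA\<^esub> (\<lambda>v\<in>carrier H. T v)) - 0) < r" if k: "k \<ge> N" for k
    proof -
      have "B.opn (s k \<ominus>\<^bsub>B.OA\<^esub> (\<lambda>v\<in>carrier H. T v)) \<le> r / 2"
      proof (rule B.opn_least)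
        fix x assume x: "x \<in> carrier H"
        show "hnorm H ((s k \<ominus>\<^bsub>B.OA\<^esub> (\<lambda>v\<in>carrier H. T v)) x) \<le> r / 2 * hnorm H x"
          unfolding B.OA_minus_apply[OF sB TB x] using lim[of k "r / 2" x] N[OF k] k x by (simp add: less_imp_le)
      qed (use r in simp)
      moreover have "0 \<le> B.opn (s k \<ominus>\<^bsub>B.OA\<^esub> (\<lambda>v\<in>carrier H. T v))"
        using B.opn_nonneg B.OM.v_minus_closed[of "s k" "\<lambda>v\<in>carrier H. T v"] sB TB by simp
      ultimately show ?thesis
        using r by simp
    qed
    then show "\<exists>N. \<forall>k\<ge>N. norm (B.opn (s k \<ominus>\<^bsub>B.OA\<^esub> (\<lambda>v\<in>carrier H. T v)) - 0) < r"
      by blast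
  qed
  then have "B.ON.tends s (\<lambda>v\<in>carrier H. T v)"
    using sB TB by (simp add: B.ON.tends_def)
  then show "\<exists>x. B.ON.tends s x"
    by (rule exI[of _ "\<lambda>v\<in>carrier H. T v"])
qed

sublocale BA: cstar_algebra "bounded_operators H"
  unfolding bounded_operators_eq
proof
  fix S T R assume STR: "S \<in> carrier B.OA" "T \<in> carrier B.OA" "R \<in> carrier B.OA"
  then have B: "S \<in> BOps" "T \<in> BOps" "R \<in> BOps"
    by simp_all
  note c = BOpsD(3-5)[OF B(1)] BOpsD(3-5)[OF B(2)] BOpsD(3-5)[OF B(3)]
  show "(S \<otimes>\<^bsub>B.OA\<^esub> T) \<otimes>\<^bsub>B.OA\<^esub> R = S \<otimes>\<^bsub>B.OA\<^esub> (T \<otimes>\<^bsub>B.OA\<^esub> R)"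
    "(S \<oplus>\<^bsub>B.OA\<^esub> T) \<otimes>\<^bsub>B.OA\<^esub> R = (S \<otimes>\<^bsub>B.OA\<^esub> R) \<oplus>\<^bsub>B.OA\<^esub> (T \<otimes>\<^bsub>B.OA\<^esub> R)"
    "R \<otimes>\<^bsub>B.OA\<^esub> (S \<oplus>\<^bsub>B.OA\<^esub> T) = (R \<otimes>\<^bsub>B.OA\<^esub> S) \<oplus>\<^bsub>B.OA\<^esub> (R \<otimes>\<^bsub>B.OA\<^esub> T)"
    unfolding operator_algebra_sel by (rule restrict_ext, simp add: c)+
next
  fix S T assume STR: "S \<in> carrier B.OA" "T \<in> carrier B.OA"
  then have B: "S \<in> BOps" "T \<in> BOps"
    by simp_all
  note c = BOpsD(3-5)[OF B(1)] BOpsD(3-5)[OF B(2)]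
  note a = BOpsD(3)[OF adjoint_BOps(1)[OF B(1)]] BOpsD(3)[OF adjoint_BOps(1)[OF B(2)]]
  show ST: "S \<otimes>\<^bsub>B.OA\<^esub> T \<in> carrier B.OA"
    using B.O_mult[OF B] by simp
  show "(k \<odot>\<^bsub>B.OA\<^esub> S) \<otimes>\<^bsub>B.OA\<^esub> T = k \<odot>\<^bsub>B.OA\<^esub> (S \<otimes>\<^bsub>B.OA\<^esub> T)"
    "S \<otimes>\<^bsub>B.OA\<^esub> (k \<odot>\<^bsub>B.OA\<^esub> T) = k \<odot>\<^bsub>B.OA\<^esub> (S \<otimes>\<^bsub>B.OA\<^esub> T)" for k
    unfolding operator_algebra_sel by (rule restrict_ext, simp add: c)+
  show "nrm B.OA (S \<otimes>\<^bsub>B.OA\<^esub> T) \<le> nrm B.OA S * nrm B.OA T"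
    using B.opn_mult[OF B] by simp
  show "nrm B.OA (S \<oplus>\<^bsub>B.OA\<^esub> T) \<le> nrm B.OA S + nrm B.OA T"
    using B.opn_add[OF B] by simp
  have "star B.OA (S \<oplus>\<^bsub>B.OA\<^esub> T) = (\<lambda>v\<in>carrier H. adjoint_op H S v \<oplus> adjoint_op H T v)"
    unfolding operator_algebra_sel
  proof (rule adjoint_eqI)
    show "(\<lambda>v\<in>carrier H. adjoint_op H S v \<oplus> adjoint_op H T v) \<in> BOps"
      by (rule B.O_add[OF adjoint_BOps(1)[OF B(1)] adjoint_BOps(1)[OF B(2)]])
  qed (simp add: c a ip_add_left ip_add adjoint_BOps(2)[OF B(1)] adjoint_BOps(2)[OF B(2)])
  then show "star B.OA (S \<oplus>\<^bsub>B.OA\<^esub> T) = star B.OA S \<oplus>\<^bsub>B.OA\<^esub> star B.OA T"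
    by simp
  have "star B.OA (S \<otimes>\<^bsub>B.OA\<^esub> T) = (\<lambda>v\<in>carrier H. adjoint_op H T (adjoint_op H S v))"
    unfolding operator_algebra_sel
  proof (rule adjoint_eqI)
    show "(\<lambda>v\<in>carrier H. adjoint_op H T (adjoint_op H S v)) \<in> BOps"
      by (rule B.O_mult[OF adjoint_BOps(1)[OF B(2)] adjoint_BOps(1)[OF B(1)]])
  qed (simp add: c a adjoint_BOps(2)[OF B(1)] adjoint_BOps(2)[OF B(2)])
  then show "star B.OA (S \<otimes>\<^bsub>B.OA\<^esub> T) = star B.OA T \<otimes>\<^bsub>B.OA\<^esub> star B.OA S"
    by simp
next
  fix T assume "T \<in> carrier B.OA"
  then have T: "T \<in> BOps"
    by simp
  note c = BOpsD(3-5)[OF T] and a = BOpsD(3)[OF adjoint_BOps(1)[OF T]]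
  show "star B.OA T \<in> carrier B.OA"
    using adjoint_BOps(1)[OF T] by simp
  have ss: "adjoint_op H (adjoint_op H T) = T"
    by (rule adjoint_eqI[OF T adjoint_swap[OF T]])
  then show "star B.OA (star B.OA T) = T"
    by simp
  have "star B.OA (k \<odot>\<^bsub>B.OA\<^esub> T) = (\<lambda>v\<in>carrier H. cnj k \<odot> adjoint_op H T v)" for k
    unfolding operator_algebra_sel
  proof (rule adjoint_eqI)
    show "(\<lambda>v\<in>carrier H. cnj k \<odot> adjoint_op H T v) \<in> BOps"
      by (rule B.O_smult[OF adjoint_BOps(1)[OF T]])
  qed (simp add: c a ip_smult_left ip_smult adjoint_BOps(2)[OF T])
  then show "star B.OA (k \<odot>\<^bsub>B.OA\<^esub> T) = cnj k \<odot>\<^bsub>B.OA\<^esub> star B.OA T" for k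
    by simp
  show "0 \<le> nrm B.OA T"
    using B.opn_nonneg[OF T] by simp
  show "nrm B.OA T = 0 \<longleftrightarrow> T = \<zero>\<^bsub>B.OA\<^esub>"
    using B.ON.n_eq_0[of T] T by simp
  show "nrm B.OA (k \<odot>\<^bsub>B.OA\<^esub> T) = cmod k * nrm B.OA T" for k
    using B.ON.n_smult[of T k] T by simp
  have "B.opn (\<lambda>v\<in>carrier H. adjoint_op H T (T v)) \<le> B.opn (adjoint_op H T) * B.opn T"
    by (rule B.opn_mult[OF adjoint_BOps(1)[OF T] T])
  also have "\<dots> \<le> B.opn T * B.opn T"
    by (rule mult_right_mono[OF opn_adjoint_le[OF T] B.opn_nonneg[OF T]])
  finally show "nrm B.OA (star B.OA T \<otimes>\<^bsub>B.OA\<^esub> T) = (nrm B.OA T)\<^sup>2"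
    using opn_adjoint_mult_ge[OF T] by (simp add: power2_eq_square)
next
  show "norm_complete B.OA (nrm B.OA)"
    using BOps_complete by simp
qed

end

text \<open>The gliding hump: a sequence of small perturbations, each almost norming one of the seminorms,
  converges to a point at which the seminorms are unbounded.\<close>

theorem (in normed_module) uniform_boundedness:
  fixes q :: "'i \<Rightarrow> 'a \<Rightarrow> real"
  assumes complete: "norm_complete M n"
    and q_add: "\<And>k x y. x \<in> carrier M \<Longrightarrow> y \<in> carrier M \<Longrightarrow> q k (x \<oplus> y) \<le> q k x + q k y"
    and q_smult: "\<And>k c x. x \<in> carrier M \<Longrightarrow> q k (c \<odot> x) = cmod c * q k x"
    and q_bounded: "\<And>k. \<exists>C. \<forall>x\<in>carrier M. q k x \<le> C * n x"
    and pointwise: "\<And>x. x \<in> carrier M \<Longrightarrow> \<exists>B. \<forall>k. q k x \<le> B"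
  shows "\<exists>B. \<forall>k. \<forall>x\<in>carrier M. n x \<le> 1 \<longrightarrow> q k x \<le> B"
proof (rule ccontr)
  assume unb: "\<nexists>B. \<forall>k. \<forall>x\<in>carrier M. n x \<le> 1 \<longrightarrow> q k x \<le> B"
  define U where "U = {x \<in> carrier M. n x \<le> 1}"
  define Nq where "Nq k = Sup (q k ` U)" for k
  have zU: "\<zero> \<in> U"
    by (simp add: U_def)
  have q0: "q k \<zero> = 0" for k
    using q_smult[of \<zero> k 0] by simp
  have bdd: "bdd_above (q k ` U)" for k
  proof -
    obtain C where C: "\<forall>x\<in>carrier M. q k x \<le> C * n x"
      using q_bounded by blast
    have "q k x \<le> \<bar>C\<bar>" if "x \<in> U" for x
    proof -
      have "q k x \<le> C * n x"
        using C that by (simp add: U_def)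
      also have "\<dots> \<le> \<bar>C\<bar> * 1"
        using that by (intro mult_mono) (auto simp: U_def)
      finally show ?thesis by simp
    qed
    then show ?thesis
      by (rule bdd_aboveI2)
  qed
  have q_U: "q k x \<le> Nq k" if "x \<in> U" for k x
    unfolding Nq_def by (rule cSup_upper[OF _ bdd]) (use that in auto)
  have Nq_nonneg: "0 \<le> Nq k" for k
    using q_U[OF zU] q0 by simp
  have q_le: "q k x \<le> Nq k * n x" if x: "x \<in> carrier M" for k x
  proof (cases "n x = 0")
    case True
    then have "x = \<zero>"
      using n_eq_0[OF x] by blast
    then show ?thesis
      by (simp add: q0)
  next
    case False
    then have p: "n x > 0"
      using n_nonneg[OF x] by linarith
    have "complex_of_real (1 / n x) \<odot> x \<in> U"
      using x p by (simp add: U_def n_smult norm_divide)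
    from q_U[OF this, of k] show ?thesis
      using x p by (simp add: q_smult norm_divide field_simps)
  qed
  \<comment> \<open>The constants: the i-th hump has size at most (1/3)^i, the steps after it add up
    to at most half of (1/3)^i, and the hump attains 3/4 of its seminorm bound, so a quarter
    survives in the limit. Seminorms beyond 4^i then outgrow the decay of the humps.\<close>
  have "\<exists>k z. z \<in> U \<and> 4 ^ i < Nq k \<and> 3/4 * Nq k \<le> q k z" for i :: nat
  proof -
    have "\<exists>k x. x \<in> carrier M \<and> n x \<le> 1 \<and> \<not> q k x \<le> 4 ^ i"
      using unb by blast
    then obtain k x where kx: "x \<in> U" "q k x > 4 ^ i"
      unfolding U_def by (auto simp: not_le)
    then have N: "4 ^ i < Nq k"
      using q_U[OF kx(1), of k] by linarith
    then have "3/4 * Nq k < Nq k"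
      using zero_less_power[of "4::real" i] by linarith
    then obtain z where "z \<in> U" "3/4 * Nq k < q k z"
      using less_cSup_iff[of "q k ` U" "3/4 * Nq k"] bdd zU unfolding Nq_def by auto
    then show ?thesis
      using N by (intro exI[of _ k] exI[of _ z]) auto
  qed
  then obtain \<kappa> z where z: "\<And>i. z i \<in> U" "\<And>i::nat. 4 ^ i < Nq (\<kappa> i)" "\<And>i. 3/4 * Nq (\<kappa> i) \<le> q (\<kappa> i) (z i)"
    by metis
  have zc: "z i \<in> carrier M" "n (z i) \<le> 1" for i
    using z(1)[of i] by (auto simp: U_def)
  define hump where "hump i = complex_of_real ((1/3) ^ i) \<odot> z i" for i
  have hc: "hump i \<in> carrier M" for i
    by (simp add: hump_def zc)
  have hn: "n (hump i) \<le> (1/3) ^ i" for i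
    using zc(2)[of i] by (simp add: hump_def n_smult zc norm_power mult_left_le norm_divide)
  have hq: "q (\<kappa> i) (hump i) \<ge> (1/3) ^ i * (3/4 * Nq (\<kappa> i))" for i
    using mult_left_mono[OF z(3), of "(1/3) ^ i" i] by (simp add: hump_def q_smult zc norm_power norm_divide)
  \<comment> \<open>By subadditivity at least one of a \<plusminus> hump has seminorm no smaller
    than the hump itself, whatever a is; the sign is chosen accordingly.\<close>
  define step where "step i a = (if q (\<kappa> i) (a \<oplus> hump i) \<ge> q (\<kappa> i) (hump i) then a \<oplus> hump i else a \<ominus> hump i)" for i a
  have step_c: "step i a \<in> carrier M" if "a \<in> carrier M" for i a
    using that hc by (simp add: step_def)
  have step_q: "q (\<kappa> i) (step i a) \<ge> q (\<kappa> i) (hump i)" if a: "a \<in> carrier M" for i a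
  proof (cases "q (\<kappa> i) (a \<oplus> hump i) \<ge> q (\<kappa> i) (hump i)")
    case False
    have "2 \<odot> hump i = (a \<oplus> hump i) \<oplus> (-1) \<odot> (a \<ominus> hump i)"
      by (rule linear_combinations2[of a "hump i"]) (simp_all add: a hc v_minus)
    then have "2 * q (\<kappa> i) (hump i) \<le> q (\<kappa> i) (a \<oplus> hump i) + q (\<kappa> i) (a \<ominus> hump i)"
      using q_add[of "a \<oplus> hump i" "(-1) \<odot> (a \<ominus> hump i)" "\<kappa> i"] q_smult[OF hc, of "\<kappa> i" 2 i]
        q_smult[of "a \<ominus> hump i" "\<kappa> i" "-1"] a hc by simp
    then show ?thesis
      using False by (simp add: step_def)
  qed (simp add: step_def)
  define s where "s = rec_nat \<zero> (\<lambda>i a. step (Suc i) a)"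
  have s0: "s 0 = \<zero>" and s_Suc: "s (Suc i) = step (Suc i) (s i)" for i
    by (simp_all add: s_def)
  have sc: "s i \<in> carrier M" for i
    by (induction i) (simp_all add: s0 s_Suc step_c)
  have diff: "n (s (Suc i) \<ominus> s i) \<le> (1/3) * (1/3) ^ i" for i
  proof -
    have "s (Suc i) \<ominus> s i = hump (Suc i) \<or> s (Suc i) \<ominus> s i = (-1) \<odot> hump (Suc i)"
    proof (cases "q (\<kappa> (Suc i)) (s i \<oplus> hump (Suc i)) \<ge> q (\<kappa> (Suc i)) (hump (Suc i))")
      case True
      have "s (Suc i) \<ominus> s i = (s i \<oplus> hump (Suc i)) \<ominus> s i"
        using True by (simp add: s_Suc step_def)
      also have "\<dots> = hump (Suc i)"
        by (rule linear_combinations2[of "s i" "hump (Suc i)"]) (simp_all add: sc hc v_minus)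
      finally show ?thesis ..
    next
      case False
      have "s (Suc i) \<ominus> s i = (s i \<ominus> hump (Suc i)) \<ominus> s i"
        using False by (simp add: s_Suc step_def)
      also have "\<dots> = (-1) \<odot> hump (Suc i)"
        by (rule linear_combinations2[of "s i" "hump (Suc i)"]) (simp_all add: sc hc v_minus)
      finally show ?thesis ..
    qed
    then show ?thesis
      using hn[of "Suc i"] n_smult[OF hc, of "-1" "Suc i"] by auto
  qed
  note geo = cauchy_seq_geometric[of s "1/3" "1/3", OF sc _ _ diff, simplified]
  obtain x where x: "tends s x"
    using complete norm_complete_iff geo(1) by blast
  have xc: "x \<in> carrier M"
    using x by (simp add: tends_def)
  have close: "n (x \<ominus> s i) \<le> (1/2) * (1/3) ^ i" for i
  proof -
    have "n (x \<ominus> s i) \<le> n (s (m + i) \<ominus> x) + (1/2) * (1/3) ^ i" for m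
    proof -
      have "n (s (i + m) \<ominus> s i) \<le> (1/2) * (1/3) ^ i"
        using geo(2)[of i m] by (simp add: field_simps)
      then show ?thesis
        using n_minus_triangle[OF xc sc[of "i + m"] sc[of i]] n_minus_commute[OF xc sc[of "i + m"]]
        unfolding add.commute[of m i] by linarith
    qed
    moreover have "(\<lambda>m. n (s (m + i) \<ominus> x) + (1/2) * (1/3) ^ i) \<longlonglongrightarrow> 0 + (1/2) * (1/3) ^ i"
      using x LIMSEQ_ignore_initial_segment[of "\<lambda>m. n (s m \<ominus> x)" 0 i] by (intro tendsto_intros) (simp add: tends_def)
    ultimately have "n (x \<ominus> s i) \<le> 0 + (1/2) * (1/3) ^ i"
      by (intro LIMSEQ_le_const) auto
    then show ?thesis by simp
  qed
  obtain B where B: "\<And>k. q k x \<le> B"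
    using pointwise[OF xc] by blast
  \<comment> \<open>The seminorm at x is at least (3/4 - 1/2) (1/3)^i \<open>Nq\<close>, with i the
    successor index, and \<open>Nq\<close> exceeds 4^i.\<close>
  have low: "(1/4) * (4/3) ^ Suc i \<le> B" for i
  proof -
    let ?k = "\<kappa> (Suc i)" and ?e = "(1/3 :: real) ^ Suc i"
    have e: "?e > 0"
      by simp
    have "s (Suc i) = x \<oplus> (-1) \<odot> (x \<ominus> s (Suc i))"
      by (rule linear_combinations2[of "s (Suc i)" x]) (simp_all add: sc xc v_minus)
    then have "q ?k (s (Suc i)) \<le> q ?k x + q ?k (x \<ominus> s (Suc i))"
      using q_add[of x "(-1) \<odot> (x \<ominus> s (Suc i))" ?k] q_smult[of "x \<ominus> s (Suc i)" ?k "-1"] xc sc by simp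
    moreover have "q ?k (x \<ominus> s (Suc i)) \<le> Nq ?k * ((1/2) * ?e)"
      by (rule order_trans[OF q_le mult_left_mono[OF close Nq_nonneg]]) (simp add: xc sc)
    moreover have "?e * (3/4 * Nq ?k) \<le> q ?k (s (Suc i))"
      using hq[of "Suc i"] step_q[OF sc, of "Suc i" i] unfolding s_Suc by linarith
    ultimately have "?e * Nq ?k * (1/4) \<le> q ?k x"
      by (simp add: algebra_simps)
    moreover have "?e * 4 ^ Suc i \<le> ?e * Nq ?k"
      using z(2)[of "Suc i"] e by (intro mult_left_mono) auto
    moreover have "?e * 4 ^ Suc i = (4/3) ^ Suc i"
      by (simp only: power_mult_distrib[symmetric]) simp
    ultimately have "(4/3) ^ Suc i * (1/4) \<le> q ?k x"
      by linarith
    then show ?thesis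
      using B[of ?k] by linarith
  qed
  obtain i where "4 * B < (4/3) ^ i"
    using real_arch_pow[of "4/3" "4 * B"] by auto
  also have "(4/3 :: real) ^ i \<le> (4/3) ^ Suc i"
    by simp
  finally show False
    using low[of i] by linarith
qed

subsection \<open>Finite rank approximation and unitaries\<close>

text \<open>Lists of pairs in place of indexed sums: approximants are built and concatenated as
  lists, and structural induction replaces the manipulation of finite sums in a carrier-based
  module.\<close>

primrec finite_rank :: "(complex, 'h, 'm) ip_module_scheme \<Rightarrow> ('h \<times> 'h) list \<Rightarrow> 'h \<Rightarrow> 'h" where
  "finite_rank H [] x = \<zero>\<^bsub>H\<^esub>"
| "finite_rank H (p # ps) x = ip H (snd p) x \<odot>\<^bsub>H\<^esub> fst p \<oplus>\<^bsub>H\<^esub> finite_rank H ps x"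

context hilbert_space
begin

lemma finite_rank_closed:
  "set ps \<subseteq> carrier H \<times> carrier H \<Longrightarrow> finite_rank H ps x \<in> carrier H"
  by (induction ps) auto

lemma finite_rank_minus:
  "set ps \<subseteq> carrier H \<times> carrier H \<Longrightarrow> x \<in> carrier H \<Longrightarrow> y \<in> carrier H \<Longrightarrow>
   finite_rank H ps (x \<ominus> y) = finite_rank H ps x \<ominus> finite_rank H ps y"
proof (induction ps)
  case (Cons p ps)
  obtain v w where p: "p = (v, w)" "v \<in> carrier H" "w \<in> carrier H"
    using Cons.prems(1) by (cases p) auto
  have c: "finite_rank H ps x \<in> carrier H" "finite_rank H ps y \<in> carrier H"
    using finite_rank_closed Cons.prems(1) by auto
  have IH: "finite_rank H ps (x \<ominus> y) = finite_rank H ps x \<ominus> finite_rank H ps y"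
    using Cons by simp
  show ?case
    using p Cons.prems(2,3) IH
    by simp (rule linear_combinations3[of v "finite_rank H ps x" "finite_rank H ps y"];
      (simp add: c ip_add ip_smult v_minus)?)
qed simp

text \<open>Gram-Schmidt along the list \<open>ys\<close>: the normalised remainder of each vector
  is added unless it vanishes. Instead of orthonormality of \<open>es\<close> the induction carries
  the orthogonality of x - P x to the range of P, which is what a best approximation argument
  uses.\<close>

lemma finite_projection:
  assumes "set ys \<subseteq> carrier H"
  shows "\<exists>es. set es \<subseteq> carrier H \<and> (\<forall>y\<in>set ys. finite_rank H (map (\<lambda>e. (e, e)) es) y = y) \<and>
    (\<forall>x\<in>carrier H. \<forall>z\<in>carrier H.
       ip H (x \<ominus> finite_rank H (map (\<lambda>e. (e, e)) es) x) (finite_rank H (map (\<lambda>e. (e, e)) es) z) = 0)"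
  using assms
proof (induction ys)
  case Nil
  show ?case
    by (rule exI[of _ "[]"]) simp
next
  case (Cons y ys)
  then obtain es where es: "set es \<subseteq> carrier H" "\<And>y. y \<in> set ys \<Longrightarrow> finite_rank H (map (\<lambda>e. (e, e)) es) y = y"
    "\<And>x z. x \<in> carrier H \<Longrightarrow> z \<in> carrier H \<Longrightarrow>
       ip H (x \<ominus> finite_rank H (map (\<lambda>e. (e, e)) es) x) (finite_rank H (map (\<lambda>e. (e, e)) es) z) = 0"
    by auto
  define P where "P = finite_rank H (map (\<lambda>e. (e, e)) es)"
  have y: "y \<in> carrier H"
    using Cons.prems by simp
  have Pc: "P x \<in> carrier H" for x
    unfolding P_def by (rule finite_rank_closed) (use es(1) in auto)
  note es' = es(2,3)[folded P_def]
  define r where "r = y \<ominus> P y"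
  have rc: "r \<in> carrier H"
    using y Pc by (simp add: r_def)
  show ?case
  proof (cases "r = \<zero>")
    case True
    then have "P y = y"
      using y Pc v_minus_eq0[of y "P y"] by (simp add: r_def)
    then show ?thesis
      using es by (intro exI[of _ es]) (auto simp: P_def)
  next
    case False
    define e where "e = complex_of_real (1 / hnorm H r) \<odot> r"
    have rp: "hnorm H r > 0"
      using False N.n_eq_0[OF rc] hnorm_nonneg[OF rc] by linarith
    have ec: "e \<in> carrier H"
      using rc by (simp add: e_def)
    have eP: "ip H e (P z) = 0" if "z \<in> carrier H" for z
      using es'(2)[OF y that] rc Pc by (simp add: e_def r_def[symmetric] ip_smult_left)
    have Pe: "ip H (P z) e = 0" if "z \<in> carrier H" for z
      using eP[OF that] ip_cnj[OF ec Pc, of z] by simp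
    have ee: "ip H e e = 1"
      using rp rc ip_self[OF rc] by (simp add: e_def ip_smult ip_smult_left power2_eq_square)
    have er: "ip H e r \<odot> e = r"
      using rp rc ip_self[OF rc] by (simp add: e_def ip_smult_left power2_eq_square)
    have fr: "finite_rank H (map (\<lambda>e. (e, e)) (e # es)) x = ip H e x \<odot> e \<oplus> P x" for x
      by (simp add: P_def)
    have y_eq: "y = P y \<oplus> r"
      using v_add_minus[of y "P y"] y Pc by (simp add: r_def)
    have "ip H e y = ip H e r"
      using arg_cong[OF y_eq, of "ip H e"] ec Pc rc eP[OF y] by (simp add: ip_add)
    then have 1: "ip H e y \<odot> e \<oplus> P y = y"
      using er y_eq rc Pc[of y] v_comm[of "P y" r] by simp
    have 2: "ip H e z \<odot> e \<oplus> P z = z" if "z \<in> set ys" for z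
    proof -
      have "z \<in> carrier H"
        using that Cons.prems by auto
      then show ?thesis
        using eP[of z] es'(1)[OF that] ec by simp
    qed
    have 3: "ip H (x \<ominus> (ip H e x \<odot> e \<oplus> P x)) (ip H e z \<odot> e \<oplus> P z) = 0"
      if x: "x \<in> carrier H" and z: "z \<in> carrier H" for x z
    proof -
      have "ip H x (P z) = ip H (P x) (P z)"
        using es'(2)[OF x z] x Pc by (simp add: ip_minus_left)
      then show ?thesis
        using x z ec Pc ip_cnj[OF ec x]
        by (simp add: ip_minus_left ip_add_left ip_add ip_smult ip_smult_left eP Pe ee)
    qed
    show ?thesis
      using 1 2 3 ec es(1) by (intro exI[of _ "e # es"]) (simp add: fr del: map_eq_conv list.map finite_rank.simps)
  qed
qed

text \<open>The image of the unit ball is totally bounded. Projecting onto the span of a finite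
  e-net moves T x no further than its nearest net point, because a projection gives the best
  approximation; and P T has finite rank, with pairs (e, T* e), since <e, T x> = <T* e, x>.\<close>

theorem compact_finite_rank_approximation:
  assumes T: "T \<in> compact_operators H" and e: "e > 0"
  shows "\<exists>ps. set ps \<subseteq> carrier H \<times> carrier H \<and>
    (\<forall>x\<in>carrier H. hnorm H (T x \<ominus> finite_rank H ps x) \<le> e * hnorm H x)"
proof -
  have TB: "T \<in> BOps"
    using T by (simp add: compact_operators_def bounded_operators_eq)
  note T' = BOpsD(3-5)[OF TB]
  define S where "S = T ` {x \<in> carrier H. hnorm H x \<le> 1}"
  have "compactin N.D.mtopology (N.D.mtopology closure_of S)"
    using T by (simp add: compact_operators_def S_def norm_topology_def)
  then have "N.D.mtotally_bounded (N.D.mtopology closure_of S)"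
    by (rule N.D.compactin_imp_mtotally_bounded)
  then obtain Y where Y: "finite Y" "Y \<subseteq> N.D.mtopology closure_of S" "N.D.mtopology closure_of S \<subseteq> (\<Union>y\<in>Y. N.D.mball y e)"
    unfolding N.D.mtotally_bounded_def using e by meson
  have "S \<subseteq> carrier H"
    using T' by (auto simp: S_def)
  then have Scl: "S \<subseteq> N.D.mtopology closure_of S"
    by (simp add: closure_of_subset)
  have YH: "Y \<subseteq> carrier H"
    using Y(2) N.D.metric_closure_of by auto
  obtain ys where ys: "set ys = Y"
    using finite_list[OF Y(1)] by blast
  obtain es where es: "set es \<subseteq> carrier H" "\<And>y. y \<in> Y \<Longrightarrow> finite_rank H (map (\<lambda>e. (e, e)) es) y = y"
    "\<And>x z. x \<in> carrier H \<Longrightarrow> z \<in> carrier H \<Longrightarrow>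
       ip H (x \<ominus> finite_rank H (map (\<lambda>e. (e, e)) es) x) (finite_rank H (map (\<lambda>e. (e, e)) es) z) = 0"
    using finite_projection[of ys] YH ys by auto
  define P where "P = finite_rank H (map (\<lambda>e. (e, e)) es)"
  have ees: "set (map (\<lambda>e. (e, e)) es) \<subseteq> carrier H \<times> carrier H"
    using es(1) by auto
  have Pc: "P x \<in> carrier H" for x
    unfolding P_def by (rule finite_rank_closed[OF ees])
  note es' = es(2,3)[folded P_def]
  have near: "hnorm H (x \<ominus> P x) \<le> hnorm H (x \<ominus> y)" if x: "x \<in> carrier H" and y: "y \<in> Y" for x y
  proof -
    have yc: "y \<in> carrier H"
      using y YH by blast
    have Pm: "P (x \<ominus> y) = P x \<ominus> P y"
      unfolding P_def by (rule finite_rank_minus[OF ees x yc])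
    \<comment> \<open>As P fixes y, this splits x - y into orthogonal parts, and Pythagoras compares
      the first with the whole.\<close>
    have "x \<ominus> y = (x \<ominus> P x) \<oplus> P (x \<ominus> y)"
      unfolding Pm es'(1)[OF y] by (rule linear_combinations3[of x y "P x"]) (simp_all add: x yc Pc v_minus)
    then have "(hnorm H (x \<ominus> y))\<^sup>2 = (hnorm H (x \<ominus> P x))\<^sup>2 + (hnorm H (P (x \<ominus> y)))\<^sup>2"
      using hnorm_add_sq[of "x \<ominus> P x" "P (x \<ominus> y)"] es'(2)[of x "x \<ominus> y"] x yc Pc by simp
    then have "(hnorm H (x \<ominus> P x))\<^sup>2 \<le> (hnorm H (x \<ominus> y))\<^sup>2"
      by simp
    then show ?thesis
      by (rule power2_le_imp_le) (simp add: hnorm_nonneg x yc)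
  qed
  define ps where "ps = map (\<lambda>e. (e, adjoint_op H T e)) es"
  have ps: "set ps \<subseteq> carrier H \<times> carrier H"
    using es(1) BOpsD(3)[OF adjoint_BOps(1)[OF TB]] by (auto simp: ps_def)
  have fr: "finite_rank H ps x = P (T x)" if x: "x \<in> carrier H" for x
    unfolding ps_def P_def using es(1)
    by (induction es) (simp_all add: adjoint_swap[OF TB _ x])
  have unit: "hnorm H (T x \<ominus> P (T x)) \<le> e" if x: "x \<in> carrier H" "hnorm H x \<le> 1" for x
  proof -
    have "T x \<in> S"
      using x by (auto simp: S_def)
    then obtain y where y: "y \<in> Y" "T x \<in> N.D.mball y e"
      using Scl Y(3) by blast
    have yc: "y \<in> carrier H"
      using y YH by blast
    have "hnorm H (T x \<ominus> y) < e"
      using y(2) yc T'(1)[OF x(1)] N.n_minus_commute[of y "T x"] by (simp add: norm_dist_def)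
    then show ?thesis
      using near[OF T'(1)[OF x(1)] y(1)] by linarith
  qed
  have "hnorm H (T x \<ominus> finite_rank H ps x) \<le> e * hnorm H x" if x: "x \<in> carrier H" for x
  proof (cases "hnorm H x = 0")
    case True
    then have x0: "x = \<zero>"
      using N.n_eq_0[OF x] by blast
    have T0: "T \<zero> = \<zero>"
      using T'(3)[of \<zero> 0] T'(1)[of \<zero>] by simp
    have "P \<zero> = \<zero>"
      using finite_rank_minus[OF ees, of \<zero> \<zero>, folded P_def] Pc[of \<zero>] by simp
    then show ?thesis
      using fr[OF x] x0 T0 by (simp add: hnorm_def)
  next
    case False
    then have p: "hnorm H x > 0"
      using hnorm_nonneg[OF x] by linarith
    define u where "u = complex_of_real (1 / hnorm H x) \<odot> x"
    have u: "u \<in> carrier H" "hnorm H u \<le> 1"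
      using x p by (simp_all add: u_def hnorm_smult norm_divide)
    have xu: "x = complex_of_real (hnorm H x) \<odot> u"
      using x p by (simp add: u_def)
    have frs: "finite_rank H ps (c \<odot> u) = c \<odot> finite_rank H ps u" for c
      using ps
    proof (induction ps)
      case (Cons p ps)
      then have "fst p \<in> carrier H" "snd p \<in> carrier H" "finite_rank H ps u \<in> carrier H"
        using finite_rank_closed by auto
      then show ?case
        using Cons u(1) by (simp add: ip_smult v_smult_add)
    qed simp
    have fc: "finite_rank H ps u \<in> carrier H"
      by (rule finite_rank_closed[OF ps])
    have "T x \<ominus> finite_rank H ps x = complex_of_real (hnorm H x) \<odot> (T u \<ominus> finite_rank H ps u)"
      using T'(1,3)[OF u(1)] fc by (subst (1 2) xu) (simp add: frs v_smult_minus)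
    then have "hnorm H (T x \<ominus> finite_rank H ps x) = hnorm H x * hnorm H (T u \<ominus> P (T u))"
      using T'(1)[OF u(1)] Pc hnorm_nonneg[OF x] by (simp add: hnorm_smult fr[OF u(1)])
    also have "\<dots> \<le> hnorm H x * e"
      by (rule mult_left_mono[OF unit[OF u] hnorm_nonneg[OF x]])
    finally show ?thesis
      by (simp add: mult.commute)
  qed
  then show ?thesis
    using ps by blast
qed

end

section \<open>Conjugation by a unitary between two Hilbert spaces\<close>

locale unitary_pair = H: hilbert_space H + H': hilbert_space H'
  for H :: "(complex, 'h, 'm) ip_module_scheme" and H' :: "(complex, 'k, 'n) ip_module_scheme" +
  fixes U :: "'h \<Rightarrow> 'k"
  assumes unitary: "unitary_map H H' U"
begin

definition Ui :: "'k \<Rightarrow> 'h" where "Ui = inv_into (carrier H) U"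

lemma U_ip: "x \<in> carrier H \<Longrightarrow> y \<in> carrier H \<Longrightarrow> ip H' (U x) (U y) = ip H x y"
  using unitary by (simp add: unitary_map_def)

lemma U_closed [simp]: "x \<in> carrier H \<Longrightarrow> U x \<in> carrier H'"
  using unitary by (auto simp: unitary_map_def)

lemma U_add: "x \<in> carrier H \<Longrightarrow> y \<in> carrier H \<Longrightarrow> U (x \<oplus>\<^bsub>H\<^esub> y) = U x \<oplus>\<^bsub>H'\<^esub> U y"
  using unitary by (simp add: unitary_map_def linear_map_def)

lemma U_smult: "x \<in> carrier H \<Longrightarrow> U (c \<odot>\<^bsub>H\<^esub> x) = c \<odot>\<^bsub>H'\<^esub> U x"
  using unitary by (simp add: unitary_map_def linear_map_def)

lemma U_minus: "x \<in> carrier H \<Longrightarrow> y \<in> carrier H \<Longrightarrow> U (x \<ominus>\<^bsub>H\<^esub> y) = U x \<ominus>\<^bsub>H'\<^esub> U y"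
  by (simp add: H.v_minus H'.v_minus U_add U_smult)

lemma U_zero: "U \<zero>\<^bsub>H\<^esub> = \<zero>\<^bsub>H'\<^esub>"
  using U_smult[of "\<zero>\<^bsub>H\<^esub>" 0] by simp

lemma U_hnorm: "x \<in> carrier H \<Longrightarrow> hnorm H' (U x) = hnorm H x"
  by (simp add: hnorm_def U_ip)

lemma Ui_closed [simp]: "y \<in> carrier H' \<Longrightarrow> Ui y \<in> carrier H"
  using unitary unfolding Ui_def unitary_map_def by (metis inv_into_into)

lemma U_Ui [simp]: "y \<in> carrier H' \<Longrightarrow> U (Ui y) = y"
  using unitary unfolding Ui_def unitary_map_def by (metis f_inv_into_f)

lemma U_inj: "x \<in> carrier H \<Longrightarrow> y \<in> carrier H \<Longrightarrow> U x = U y \<Longrightarrow> x = y"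
proof -
  assume x: "x \<in> carrier H" "y \<in> carrier H" "U x = U y"
  then have "hnorm H (x \<ominus>\<^bsub>H\<^esub> y) = 0"
    using U_hnorm[of "x \<ominus>\<^bsub>H\<^esub> y"] by (simp add: U_minus)
  then show "x = y"
    using H.N.n_eq_0[of "x \<ominus>\<^bsub>H\<^esub> y"] H.v_minus_eq0[of x y] x by simp
qed

lemma Ui_U [simp]: "x \<in> carrier H \<Longrightarrow> Ui (U x) = x"
  by (rule U_inj) simp_all

lemma Ui_eq: "y \<in> carrier H' \<Longrightarrow> x \<in> carrier H \<Longrightarrow> U x = y \<Longrightarrow> Ui y = x"
  using Ui_U by blast

lemma Ui_add: "x \<in> carrier H' \<Longrightarrow> y \<in> carrier H' \<Longrightarrow> Ui (x \<oplus>\<^bsub>H'\<^esub> y) = Ui x \<oplus>\<^bsub>H\<^esub> Ui y"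
  by (rule Ui_eq) (simp_all add: U_add)

lemma Ui_smult: "x \<in> carrier H' \<Longrightarrow> Ui (c \<odot>\<^bsub>H'\<^esub> x) = c \<odot>\<^bsub>H\<^esub> Ui x"
  by (rule Ui_eq) (simp_all add: U_smult)

lemma Ui_hnorm: "y \<in> carrier H' \<Longrightarrow> hnorm H (Ui y) = hnorm H' y"
  using U_hnorm[of "Ui y"] by simp

lemma U_ip_left: "x \<in> carrier H \<Longrightarrow> y \<in> carrier H' \<Longrightarrow> ip H' (U x) y = ip H x (Ui y)"
  using U_ip[of x "Ui y"] by simp

lemma U_ip_right: "x \<in> carrier H \<Longrightarrow> y \<in> carrier H' \<Longrightarrow> ip H' y (U x) = ip H (Ui y) x"
  using U_ip[of "Ui y" x] by simp

abbreviation "adU' \<equiv> ad (carrier H) (carrier H') U"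

lemma ad_apply: "y \<in> carrier H' \<Longrightarrow> adU' T y = U (T (Ui y))"
  by (simp add: ad_def Ui_def)

lemma ad_eq: "adU' T = (\<lambda>y\<in>carrier H'. U (T (Ui y)))"
  by (simp add: ad_def Ui_def)

lemma ad_U: "x \<in> carrier H \<Longrightarrow> adU' T (U x) = U (T x)"
  by (simp add: ad_apply)

lemma ad_BOps: "T \<in> H.BOps \<Longrightarrow> adU' T \<in> H'.BOps"
proof -
  assume T: "T \<in> H.BOps"
  note T' = H.BOpsD(3-5)[OF T]
  obtain c where c: "c \<ge> 0" "\<forall>x\<in>carrier H. hnorm H (T x) \<le> c * hnorm H x"
    using H.BOpsD(6)[OF T] by blast
  show ?thesis
    unfolding ad_eq
  proof (rule H'.BOpsI[of _ c])
    fix y assume y: "y \<in> carrier H'"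
    show "hnorm H' (U (T (Ui y))) \<le> c * hnorm H' y"
      using bspec[OF c(2) Ui_closed[OF y]] y by (simp add: T' U_hnorm Ui_hnorm)
  qed (simp_all add: T' U_add U_smult Ui_add Ui_smult)
qed

theorem ad_star_hom: "star_hom (bounded_operators H) (bounded_operators H') adU'"
proof (rule star_homI)
  fix S T assume "S \<in> carrier (bounded_operators H)" "T \<in> carrier (bounded_operators H)"
  then have S: "S \<in> H.BOps" and T: "T \<in> H.BOps"
    by (simp_all add: H.bounded_operators_eq)
  show "adU' (S \<oplus>\<^bsub>bounded_operators H\<^esub> T) = adU' S \<oplus>\<^bsub>bounded_operators H'\<^esub> adU' T"
    unfolding H.bounded_operators_eq H'.bounded_operators_eq operator_algebra_sel ad_eq
    by (rule restrict_ext) (simp add: H.BOpsD(3)[OF S] H.BOpsD(3)[OF T] U_add)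
  show "adU' (S \<otimes>\<^bsub>bounded_operators H\<^esub> T) = adU' S \<otimes>\<^bsub>bounded_operators H'\<^esub> adU' T"
    unfolding H.bounded_operators_eq H'.bounded_operators_eq operator_algebra_sel ad_eq
    by (rule restrict_ext) (simp add: H.BOpsD(3)[OF S] H.BOpsD(3)[OF T])
next
  fix T assume "T \<in> carrier (bounded_operators H)"
  then have T: "T \<in> H.BOps"
    by (simp add: H.bounded_operators_eq)
  note a = H.BOpsD(3)[OF H.adjoint_BOps(1)[OF T]]
  show "adU' T \<in> carrier (bounded_operators H')"
    using ad_BOps[OF T] by (simp add: H'.bounded_operators_eq)
  show "adU' (c \<odot>\<^bsub>bounded_operators H\<^esub> T) = c \<odot>\<^bsub>bounded_operators H'\<^esub> adU' T" for c
    unfolding H.bounded_operators_eq H'.bounded_operators_eq operator_algebra_sel ad_eq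
    by (rule restrict_ext) (simp add: H.BOpsD(3)[OF T] U_smult)
  have "adjoint_op H' (adU' T) = adU' (adjoint_op H T)"
  proof (rule H'.adjoint_eqI)
    show "adU' (adjoint_op H T) \<in> H'.BOps"
      by (rule ad_BOps[OF H.adjoint_BOps(1)[OF T]])
    fix v w assume v: "v \<in> carrier H'" and w: "w \<in> carrier H'"
    show "ip H' (adU' T v) w = ip H' v (adU' (adjoint_op H T) w)"
      using v w H.BOpsD(3)[OF T] a
      by (simp add: ad_apply U_ip_left U_ip_right H.adjoint_BOps(2)[OF T])
  qed
  then show "adU' (star (bounded_operators H) T) = star (bounded_operators H') (adU' T)"
    by (simp add: H.bounded_operators_eq H'.bounded_operators_eq)
qed

end

section \<open>The Hilbert module of sections\<close>

text \<open>Neighbourhoods relative to an open set are neighbourhoods in the whole space, so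
  continuity becomes the convergence of real numbers along \<open>nhds\<close>. This form carries
  over to sections, whose values lie in varying fibres.\<close>

lemma continuous_map_norm_topology_iff:
  assumes M: "normed_module M n" and Y: "open (Y :: 'x::topological_space set)"
  shows "continuous_map (top_of_set Y) (norm_topology M n) w \<longleftrightarrow>
    (\<forall>x\<in>Y. w x \<in> carrier M) \<and> (\<forall>x0\<in>Y. ((\<lambda>x. n (w x \<ominus>\<^bsub>M\<^esub> w x0)) \<longlongrightarrow> 0) (nhds x0))"
proof -
  interpret normed_module M n by (rule M)
  have w: "w \<in> Y \<rightarrow> carrier M" if "continuous_map (top_of_set Y) (norm_topology M n) w"
    using continuous_map_image_subset_topspace[OF that] by (auto simp: norm_topology_def)
  have *: "(\<forall>x\<in>topspace (top_of_set Y). \<forall>\<epsilon>>0. \<exists>U. openin (top_of_set Y) U \<and> x \<in> U \<and> (\<forall>y\<in>U. w y \<in> D.mball (w x) \<epsilon>)) \<longleftrightarrow>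
    (\<forall>x0\<in>Y. ((\<lambda>x. n (w x \<ominus>\<^bsub>M\<^esub> w x0)) \<longlongrightarrow> 0) (nhds x0))" if w: "w \<in> Y \<rightarrow> carrier M"
  proof safe
    fix x0 assume x0: "x0 \<in> Y"
      and *: "\<forall>x\<in>topspace (top_of_set Y). \<forall>\<epsilon>>0. \<exists>U. openin (top_of_set Y) U \<and> x \<in> U \<and> (\<forall>y\<in>U. w y \<in> D.mball (w x) \<epsilon>)"
    show "((\<lambda>x. n (w x \<ominus>\<^bsub>M\<^esub> w x0)) \<longlongrightarrow> 0) (nhds x0)"
    proof (rule tendstoI)
      fix e :: real assume "e > 0"
      then obtain U where U: "openin (top_of_set Y) U" "x0 \<in> U" "\<forall>y\<in>U. w y \<in> D.mball (w x0) e"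
        using bspec[OF *, unfolded topspace_euclidean_subtopology, OF x0] by blast
      have "open U" "U \<subseteq> Y"
        using U(1) Y by (auto simp: openin_open_eq)
      moreover have "dist (n (w x \<ominus>\<^bsub>M\<^esub> w x0)) 0 < e" if "x \<in> U" for x
      proof -
        have "w x \<in> carrier M" "w x0 \<in> carrier M"
          using w that x0 \<open>U \<subseteq> Y\<close> by auto
        then show ?thesis
          using U(3) that n_minus_commute[of "w x" "w x0"] by (auto simp: norm_dist_def)
      qed
      ultimately show "\<forall>\<^sub>F x in nhds x0. dist (n (w x \<ominus>\<^bsub>M\<^esub> w x0)) 0 < e"
        using U(2) unfolding eventually_nhds by blast
    qed
  next
    fix x0 and e :: real assume x0: "x0 \<in> topspace (top_of_set Y)" and e: "e > 0"
      and *: "\<forall>x0\<in>Y. ((\<lambda>x. n (w x \<ominus>\<^bsub>M\<^esub> w x0)) \<longlongrightarrow> 0) (nhds x0)"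
    have x0Y: "x0 \<in> Y"
      using x0 by simp
    have "\<forall>\<^sub>F x in nhds x0. n (w x \<ominus>\<^bsub>M\<^esub> w x0) < e"
      using bspec[OF * x0Y] e by (rule order_tendstoD)
    then obtain S where S: "open S" "x0 \<in> S" "\<And>x. x \<in> S \<Longrightarrow> n (w x \<ominus>\<^bsub>M\<^esub> w x0) < e"
      unfolding eventually_nhds by blast
    have "w y \<in> D.mball (w x0) e" if "y \<in> S \<inter> Y" for y
    proof -
      have "w y \<in> carrier M" "w x0 \<in> carrier M"
        using w that x0Y by auto
      then show ?thesis
        using S(3)[of y] that n_minus_commute[of "w y" "w x0"] by (simp add: norm_dist_def)
    qed
    then show "\<exists>U. openin (top_of_set Y) U \<and> x0 \<in> U \<and> (\<forall>y\<in>U. w y \<in> D.mball (w x0) e)"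
      using S(1,2) x0Y Y by (intro exI[of _ "S \<inter> Y"]) (auto simp: openin_open_eq)
  qed
  show ?thesis
  proof (cases "w \<in> Y \<rightarrow> carrier M")
    case True
    have "continuous_map (top_of_set Y) (norm_topology M n) w \<longleftrightarrow> (\<forall>x\<in>topspace (top_of_set Y). \<forall>\<epsilon>>0.
      \<exists>U. openin (top_of_set Y) U \<and> x \<in> U \<and> (\<forall>y\<in>U. w y \<in> D.mball (w x) \<epsilon>))"
      unfolding norm_topology_def by (rule D.continuous_map_to_metric)
    then show ?thesis
      using *[OF True] True by auto
  next
    case False
    then show ?thesis
      using w by auto
  qed
qed

section \<open>The Hilbert bundle and its local transport\<close>

locale hilbert_bundle =
  fixes K :: "'x::topological_space set set" and H :: "'x set \<Rightarrow> (complex, 'h) ip_module"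
    and U :: "'x set \<Rightarrow> 'x set \<Rightarrow> 'h \<Rightarrow> 'h" and Hx :: "'x \<Rightarrow> (complex, 'k) ip_module"
    and V :: "'x \<Rightarrow> 'x set \<Rightarrow> 'h \<Rightarrow> 'k" and \<T> :: "('x \<times> 'k) topology"
  assumes Hausdorff: "Hausdorff_space (euclidean :: 'x topology)"
    and basis: "topological_basis K"
    and net_bundle: "hilbert_net_bundle K H U"
    and assoc_bundle: "associated_hilbert_bundle K H U Hx V \<T>"
begin

sublocale F: hilbert_space "Hx x" for x
  using assoc_bundle by (simp add: associated_hilbert_bundle_def)

lemma H_hilbert: "Y \<in> K \<Longrightarrow> hilbert_space (H Y)"
  using net_bundle by (simp add: hilbert_net_bundle_def)

lemma U_unitary: "Y \<in> K \<Longrightarrow> Y' \<in> K \<Longrightarrow> Y \<subseteq> Y' \<Longrightarrow> unitary_pair (H Y) (H Y') (U Y' Y)"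
  using net_bundle by (simp add: hilbert_net_bundle_def unitary_pair_def unitary_pair_axioms_def)

lemma U_closed: "Y \<in> K \<Longrightarrow> Y' \<in> K \<Longrightarrow> Y \<subseteq> Y' \<Longrightarrow> h \<in> carrier (H Y) \<Longrightarrow> U Y' Y h \<in> carrier (H Y')"
  by (rule unitary_pair.U_closed[OF U_unitary])

lemma K_open: "Y \<in> K \<Longrightarrow> open Y"
  using basis by (rule topological_basis_open)

lemma K_nbhd: "open O' \<Longrightarrow> x \<in> O' \<Longrightarrow> \<exists>Y\<in>K. x \<in> Y \<and> Y \<subseteq> O'"
  using topological_basisE[OF basis, of O' x] by metis

lemma K_cover: "\<exists>Y\<in>K. x \<in> Y"
  using K_nbhd[of UNIV x] by auto

lemma V_unitary: "Y \<in> K \<Longrightarrow> x \<in> Y \<Longrightarrow> unitary_pair (H Y) (Hx x) (V x Y)"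
  using assoc_bundle H_hilbert F.hilbert_space_axioms
  by (simp add: associated_hilbert_bundle_def omega_def unitary_pair_def unitary_pair_axioms_def)

definition Vi :: "'x \<Rightarrow> 'x set \<Rightarrow> 'k \<Rightarrow> 'h" where "Vi x Y = inv_into (carrier (H Y)) (V x Y)"

lemma Vi_Ui: "Y \<in> K \<Longrightarrow> x \<in> Y \<Longrightarrow> Vi x Y = unitary_pair.Ui (H Y) (V x Y)"
  using unitary_pair.Ui_def[OF V_unitary] by (simp add: Vi_def)

lemma V_closed: "Y \<in> K \<Longrightarrow> x \<in> Y \<Longrightarrow> h \<in> carrier (H Y) \<Longrightarrow> V x Y h \<in> carrier (Hx x)"
  by (rule unitary_pair.U_closed[OF V_unitary])

lemma Vi_closed: "Y \<in> K \<Longrightarrow> x \<in> Y \<Longrightarrow> \<xi> \<in> carrier (Hx x) \<Longrightarrow> Vi x Y \<xi> \<in> carrier (H Y)"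
  using unitary_pair.Ui_closed[OF V_unitary] by (simp add: Vi_Ui)

lemma V_Vi: "Y \<in> K \<Longrightarrow> x \<in> Y \<Longrightarrow> \<xi> \<in> carrier (Hx x) \<Longrightarrow> V x Y (Vi x Y \<xi>) = \<xi>"
  using unitary_pair.U_Ui[OF V_unitary] by (simp add: Vi_Ui)

lemma Vi_V: "Y \<in> K \<Longrightarrow> x \<in> Y \<Longrightarrow> h \<in> carrier (H Y) \<Longrightarrow> Vi x Y (V x Y h) = h"
  using unitary_pair.Ui_U[OF V_unitary] by (simp add: Vi_Ui)

lemma V_minus: "Y \<in> K \<Longrightarrow> x \<in> Y \<Longrightarrow> h \<in> carrier (H Y) \<Longrightarrow> k \<in> carrier (H Y) \<Longrightarrow>
    V x Y (h \<ominus>\<^bsub>H Y\<^esub> k) = V x Y h \<ominus>\<^bsub>Hx x\<^esub> V x Y k"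
  by (rule unitary_pair.U_minus[OF V_unitary])

lemma V_hnorm: "Y \<in> K \<Longrightarrow> x \<in> Y \<Longrightarrow> h \<in> carrier (H Y) \<Longrightarrow> hnorm (Hx x) (V x Y h) = hnorm (H Y) h"
  by (rule unitary_pair.U_hnorm[OF V_unitary])

lemma V_U: "Y \<in> K \<Longrightarrow> Y' \<in> K \<Longrightarrow> x \<in> Y \<Longrightarrow> Y \<subseteq> Y' \<Longrightarrow> h \<in> carrier (H Y) \<Longrightarrow> V x Y' (U Y' Y h) = V x Y h"
  using assoc_bundle subsetD[of Y Y' x] by (simp add: associated_hilbert_bundle_def omega_def)

text \<open>The flat parallel transport inside the chart \<open>Y\<close>, from the fibre at
  \<open>x0\<close> to the fibre at \<open>x\<close>. Values in different fibres are compared by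
  means of it.\<close>

definition transport :: "'x set \<Rightarrow> 'x \<Rightarrow> 'x \<Rightarrow> 'k \<Rightarrow> 'k" where
  "transport Y x0 x \<xi> = V x Y (Vi x0 Y \<xi>)"

context
  fixes Y x0 x assumes Y: "Y \<in> K" "x0 \<in> Y" "x \<in> Y"
begin

lemma transport_closed: "\<xi> \<in> carrier (Hx x0) \<Longrightarrow> transport Y x0 x \<xi> \<in> carrier (Hx x)"
  using Y by (simp add: transport_def V_closed Vi_closed)

lemma transport_ip: "\<xi> \<in> carrier (Hx x0) \<Longrightarrow> \<eta> \<in> carrier (Hx x0) \<Longrightarrow>
    ip (Hx x) (transport Y x0 x \<xi>) (transport Y x0 x \<eta>) = ip (Hx x0) \<xi> \<eta>"
  using unitary_pair.U_ip[OF V_unitary[of Y x]] unitary_pair.U_ip[OF V_unitary[of Y x0], of "Vi x0 Y \<xi>" "Vi x0 Y \<eta>"] Y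
  by (simp add: transport_def Vi_closed V_Vi)

lemma transport_hnorm: "\<xi> \<in> carrier (Hx x0) \<Longrightarrow> hnorm (Hx x) (transport Y x0 x \<xi>) = hnorm (Hx x0) \<xi>"
  by (simp add: hnorm_def transport_ip)

lemma transport_add: "\<xi> \<in> carrier (Hx x0) \<Longrightarrow> \<eta> \<in> carrier (Hx x0) \<Longrightarrow>
    transport Y x0 x (\<xi> \<oplus>\<^bsub>Hx x0\<^esub> \<eta>) = transport Y x0 x \<xi> \<oplus>\<^bsub>Hx x\<^esub> transport Y x0 x \<eta>"
  using unitary_pair.U_add[OF V_unitary[of Y x]] unitary_pair.Ui_add[OF V_unitary[of Y x0]] Y
  by (simp add: transport_def Vi_closed Vi_Ui[symmetric])

lemma transport_smult: "\<xi> \<in> carrier (Hx x0) \<Longrightarrow>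
    transport Y x0 x (c \<odot>\<^bsub>Hx x0\<^esub> \<xi>) = c \<odot>\<^bsub>Hx x\<^esub> transport Y x0 x \<xi>"
  using unitary_pair.U_smult[OF V_unitary[of Y x]] unitary_pair.Ui_smult[OF V_unitary[of Y x0]] Y
  by (simp add: transport_def Vi_closed Vi_Ui[symmetric])

lemma transport_zero: "transport Y x0 x \<zero>\<^bsub>Hx x0\<^esub> = \<zero>\<^bsub>Hx x\<^esub>"
  using transport_smult[of "\<zero>\<^bsub>Hx x0\<^esub>" 0] transport_closed[of "\<zero>\<^bsub>Hx x0\<^esub>"] by simp

lemma transport_minus: "\<xi> \<in> carrier (Hx x0) \<Longrightarrow> \<eta> \<in> carrier (Hx x0) \<Longrightarrow>
    transport Y x0 x (\<xi> \<ominus>\<^bsub>Hx x0\<^esub> \<eta>) = transport Y x0 x \<xi> \<ominus>\<^bsub>Hx x\<^esub> transport Y x0 x \<eta>"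
  by (simp add: F.v_minus transport_add transport_smult transport_closed)

end

lemma eventually_mem: "Y \<in> K \<Longrightarrow> x0 \<in> Y \<Longrightarrow> \<forall>\<^sub>F x in nhds x0. x \<in> Y"
  by (rule eventually_nhds_in_open[OF K_open])

text \<open>Passing to a smaller chart changes the trivialisations at both points by the same
  unitary \<open>U Y Y'\<close>, which cancels.\<close>

lemma transport_subset:
  assumes "Y \<in> K" "Y' \<in> K" "Y' \<subseteq> Y" "x0 \<in> Y'" "x \<in> Y'" "\<xi> \<in> carrier (Hx x0)"
  shows "transport Y x0 x \<xi> = transport Y' x0 x \<xi>"
proof -
  define h where "h = Vi x0 Y' \<xi>"
  have h: "h \<in> carrier (H Y')"
    using assms Vi_closed by (simp add: h_def)
  have "V x0 Y (U Y Y' h) = \<xi>"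
    using V_U[OF assms(2,1,4,3) h] V_Vi[OF assms(2,4,6)] by (simp add: h_def)
  moreover have Uh: "U Y Y' h \<in> carrier (H Y)"
    using U_closed[OF assms(2,1,3) h] .
  ultimately have "Vi x0 Y \<xi> = U Y Y' h"
    using Vi_V[OF assms(1) _ Uh, of x0] assms by auto
  then show ?thesis
    using V_U[OF assms(2,1,5,3) h] by (simp add: transport_def h_def)
qed

end

section \<open>Continuous sections vanishing at infinity\<close>

context hilbert_bundle
begin

abbreviation "E \<equiv> section_module Hx \<T>"
abbreviation "nx \<equiv> \<lambda>x. hnorm (Hx x)"

lemma E_sel [simp]:
  "zero E = (\<lambda>x. \<zero>\<^bsub>Hx x\<^esub>)" "add E = (\<lambda>v w x. v x \<oplus>\<^bsub>Hx x\<^esub> w x)" "smult E = (\<lambda>c v x. c \<odot>\<^bsub>Hx x\<^esub> v x)"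
  "ip E = (\<lambda>v w x. ip (Hx x) (v x) (w x))" "ract E = (\<lambda>v f x. f x \<odot>\<^bsub>Hx x\<^esub> v x)"
  "lact E = (\<lambda>f v x. f x \<odot>\<^bsub>Hx x\<^esub> v x)"
  by (simp_all add: section_module_def)

text \<open>Continuity at \<open>x0\<close> as approximation of v by the locally constant section
  through v x0. It involves only norms in single fibres and takes the place of the topology of the
  total space in all estimates.\<close>

definition continuous_section :: "('x \<Rightarrow> 'k) \<Rightarrow> bool" where
  "continuous_section v \<longleftrightarrow> (\<forall>Y\<in>K. \<forall>x0\<in>Y.
     ((\<lambda>x. nx x (v x \<ominus>\<^bsub>Hx x\<^esub> transport Y x0 x (v x0))) \<longlongrightarrow> 0) (nhds x0))"

text \<open>In a chart the section is the graph of a map \<open>w Y\<close> into the Hilbert space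
  over \<open>Y\<close>; as the chart maps are homeomorphisms and the charts an open cover,
  continuity of the section is that of all these maps. The unitary at x turns w x - w x0 into the
  difference of v x and the transported v x0.\<close>

lemma section_continuous_map_iff:
  assumes v: "\<And>x. v x \<in> carrier (Hx x)"
  shows "continuous_map euclidean \<T> (\<lambda>x. (x, v x)) \<longleftrightarrow> continuous_section v"
proof -
  define w where "w Y x = Vi x Y (v x)" for Y x
  define N where "N Y = norm_topology (H Y) (hnorm (H Y))" for Y
  have wc: "w Y x \<in> carrier (H Y)" if "Y \<in> K" "x \<in> Y" for Y x
    using that v by (simp add: w_def Vi_closed)
  have Vw: "V x Y (w Y x) = v x" if "Y \<in> K" "x \<in> Y" for Y x
    using that v by (simp add: w_def V_Vi)
  have nm: "normed_module (H Y) (hnorm (H Y))" if "Y \<in> K" for Y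
  proof -
    interpret hilbert_space "H Y" by (rule H_hilbert[OF that])
    show ?thesis by (rule N.normed_module_axioms)
  qed
  have tN: "topspace (N Y) = carrier (H Y)" if "Y \<in> K" for Y
  proof -
    interpret normed_module "H Y" "hnorm (H Y)" by (rule nm[OF that])
    show ?thesis by (simp add: N_def norm_topology_def)
  qed
  have T: "openin \<T> (total_space Hx Y)" "homeomorphic_map (prod_topology (top_of_set Y) (N Y))
          (subtopology \<T> (total_space Hx Y)) (\<lambda>(x, h). (x, V x Y h))" if "Y \<in> K" for Y
    using assoc_bundle that by (simp_all add: associated_hilbert_bundle_def N_def)
  have topT: "topspace \<T> = total_space Hx UNIV"
    using assoc_bundle by (simp add: associated_hilbert_bundle_def)
  have 1: "continuous_map euclidean \<T> (\<lambda>x. (x, v x)) \<longleftrightarrow> (\<forall>Y\<in>K. continuous_map (top_of_set Y) (N Y) (w Y))"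
  proof
    assume c: "continuous_map euclidean \<T> (\<lambda>x. (x, v x))"
    show "\<forall>Y\<in>K. continuous_map (top_of_set Y) (N Y) (w Y)"
    proof
      fix Y assume Y: "Y \<in> K"
      obtain g where g: "homeomorphic_maps (prod_topology (top_of_set Y) (N Y))
          (subtopology \<T> (total_space Hx Y)) (\<lambda>(x, h). (x, V x Y h)) g"
        using T(2)[OF Y] unfolding homeomorphic_map_maps by blast
      have "continuous_map (top_of_set Y) \<T> (\<lambda>x. (x, v x))"
        by (rule continuous_map_from_subtopology[OF c])
      then have "continuous_map (top_of_set Y) (subtopology \<T> (total_space Hx Y)) (\<lambda>x. (x, v x))"
        using v by (auto simp: continuous_map_in_subtopology total_space_def)
      moreover have "continuous_map (subtopology \<T> (total_space Hx Y)) (prod_topology (top_of_set Y) (N Y)) g"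
        using g by (simp add: homeomorphic_maps_def)
      ultimately have "continuous_map (top_of_set Y) (N Y) (snd \<circ> (g \<circ> (\<lambda>x. (x, v x))))"
        by (intro continuous_map_compose[OF continuous_map_compose continuous_map_snd])
      moreover have "(snd \<circ> (g \<circ> (\<lambda>x. (x, v x)))) x = w Y x" if x: "x \<in> topspace (top_of_set Y)" for x
      proof -
        have "(x, w Y x) \<in> topspace (prod_topology (top_of_set Y) (N Y))"
          using x wc[OF Y] by (simp add: tN[OF Y])
        then have "g ((\<lambda>(x, h). (x, V x Y h)) (x, w Y x)) = (x, w Y x)"
          using g unfolding homeomorphic_maps_def by blast
        then show ?thesis
          using x Vw[OF Y] by simp
      qed
      ultimately show "continuous_map (top_of_set Y) (N Y) (w Y)"
        by (rule continuous_map_eq)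
    qed
  next
    assume c: "\<forall>Y\<in>K. continuous_map (top_of_set Y) (N Y) (w Y)"
    have cY: "continuous_map (top_of_set Y) \<T> (\<lambda>x. (x, v x))" if Y: "Y \<in> K" for Y
    proof -
      have "continuous_map (top_of_set Y) (prod_topology (top_of_set Y) (N Y)) (\<lambda>x. (x, w Y x))"
        using c Y by (simp add: continuous_map_paired)
      moreover have "continuous_map (prod_topology (top_of_set Y) (N Y)) \<T> (\<lambda>(x, h). (x, V x Y h))"
        using homeomorphic_imp_continuous_map[OF T(2)[OF Y]] by (rule continuous_map_into_fulltopology)
      ultimately have "continuous_map (top_of_set Y) \<T> ((\<lambda>(x, h). (x, V x Y h)) \<circ> (\<lambda>x. (x, w Y x)))"
        by (rule continuous_map_compose)
      then show ?thesis
        by (rule continuous_map_eq) (use Vw[OF Y] in auto)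
    qed
    show "continuous_map euclidean \<T> (\<lambda>x. (x, v x))"
      unfolding continuous_map_def
    proof (intro conjI allI impI)
      show "(\<lambda>x. (x, v x)) \<in> topspace euclidean \<rightarrow> topspace \<T>"
        using v by (auto simp: topT total_space_def)
      fix W assume W: "openin \<T> W"
      have "open {x \<in> Y. (x, v x) \<in> W}" if Y: "Y \<in> K" for Y
      proof -
        have "openin (top_of_set Y) {x \<in> topspace (top_of_set Y). (x, v x) \<in> W}"
          using cY[OF Y] W unfolding continuous_map_def by blast
        then show ?thesis
          using K_open[OF Y] by (auto simp: openin_open_eq)
      qed
      then have "open (\<Union>Y\<in>K. {x \<in> Y. (x, v x) \<in> W})"
        by blast
      moreover have "(\<Union>Y\<in>K. {x \<in> Y. (x, v x) \<in> W}) = {x \<in> topspace euclidean. (x, v x) \<in> W}"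
        using K_cover by auto
      ultimately show "openin euclidean {x \<in> topspace euclidean. (x, v x) \<in> W}"
        by simp
    qed
  qed
  have 2: "continuous_map (top_of_set Y) (N Y) (w Y) \<longleftrightarrow>
    (\<forall>x0\<in>Y. ((\<lambda>x. nx x (v x \<ominus>\<^bsub>Hx x\<^esub> transport Y x0 x (v x0))) \<longlongrightarrow> 0) (nhds x0))" if Y: "Y \<in> K" for Y
  proof -
    have "((\<lambda>x. nx x (v x \<ominus>\<^bsub>Hx x\<^esub> transport Y x0 x (v x0))) \<longlongrightarrow> 0) (nhds x0) \<longleftrightarrow>
      ((\<lambda>x. hnorm (H Y) (w Y x \<ominus>\<^bsub>H Y\<^esub> w Y x0)) \<longlongrightarrow> 0) (nhds x0)" if x0: "x0 \<in> Y" for x0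
    proof (rule tendsto_cong, rule eventually_mono[OF eventually_mem[OF Y x0]])
      fix x assume x: "x \<in> Y"
      interpret hilbert_space "H Y" by (rule H_hilbert[OF Y])
      have "v x \<ominus>\<^bsub>Hx x\<^esub> transport Y x0 x (v x0) = V x Y (w Y x \<ominus>\<^bsub>H Y\<^esub> w Y x0)"
        using V_minus[OF Y x wc[OF Y x] wc[OF Y x0]] Vw[OF Y x] by (simp add: transport_def w_def)
      then show "nx x (v x \<ominus>\<^bsub>Hx x\<^esub> transport Y x0 x (v x0)) = hnorm (H Y) (w Y x \<ominus>\<^bsub>H Y\<^esub> w Y x0)"
        using V_hnorm[OF Y x v_minus_closed[OF wc[OF Y x] wc[OF Y x0]]] by simp
    qed
    then show ?thesis
      unfolding N_def continuous_map_norm_topology_iff[OF nm[OF Y] K_open[OF Y]] using wc[OF Y] by simp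
  qed
  show ?thesis
    unfolding 1 continuous_section_def using 2 by blast
qed

definition vanishing :: "('x \<Rightarrow> 'k) \<Rightarrow> bool" where
  "vanishing v \<longleftrightarrow> (\<forall>e>0. \<exists>C. compact C \<and> (\<forall>x. x \<notin> C \<longrightarrow> nx x (v x) < e))"

lemma E_iff: "v \<in> carrier E \<longleftrightarrow> (\<forall>x. v x \<in> carrier (Hx x)) \<and> continuous_section v \<and> vanishing v"
  using section_continuous_map_iff[of v] unfolding section_module_def vanishing_def by auto

lemma E_fibre: "v \<in> carrier E \<Longrightarrow> v x \<in> carrier (Hx x)"
  by (simp add: E_iff)

lemma E_near: "v \<in> carrier E \<Longrightarrow> Y \<in> K \<Longrightarrow> x0 \<in> Y \<Longrightarrow>
    ((\<lambda>x. nx x (v x \<ominus>\<^bsub>Hx x\<^esub> transport Y x0 x (v x0))) \<longlongrightarrow> 0) (nhds x0)"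
  by (simp add: E_iff continuous_section_def)

lemma continuous_sectionI:
  assumes "\<And>Y x0. Y \<in> K \<Longrightarrow> x0 \<in> Y \<Longrightarrow> \<exists>g. (g \<longlongrightarrow> 0) (nhds x0) \<and>
    (\<forall>\<^sub>F x in nhds x0. nx x (v x \<ominus>\<^bsub>Hx x\<^esub> transport Y x0 x (v x0)) \<le> g x)"
    and v: "\<And>x. v x \<in> carrier (Hx x)"
  shows "continuous_section v"
  unfolding continuous_section_def
proof (intro ballI)
  fix Y x0 assume Y: "Y \<in> K" "x0 \<in> Y"
  then obtain g where g: "(g \<longlongrightarrow> 0) (nhds x0)"
    "\<forall>\<^sub>F x in nhds x0. nx x (v x \<ominus>\<^bsub>Hx x\<^esub> transport Y x0 x (v x0)) \<le> g x"
    using assms(1) by blast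
  have "\<forall>\<^sub>F x in nhds x0. 0 \<le> nx x (v x \<ominus>\<^bsub>Hx x\<^esub> transport Y x0 x (v x0))"
    using eventually_mem[OF Y]
    by (rule eventually_mono) (use v Y in \<open>simp add: F.hnorm_nonneg transport_closed\<close>)
  then show "((\<lambda>x. nx x (v x \<ominus>\<^bsub>Hx x\<^esub> transport Y x0 x (v x0))) \<longlongrightarrow> 0) (nhds x0)"
    using real_tendsto_sandwich[OF _ g(2) tendsto_const g(1)] by blast
qed

lemma E_norm_tendsto:
  assumes v: "v \<in> carrier E"
  shows "((\<lambda>x. nx x (v x)) \<longlongrightarrow> nx x0 (v x0)) (nhds x0)"
proof -
  obtain Y where Y: "Y \<in> K" "x0 \<in> Y"
    using K_cover by blast
  have "((\<lambda>x. nx x (v x) - nx x0 (v x0)) \<longlongrightarrow> 0) (nhds x0)"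
  proof (rule Lim_null_comparison[OF _ E_near[OF v Y]], rule eventually_mono[OF eventually_mem[OF Y]])
    fix x assume x: "x \<in> Y"
    show "norm (nx x (v x) - nx x0 (v x0)) \<le> nx x (v x \<ominus>\<^bsub>Hx x\<^esub> transport Y x0 x (v x0))"
      using F.N.n_abs_diff_le[OF E_fibre[OF v] transport_closed[OF Y x E_fibre[OF v]]]
      by (simp add: transport_hnorm[OF Y x E_fibre[OF v]])
  qed
  then show ?thesis
    by (simp add: LIM_zero_iff)
qed

lemma E_norm_C0: "v \<in> carrier E \<Longrightarrow> (\<lambda>x. complex_of_real (nx x (v x))) \<in> C0 UNIV"
  unfolding C0_iff continuous_on_UNIV_iff_nhds
proof (intro conjI allI impI)
  assume v: "v \<in> carrier E"
  show "((\<lambda>x. complex_of_real (nx x (v x))) \<longlongrightarrow> complex_of_real (nx x0 (v x0))) (nhds x0)" for x0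
    by (rule tendsto_of_real[OF E_norm_tendsto[OF v]])
  fix e :: real assume "e > 0"
  then obtain C where "compact C" "\<forall>x. x \<notin> C \<longrightarrow> nx x (v x) < e"
    using v unfolding E_iff vanishing_def by blast
  then show "\<exists>C. compact C \<and> (\<forall>x. x \<notin> C \<longrightarrow> cmod (complex_of_real (nx x (v x))) < e)"
    using F.hnorm_nonneg[OF E_fibre[OF v]] by (intro exI[of _ C]) simp
qed

lemma E_bounded: "v \<in> carrier E \<Longrightarrow> \<exists>B>0. \<forall>x. nx x (v x) \<le> B"
  using C0_bounded[OF E_norm_C0] F.hnorm_nonneg[OF E_fibre] by fastforce

text \<open>Vanishing at infinity is inherited from a dominating scalar function, usually the norm
  of a given section, so that only continuity remains to be checked when new sections are
  built.\<close>

lemma E_dominated: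
  assumes v: "\<And>x. v x \<in> carrier (Hx x)" and c: "continuous_section v"
    and g: "g \<in> C0 UNIV" and le: "\<And>x. nx x (v x) \<le> c * cmod (g x)"
  shows "v \<in> carrier E"
  unfolding E_iff
proof (intro conjI allI v c)
  show "vanishing v"
    unfolding vanishing_def
  proof (intro allI impI)
    fix e :: real assume e: "e > 0"
    have "0 < e / (\<bar>c\<bar> + 1)"
      using e by simp
    then obtain C where C: "compact C" "\<And>x. x \<notin> C \<Longrightarrow> cmod (g x) < e / (\<bar>c\<bar> + 1)"
      using g unfolding C0_iff by meson
    have "nx x (v x) < e" if "x \<notin> C" for x
    proof -
      have "nx x (v x) \<le> (\<bar>c\<bar> + 1) * cmod (g x)"
        by (rule order_trans[OF le mult_right_mono]) auto
      also have "\<dots> < e"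
        using C(2)[OF that] by (simp add: field_simps)
      finally show ?thesis .
    qed
    then show "\<exists>C. compact C \<and> (\<forall>x. x \<notin> C \<longrightarrow> nx x (v x) < e)"
      using C(1) by blast
  qed
qed

lemma E_zero: "(\<lambda>x. \<zero>\<^bsub>Hx x\<^esub>) \<in> carrier E"
proof (rule E_dominated[of _ "\<lambda>x. 0" 0])
  show "continuous_section (\<lambda>x. \<zero>\<^bsub>Hx x\<^esub>)"
  proof (rule continuous_sectionI)
    fix Y x0 assume Y: "Y \<in> K" "x0 \<in> Y"
    show "\<exists>g. (g \<longlongrightarrow> 0) (nhds x0) \<and>
      (\<forall>\<^sub>F x in nhds x0. nx x (\<zero>\<^bsub>Hx x\<^esub> \<ominus>\<^bsub>Hx x\<^esub> transport Y x0 x \<zero>\<^bsub>Hx x0\<^esub>) \<le> g x)"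
      by (intro exI[of _ "\<lambda>x. 0"] conjI tendsto_const eventually_mono[OF eventually_mem[OF Y]])
        (simp add: transport_zero[OF Y])
  qed simp
  show "(\<lambda>x. 0) \<in> C0 UNIV"
    unfolding C0_iff by (auto intro!: exI[of _ "{}"])
qed simp_all

lemma E_add:
  assumes v: "v \<in> carrier E" and w: "w \<in> carrier E"
  shows "(\<lambda>x. v x \<oplus>\<^bsub>Hx x\<^esub> w x) \<in> carrier E"
proof (rule E_dominated[of _ "\<lambda>x. complex_of_real (nx x (v x)) + complex_of_real (nx x (w x))" 1])
  show "continuous_section (\<lambda>x. v x \<oplus>\<^bsub>Hx x\<^esub> w x)"
  proof (rule continuous_sectionI)
    fix Y x0 assume Y: "Y \<in> K" "x0 \<in> Y"
    show "\<exists>g. (g \<longlongrightarrow> 0) (nhds x0) \<and>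
      (\<forall>\<^sub>F x in nhds x0. nx x ((v x \<oplus>\<^bsub>Hx x\<^esub> w x) \<ominus>\<^bsub>Hx x\<^esub> transport Y x0 x (v x0 \<oplus>\<^bsub>Hx x0\<^esub> w x0)) \<le> g x)"
    proof (intro exI conjI)
      show "((\<lambda>x. nx x (v x \<ominus>\<^bsub>Hx x\<^esub> transport Y x0 x (v x0)) + nx x (w x \<ominus>\<^bsub>Hx x\<^esub> transport Y x0 x (w x0))) \<longlongrightarrow> 0) (nhds x0)"
        using tendsto_add[OF E_near[OF v Y] E_near[OF w Y]] by simp
      show "\<forall>\<^sub>F x in nhds x0. nx x ((v x \<oplus>\<^bsub>Hx x\<^esub> w x) \<ominus>\<^bsub>Hx x\<^esub> transport Y x0 x (v x0 \<oplus>\<^bsub>Hx x0\<^esub> w x0))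
        \<le> nx x (v x \<ominus>\<^bsub>Hx x\<^esub> transport Y x0 x (v x0)) + nx x (w x \<ominus>\<^bsub>Hx x\<^esub> transport Y x0 x (w x0))"
        using eventually_mem[OF Y]
      proof (rule eventually_mono)
        fix x assume x: "x \<in> Y"
        show "nx x ((v x \<oplus>\<^bsub>Hx x\<^esub> w x) \<ominus>\<^bsub>Hx x\<^esub> transport Y x0 x (v x0 \<oplus>\<^bsub>Hx x0\<^esub> w x0))
          \<le> nx x (v x \<ominus>\<^bsub>Hx x\<^esub> transport Y x0 x (v x0)) + nx x (w x \<ominus>\<^bsub>Hx x\<^esub> transport Y x0 x (w x0))"
          unfolding transport_add[OF Y x E_fibre[OF v] E_fibre[OF w]]
          by (rule F.N.n_add_minus_add_le) (simp_all add: E_fibre v w transport_closed[OF Y x])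
      qed
    qed
  qed (simp add: E_fibre v w)
  show "(\<lambda>x. complex_of_real (nx x (v x)) + complex_of_real (nx x (w x))) \<in> C0 UNIV"
    by (rule C0_add[OF E_norm_C0[OF v] E_norm_C0[OF w]])
  show "nx x (v x \<oplus>\<^bsub>Hx x\<^esub> w x) \<le> 1 * cmod (complex_of_real (nx x (v x)) + complex_of_real (nx x (w x)))" for x
    using F.N.n_triangle[OF E_fibre[OF v] E_fibre[OF w]] F.hnorm_nonneg[OF E_fibre[OF v]] F.hnorm_nonneg[OF E_fibre[OF w]]
    by (simp flip: of_real_add)
qed (simp add: E_fibre v w)

lemma E_fun_smult:
  assumes f: "continuous_on UNIV f" and B: "\<And>x. cmod (f x) \<le> B" and v: "v \<in> carrier E"
  shows "(\<lambda>x. f x \<odot>\<^bsub>Hx x\<^esub> v x) \<in> carrier E"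
proof (rule E_dominated[OF _ _ E_norm_C0[OF v], of _ B])
  show "continuous_section (\<lambda>x. f x \<odot>\<^bsub>Hx x\<^esub> v x)"
  proof (rule continuous_sectionI)
    fix Y x0 assume Y: "Y \<in> K" "x0 \<in> Y"
    show "\<exists>g. (g \<longlongrightarrow> 0) (nhds x0) \<and>
      (\<forall>\<^sub>F x in nhds x0. nx x (f x \<odot>\<^bsub>Hx x\<^esub> v x \<ominus>\<^bsub>Hx x\<^esub> transport Y x0 x (f x0 \<odot>\<^bsub>Hx x0\<^esub> v x0)) \<le> g x)"
    proof (intro exI conjI)
      have "(f \<longlongrightarrow> f x0) (nhds x0)"
        using f continuous_on_UNIV_iff_nhds by blast
      then have "((\<lambda>x. B * nx x (v x \<ominus>\<^bsub>Hx x\<^esub> transport Y x0 x (v x0)) + cmod (f x - f x0) * nx x0 (v x0))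
          \<longlongrightarrow> B * 0 + 0 * nx x0 (v x0)) (nhds x0)"
        by (intro tendsto_intros E_near[OF v Y]) (simp add: tendsto_norm_zero_iff LIM_zero)
      then show "((\<lambda>x. B * nx x (v x \<ominus>\<^bsub>Hx x\<^esub> transport Y x0 x (v x0)) + cmod (f x - f x0) * nx x0 (v x0))
          \<longlongrightarrow> 0) (nhds x0)"
        by simp
      show "\<forall>\<^sub>F x in nhds x0. nx x (f x \<odot>\<^bsub>Hx x\<^esub> v x \<ominus>\<^bsub>Hx x\<^esub> transport Y x0 x (f x0 \<odot>\<^bsub>Hx x0\<^esub> v x0))
        \<le> B * nx x (v x \<ominus>\<^bsub>Hx x\<^esub> transport Y x0 x (v x0)) + cmod (f x - f x0) * nx x0 (v x0)"
        using eventually_mem[OF Y]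
      proof (rule eventually_mono)
        fix x assume x: "x \<in> Y"
        define t where "t = transport Y x0 x (v x0)"
        have t: "t \<in> carrier (Hx x)" "nx x t = nx x0 (v x0)"
          using transport_closed[OF Y x E_fibre[OF v]] transport_hnorm[OF Y x E_fibre[OF v]] by (simp_all add: t_def)
        have "f x \<odot>\<^bsub>Hx x\<^esub> v x \<ominus>\<^bsub>Hx x\<^esub> f x0 \<odot>\<^bsub>Hx x\<^esub> t = f x \<odot>\<^bsub>Hx x\<^esub> (v x \<ominus>\<^bsub>Hx x\<^esub> t) \<oplus>\<^bsub>Hx x\<^esub> (f x - f x0) \<odot>\<^bsub>Hx x\<^esub> t"
          by (rule F.linear_combinations2[of "v x" x t]) (simp_all add: E_fibre v t F.v_minus algebra_simps)
        then have "nx x (f x \<odot>\<^bsub>Hx x\<^esub> v x \<ominus>\<^bsub>Hx x\<^esub> f x0 \<odot>\<^bsub>Hx x\<^esub> t) \<le> cmod (f x) * nx x (v x \<ominus>\<^bsub>Hx x\<^esub> t) + cmod (f x - f x0) * nx x t"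
          using F.N.n_triangle[of "f x \<odot>\<^bsub>Hx x\<^esub> (v x \<ominus>\<^bsub>Hx x\<^esub> t)" x "(f x - f x0) \<odot>\<^bsub>Hx x\<^esub> t"] E_fibre[OF v] t(1)
          by (simp add: F.hnorm_smult)
        also have "cmod (f x) * nx x (v x \<ominus>\<^bsub>Hx x\<^esub> t) \<le> B * nx x (v x \<ominus>\<^bsub>Hx x\<^esub> t)"
          by (rule mult_right_mono[OF B]) (simp add: F.hnorm_nonneg E_fibre v t)
        finally show "nx x (f x \<odot>\<^bsub>Hx x\<^esub> v x \<ominus>\<^bsub>Hx x\<^esub> transport Y x0 x (f x0 \<odot>\<^bsub>Hx x0\<^esub> v x0))
          \<le> B * nx x (v x \<ominus>\<^bsub>Hx x\<^esub> transport Y x0 x (v x0)) + cmod (f x - f x0) * nx x0 (v x0)"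
          unfolding transport_smult[OF Y x E_fibre[OF v]] t_def[symmetric] t(2) by simp
      qed
    qed
  qed (simp add: E_fibre v)
  show "nx x (f x \<odot>\<^bsub>Hx x\<^esub> v x) \<le> B * cmod (complex_of_real (nx x (v x)))" for x
    using mult_right_mono[OF B F.hnorm_nonneg[OF E_fibre[OF v]], of x x] F.hnorm_nonneg[OF E_fibre[OF v]]
    by (simp add: F.hnorm_smult E_fibre v)
qed (simp add: E_fibre v)

lemma E_C0_smult: "f \<in> C0 UNIV \<Longrightarrow> v \<in> carrier E \<Longrightarrow> (\<lambda>x. f x \<odot>\<^bsub>Hx x\<^esub> v x) \<in> carrier E"
proof -
  assume f: "f \<in> C0 UNIV" and v: "v \<in> carrier E"
  obtain B where "\<And>x. cmod (f x) \<le> B"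
    using C0_bounded[OF f] by blast
  then show ?thesis
    by (rule E_fun_smult[OF C0_continuous[OF f] _ v])
qed

lemma E_smult: "v \<in> carrier E \<Longrightarrow> (\<lambda>x. c \<odot>\<^bsub>Hx x\<^esub> v x) \<in> carrier E"
  by (rule E_fun_smult[of "\<lambda>x. c" "cmod c"]) auto

lemma E_ip_C0:
  assumes v: "v \<in> carrier E" and w: "w \<in> carrier E"
  shows "(\<lambda>x. ip (Hx x) (v x) (w x)) \<in> C0 UNIV"
proof -
  obtain B where B: "B > 0" "\<And>x. nx x (w x) \<le> B"
    using E_bounded[OF w] by blast
  show ?thesis
  proof (rule C0_dominated[OF _ E_norm_C0[OF v]])
    show "cmod (ip (Hx x) (v x) (w x)) \<le> B * cmod (complex_of_real (nx x (v x)))" for x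
    proof -
      have "cmod (ip (Hx x) (v x) (w x)) \<le> nx x (v x) * nx x (w x)"
        by (rule F.cauchy_schwarz[OF E_fibre[OF v] E_fibre[OF w]])
      also have "\<dots> \<le> nx x (v x) * B"
        by (rule mult_left_mono[OF B(2) F.hnorm_nonneg[OF E_fibre[OF v]]])
      finally show ?thesis
        using F.hnorm_nonneg[OF E_fibre[OF v], of x] by (simp add: mult.commute)
    qed
    show "continuous_on UNIV (\<lambda>x. ip (Hx x) (v x) (w x))"
      unfolding continuous_on_UNIV_iff_nhds
    proof
      fix x0
      obtain Y where Y: "Y \<in> K" "x0 \<in> Y"
        using K_cover by blast
      have "((\<lambda>x. ip (Hx x) (v x) (w x) - ip (Hx x0) (v x0) (w x0)) \<longlongrightarrow> 0) (nhds x0)"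
      proof (rule Lim_null_comparison)
        show "((\<lambda>x. nx x (v x \<ominus>\<^bsub>Hx x\<^esub> transport Y x0 x (v x0)) * B + nx x0 (v x0) * nx x (w x \<ominus>\<^bsub>Hx x\<^esub> transport Y x0 x (w x0))) \<longlongrightarrow> 0) (nhds x0)"
          using tendsto_add[OF tendsto_mult_right[OF E_near[OF v Y], of B] tendsto_mult_left[OF E_near[OF w Y], of "nx x0 (v x0)"]] by simp
        show "\<forall>\<^sub>F x in nhds x0. norm (ip (Hx x) (v x) (w x) - ip (Hx x0) (v x0) (w x0)) \<le>
          nx x (v x \<ominus>\<^bsub>Hx x\<^esub> transport Y x0 x (v x0)) * B + nx x0 (v x0) * nx x (w x \<ominus>\<^bsub>Hx x\<^esub> transport Y x0 x (w x0))"
          using eventually_mem[OF Y]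
        proof (rule eventually_mono)
          fix x assume x: "x \<in> Y"
          define s where "s = transport Y x0 x (v x0)"
          define t where "t = transport Y x0 x (w x0)"
          have st: "s \<in> carrier (Hx x)" "nx x s = nx x0 (v x0)" "t \<in> carrier (Hx x)"
            "ip (Hx x) s t = ip (Hx x0) (v x0) (w x0)"
            using transport_closed[OF Y x] transport_hnorm[OF Y x] transport_ip[OF Y x] E_fibre[OF v] E_fibre[OF w]
            by (simp_all add: s_def t_def)
          have vw: "v x \<in> carrier (Hx x)" "w x \<in> carrier (Hx x)"
            using E_fibre v w by auto
          have "ip (Hx x) (v x) (w x) - ip (Hx x) s t = ip (Hx x) (v x \<ominus>\<^bsub>Hx x\<^esub> s) (w x) + ip (Hx x) s (w x \<ominus>\<^bsub>Hx x\<^esub> t)"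
            using st vw by (simp add: F.ip_minus F.ip_minus_left)
          then have "cmod (ip (Hx x) (v x) (w x) - ip (Hx x) s t) \<le>
            cmod (ip (Hx x) (v x \<ominus>\<^bsub>Hx x\<^esub> s) (w x)) + cmod (ip (Hx x) s (w x \<ominus>\<^bsub>Hx x\<^esub> t))"
            using norm_triangle_ineq by metis
          also have "\<dots> \<le> nx x (v x \<ominus>\<^bsub>Hx x\<^esub> s) * nx x (w x) + nx x s * nx x (w x \<ominus>\<^bsub>Hx x\<^esub> t)"
            by (intro add_mono F.cauchy_schwarz) (use st vw in auto)
          also have "\<dots> \<le> nx x (v x \<ominus>\<^bsub>Hx x\<^esub> s) * B + nx x s * nx x (w x \<ominus>\<^bsub>Hx x\<^esub> t)"
            using mult_left_mono[OF B(2)[of x] F.hnorm_nonneg[OF F.v_minus_closed[OF vw(1) st(1)]]] by simp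
          finally show "norm (ip (Hx x) (v x) (w x) - ip (Hx x0) (v x0) (w x0)) \<le>
            nx x (v x \<ominus>\<^bsub>Hx x\<^esub> transport Y x0 x (v x0)) * B + nx x0 (v x0) * nx x (w x \<ominus>\<^bsub>Hx x\<^esub> transport Y x0 x (w x0))"
            unfolding s_def[symmetric] t_def[symmetric] st(2) st(4) by simp
        qed
      qed
      then show "((\<lambda>x. ip (Hx x) (v x) (w x)) \<longlongrightarrow> ip (Hx x0) (v x0) (w x0)) (nhds x0)"
        by (simp add: LIM_zero_iff)
    qed
  qed
qed

text \<open>A three term estimate: the error at x, the continuity of the approximant, and the error
  at x0, which the transport carries to x isometrically.\<close>

lemma E_uniform_limit:
  assumes v: "\<And>x. v x \<in> carrier (Hx x)"
    and ap: "\<And>e. e > 0 \<Longrightarrow> \<exists>w\<in>carrier E. \<forall>x. nx x (w x \<ominus>\<^bsub>Hx x\<^esub> v x) \<le> e"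
  shows "v \<in> carrier E"
  unfolding E_iff
proof (intro conjI allI v)
  show "vanishing v"
    unfolding vanishing_def
  proof (intro allI impI)
    fix e :: real assume e: "e > 0"
    obtain w where w: "w \<in> carrier E" "\<And>x. nx x (w x \<ominus>\<^bsub>Hx x\<^esub> v x) \<le> e / 2"
      using ap[of "e / 2"] e by auto
    obtain C where C: "compact C" "\<And>x. x \<notin> C \<Longrightarrow> nx x (w x) < e / 2"
      using w(1) e unfolding E_iff vanishing_def by (meson half_gt_zero)
    have "nx x (v x) < e" if "x \<notin> C" for x
      using C(2)[OF that] w(2)[of x] F.N.n_le_add_minus[OF v E_fibre[OF w(1)], of x]
        F.N.n_minus_commute[OF v E_fibre[OF w(1)], of x] by simp
    then show "\<exists>C. compact C \<and> (\<forall>x. x \<notin> C \<longrightarrow> nx x (v x) < e)"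
      using C(1) by blast
  qed
  show "continuous_section v"
    unfolding continuous_section_def
  proof (intro ballI tendstoI)
    fix Y x0 and e :: real assume Y: "Y \<in> K" "x0 \<in> Y" and e: "e > 0"
    obtain w where w: "w \<in> carrier E" "\<And>x. nx x (w x \<ominus>\<^bsub>Hx x\<^esub> v x) \<le> e / 4"
      using ap[of "e / 4"] e by auto
    have "\<forall>\<^sub>F x in nhds x0. nx x (w x \<ominus>\<^bsub>Hx x\<^esub> transport Y x0 x (w x0)) < e / 4"
      by (rule order_tendstoD(2)[OF E_near[OF w(1) Y]]) (use e in simp)
    then show "\<forall>\<^sub>F x in nhds x0. dist (nx x (v x \<ominus>\<^bsub>Hx x\<^esub> transport Y x0 x (v x0))) 0 < e"
      using eventually_mem[OF Y]
    proof (rule eventually_elim2)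
      fix x assume n: "nx x (w x \<ominus>\<^bsub>Hx x\<^esub> transport Y x0 x (w x0)) < e / 4" and x: "x \<in> Y"
      have c: "v x \<in> carrier (Hx x)" "w x \<in> carrier (Hx x)" "transport Y x0 x (v x0) \<in> carrier (Hx x)"
        "transport Y x0 x (w x0) \<in> carrier (Hx x)"
        using v E_fibre[OF w(1)] transport_closed[OF Y x] by auto
      have "nx x (transport Y x0 x (w x0) \<ominus>\<^bsub>Hx x\<^esub> transport Y x0 x (v x0)) \<le> e / 4"
        using w(2)[of x0] transport_minus[OF Y x E_fibre[OF w(1)] v] transport_hnorm[OF Y x F.v_minus_closed[OF E_fibre[OF w(1)] v]]
        by simp
      then have "nx x (v x \<ominus>\<^bsub>Hx x\<^esub> transport Y x0 x (v x0)) < e"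
        using F.N.n_minus_triangle[OF c(1,2,3)] F.N.n_minus_triangle[OF c(2,4,3)] w(2)[of x] n
          F.N.n_minus_commute[OF c(1,2)] e by linarith
      then show "dist (nx x (v x \<ominus>\<^bsub>Hx x\<^esub> transport Y x0 x (v x0))) 0 < e"
        using F.hnorm_nonneg[OF F.v_minus_closed[OF c(1,3)]] by simp
    qed
  qed
qed

end

subsection \<open>Adjointable operators\<close>

context hilbert_bundle
begin

abbreviation "Nm \<equiv> module_norm (C0_alg :: ('x \<Rightarrow> complex) star_alg) E"

sublocale EM: complex_module E
proof (rule complex_moduleI)
  show "v \<oplus>\<^bsub>E\<^esub> w \<in> carrier E" if "v \<in> carrier E" "w \<in> carrier E" for v w
    using E_add[OF that] by simp
  show "c \<odot>\<^bsub>E\<^esub> v \<in> carrier E" if "v \<in> carrier E" for c v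
    using E_smult[OF that] by simp
  show "\<zero>\<^bsub>E\<^esub> \<in> carrier E"
    using E_zero by simp
qed (simp_all add: fun_eq_iff E_fibre F.v_assoc F.v_comm F.v_lcomm F.v_add_smult F.v_smult_add)

lemma E_minus: "v \<in> carrier E \<Longrightarrow> w \<in> carrier E \<Longrightarrow> (v \<ominus>\<^bsub>E\<^esub> w) x = v x \<ominus>\<^bsub>Hx x\<^esub> w x"
  by (subst EM.v_minus) (simp_all add: F.v_minus E_fibre)

lemma Nm_upper: "v \<in> carrier E \<Longrightarrow> nx x (v x) \<le> Nm v"
proof -
  assume v: "v \<in> carrier E"
  have "(nx x (v x))\<^sup>2 \<le> nrm C0_alg (ip E v v)"
    using C0_nrm_upper[OF E_ip_C0[OF v v], of x] F.ip_self[OF E_fibre[OF v], of x] by (simp add: norm_power)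
  then show ?thesis
    unfolding module_norm_def by (rule real_le_rsqrt)
qed

lemma Nm_nonneg: "v \<in> carrier E \<Longrightarrow> 0 \<le> Nm v"
  by (rule order_trans[OF F.hnorm_nonneg[OF E_fibre] Nm_upper])

lemma Nm_least:
  assumes v: "v \<in> carrier E" and c: "\<And>x. nx x (v x) \<le> c"
  shows "Nm v \<le> c"
proof -
  have c0: "0 \<le> c"
    by (rule order_trans[OF F.hnorm_nonneg[OF E_fibre[OF v]] c])
  have n: "nrm C0_alg (ip E v v) \<le> c\<^sup>2"
  proof (rule C0_nrm_least)
    fix x
    have "(nx x (v x))\<^sup>2 \<le> c\<^sup>2"
      by (rule power_mono[OF c F.hnorm_nonneg[OF E_fibre[OF v]]])
    then show "cmod (ip E v v x) \<le> c\<^sup>2"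
      using F.ip_self[OF E_fibre[OF v], of x] by (simp add: norm_power)
  qed
  show ?thesis
    unfolding module_norm_def by (rule real_le_lsqrt[OF c0 n])
qed

sublocale EN: normed_module E Nm
proof
  fix v assume v: "v \<in> carrier E"
  show "0 \<le> Nm v"
    by (rule Nm_nonneg[OF v])
  show "Nm v = 0 \<longleftrightarrow> v = \<zero>\<^bsub>E\<^esub>"
  proof
    assume 0: "Nm v = 0"
    have "v x = \<zero>\<^bsub>Hx x\<^esub>" for x
    proof -
      have "nx x (v x) = 0"
        using Nm_upper[OF v, of x] F.hnorm_nonneg[OF E_fibre[OF v], of x] 0 by linarith
      then show ?thesis
        using F.N.n_eq_0[OF E_fibre[OF v]] by blast
    qed
    then show "v = \<zero>\<^bsub>E\<^esub>"
      by (simp add: fun_eq_iff)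
  next
    assume "v = \<zero>\<^bsub>E\<^esub>"
    then have "Nm v \<le> 0"
      by (intro Nm_least v) simp
    then show "Nm v = 0"
      using Nm_nonneg[OF v] by linarith
  qed
  have le: "Nm (c \<odot>\<^bsub>E\<^esub> v) \<le> cmod c * Nm v" if v: "v \<in> carrier E" for c v
    by (rule Nm_least[OF EM.v_smult[OF v]])
      (simp add: F.hnorm_smult E_fibre[OF v] mult_left_mono[OF Nm_upper[OF v]])
  show "Nm (c \<odot>\<^bsub>E\<^esub> v) = cmod c * Nm v" for c
  proof (cases "c = 0")
    case True
    then show ?thesis
      using le[OF v, of c] Nm_nonneg[OF EM.v_smult[OF v, of c]] by (simp del: E_sel)
  next
    case False
    have "Nm ((1 / c) \<odot>\<^bsub>E\<^esub> (c \<odot>\<^bsub>E\<^esub> v)) \<le> cmod (1 / c) * Nm (c \<odot>\<^bsub>E\<^esub> v)"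
      by (rule le[OF EM.v_smult[OF v]])
    then have "cmod c * Nm v \<le> Nm (c \<odot>\<^bsub>E\<^esub> v)"
      using False by (simp add: EM.v_smult_smult[OF v] EM.v_one[OF v] norm_divide field_simps del: E_sel)
    then show ?thesis
      using le[OF v, of c] by simp
  qed
  fix w assume w: "w \<in> carrier E"
  show "Nm (v \<oplus>\<^bsub>E\<^esub> w) \<le> Nm v + Nm w"
  proof (rule Nm_least[OF EM.v_add[OF v w]])
    show "nx x ((v \<oplus>\<^bsub>E\<^esub> w) x) \<le> Nm v + Nm w" for x
      using F.N.n_triangle[OF E_fibre[OF v] E_fibre[OF w], of x] Nm_upper[OF v, of x] Nm_upper[OF w, of x] by simp
  qed
qed

lemma E_complete: "norm_complete E Nm"
  unfolding EN.norm_complete_iff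
proof safe
  fix s assume s: "EN.cauchy_seq s"
  then have sE: "s k \<in> carrier E" for k
    by (simp add: EN.cauchy_seq_def)
  have c: "\<exists>N. \<forall>i\<ge>N. \<forall>j\<ge>N. \<forall>x. nx x (s i x \<ominus>\<^bsub>Hx x\<^esub> s j x) \<le> e" if e: "e > 0" for e
  proof -
    obtain N where N: "\<forall>i\<ge>N. \<forall>j\<ge>N. Nm (s i \<ominus>\<^bsub>E\<^esub> s j) < e"
      using s e unfolding EN.cauchy_seq_def by blast
    have "nx x (s i x \<ominus>\<^bsub>Hx x\<^esub> s j x) \<le> e" if "i \<ge> N" "j \<ge> N" for i j x
    proof -
      have "nx x (s i x \<ominus>\<^bsub>Hx x\<^esub> s j x) \<le> Nm (s i \<ominus>\<^bsub>E\<^esub> s j)"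
        using Nm_upper[OF EM.v_minus_closed[OF sE[of i] sE[of j]], of x] by (simp add: E_minus[OF sE sE])
      also have "\<dots> < e"
        using N that by blast
      finally show ?thesis by simp
    qed
    then show ?thesis by blast
  qed
  obtain v where v: "\<And>x. v x \<in> carrier (Hx x)"
    "\<And>e. e > 0 \<Longrightarrow> \<exists>N. \<forall>k\<ge>N. \<forall>x. nx x (s k x \<ominus>\<^bsub>Hx x\<^esub> v x) \<le> e"
    by (rule uniform_complete[of Hx "\<lambda>x. nx x" s]) (use F.N.normed_module_axioms F.complete E_fibre[OF sE] c in auto)
  have vE: "v \<in> carrier E"
  proof (rule E_uniform_limit[OF v(1)])
    fix e :: real assume "e > 0"
    then obtain N where "\<forall>k\<ge>N. \<forall>x. nx x (s k x \<ominus>\<^bsub>Hx x\<^esub> v x) \<le> e"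
      using v(2) by blast
    then show "\<exists>w\<in>carrier E. \<forall>x. nx x (w x \<ominus>\<^bsub>Hx x\<^esub> v x) \<le> e"
      by (intro bexI[of _ "s N"] sE) simp
  qed
  have "(\<lambda>k. Nm (s k \<ominus>\<^bsub>E\<^esub> v)) \<longlonglongrightarrow> 0"
  proof (rule LIMSEQ_I)
    fix r :: real assume r: "r > 0"
    then have "r / 2 > 0"
      by simp
    then obtain N where N: "\<And>k x. k \<ge> N \<Longrightarrow> nx x (s k x \<ominus>\<^bsub>Hx x\<^esub> v x) \<le> r / 2"
      using v(2) by blast
    have "norm (Nm (s k \<ominus>\<^bsub>E\<^esub> v) - 0) < r" if "k \<ge> N" for k
    proof -
      have "Nm (s k \<ominus>\<^bsub>E\<^esub> v) \<le> r / 2"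
        by (rule Nm_least[OF EM.v_minus_closed[OF sE vE]]) (use N[OF that] in \<open>simp add: E_minus[OF sE vE]\<close>)
      then show ?thesis
        using Nm_nonneg[OF EM.v_minus_closed[OF sE[of k] vE]] r by simp
    qed
    then show "\<exists>N. \<forall>k\<ge>N. norm (Nm (s k \<ominus>\<^bsub>E\<^esub> v) - 0) < r"
      by blast
  qed
  then have "EN.tends s v"
    using sE vE by (simp add: EN.tends_def)
  then show "\<exists>x. EN.tends s x"
    by (rule exI[of _ v])
qed

lemma E_eqI_left:
  assumes x: "x \<in> carrier E" and y: "y \<in> carrier E" and eq: "\<And>u. u \<in> carrier E \<Longrightarrow> ip E x u = ip E y u"
  shows "x = y"
proof (rule ext)
  fix z
  have d: "x \<ominus>\<^bsub>E\<^esub> y \<in> carrier E"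
    using x y by (rule EM.v_minus_closed)
  have "ip (Hx z) (x z) (x z \<ominus>\<^bsub>Hx z\<^esub> y z) = ip (Hx z) (y z) (x z \<ominus>\<^bsub>Hx z\<^esub> y z)"
    using fun_cong[OF eq[OF d], of z] by (simp add: E_minus[OF x y])
  then have "ip (Hx z) (x z \<ominus>\<^bsub>Hx z\<^esub> y z) (x z \<ominus>\<^bsub>Hx z\<^esub> y z) = 0"
    by (simp add: F.ip_minus_left E_fibre x y)
  then show "x z = y z"
    using F.ip_definite[OF F.v_minus_closed[OF E_fibre[OF x] E_fibre[OF y]]] F.v_minus_eq0[OF E_fibre[OF x] E_fibre[OF y]] by blast
qed

lemma E_ip_swap: "v \<in> carrier E \<Longrightarrow> w \<in> carrier E \<Longrightarrow> ip E w v = (\<lambda>x. cnj (ip E v w x))"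
  using F.ip_cnj[OF E_fibre[of v] E_fibre[of w]] by (simp add: fun_eq_iff)

lemma E_eqI_right:
  assumes x: "x \<in> carrier E" and y: "y \<in> carrier E" and eq: "\<And>u. u \<in> carrier E \<Longrightarrow> ip E u x = ip E u y"
  shows "x = y"
proof (rule E_eqI_left[OF x y])
  fix u assume u: "u \<in> carrier E"
  show "ip E x u = ip E y u"
    unfolding E_ip_swap[OF u x] E_ip_swap[OF u y] eq[OF u] ..
qed

definition AOps :: "(('x \<Rightarrow> 'k) \<Rightarrow> 'x \<Rightarrow> 'k) set" where
  "AOps = {T \<in> carrier E \<rightarrow>\<^sub>E carrier E. \<exists>S\<in>carrier E \<rightarrow> carrier E.
        \<forall>v\<in>carrier E. \<forall>w\<in>carrier E. ip E (T v) w = ip E v (S w)}"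

lemma adjointable_operators_eq: "adjointable_operators C0_alg E = operator_algebra E Nm AOps"
  unfolding adjointable_operators_def AOps_def ..

lemma AOpsI:
  assumes "\<And>v. v \<in> carrier E \<Longrightarrow> T v \<in> carrier E" "\<And>v. v \<in> carrier E \<Longrightarrow> S v \<in> carrier E"
    "\<And>v w. v \<in> carrier E \<Longrightarrow> w \<in> carrier E \<Longrightarrow> ip E (T v) w = ip E v (S w)"
  shows "(\<lambda>v\<in>carrier E. T v) \<in> AOps"
  using assms unfolding AOps_def by (intro CollectI conjI bexI[of _ S]) auto

lemma AOpsD:
  assumes "T \<in> AOps"
  shows "T \<in> carrier E \<rightarrow>\<^sub>E carrier E"
    and "\<exists>S. (\<forall>v\<in>carrier E. S v \<in> carrier E) \<and> (\<forall>v\<in>carrier E. \<forall>w\<in>carrier E. ip E (T v) w = ip E v (S w))"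
proof -
  show "T \<in> carrier E \<rightarrow>\<^sub>E carrier E"
    using assms by (simp add: AOps_def)
  obtain S where S: "S \<in> carrier E \<rightarrow> carrier E" "\<forall>v\<in>carrier E. \<forall>w\<in>carrier E. ip E (T v) w = ip E v (S w)"
    using assms unfolding AOps_def by blast
  show "\<exists>S. (\<forall>v\<in>carrier E. S v \<in> carrier E) \<and> (\<forall>v\<in>carrier E. \<forall>w\<in>carrier E. ip E (T v) w = ip E v (S w))"
    by (rule exI[of _ S]) (use S in auto)
qed

lemma ip_E_nrm_le: "v \<in> carrier E \<Longrightarrow> w \<in> carrier E \<Longrightarrow> nrm C0_alg (ip E v w) \<le> Nm v * Nm w"
proof (rule C0_nrm_least)
  fix x assume v: "v \<in> carrier E" and w: "w \<in> carrier E"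
  have "cmod (ip E v w x) \<le> nx x (v x) * nx x (w x)"
    using F.cauchy_schwarz[OF E_fibre[OF v] E_fibre[OF w]] by simp
  also have "\<dots> \<le> Nm v * Nm w"
    by (rule mult_mono[OF Nm_upper[OF v] Nm_upper[OF w] Nm_nonneg[OF v] F.hnorm_nonneg[OF E_fibre[OF w]]])
  finally show "cmod (ip E v w x) \<le> Nm v * Nm w" .
qed

text \<open>The maps w \<mapsto> <T z, w> with z in the unit ball are pointwise bounded, as <T z, w>
  = <z, S w> has norm at most that of S w. By uniform boundedness they are bounded on the unit ball,
  and taking w proportional to T z bounds T z itself.\<close>

lemma AOps_bounded:
  assumes T: "T \<in> AOps"
  shows "\<exists>c. \<forall>v\<in>carrier E. Nm (T v) \<le> c * Nm v"
proof -
  interpret C0: cstar_algebra "C0_alg :: ('x \<Rightarrow> complex) star_alg" by (rule C0_alg_cstar)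
  obtain S where S: "\<And>v. v \<in> carrier E \<Longrightarrow> S v \<in> carrier E"
    "\<And>v w. v \<in> carrier E \<Longrightarrow> w \<in> carrier E \<Longrightarrow> ip E (T v) w = ip E v (S w)"
    using AOpsD(2)[OF T] by blast
  have Tc: "T v \<in> carrier E" if "v \<in> carrier E" for v
    using AOpsD(1)[OF T] that by (rule PiE_mem)
  \<comment> \<open>Uniform boundedness is stated for a family indexed by a whole type; vectors
    outside the unit ball are therefore replaced by 0.\<close>
  define z where "z v = (if v \<in> carrier E \<and> Nm v \<le> 1 then v else \<zero>\<^bsub>E\<^esub>)" for v
  have zc: "z v \<in> carrier E" "Nm (z v) \<le> 1" for v
    using EN.n_zero by (auto simp: z_def simp del: E_sel)
  define q where "q v w = nrm C0_alg (ip E (T (z v)) w)" for v w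
  have C: "ip E (T (z v)) w \<in> carrier C0_alg" if "w \<in> carrier E" for v w
    using E_ip_C0[OF Tc[OF zc(1)] that] by simp
  have "\<exists>B. \<forall>v. \<forall>w\<in>carrier E. Nm w \<le> 1 \<longrightarrow> q v w \<le> B"
  proof (rule EN.uniform_boundedness[OF E_complete])
    fix v x y c assume x: "x \<in> carrier E"
    have "ip E (T (z v)) (c \<odot>\<^bsub>E\<^esub> x) = c \<odot>\<^bsub>C0_alg\<^esub> ip E (T (z v)) x"
      using x Tc[OF zc(1)] by (simp add: F.ip_smult E_fibre)
    then show "q v (c \<odot>\<^bsub>E\<^esub> x) = cmod c * q v x"
      using C0.nrm_smult[OF C[OF x]] by (simp add: q_def)
    assume y: "y \<in> carrier E"
    have "ip E (T (z v)) (x \<oplus>\<^bsub>E\<^esub> y) = ip E (T (z v)) x \<oplus>\<^bsub>C0_alg\<^esub> ip E (T (z v)) y"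
      using x y Tc[OF zc(1)] by (simp add: F.ip_add E_fibre)
    then show "q v (x \<oplus>\<^bsub>E\<^esub> y) \<le> q v x + q v y"
      using C0.nrm_triangle[OF C[OF x] C[OF y]] by (simp add: q_def)
  next
    fix v
    show "\<exists>C. \<forall>x\<in>carrier E. q v x \<le> C * Nm x"
      using ip_E_nrm_le[OF Tc[OF zc(1)]] unfolding q_def by blast
  next
    fix x assume x: "x \<in> carrier E"
    show "\<exists>B. \<forall>v. q v x \<le> B"
    proof (intro exI allI)
      fix v
      have "q v x \<le> Nm (z v) * Nm (S x)"
        unfolding q_def S(2)[OF zc(1) x] by (rule ip_E_nrm_le[OF zc(1) S(1)[OF x]])
      also have "\<dots> \<le> 1 * Nm (S x)"
        by (rule mult_right_mono[OF zc(2) Nm_nonneg[OF S(1)[OF x]]])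
      finally show "q v x \<le> Nm (S x)"
        by simp
    qed
  qed
  then obtain B where B: "\<And>v w. w \<in> carrier E \<Longrightarrow> Nm w \<le> 1 \<Longrightarrow> q v w \<le> B"
    by blast
  have sq: "nrm C0_alg (ip E v v) = (Nm v)\<^sup>2" if "v \<in> carrier E" for v
  proof -
    have "0 \<le> nrm C0_alg (ip E v v)"
      using C0.nrm_nonneg[of "ip E v v"] E_ip_C0[OF that that] by simp
    then show ?thesis
      by (simp add: module_norm_def)
  qed
  have scale: "Nm (complex_of_real (1 / Nm v) \<odot>\<^bsub>E\<^esub> v) \<le> 1" if "v \<in> carrier E" "Nm v > 0" for v
    using EN.n_smult[OF that(1), of "complex_of_real (1 / Nm v)"] that(2) by (simp add: norm_divide del: E_sel)
  have unit: "Nm (T v) \<le> B" if v: "v \<in> carrier E" "Nm v \<le> 1" for v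
  proof (cases "Nm (T v) > 0")
    case True
    define w where "w = complex_of_real (1 / Nm (T v)) \<odot>\<^bsub>E\<^esub> T v"
    have w: "w \<in> carrier E" "Nm w \<le> 1"
      using scale[OF Tc[OF v(1)] True] EM.v_smult[OF Tc[OF v(1)]] by (simp_all add: w_def del: E_sel)
    have "ip E (T v) w = complex_of_real (1 / Nm (T v)) \<odot>\<^bsub>C0_alg\<^esub> ip E (T v) (T v)"
      using Tc[OF v(1)] by (simp add: w_def F.ip_smult E_fibre)
    then have "nrm C0_alg (ip E (T v) w) = (1 / Nm (T v)) * (Nm (T v))\<^sup>2"
      using C0.nrm_smult[of "ip E (T v) (T v)" "complex_of_real (1 / Nm (T v))"] E_ip_C0[OF Tc[OF v(1)] Tc[OF v(1)]] True
        sq[OF Tc[OF v(1)]] by (simp add: norm_divide)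
    also have "\<dots> = Nm (T v)"
      using True by (simp add: power2_eq_square)
    finally have "Nm (T v) = q v w"
      using v by (simp add: q_def z_def)
    also have "\<dots> \<le> B"
      by (rule B[OF w])
    finally show ?thesis .
  next
    \<comment> \<open>When T v has norm 0 only B \<ge> 0 is to be shown, and the test vector 0 gives
      that.\<close>
    case False
    have "0 \<le> q v \<zero>\<^bsub>E\<^esub>"
      unfolding q_def by (rule C0.nrm_nonneg[OF C[OF EM.v_zero]])
    also have "\<dots> \<le> B"
      by (rule B[OF EM.v_zero]) (simp only: EN.n_zero zero_le_one)
    finally show ?thesis
      using False by linarith
  qed
  have Tsc: "T (c \<odot>\<^bsub>E\<^esub> v) = c \<odot>\<^bsub>E\<^esub> T v" if v: "v \<in> carrier E" for c v
  proof (rule E_eqI_left[OF Tc[OF EM.v_smult[OF v]] EM.v_smult[OF Tc[OF v]]])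
    fix u assume u: "u \<in> carrier E"
    show "ip E (T (c \<odot>\<^bsub>E\<^esub> v)) u = ip E (c \<odot>\<^bsub>E\<^esub> T v) u"
      using S(2)[OF EM.v_smult[OF v] u, of c] S(2)[OF v u] v u Tc[OF v] S(1)[OF u]
      by (simp add: F.ip_smult_left E_fibre fun_eq_iff)
  qed
  have "Nm (T v) \<le> B * Nm v" if v: "v \<in> carrier E" for v
  proof (cases "Nm v > 0")
    case True
    have "Nm (T (complex_of_real (1 / Nm v) \<odot>\<^bsub>E\<^esub> v)) \<le> B"
      by (rule unit[OF EM.v_smult[OF v] scale[OF v True]])
    then show ?thesis
      unfolding Tsc[OF v] EN.n_smult[OF Tc[OF v]] using True by (simp add: norm_divide field_simps)
  next
    case False
    then have "Nm v = 0"
      using Nm_nonneg[OF v] by linarith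
    then have v0: "v = 0 \<odot>\<^bsub>E\<^esub> v"
      using EN.n_eq_0[OF v] EM.v_zero_smult[OF v] by simp
    have "Nm (T v) = 0"
      using EN.n_smult[OF Tc[OF v], of 0] Tsc[OF v, of 0] v0 by simp
    then show ?thesis
      using \<open>Nm v = 0\<close> by simp
  qed
  then show ?thesis
    by blast
qed

sublocale A: operator_space E Nm AOps
proof
  fix T assume T: "T \<in> AOps"
  obtain S where S: "\<And>v. v \<in> carrier E \<Longrightarrow> S v \<in> carrier E"
    "\<And>v w. v \<in> carrier E \<Longrightarrow> w \<in> carrier E \<Longrightarrow> ip E (T v) w = ip E v (S w)"
    using AOpsD(2)[OF T] by blast
  have Tc: "T v \<in> carrier E" if "v \<in> carrier E" for v
    using AOpsD(1)[OF T] that by (rule PiE_mem)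
  show "T \<in> carrier E \<rightarrow>\<^sub>E carrier E"
    by (rule AOpsD(1)[OF T])
  show "\<exists>c. \<forall>x\<in>carrier E. Nm (T x) \<le> c * Nm x"
    by (rule AOps_bounded[OF T])
  \<comment> \<open>Linearity is forced by the existence of an adjoint: both sides of each identity
    have the same inner products with all sections.\<close>
  show "linear_map E E T"
    unfolding linear_map_def
  proof (intro conjI ballI allI funcsetI Tc)
    fix v w assume v: "v \<in> carrier E" and w: "w \<in> carrier E"
    show "T (v \<oplus>\<^bsub>E\<^esub> w) = T v \<oplus>\<^bsub>E\<^esub> T w"
    proof (rule E_eqI_left[OF Tc[OF EM.v_add[OF v w]] EM.v_add[OF Tc[OF v] Tc[OF w]]])
      fix u assume u: "u \<in> carrier E"
      show "ip E (T (v \<oplus>\<^bsub>E\<^esub> w)) u = ip E (T v \<oplus>\<^bsub>E\<^esub> T w) u"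
        using S(2)[OF EM.v_add[OF v w] u] S(2)[OF v u] S(2)[OF w u] v w u Tc[OF v] Tc[OF w] S(1)[OF u]
        by (simp add: F.ip_add_left E_fibre fun_eq_iff)
    qed
  next
    fix c v assume v: "v \<in> carrier E"
    show "T (c \<odot>\<^bsub>E\<^esub> v) = c \<odot>\<^bsub>E\<^esub> T v"
    proof (rule E_eqI_left[OF Tc[OF EM.v_smult[OF v]] EM.v_smult[OF Tc[OF v]]])
      fix u assume u: "u \<in> carrier E"
      show "ip E (T (c \<odot>\<^bsub>E\<^esub> v)) u = ip E (c \<odot>\<^bsub>E\<^esub> T v) u"
        using S(2)[OF EM.v_smult[OF v] u, of c] S(2)[OF v u] v u Tc[OF v] S(1)[OF u]
        by (simp add: F.ip_smult_left E_fibre fun_eq_iff)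
    qed
  qed
  show "(\<lambda>v\<in>carrier E. c \<odot>\<^bsub>E\<^esub> T v) \<in> AOps" for c
  proof (rule AOpsI[of _ "\<lambda>w. cnj c \<odot>\<^bsub>E\<^esub> S w"])
    fix v w assume v: "v \<in> carrier E" and w: "w \<in> carrier E"
    show "ip E (c \<odot>\<^bsub>E\<^esub> T v) w = ip E v (cnj c \<odot>\<^bsub>E\<^esub> S w)"
      using S(2)[OF v w] v w Tc[OF v] S(1)[OF w] by (simp add: F.ip_smult_left F.ip_smult E_fibre fun_eq_iff)
  qed (simp_all only: EM.v_smult Tc S(1))
  fix R assume R: "R \<in> AOps"
  obtain Q where Q: "\<And>v. v \<in> carrier E \<Longrightarrow> Q v \<in> carrier E"
    "\<And>v w. v \<in> carrier E \<Longrightarrow> w \<in> carrier E \<Longrightarrow> ip E (R v) w = ip E v (Q w)"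
    using AOpsD(2)[OF R] by blast
  have Rc: "R v \<in> carrier E" if "v \<in> carrier E" for v
    using AOpsD(1)[OF R] that by (rule PiE_mem)
  show "(\<lambda>v\<in>carrier E. T v \<oplus>\<^bsub>E\<^esub> R v) \<in> AOps"
  proof (rule AOpsI[of _ "\<lambda>w. S w \<oplus>\<^bsub>E\<^esub> Q w"])
    fix v w assume v: "v \<in> carrier E" and w: "w \<in> carrier E"
    show "ip E (T v \<oplus>\<^bsub>E\<^esub> R v) w = ip E v (S w \<oplus>\<^bsub>E\<^esub> Q w)"
      using S(2)[OF v w] Q(2)[OF v w] v w Tc[OF v] Rc[OF v] S(1)[OF w] Q(1)[OF w]
      by (simp add: F.ip_add_left F.ip_add E_fibre fun_eq_iff)
  qed (simp_all only: EM.v_add Tc Rc S(1) Q(1))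
  show "(\<lambda>v\<in>carrier E. T (R v)) \<in> AOps"
    by (rule AOpsI[of _ "\<lambda>w. Q (S w)"]) (simp_all only: S Q Tc Rc)
next
  show "(\<lambda>v\<in>carrier E. \<zero>\<^bsub>E\<^esub>) \<in> AOps"
    by (rule AOpsI[of _ "\<lambda>v. \<zero>\<^bsub>E\<^esub>"]) (simp_all add: E_zero E_fibre)
qed

lemma adjoint_E_eqI:
  assumes "S \<in> AOps" "\<And>v w. v \<in> carrier E \<Longrightarrow> w \<in> carrier E \<Longrightarrow> ip E (T v) w = ip E v (S w)"
  shows "adjoint_op E T = S"
  by (rule adjoint_op_eq[OF AOpsD(1)[OF assms(1)] assms(2) E_eqI_right])

theorem E_hilbert_module: "hilbert_module C0_alg E"
proof (intro hilbert_module.intro hilbert_module_axioms.intro C0_alg_cstar EM.module_axioms E_complete)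
  fix v b assume v: "v \<in> carrier E" and b: "b \<in> carrier (C0_alg :: ('x \<Rightarrow> complex) star_alg)"
  show "ract E v b \<in> carrier E"
    using E_C0_smult[OF _ v] b by simp
next
  fix v w assume v: "v \<in> carrier E" and w: "w \<in> carrier E"
  show "ip E v w \<in> carrier C0_alg"
    using E_ip_C0[OF v w] by simp
  show "ip E w v = star C0_alg (ip E v w)"
    using E_ip_swap[OF v w] by simp
next
  fix v assume v: "v \<in> carrier E"
  have "ip E v v = star C0_alg (\<lambda>x. complex_of_real (nx x (v x))) \<otimes>\<^bsub>C0_alg\<^esub> (\<lambda>x. complex_of_real (nx x (v x)))"
    using F.ip_self[OF E_fibre[OF v]] by (simp add: power2_eq_square)
  then show "\<exists>b\<in>carrier C0_alg. ip E v v = star C0_alg b \<otimes>\<^bsub>C0_alg\<^esub> b"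
    using E_norm_C0[OF v] by (intro bexI[of _ "\<lambda>x. complex_of_real (nx x (v x))"]) simp_all
  assume "ip E v v = \<zero>\<^bsub>C0_alg\<^esub>"
  then have "ip (Hx x) (v x) (v x) = 0" for x
    by (simp add: fun_eq_iff)
  then show "v = \<zero>\<^bsub>E\<^esub>"
    using F.ip_definite[OF E_fibre[OF v]] by (simp add: fun_eq_iff)
qed (simp_all add: E_fibre F.v_smult_add F.v_add_smult F.ip_add F.ip_smult fun_eq_iff mult.commute mult.left_commute)

theorem E_hilbert_bimodule: "hilbert_bimodule C0_alg E"
  unfolding hilbert_bimodule_def adjointable_operators_eq
proof (intro conjI E_hilbert_module star_homI)
  have cl: "lact E b v \<in> carrier E" if "b \<in> C0 UNIV" "v \<in> carrier E" for b v
    using E_C0_smult[OF that] by simp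
  have adj: "ip E (lact E b v) w = ip E v (lact E (\<lambda>x. cnj (b x)) w)" if "v \<in> carrier E" "w \<in> carrier E" for b v w
    using that by (simp add: F.ip_smult_left F.ip_smult E_fibre)
  have mem: "(\<lambda>v\<in>carrier E. lact E b v) \<in> AOps" if b: "b \<in> C0 UNIV" for b
    by (rule AOpsI[OF cl[OF b] cl[OF C0_cnj[OF b]] adj])
  fix b assume "b \<in> carrier (C0_alg :: ('x \<Rightarrow> complex) star_alg)"
  then have b: "b \<in> C0 UNIV"
    by simp
  show "(\<lambda>v\<in>carrier E. lact E b v) \<in> carrier A.OA"
    using mem[OF b] by simp
  show "(\<lambda>v\<in>carrier E. lact E (c \<odot>\<^bsub>C0_alg\<^esub> b) v) = c \<odot>\<^bsub>A.OA\<^esub> (\<lambda>v\<in>carrier E. lact E b v)" for c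
    unfolding operator_algebra_sel by (rule restrict_ext) (simp add: E_fibre)
  have "adjoint_op E (\<lambda>v\<in>carrier E. lact E b v) = (\<lambda>v\<in>carrier E. lact E (\<lambda>x. cnj (b x)) v)"
    by (rule adjoint_E_eqI[OF mem[OF C0_cnj[OF b]]]) (use adj in \<open>simp del: E_sel\<close>)
  then show "(\<lambda>v\<in>carrier E. lact E (star C0_alg b) v) = star A.OA (\<lambda>v\<in>carrier E. lact E b v)"
    by (simp del: E_sel)
  fix d assume "d \<in> carrier (C0_alg :: ('x \<Rightarrow> complex) star_alg)"
  then have d: "d \<in> C0 UNIV"
    by simp
  show "(\<lambda>v\<in>carrier E. lact E (b \<oplus>\<^bsub>C0_alg\<^esub> d) v) = (\<lambda>v\<in>carrier E. lact E b v) \<oplus>\<^bsub>A.OA\<^esub> (\<lambda>v\<in>carrier E. lact E d v)"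
    unfolding operator_algebra_sel by (rule restrict_ext) (simp add: E_fibre F.v_add_smult)
  show "(\<lambda>v\<in>carrier E. lact E (b \<otimes>\<^bsub>C0_alg\<^esub> d) v) = (\<lambda>v\<in>carrier E. lact E b v) \<otimes>\<^bsub>A.OA\<^esub> (\<lambda>v\<in>carrier E. lact E d v)"
    unfolding operator_algebra_sel by (rule restrict_ext) (simp add: E_fibre E_C0_smult[OF d])
qed

end

subsection \<open>Fields of operators\<close>

context hilbert_bundle
begin

definition bounded_field :: "('x \<Rightarrow> 'k \<Rightarrow> 'k) \<Rightarrow> bool" where
  "bounded_field b \<longleftrightarrow> (\<forall>x. b x \<in> F.BOps x) \<and> (\<exists>c\<ge>0. \<forall>x. \<forall>\<xi>\<in>carrier (Hx x). nx x (b x \<xi>) \<le> c * nx x \<xi>)"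

text \<open>Expressed through the effect on sections, since this is what makes a field of operators
  act on the module; \<open>continuous_fieldI\<close> gives a local criterion.\<close>

definition continuous_field :: "('x \<Rightarrow> 'k \<Rightarrow> 'k) \<Rightarrow> bool" where
  "continuous_field b \<longleftrightarrow> bounded_field b \<and> (\<forall>v\<in>carrier E. (\<lambda>x. b x (v x)) \<in> carrier E)"

lemma bounded_fieldD:
  assumes "bounded_field b"
  shows "b x \<in> F.BOps x" "\<xi> \<in> carrier (Hx x) \<Longrightarrow> b x \<xi> \<in> carrier (Hx x)"
    "\<exists>c\<ge>0. \<forall>x. \<forall>\<xi>\<in>carrier (Hx x). nx x (b x \<xi>) \<le> c * nx x \<xi>"
proof -
  show b: "b x \<in> F.BOps x"
    using assms by (simp add: bounded_field_def)
  show "\<xi> \<in> carrier (Hx x) \<Longrightarrow> b x \<xi> \<in> carrier (Hx x)"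
    by (rule F.BOpsD(3)[OF b])
  show "\<exists>c\<ge>0. \<forall>x. \<forall>\<xi>\<in>carrier (Hx x). nx x (b x \<xi>) \<le> c * nx x \<xi>"
    using assms by (simp add: bounded_field_def)
qed

lemma continuous_fieldD:
  assumes "continuous_field b"
  shows "bounded_field b" "b x \<in> F.BOps x" "\<xi> \<in> carrier (Hx x) \<Longrightarrow> b x \<xi> \<in> carrier (Hx x)"
    "v \<in> carrier E \<Longrightarrow> (\<lambda>x. b x (v x)) \<in> carrier E"
proof -
  show b: "bounded_field b"
    using assms by (simp add: continuous_field_def)
  show "b x \<in> F.BOps x" "\<xi> \<in> carrier (Hx x) \<Longrightarrow> b x \<xi> \<in> carrier (Hx x)"
    using bounded_fieldD[OF b] by auto
  show "v \<in> carrier E \<Longrightarrow> (\<lambda>x. b x (v x)) \<in> carrier E"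
    using assms by (simp add: continuous_field_def)
qed

text \<open>The difference of b x (v x) and the transported b x0 (v x0) is split at b x applied to
  the transported v x0. The first part is controlled by the uniform bound of the field and the
  continuity of v, the second by the hypothesis.\<close>

lemma continuous_fieldI:
  assumes b: "bounded_field b"
    and near: "\<And>Y x0 \<xi>. Y \<in> K \<Longrightarrow> x0 \<in> Y \<Longrightarrow> \<xi> \<in> carrier (Hx x0) \<Longrightarrow>
      ((\<lambda>x. nx x (b x (transport Y x0 x \<xi>) \<ominus>\<^bsub>Hx x\<^esub> transport Y x0 x (b x0 \<xi>))) \<longlongrightarrow> 0) (nhds x0)"
  shows "continuous_field b"
  unfolding continuous_field_def
proof (intro conjI b ballI)
  fix v assume v: "v \<in> carrier E"
  obtain c where c: "c \<ge> 0" "\<And>x \<xi>. \<xi> \<in> carrier (Hx x) \<Longrightarrow> nx x (b x \<xi>) \<le> c * nx x \<xi>"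
    using bounded_fieldD(3)[OF b] by blast
  have bc: "b x (v x) \<in> carrier (Hx x)" for x
    by (rule bounded_fieldD(2)[OF b E_fibre[OF v]])
  show "(\<lambda>x. b x (v x)) \<in> carrier E"
  proof (rule E_dominated[OF bc _ E_norm_C0[OF v]])
    show "nx x (b x (v x)) \<le> c * cmod (complex_of_real (nx x (v x)))" for x
      using c(2)[OF E_fibre[OF v], of x] F.hnorm_nonneg[OF E_fibre[OF v], of x] by simp
    show "continuous_section (\<lambda>x. b x (v x))"
    proof (rule continuous_sectionI)
      fix Y x0 assume Y: "Y \<in> K" "x0 \<in> Y"
      show "\<exists>g. (g \<longlongrightarrow> 0) (nhds x0) \<and>
        (\<forall>\<^sub>F x in nhds x0. nx x (b x (v x) \<ominus>\<^bsub>Hx x\<^esub> transport Y x0 x (b x0 (v x0))) \<le> g x)"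
      proof (intro exI conjI)
        show "((\<lambda>x. c * nx x (v x \<ominus>\<^bsub>Hx x\<^esub> transport Y x0 x (v x0)) +
          nx x (b x (transport Y x0 x (v x0)) \<ominus>\<^bsub>Hx x\<^esub> transport Y x0 x (b x0 (v x0)))) \<longlongrightarrow> 0) (nhds x0)"
          using tendsto_add[OF tendsto_mult_left[OF E_near[OF v Y], of c] near[OF Y E_fibre[OF v]]] by simp
        show "\<forall>\<^sub>F x in nhds x0. nx x (b x (v x) \<ominus>\<^bsub>Hx x\<^esub> transport Y x0 x (b x0 (v x0))) \<le>
          c * nx x (v x \<ominus>\<^bsub>Hx x\<^esub> transport Y x0 x (v x0)) +
          nx x (b x (transport Y x0 x (v x0)) \<ominus>\<^bsub>Hx x\<^esub> transport Y x0 x (b x0 (v x0)))"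
          using eventually_mem[OF Y]
        proof (rule eventually_mono)
          fix x assume x: "x \<in> Y"
          define t where "t = transport Y x0 x (v x0)"
          have t: "t \<in> carrier (Hx x)"
            unfolding t_def by (rule transport_closed[OF Y x E_fibre[OF v]])
          have d: "v x \<ominus>\<^bsub>Hx x\<^esub> t \<in> carrier (Hx x)"
            by (rule F.v_minus_closed[OF E_fibre[OF v] t])
          have "b x (v x \<ominus>\<^bsub>Hx x\<^esub> t) = b x (v x) \<ominus>\<^bsub>Hx x\<^esub> b x t"
            using linear_map_zero_minus(2)[OF F.BOpsD(2)[OF bounded_fieldD(1)[OF b]] F.complex_module_axioms F.complex_module_axioms E_fibre[OF v] t] .
          then have "nx x (b x (v x) \<ominus>\<^bsub>Hx x\<^esub> b x t) \<le> c * nx x (v x \<ominus>\<^bsub>Hx x\<^esub> t)"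
            using c(2)[OF d] by simp
          then show "nx x (b x (v x) \<ominus>\<^bsub>Hx x\<^esub> transport Y x0 x (b x0 (v x0))) \<le>
            c * nx x (v x \<ominus>\<^bsub>Hx x\<^esub> transport Y x0 x (v x0)) +
            nx x (b x (transport Y x0 x (v x0)) \<ominus>\<^bsub>Hx x\<^esub> transport Y x0 x (b x0 (v x0)))"
            unfolding t_def[symmetric]
            using F.N.n_minus_triangle[OF bc[of x] bounded_fieldD(2)[OF b t] transport_closed[OF Y x bc[of x0]]] by linarith
        qed
      qed
    qed (rule bc)
  qed
qed

lemma fibrewise_apply: "v \<in> carrier E \<Longrightarrow> fibrewise E b v = (\<lambda>x. b x (v x))"
  by (simp add: fibrewise_def)

text \<open>Adjoints in the single fibres do not suffice, for they have to send sections to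
  sections; hence continuity is demanded of the adjoint field as well.\<close>

lemma fibrewise_AOps:
  assumes b: "continuous_field b" and c: "continuous_field c"
    and adj: "\<And>x \<xi> \<eta>. \<xi> \<in> carrier (Hx x) \<Longrightarrow> \<eta> \<in> carrier (Hx x) \<Longrightarrow> ip (Hx x) (b x \<xi>) \<eta> = ip (Hx x) \<xi> (c x \<eta>)"
  shows "fibrewise E b \<in> AOps" "adjoint_op E (fibrewise E b) = fibrewise E c"
proof -
  have adj': "ip (Hx x) (c x \<xi>) \<eta> = ip (Hx x) \<xi> (b x \<eta>)" if "\<xi> \<in> carrier (Hx x)" "\<eta> \<in> carrier (Hx x)" for x \<xi> \<eta>
    using adj[OF that(2,1)] F.ip_cnj[OF that(2) continuous_fieldD(3)[OF c that(1)]] F.ip_cnj[OF continuous_fieldD(3)[OF b that(2)] that(1)] by simp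
  show b': "fibrewise E b \<in> AOps"
    unfolding fibrewise_def by (rule AOpsI[of _ "\<lambda>v x. c x (v x)"]) (simp_all add: continuous_fieldD(4) b c adj E_fibre)
  have c': "fibrewise E c \<in> AOps"
    unfolding fibrewise_def by (rule AOpsI[of _ "\<lambda>v x. b x (v x)"]) (simp_all add: continuous_fieldD(4) b c adj' E_fibre)
  show "adjoint_op E (fibrewise E b) = fibrewise E c"
    by (rule adjoint_E_eqI[OF c']) (simp add: fibrewise_apply adj E_fibre)
qed

definition at_point :: "(('x \<Rightarrow> 'k) \<times> ('x \<Rightarrow> 'k)) list \<Rightarrow> 'x \<Rightarrow> ('k \<times> 'k) list" where
  "at_point ps x = map (\<lambda>p. (fst p x, snd p x)) ps"

abbreviation "FR ps x \<xi> \<equiv> finite_rank (Hx x) (at_point ps x) \<xi>"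

lemma at_point_simps [simp]: "at_point [] x = []" "at_point (p # ps) x = (fst p x, snd p x) # at_point ps x"
  by (simp_all add: at_point_def)

lemma at_point_closed: "set ps \<subseteq> carrier E \<times> carrier E \<Longrightarrow> set (at_point ps x) \<subseteq> carrier (Hx x) \<times> carrier (Hx x)"
  by (auto simp: at_point_def E_fibre dest!: subsetD)

lemma FR_closed: "set ps \<subseteq> carrier E \<times> carrier E \<Longrightarrow> FR ps x \<xi> \<in> carrier (Hx x)"
  by (rule F.finite_rank_closed[OF at_point_closed])

text \<open>These fields are the compact module operators; the definition works fibrewise, where estimates are
  available.\<close>

definition compact_field :: "('x \<Rightarrow> 'k \<Rightarrow> 'k) \<Rightarrow> bool" where
  "compact_field b \<longleftrightarrow> (\<forall>x. \<forall>\<xi>\<in>carrier (Hx x). b x \<xi> \<in> carrier (Hx x)) \<and>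
    (\<forall>e>0. \<exists>ps. set ps \<subseteq> carrier E \<times> carrier E \<and>
      (\<forall>x. \<forall>\<xi>\<in>carrier (Hx x). nx x (b x \<xi> \<ominus>\<^bsub>Hx x\<^esub> FR ps x \<xi>) \<le> e * nx x \<xi>))"

lemma compact_fieldD:
  assumes "compact_field b"
  shows "\<xi> \<in> carrier (Hx x) \<Longrightarrow> b x \<xi> \<in> carrier (Hx x)"
    "e > 0 \<Longrightarrow> \<exists>ps. set ps \<subseteq> carrier E \<times> carrier E \<and>
      (\<forall>x. \<forall>\<xi>\<in>carrier (Hx x). nx x (b x \<xi> \<ominus>\<^bsub>Hx x\<^esub> FR ps x \<xi>) \<le> e * nx x \<xi>)"
  using assms by (auto simp: compact_field_def)

lemma compact_field_cong:
  "compact_field b \<Longrightarrow> (\<And>x \<xi>. \<xi> \<in> carrier (Hx x) \<Longrightarrow> b x \<xi> = c x \<xi>) \<Longrightarrow> compact_field c"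
  unfolding compact_field_def by simp

lemma compact_field_lim:
  assumes b: "\<And>x \<xi>. \<xi> \<in> carrier (Hx x) \<Longrightarrow> b x \<xi> \<in> carrier (Hx x)"
    and ap: "\<And>e. e > 0 \<Longrightarrow> \<exists>c. compact_field c \<and> (\<forall>x. \<forall>\<xi>\<in>carrier (Hx x). nx x (b x \<xi> \<ominus>\<^bsub>Hx x\<^esub> c x \<xi>) \<le> e * nx x \<xi>)"
  shows "compact_field b"
  unfolding compact_field_def
proof (intro conjI allI ballI impI b)
  fix e :: real assume "e > 0"
  then have e: "e / 2 > 0"
    by simp
  obtain c where c: "compact_field c" "\<And>x \<xi>. \<xi> \<in> carrier (Hx x) \<Longrightarrow> nx x (b x \<xi> \<ominus>\<^bsub>Hx x\<^esub> c x \<xi>) \<le> e / 2 * nx x \<xi>"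
    using ap[OF e] by blast
  obtain ps where ps: "set ps \<subseteq> carrier E \<times> carrier E"
    "\<And>x \<xi>. \<xi> \<in> carrier (Hx x) \<Longrightarrow> nx x (c x \<xi> \<ominus>\<^bsub>Hx x\<^esub> FR ps x \<xi>) \<le> e / 2 * nx x \<xi>"
    using compact_fieldD(2)[OF c(1) e] by blast
  have "nx x (b x \<xi> \<ominus>\<^bsub>Hx x\<^esub> FR ps x \<xi>) \<le> e * nx x \<xi>" if \<xi>: "\<xi> \<in> carrier (Hx x)" for x \<xi>
  proof -
    have "e * nx x \<xi> = e / 2 * nx x \<xi> + e / 2 * nx x \<xi>"
      by simp
    then show ?thesis
      using F.N.n_minus_triangle[OF b[OF \<xi>] compact_fieldD(1)[OF c(1) \<xi>] FR_closed[OF ps(1)]] c(2)[OF \<xi>] ps(2)[OF \<xi>]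
      by (smt (verit))
  qed
  then show "\<exists>ps. set ps \<subseteq> carrier E \<times> carrier E \<and> (\<forall>x. \<forall>\<xi>\<in>carrier (Hx x). nx x (b x \<xi> \<ominus>\<^bsub>Hx x\<^esub> FR ps x \<xi>) \<le> e * nx x \<xi>)"
    using ps(1) by blast
qed

lemma FR_append:
  "set ps \<subseteq> carrier E \<times> carrier E \<Longrightarrow> set qs \<subseteq> carrier E \<times> carrier E \<Longrightarrow>
   FR (ps @ qs) x \<xi> = FR ps x \<xi> \<oplus>\<^bsub>Hx x\<^esub> FR qs x \<xi>"
proof (induction ps)
  case (Cons p ps)
  then show ?case
    using FR_closed[of ps x \<xi>] FR_closed[of qs x \<xi>] by (auto simp: F.v_assoc E_fibre)
qed (simp add: FR_closed)

lemma compact_field_add: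
  assumes b: "compact_field b" and c: "compact_field c"
  shows "compact_field (\<lambda>x \<xi>. b x \<xi> \<oplus>\<^bsub>Hx x\<^esub> c x \<xi>)"
  unfolding compact_field_def
proof (intro conjI allI ballI impI)
  show "b x \<xi> \<oplus>\<^bsub>Hx x\<^esub> c x \<xi> \<in> carrier (Hx x)" if "\<xi> \<in> carrier (Hx x)" for x \<xi>
    using compact_fieldD(1)[OF b that] compact_fieldD(1)[OF c that] by (rule F.v_add)
  fix e :: real assume "e > 0"
  then have e: "e / 2 > 0"
    by simp
  obtain ps where ps: "set ps \<subseteq> carrier E \<times> carrier E"
    "\<And>x \<xi>. \<xi> \<in> carrier (Hx x) \<Longrightarrow> nx x (b x \<xi> \<ominus>\<^bsub>Hx x\<^esub> FR ps x \<xi>) \<le> e / 2 * nx x \<xi>"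
    using compact_fieldD(2)[OF b e] by blast
  obtain qs where qs: "set qs \<subseteq> carrier E \<times> carrier E"
    "\<And>x \<xi>. \<xi> \<in> carrier (Hx x) \<Longrightarrow> nx x (c x \<xi> \<ominus>\<^bsub>Hx x\<^esub> FR qs x \<xi>) \<le> e / 2 * nx x \<xi>"
    using compact_fieldD(2)[OF c e] by blast
  have "nx x ((b x \<xi> \<oplus>\<^bsub>Hx x\<^esub> c x \<xi>) \<ominus>\<^bsub>Hx x\<^esub> FR (ps @ qs) x \<xi>) \<le> e * nx x \<xi>" if \<xi>: "\<xi> \<in> carrier (Hx x)" for x \<xi>
  proof -
    have "e * nx x \<xi> = e / 2 * nx x \<xi> + e / 2 * nx x \<xi>"
      by simp
    then show ?thesis
      unfolding FR_append[OF ps(1) qs(1)]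
      using F.N.n_add_minus_add_le[OF compact_fieldD(1)[OF b \<xi>] compact_fieldD(1)[OF c \<xi>] FR_closed[OF ps(1)] FR_closed[OF qs(1)]]
        ps(2)[OF \<xi>] qs(2)[OF \<xi>] by (smt (verit))
  qed
  then show "\<exists>ps. set ps \<subseteq> carrier E \<times> carrier E \<and>
      (\<forall>x. \<forall>\<xi>\<in>carrier (Hx x). nx x ((b x \<xi> \<oplus>\<^bsub>Hx x\<^esub> c x \<xi>) \<ominus>\<^bsub>Hx x\<^esub> FR ps x \<xi>) \<le> e * nx x \<xi>)"
    using ps(1) qs(1) by (intro exI[of _ "ps @ qs"]) simp
qed

lemma BOps_minus: "T \<in> F.BOps x \<Longrightarrow> \<xi> \<in> carrier (Hx x) \<Longrightarrow> \<eta> \<in> carrier (Hx x) \<Longrightarrow>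
    T (\<xi> \<ominus>\<^bsub>Hx x\<^esub> \<eta>) = T \<xi> \<ominus>\<^bsub>Hx x\<^esub> T \<eta>"
  by (rule linear_map_zero_minus(2)[OF F.BOpsD(2) F.complex_module_axioms F.complex_module_axioms])

lemma BOps_zero: "T \<in> F.BOps x \<Longrightarrow> T \<zero>\<^bsub>Hx x\<^esub> = \<zero>\<^bsub>Hx x\<^esub>"
  by (rule linear_map_zero_minus(1)[OF F.BOpsD(2) F.complex_module_axioms F.complex_module_axioms])

text \<open>Composition on the left turns a pair (v, w) into (c v, w), which consists of sections
  because c is a continuous field; its uniform bound controls the error.\<close>

lemma compact_field_left:
  assumes c: "continuous_field c" and b: "compact_field b"
  shows "compact_field (\<lambda>x \<xi>. c x (b x \<xi>))"
  unfolding compact_field_def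
proof (intro conjI allI ballI impI)
  show "c x (b x \<xi>) \<in> carrier (Hx x)" if "\<xi> \<in> carrier (Hx x)" for x \<xi>
    using compact_fieldD(1)[OF b that] by (rule continuous_fieldD(3)[OF c])
  obtain C where C: "C \<ge> 0" "\<And>x \<xi>. \<xi> \<in> carrier (Hx x) \<Longrightarrow> nx x (c x \<xi>) \<le> C * nx x \<xi>"
    using bounded_fieldD(3)[OF continuous_fieldD(1)[OF c]] by blast
  fix e :: real assume "e > 0"
  \<comment> \<open>C + 1 rather than C, to keep the divisor positive when C = 0.\<close>
  then have e: "e / (C + 1) > 0"
    using C(1) by simp
  obtain ps where ps: "set ps \<subseteq> carrier E \<times> carrier E"
    "\<And>x \<xi>. \<xi> \<in> carrier (Hx x) \<Longrightarrow> nx x (b x \<xi> \<ominus>\<^bsub>Hx x\<^esub> FR ps x \<xi>) \<le> e / (C + 1) * nx x \<xi>"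
    using compact_fieldD(2)[OF b e] by blast
  define qs where "qs = map (\<lambda>p. (\<lambda>x. c x (fst p x), snd p)) ps"
  have qs: "set qs \<subseteq> carrier E \<times> carrier E"
    using ps(1) continuous_fieldD(4)[OF c] by (auto simp: qs_def)
  have FRq: "FR qs x \<xi> = c x (FR ps x \<xi>)" for x \<xi>
    unfolding qs_def using ps(1)
  proof (induction ps)
    case Nil
    then show ?case
      using BOps_zero[OF continuous_fieldD(2)[OF c]] by simp
  next
    case (Cons p ps)
    then have "fst p x \<in> carrier (Hx x)" "FR ps x \<xi> \<in> carrier (Hx x)"
      using FR_closed[of ps] E_fibre by auto
    then show ?case
      using Cons by (simp add: F.BOpsD(4,5)[OF continuous_fieldD(2)[OF c]])
  qed
  have "nx x (c x (b x \<xi>) \<ominus>\<^bsub>Hx x\<^esub> FR qs x \<xi>) \<le> e * nx x \<xi>" if \<xi>: "\<xi> \<in> carrier (Hx x)" for x \<xi>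
  proof -
    have bc: "b x \<xi> \<in> carrier (Hx x)"
      by (rule compact_fieldD(1)[OF b \<xi>])
    have "c x (b x \<xi>) \<ominus>\<^bsub>Hx x\<^esub> FR qs x \<xi> = c x (b x \<xi> \<ominus>\<^bsub>Hx x\<^esub> FR ps x \<xi>)"
      unfolding FRq by (rule BOps_minus[OF continuous_fieldD(2)[OF c] bc FR_closed[OF ps(1)], symmetric])
    then have "nx x (c x (b x \<xi>) \<ominus>\<^bsub>Hx x\<^esub> FR qs x \<xi>) \<le> C * nx x (b x \<xi> \<ominus>\<^bsub>Hx x\<^esub> FR ps x \<xi>)"
      using C(2)[OF F.v_minus_closed[OF bc FR_closed[OF ps(1)]]] by simp
    also have "\<dots> \<le> (C + 1) * (e / (C + 1) * nx x \<xi>)"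
      by (rule mult_mono[OF _ ps(2)[OF \<xi>]]) (use C(1) F.hnorm_nonneg[OF F.v_minus_closed[OF bc FR_closed[OF ps(1)]]] in auto)
    also have "\<dots> = e * nx x \<xi>"
      using C(1) by (simp add: add_nonneg_eq_0_iff)
    finally show ?thesis .
  qed
  then show "\<exists>ps. set ps \<subseteq> carrier E \<times> carrier E \<and>
      (\<forall>x. \<forall>\<xi>\<in>carrier (Hx x). nx x (c x (b x \<xi>) \<ominus>\<^bsub>Hx x\<^esub> FR ps x \<xi>) \<le> e * nx x \<xi>)"
    using qs by blast
qed

text \<open>A pair (v, w) becomes (v, d w), where d is the adjoint of c; this is why the adjoint
  field has to be continuous.\<close>

lemma compact_field_right:
  assumes c: "continuous_field c" and d: "continuous_field d" and b: "compact_field b"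
    and adj: "\<And>x \<xi> \<eta>. \<xi> \<in> carrier (Hx x) \<Longrightarrow> \<eta> \<in> carrier (Hx x) \<Longrightarrow> ip (Hx x) (d x \<xi>) \<eta> = ip (Hx x) \<xi> (c x \<eta>)"
  shows "compact_field (\<lambda>x \<xi>. b x (c x \<xi>))"
  unfolding compact_field_def
proof (intro conjI allI ballI impI)
  show "b x (c x \<xi>) \<in> carrier (Hx x)" if "\<xi> \<in> carrier (Hx x)" for x \<xi>
    using continuous_fieldD(3)[OF c that] by (rule compact_fieldD(1)[OF b])
  obtain C where C: "C \<ge> 0" "\<And>x \<xi>. \<xi> \<in> carrier (Hx x) \<Longrightarrow> nx x (c x \<xi>) \<le> C * nx x \<xi>"
    using bounded_fieldD(3)[OF continuous_fieldD(1)[OF c]] by blast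
  fix e :: real assume e0: "e > 0"
  then have e: "e / (C + 1) > 0"
    using C(1) by simp
  obtain ps where ps: "set ps \<subseteq> carrier E \<times> carrier E"
    "\<And>x \<xi>. \<xi> \<in> carrier (Hx x) \<Longrightarrow> nx x (b x \<xi> \<ominus>\<^bsub>Hx x\<^esub> FR ps x \<xi>) \<le> e / (C + 1) * nx x \<xi>"
    using compact_fieldD(2)[OF b e] by blast
  define qs where "qs = map (\<lambda>p. (fst p, \<lambda>x. d x (snd p x))) ps"
  have qs: "set qs \<subseteq> carrier E \<times> carrier E"
    using ps(1) continuous_fieldD(4)[OF d] by (auto simp: qs_def)
  have FRq: "FR qs x \<xi> = FR ps x (c x \<xi>)" if \<xi>: "\<xi> \<in> carrier (Hx x)" for x \<xi>
    unfolding qs_def using ps(1)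
    by (induction ps) (auto simp: adj[OF _ \<xi>] E_fibre)
  have "nx x (b x (c x \<xi>) \<ominus>\<^bsub>Hx x\<^esub> FR qs x \<xi>) \<le> e * nx x \<xi>" if \<xi>: "\<xi> \<in> carrier (Hx x)" for x \<xi>
  proof -
    have "nx x (b x (c x \<xi>) \<ominus>\<^bsub>Hx x\<^esub> FR qs x \<xi>) \<le> e / (C + 1) * nx x (c x \<xi>)"
      unfolding FRq[OF \<xi>] by (rule ps(2)[OF continuous_fieldD(3)[OF c \<xi>]])
    also have "\<dots> \<le> e / (C + 1) * (C * nx x \<xi>)"
      by (rule mult_left_mono[OF C(2)[OF \<xi>]]) (use e in simp)
    also have "\<dots> \<le> e / (C + 1) * ((C + 1) * nx x \<xi>)"
      by (intro mult_left_mono mult_right_mono) (use e F.hnorm_nonneg[OF \<xi>] in auto)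
    also have "\<dots> = e * nx x \<xi>"
      using C(1) by (simp add: add_nonneg_eq_0_iff)
    finally show ?thesis .
  qed
  then show "\<exists>ps. set ps \<subseteq> carrier E \<times> carrier E \<and>
      (\<forall>x. \<forall>\<xi>\<in>carrier (Hx x). nx x (b x (c x \<xi>) \<ominus>\<^bsub>Hx x\<^esub> FR ps x \<xi>) \<le> e * nx x \<xi>)"
    using qs by blast
qed

text \<open>Makes scalar multiples of compact fields an instance of composition on the left.\<close>

lemma continuous_field_scalar: "continuous_field (\<lambda>x. \<lambda>\<xi>\<in>carrier (Hx x). k \<odot>\<^bsub>Hx x\<^esub> \<xi>)"
  unfolding continuous_field_def bounded_field_def
proof (intro conjI allI ballI exI)
  fix x
  show "(\<lambda>\<xi>\<in>carrier (Hx x). k \<odot>\<^bsub>Hx x\<^esub> \<xi>) \<in> F.BOps x"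
    by (rule F.BOpsI[of _ _ "cmod k"]) (simp_all add: F.v_smult_add F.hnorm_smult mult.commute)
  show "nx x ((\<lambda>\<xi>\<in>carrier (Hx x). k \<odot>\<^bsub>Hx x\<^esub> \<xi>) \<xi>) \<le> cmod k * nx x \<xi>" if "\<xi> \<in> carrier (Hx x)" for \<xi>
    using that by (simp add: F.hnorm_smult)
next
  fix v assume v: "v \<in> carrier E"
  show "(\<lambda>x. (\<lambda>\<xi>\<in>carrier (Hx x). k \<odot>\<^bsub>Hx x\<^esub> \<xi>) (v x)) \<in> carrier E"
    using E_smult[OF v, of k] by (simp add: E_fibre[OF v])
qed simp

lemma compact_field_smult: "compact_field b \<Longrightarrow> compact_field (\<lambda>x \<xi>. k \<odot>\<^bsub>Hx x\<^esub> b x \<xi>)"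
  by (rule compact_field_cong[OF compact_field_left[OF continuous_field_scalar]]) (auto simp: compact_fieldD)

text \<open>Both transports agree with that of a basic set Z around x0 inside Y \<inter> Y'. Beyond
  Z they may differ, hence only an eventual equality.\<close>

lemma transport_indep:
  assumes "Y \<in> K" "Y' \<in> K" "x0 \<in> Y" "x0 \<in> Y'"
  shows "\<forall>\<^sub>F x in nhds x0. \<forall>\<xi>\<in>carrier (Hx x0). transport Y x0 x \<xi> = transport Y' x0 x \<xi>"
proof -
  obtain Z where Z: "Z \<in> K" "x0 \<in> Z" "Z \<subseteq> Y \<inter> Y'"
    using K_nbhd[of "Y \<inter> Y'" x0] assms K_open by blast
  show ?thesis
    using eventually_mem[OF Z(1,2)]
  proof (rule eventually_mono)
    fix x assume x: "x \<in> Z"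
    show "\<forall>\<xi>\<in>carrier (Hx x0). transport Y x0 x \<xi> = transport Y' x0 x \<xi>"
      using transport_subset[OF assms(1) Z(1) _ Z(2) x] transport_subset[OF assms(2) Z(1) _ Z(2) x] Z(3) by simp
  qed
qed

text \<open>In the chart \<open>Y\<close> the section is a constant vector times g, and outside it
  vanishes. The deviation |g x - g x0| ||h|| also works at points x0 outside \<open>Y\<close>,
  because g is zero there and the norm of the section is at most |g x| ||h||.\<close>

lemma local_section:
  assumes Y: "Y \<in> K" and g: "g \<in> C0 Y" and h: "h \<in> carrier (H Y)"
  shows "(\<lambda>x. if x \<in> Y then g x \<odot>\<^bsub>Hx x\<^esub> V x Y h else \<zero>\<^bsub>Hx x\<^esub>) \<in> carrier E"
proof -
  let ?s = "\<lambda>x. if x \<in> Y then g x \<odot>\<^bsub>Hx x\<^esub> V x Y h else \<zero>\<^bsub>Hx x\<^esub>"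
  have gC: "g \<in> C0 UNIV"
    by (rule C0_subset_C0_UNIV[OF Hausdorff K_open[OF Y] g])
  have g0: "g x = 0" if "x \<notin> Y" for x
    using g that by (simp add: C0_def)
  have sc: "?s x \<in> carrier (Hx x)" for x
    using V_closed[OF Y _ h] by simp
  have sn: "nx x (?s x) \<le> hnorm (H Y) h * cmod (g x)" for x
    using V_hnorm[OF Y _ h] V_closed[OF Y _ h] by (simp add: F.hnorm_smult g0 mult.commute)
  show ?thesis
  proof (rule E_dominated[OF sc _ gC sn])
    show "continuous_section ?s"
    proof (rule continuous_sectionI[OF _ sc])
      fix Y' x0 assume Y': "Y' \<in> K" "x0 \<in> Y'"
      have "(g \<longlongrightarrow> g x0) (nhds x0)"
        using C0_continuous[OF gC] continuous_on_UNIV_iff_nhds by blast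
      then have "((\<lambda>x. cmod (g x - g x0) * hnorm (H Y) h) \<longlongrightarrow> 0 * hnorm (H Y) h) (nhds x0)"
        by (intro tendsto_mult_right) (simp add: tendsto_norm_zero_iff LIM_zero)
      then have lim: "((\<lambda>x. cmod (g x - g x0) * hnorm (H Y) h) \<longlongrightarrow> 0) (nhds x0)"
        by simp
      have "\<forall>\<^sub>F x in nhds x0. nx x (?s x \<ominus>\<^bsub>Hx x\<^esub> transport Y' x0 x (?s x0)) \<le> cmod (g x - g x0) * hnorm (H Y) h"
      proof (cases "x0 \<in> Y")
        case True
        show ?thesis
          using transport_indep[OF Y'(1) Y Y'(2) True] eventually_mem[OF Y True]
        proof (rule eventually_elim2)
          fix x assume t: "\<forall>\<xi>\<in>carrier (Hx x0). transport Y' x0 x \<xi> = transport Y x0 x \<xi>" and x: "x \<in> Y"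
          have "transport Y' x0 x (?s x0) = g x0 \<odot>\<^bsub>Hx x\<^esub> V x Y h"
            using t sc[of x0] True Y x V_closed[OF Y True h]
            by (simp add: transport_smult) (simp add: transport_def Vi_V h)
          then have "?s x \<ominus>\<^bsub>Hx x\<^esub> transport Y' x0 x (?s x0) = (g x - g x0) \<odot>\<^bsub>Hx x\<^esub> V x Y h"
            using x V_closed[OF Y x h] F.v_add_smult[OF V_closed[OF Y x h], of "g x" "- g x0"] by (simp add: F.v_minus)
          then show "nx x (?s x \<ominus>\<^bsub>Hx x\<^esub> transport Y' x0 x (?s x0)) \<le> cmod (g x - g x0) * hnorm (H Y) h"
            using V_closed[OF Y x h] V_hnorm[OF Y x h] by (simp add: F.hnorm_smult)
        qed
      next
        case False
        show ?thesis
          using eventually_mem[OF Y']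
        proof (rule eventually_mono)
          fix x assume x: "x \<in> Y'"
          have "?s x \<ominus>\<^bsub>Hx x\<^esub> transport Y' x0 x (?s x0) = ?s x"
            using False transport_zero[OF Y' x] sc[of x] F.v_minus_zero[OF sc[of x]] by simp
          then show "nx x (?s x \<ominus>\<^bsub>Hx x\<^esub> transport Y' x0 x (?s x0)) \<le> cmod (g x - g x0) * hnorm (H Y) h"
            using sn[of x] g0[OF False] by (simp add: mult.commute)
        qed
      qed
      with lim show "\<exists>g'. (g' \<longlongrightarrow> 0) (nhds x0) \<and>
          (\<forall>\<^sub>F x in nhds x0. nx x (?s x \<ominus>\<^bsub>Hx x\<^esub> transport Y' x0 x (?s x0)) \<le> g' x)"
        by blast
    qed
  qed
qed

lemma compact_field_generator:
  assumes Y: "Y \<in> K" and f: "f \<in> C0 Y" and T: "T \<in> compact_operators (H Y)"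
  shows "compact_field (\<lambda>x \<xi>. if x \<in> Y then f x \<odot>\<^bsub>Hx x\<^esub> V x Y (T (Vi x Y \<xi>)) else \<zero>\<^bsub>Hx x\<^esub>)"
  unfolding compact_field_def
proof (intro conjI allI ballI impI)
  interpret HY: hilbert_space "H Y" by (rule H_hilbert[OF Y])
  have TB: "T \<in> HY.BOps"
    using T by (simp add: compact_operators_def HY.bounded_operators_eq)
  have Tc: "T h \<in> carrier (H Y)" if "h \<in> carrier (H Y)" for h
    by (rule HY.BOpsD(3)[OF TB that])
  show "(if x \<in> Y then f x \<odot>\<^bsub>Hx x\<^esub> V x Y (T (Vi x Y \<xi>)) else \<zero>\<^bsub>Hx x\<^esub>) \<in> carrier (Hx x)"
    if "\<xi> \<in> carrier (Hx x)" for x \<xi>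
    using that Y by (simp add: V_closed Tc Vi_closed)
  obtain g h where gh: "g \<in> C0 Y" "h \<in> C0 Y" "\<And>x. f x = g x * h x" "\<And>x. cnj (h x) = h x"
    using C0_factor[OF f] by metis
  obtain B where B: "B > 0" "\<And>x. cmod (f x) \<le> B"
    using C0_bounded[OF C0_subset_C0_UNIV[OF Hausdorff K_open[OF Y] f]] by blast
  fix e :: real assume "e > 0"
  then have e: "e / B > 0"
    using B by simp
  obtain ps where ps: "set ps \<subseteq> carrier (H Y) \<times> carrier (H Y)"
    "\<And>k. k \<in> carrier (H Y) \<Longrightarrow> hnorm (H Y) (T k \<ominus>\<^bsub>H Y\<^esub> finite_rank (H Y) ps k) \<le> e / B * hnorm (H Y) k"
    using HY.compact_finite_rank_approximation[OF T e] by blast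
  define sec where "sec g k = (\<lambda>x. if x \<in> Y then g x \<odot>\<^bsub>Hx x\<^esub> V x Y k else \<zero>\<^bsub>Hx x\<^esub>)" for g k
  \<comment> \<open>Each rank one summand takes one factor of f on either side: g multiplies the
    left vector, h the right one. As h is real, no conjugate appears when it leaves the inner
    product.\<close>
  define qs where "qs = map (\<lambda>p. (sec g (fst p), sec h (snd p))) ps"
  have qs: "set qs \<subseteq> carrier E \<times> carrier E"
    using ps(1) local_section[OF Y gh(1)] local_section[OF Y gh(2)] by (auto simp: qs_def sec_def)
  have FRq: "FR qs x \<xi> = (if x \<in> Y then f x \<odot>\<^bsub>Hx x\<^esub> V x Y (finite_rank (H Y) ps (Vi x Y \<xi>)) else \<zero>\<^bsub>Hx x\<^esub>)"
    if \<xi>: "\<xi> \<in> carrier (Hx x)" for x \<xi>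
  proof (cases "x \<in> Y")
    case True
    interpret W: unitary_pair "H Y" "Hx x" "V x Y" by (rule V_unitary[OF Y True])
    have Ui: "W.Ui = Vi x Y"
      by (rule Vi_Ui[OF Y True, symmetric])
    have "FR qs x \<xi> = f x \<odot>\<^bsub>Hx x\<^esub> V x Y (finite_rank (H Y) ps (Vi x Y \<xi>))"
      unfolding qs_def using ps(1)
    proof (induction ps)
      case Nil
      then show ?case
        by (simp add: W.U_zero)
    next
      case (Cons p ps)
      then have c: "fst p \<in> carrier (H Y)" "snd p \<in> carrier (H Y)" "finite_rank (H Y) ps (Vi x Y \<xi>) \<in> carrier (H Y)"
        using HY.finite_rank_closed by auto
      have "ip (Hx x) (sec h (snd p) x) \<xi> \<odot>\<^bsub>Hx x\<^esub> sec g (fst p) x =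
        f x \<odot>\<^bsub>Hx x\<^esub> V x Y (ip (H Y) (snd p) (Vi x Y \<xi>) \<odot>\<^bsub>H Y\<^esub> fst p)"
        using c True \<xi> gh(3,4) by (simp add: sec_def F.ip_smult_left W.U_ip_left Ui W.U_smult mult_ac)
      then show ?case
        using Cons c by (simp add: W.U_add F.v_smult_add W.U_smult)
    qed
    then show ?thesis
      using True by simp
  next
    case False
    show ?thesis
      unfolding qs_def using ps(1) False \<xi> by (induction ps) (auto simp: sec_def)
  qed
  have "nx x ((if x \<in> Y then f x \<odot>\<^bsub>Hx x\<^esub> V x Y (T (Vi x Y \<xi>)) else \<zero>\<^bsub>Hx x\<^esub>) \<ominus>\<^bsub>Hx x\<^esub> FR qs x \<xi>) \<le> e * nx x \<xi>"
    if \<xi>: "\<xi> \<in> carrier (Hx x)" for x \<xi>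
  proof (cases "x \<in> Y")
    case True
    interpret W: unitary_pair "H Y" "Hx x" "V x Y" by (rule V_unitary[OF Y True])
    define k where "k = Vi x Y \<xi>"
    have k: "k \<in> carrier (H Y)" "hnorm (H Y) k = nx x \<xi>"
      using Vi_closed[OF Y True \<xi>] V_hnorm[OF Y True Vi_closed[OF Y True \<xi>]] V_Vi[OF Y True \<xi>] by (simp_all add: k_def)
    have c: "T k \<in> carrier (H Y)" "finite_rank (H Y) ps k \<in> carrier (H Y)"
      using Tc[OF k(1)] HY.finite_rank_closed[OF ps(1)] by auto
    have "f x \<odot>\<^bsub>Hx x\<^esub> V x Y (T k) \<ominus>\<^bsub>Hx x\<^esub> f x \<odot>\<^bsub>Hx x\<^esub> V x Y (finite_rank (H Y) ps k) =
      f x \<odot>\<^bsub>Hx x\<^esub> V x Y (T k \<ominus>\<^bsub>H Y\<^esub> finite_rank (H Y) ps k)"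
      using c by (simp add: W.U_minus F.v_smult_minus)
    then have "nx x (f x \<odot>\<^bsub>Hx x\<^esub> V x Y (T k) \<ominus>\<^bsub>Hx x\<^esub> f x \<odot>\<^bsub>Hx x\<^esub> V x Y (finite_rank (H Y) ps k)) =
      cmod (f x) * hnorm (H Y) (T k \<ominus>\<^bsub>H Y\<^esub> finite_rank (H Y) ps k)"
      using c by (simp add: F.hnorm_smult W.U_hnorm)
    also have "\<dots> \<le> B * (e / B * nx x \<xi>)"
      using ps(2)[OF k(1)] k(2) by (intro mult_mono B(2)) (use B(1) HY.hnorm_nonneg c in auto)
    also have "\<dots> = e * nx x \<xi>"
      using B(1) by simp
    finally show ?thesis
      unfolding FRq[OF \<xi>] using True by (simp add: k_def)
  next
    case False
    then show ?thesis
      using \<open>e > 0\<close> F.hnorm_nonneg[OF \<xi>] by (simp add: FRq[OF \<xi>])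
  qed
  then show "\<exists>ps. set ps \<subseteq> carrier E \<times> carrier E \<and> (\<forall>x. \<forall>\<xi>\<in>carrier (Hx x).
      nx x ((if x \<in> Y then f x \<odot>\<^bsub>Hx x\<^esub> V x Y (T (Vi x Y \<xi>)) else \<zero>\<^bsub>Hx x\<^esub>) \<ominus>\<^bsub>Hx x\<^esub> FR ps x \<xi>) \<le> e * nx x \<xi>)"
    using qs by blast
qed

text \<open>A finite rank field acts as a sum of rank one module operators, and since the module
  norm is a supremum over the base, an estimate in all fibres is an estimate in operator
  norm.\<close>

theorem compact_field_compact_operator:
  assumes T: "fibrewise E b \<in> AOps" and b: "compact_field b"
  shows "fibrewise E b \<in> compact_module_operators C0_alg E"
proof -
  let ?R = "{rank_one E v w | v w. v \<in> carrier E \<and> w \<in> carrier E}"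
  have ro: "rank_one E v w \<in> AOps" if v: "v \<in> carrier E" and w: "w \<in> carrier E" for v w
  proof -
    have c: "ract E v (ip E w u) \<in> carrier E" if "v \<in> carrier E" "w \<in> carrier E" "u \<in> carrier E" for v w u
      using E_C0_smult[OF E_ip_C0[OF that(2,3)] that(1)] by simp
    show ?thesis
      unfolding rank_one_def
    proof (rule AOpsI[of _ "\<lambda>u. ract E w (ip E v u)"])
      fix u z assume u: "u \<in> carrier E" and z: "z \<in> carrier E"
      show "ip E (ract E v (ip E w u)) z = ip E u (ract E w (ip E v z))"
      proof (rule ext)
        fix x
        show "ip E (ract E v (ip E w u)) z x = ip E u (ract E w (ip E v z)) x"
          using F.ip_cnj[OF E_fibre[OF w] E_fibre[OF u], of x]
          by (simp add: F.ip_smult F.ip_smult_left E_fibre u v w z)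
      qed
    qed (use c v w in blast)+
  qed
  have R: "?R \<subseteq> carrier A.OA"
    using ro by auto
  define L where "L = lin_span A.OA ?R"
  have L: "L \<subseteq> carrier A.OA" "\<zero>\<^bsub>A.OA\<^esub> \<in> L" "\<forall>x\<in>L. \<forall>y\<in>L. x \<oplus>\<^bsub>A.OA\<^esub> y \<in> L"
    using A.OM.lin_span_submodule[OF R] unfolding A.OM.submodule_iff L_def[symmetric] by auto
  have RL: "?R \<subseteq> L"
    unfolding L_def by (rule lin_span_superset)
  have FRL: "fibrewise E (FR ps) \<in> L" if "set ps \<subseteq> carrier E \<times> carrier E" for ps
    using that
  proof (induction ps)
    case Nil
    have "fibrewise E (FR []) = \<zero>\<^bsub>A.OA\<^esub>"
      by (simp add: fibrewise_def)
    then show ?case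
      by (simp only: L(2))
  next
    case (Cons p ps)
    then have p: "rank_one E (fst p) (snd p) \<in> L"
      using RL by (cases p) auto
    have "fibrewise E (FR (p # ps)) = rank_one E (fst p) (snd p) \<oplus>\<^bsub>A.OA\<^esub> fibrewise E (FR ps)"
      unfolding operator_algebra_sel fibrewise_def rank_one_def by (rule restrict_ext) simp
    moreover have "fibrewise E (FR ps) \<in> L"
      using Cons by simp
    ultimately show ?case
      using L(3)[rule_format, OF p, of "fibrewise E (FR ps)"] by (simp only:)
  qed
  show ?thesis
    unfolding compact_module_operators_def adjointable_operators_eq closed_span_def L_def[symmetric]
      operator_algebra_sel(8) A.ON.mem_closure_iff
  proof (intro conjI allI impI)
    show "fibrewise E b \<in> carrier A.OA"
      using T by simp
    fix e :: real assume "e > 0"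
    then have e: "e / 2 > 0"
      by simp
    obtain ps where ps: "set ps \<subseteq> carrier E \<times> carrier E"
      "\<And>x \<xi>. \<xi> \<in> carrier (Hx x) \<Longrightarrow> nx x (b x \<xi> \<ominus>\<^bsub>Hx x\<^esub> FR ps x \<xi>) \<le> e / 2 * nx x \<xi>"
      using compact_fieldD(2)[OF b e] by blast
    have S: "fibrewise E (FR ps) \<in> AOps"
      using FRL[OF ps(1)] L(1) by auto
    have "A.opn (fibrewise E b \<ominus>\<^bsub>A.OA\<^esub> fibrewise E (FR ps)) \<le> e / 2"
    proof (rule A.opn_least)
      fix v assume v: "v \<in> carrier E"
      have Tv: "fibrewise E b v \<in> carrier E" "fibrewise E (FR ps) v \<in> carrier E"
        using A.O_closed[OF T v] A.O_closed[OF S v] by auto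
      show "Nm ((fibrewise E b \<ominus>\<^bsub>A.OA\<^esub> fibrewise E (FR ps)) v) \<le> e / 2 * Nm v"
        unfolding A.OA_minus_apply[OF T S v]
      proof (rule Nm_least[OF EM.v_minus_closed[OF Tv]])
        fix x
        have "nx x (b x (v x) \<ominus>\<^bsub>Hx x\<^esub> FR ps x (v x)) \<le> e / 2 * nx x (v x)"
          by (rule ps(2)[OF E_fibre[OF v]])
        also have "\<dots> \<le> e / 2 * Nm v"
          by (rule mult_left_mono[OF Nm_upper[OF v]]) (use e in simp)
        finally show "nx x ((fibrewise E b v \<ominus>\<^bsub>E\<^esub> fibrewise E (FR ps) v) x) \<le> e / 2 * Nm v"
          unfolding E_minus[OF Tv] by (simp add: fibrewise_apply[OF v])
      qed
    qed (use e in simp)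
    then show "\<exists>S\<in>L. S \<in> carrier A.OA \<and> A.opn (fibrewise E b \<ominus>\<^bsub>A.OA\<^esub> S) < e"
      using FRL[OF ps(1)] S \<open>e > 0\<close> by (intro bexI[of _ "fibrewise E (FR ps)"]) auto
  qed
qed

end

subsection \<open>The algebra of operator fields\<close>

context hilbert_bundle
begin

abbreviation "Bx \<equiv> \<lambda>x. bounded_operators (Hx x)"

lemma Bx_sel [simp]:
  "carrier (Bx x) = F.BOps x" "mult (Bx x) = (\<lambda>S T. \<lambda>v\<in>carrier (Hx x). S (T v))"
  "zero (Bx x) = (\<lambda>v\<in>carrier (Hx x). \<zero>\<^bsub>Hx x\<^esub>)"
  "add (Bx x) = (\<lambda>S T. \<lambda>v\<in>carrier (Hx x). S v \<oplus>\<^bsub>Hx x\<^esub> T v)"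
  "smult (Bx x) = (\<lambda>c T. \<lambda>v\<in>carrier (Hx x). c \<odot>\<^bsub>Hx x\<^esub> T v)"
  "star (Bx x) = adjoint_op (Hx x)" "nrm (Bx x) = F.B.opn x"
  by (simp_all add: F.bounded_operators_eq)

lemma Bx_minus_apply: "S \<in> F.BOps x \<Longrightarrow> T \<in> F.BOps x \<Longrightarrow> \<xi> \<in> carrier (Hx x) \<Longrightarrow>
    (S \<ominus>\<^bsub>Bx x\<^esub> T) \<xi> = S \<xi> \<ominus>\<^bsub>Hx x\<^esub> T \<xi>"
  unfolding F.bounded_operators_eq by (rule F.B.OA_minus_apply)

lemma BH_carrier: "Y \<in> K \<Longrightarrow> carrier (BH H Y) = hilbert_space.BOps (H Y)"
  unfolding BH_def using hilbert_space.bounded_operators_eq[OF H_hilbert] by simp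

lemma adV_apply: "Y \<in> K \<Longrightarrow> x \<in> Y \<Longrightarrow> \<xi> \<in> carrier (Hx x) \<Longrightarrow> adV H Hx V x Y T \<xi> = V x Y (T (Vi x Y \<xi>))"
  by (simp add: adV_def ad_def Vi_def)

lemma adV_hom: "Y \<in> K \<Longrightarrow> x \<in> Y \<Longrightarrow> star_hom (BH H Y) (Bx x) (adV H Hx V x Y)"
  unfolding BH_def adV_def by (rule unitary_pair.ad_star_hom[OF V_unitary])

sublocale NB: net_fields Bx K "BH H" "adV H Hx V"
proof (intro net_fields.intro net_fields_axioms.intro cstar_family.intro)
  show "cstar_algebra (Bx x)" for x
    by (rule F.BA.cstar_algebra_axioms)
  show "cstar_algebra (BH H Y)" if "Y \<in> K" for Y
  proof -
    interpret HY: hilbert_space "H Y" by (rule H_hilbert[OF that])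
    show ?thesis
      unfolding BH_def by (rule HY.BA.cstar_algebra_axioms)
  qed
qed (simp_all add: Hausdorff K_open adV_hom)

lemma elementary_field_apply:
  assumes Y: "Y \<in> K" and T: "T \<in> carrier (BH H Y)" and \<xi>: "\<xi> \<in> carrier (Hx x)"
  shows "elementary_field Bx (adV H Hx V) f Y T x \<xi> =
    (if x \<in> Y then f x \<odot>\<^bsub>Hx x\<^esub> V x Y (T (Vi x Y \<xi>)) else \<zero>\<^bsub>Hx x\<^esub>)"
  using \<xi> by (simp add: elementary_field_def adV_apply[OF Y])

lemma NB_bounded:
  assumes b: "b \<in> carrier NB.P"
  shows "bounded_field b" "\<xi> \<in> carrier (Hx x) \<Longrightarrow> nx x (b x \<xi>) \<le> nrm NB.P b * nx x \<xi>"
proof -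
  have bx: "b x \<in> F.BOps x" for x
    using NB.P_fibre[OF b, of x] by simp
  have le: "nx x (b x \<xi>) \<le> nrm NB.P b * nx x \<xi>" if "\<xi> \<in> carrier (Hx x)" for x \<xi>
    by (rule order_trans[OF F.B.opn_upper[OF bx that] mult_right_mono[OF _ F.hnorm_nonneg[OF that]]])
      (use NB.P_nrm_upper[OF b, of x] in simp)
  then show "\<xi> \<in> carrier (Hx x) \<Longrightarrow> nx x (b x \<xi>) \<le> nrm NB.P b * nx x \<xi>"
    by blast
  show "bounded_field b"
    unfolding bounded_field_def using bx le NB.P_nonneg[OF b] by blast
qed

text \<open>Around a point of \<open>Y\<close> the field is f times an operator that is constant in
  the chart, so on transported vectors it deviates by |f x - f x0| times a constant. Around other
  points f x0 = 0, and the size of f x alone gives the same bound.\<close>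

lemma elementary_field_continuous_field:
  assumes Y: "Y \<in> K" and f: "f \<in> C0 Y" and T: "T \<in> carrier (BH H Y)"
  shows "continuous_field (elementary_field Bx (adV H Hx V) f Y T)" (is "continuous_field ?b")
proof (rule continuous_fieldI)
  interpret HY: hilbert_space "H Y" by (rule H_hilbert[OF Y])
  have TB: "T \<in> HY.BOps"
    using T by (simp add: BH_carrier[OF Y])
  have Tc: "T h \<in> carrier (H Y)" if "h \<in> carrier (H Y)" for h
    by (rule HY.BOpsD(3)[OF TB that])
  obtain C where C: "C \<ge> 0" "\<And>h. h \<in> carrier (H Y) \<Longrightarrow> hnorm (H Y) (T h) \<le> C * hnorm (H Y) h"
    using HY.BOpsD(6)[OF TB] by blast
  show bf: "bounded_field ?b"
    by (rule NB_bounded(1)[OF NB.elementary_field_closed[OF Y f T]])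
  have fC: "f \<in> C0 UNIV"
    by (rule NB.C0_K[OF Y f])
  fix Y' x0 \<xi> assume Y': "Y' \<in> K" "x0 \<in> Y'" and \<xi>: "\<xi> \<in> carrier (Hx x0)"
  have bc: "?b x \<eta> \<in> carrier (Hx x)" if "\<eta> \<in> carrier (Hx x)" for x \<eta>
    by (rule bounded_fieldD(2)[OF bf that])
  define D where "D = C * nx x0 \<xi>"
  have "(f \<longlongrightarrow> f x0) (nhds x0)"
    using C0_continuous[OF fC] continuous_on_UNIV_iff_nhds by blast
  then have "((\<lambda>x. cmod (f x - f x0) * D) \<longlongrightarrow> 0 * D) (nhds x0)"
    by (intro tendsto_mult_right) (simp add: tendsto_norm_zero_iff LIM_zero)
  then have lim: "((\<lambda>x. cmod (f x - f x0) * D) \<longlongrightarrow> 0) (nhds x0)"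
    by simp
  have ev: "\<forall>\<^sub>F x in nhds x0. nx x (?b x (transport Y' x0 x \<xi>) \<ominus>\<^bsub>Hx x\<^esub> transport Y' x0 x (?b x0 \<xi>)) \<le> cmod (f x - f x0) * D"
  proof (cases "x0 \<in> Y")
    case True
    define k where "k = Vi x0 Y \<xi>"
    have k: "k \<in> carrier (H Y)" "hnorm (H Y) k = nx x0 \<xi>"
      using Vi_closed[OF Y True \<xi>] V_hnorm[OF Y True Vi_closed[OF Y True \<xi>]] V_Vi[OF Y True \<xi>] by (simp_all add: k_def)
    have b0: "?b x0 \<xi> = f x0 \<odot>\<^bsub>Hx x0\<^esub> V x0 Y (T k)"
      by (simp add: elementary_field_apply[OF Y T \<xi>] True k_def)
    show ?thesis
      using transport_indep[OF Y'(1) Y Y'(2) True] eventually_mem[OF Y True]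
    proof (rule eventually_elim2)
      fix x assume t: "\<forall>\<xi>\<in>carrier (Hx x0). transport Y' x0 x \<xi> = transport Y x0 x \<xi>" and x: "x \<in> Y"
      have VT: "V x Y (T k) \<in> carrier (Hx x)" "V x0 Y (T k) \<in> carrier (Hx x0)"
        using V_closed[OF Y x Tc[OF k(1)]] V_closed[OF Y True Tc[OF k(1)]] by auto
      have "transport Y' x0 x (?b x0 \<xi>) = transport Y x0 x (?b x0 \<xi>)"
        using t bc[OF \<xi>] by blast
      also have "\<dots> = f x0 \<odot>\<^bsub>Hx x\<^esub> transport Y x0 x (V x0 Y (T k))"
        unfolding b0 by (rule transport_smult[OF Y True x VT(2)])
      also have "\<dots> = f x0 \<odot>\<^bsub>Hx x\<^esub> V x Y (T k)"
        by (simp add: transport_def Vi_V[OF Y True Tc[OF k(1)]])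
      finally have 1: "transport Y' x0 x (?b x0 \<xi>) = f x0 \<odot>\<^bsub>Hx x\<^esub> V x Y (T k)" .
      have "transport Y' x0 x \<xi> = V x Y k"
        using t \<xi> by (simp add: transport_def k_def)
      then have 2: "?b x (transport Y' x0 x \<xi>) = f x \<odot>\<^bsub>Hx x\<^esub> V x Y (T k)"
        using V_closed[OF Y x k(1)] Vi_V[OF Y x k(1)] x by (simp add: elementary_field_apply[OF Y T])
      have "f x \<odot>\<^bsub>Hx x\<^esub> V x Y (T k) \<ominus>\<^bsub>Hx x\<^esub> f x0 \<odot>\<^bsub>Hx x\<^esub> V x Y (T k) = (f x - f x0) \<odot>\<^bsub>Hx x\<^esub> V x Y (T k)"
        using VT(1) F.v_add_smult[OF VT(1), of "f x" "- f x0"] by (simp add: F.v_minus)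
      then have "nx x (?b x (transport Y' x0 x \<xi>) \<ominus>\<^bsub>Hx x\<^esub> transport Y' x0 x (?b x0 \<xi>)) = cmod (f x - f x0) * hnorm (H Y) (T k)"
        unfolding 1 2 using VT(1) V_hnorm[OF Y x Tc[OF k(1)]] by (simp add: F.hnorm_smult)
      also have "\<dots> \<le> cmod (f x - f x0) * D"
        using C(2)[OF k(1)] k(2) by (intro mult_left_mono) (auto simp: D_def)
      finally show "nx x (?b x (transport Y' x0 x \<xi>) \<ominus>\<^bsub>Hx x\<^esub> transport Y' x0 x (?b x0 \<xi>)) \<le> cmod (f x - f x0) * D" .
    qed
  next
    case False
    have f0: "f x = 0" if "x \<notin> Y" for x
      using f that by (simp add: C0_def)
    have b0: "?b x0 \<xi> = \<zero>\<^bsub>Hx x0\<^esub>"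
      by (simp add: elementary_field_apply[OF Y T \<xi>] False)
    show ?thesis
      using eventually_mem[OF Y']
    proof (rule eventually_mono)
      fix x assume x: "x \<in> Y'"
      define t where "t = transport Y' x0 x \<xi>"
      have t: "t \<in> carrier (Hx x)" "nx x t = nx x0 \<xi>"
        using transport_closed[OF Y' x \<xi>] transport_hnorm[OF Y' x \<xi>] by (simp_all add: t_def)
      have "nx x (?b x t) \<le> cmod (f x) * D"
      proof (cases "x \<in> Y")
        case True
        have v: "Vi x Y t \<in> carrier (H Y)" "hnorm (H Y) (Vi x Y t) = nx x0 \<xi>"
          using Vi_closed[OF Y True t(1)] V_hnorm[OF Y True Vi_closed[OF Y True t(1)]] V_Vi[OF Y True t(1)] t(2) by simp_all
        have "nx x (?b x t) = cmod (f x) * hnorm (H Y) (T (Vi x Y t))"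
          using V_closed[OF Y True Tc[OF v(1)]] V_hnorm[OF Y True Tc[OF v(1)]] True
          by (simp add: elementary_field_apply[OF Y T t(1)] F.hnorm_smult)
        then show ?thesis
          using C(2)[OF v(1)] v(2) by (simp add: D_def mult_left_mono)
      next
        case False
        then show ?thesis
          by (simp add: elementary_field_apply[OF Y T t(1)] f0)
      qed
      then show "nx x (?b x (transport Y' x0 x \<xi>) \<ominus>\<^bsub>Hx x\<^esub> transport Y' x0 x (?b x0 \<xi>)) \<le> cmod (f x - f x0) * D"
        unfolding b0 transport_zero[OF Y' x] t_def[symmetric] by (simp add: bc[OF t(1)] f0[OF False])
    qed
  qed
  have nn: "\<forall>\<^sub>F x in nhds x0. 0 \<le> nx x (?b x (transport Y' x0 x \<xi>) \<ominus>\<^bsub>Hx x\<^esub> transport Y' x0 x (?b x0 \<xi>))"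
    using eventually_mem[OF Y']
  proof (rule eventually_mono)
    fix x assume x: "x \<in> Y'"
    show "0 \<le> nx x (?b x (transport Y' x0 x \<xi>) \<ominus>\<^bsub>Hx x\<^esub> transport Y' x0 x (?b x0 \<xi>))"
      by (intro F.hnorm_nonneg F.v_minus_closed bc transport_closed[OF Y' x] \<xi>)
  qed
  show "((\<lambda>x. nx x (?b x (transport Y' x0 x \<xi>) \<ominus>\<^bsub>Hx x\<^esub> transport Y' x0 x (?b x0 \<xi>))) \<longlongrightarrow> 0) (nhds x0)"
    by (rule real_tendsto_sandwich[OF nn ev tendsto_const lim])
qed

text \<open>Mapping sections to sections is preserved by the algebraic operations and by uniform
  limits, the latter because each section is bounded.\<close>

theorem NB_continuous_field:
  assumes b: "b \<in> carrier NB.AA"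
  shows "continuous_field b"
proof -
  have "\<forall>v\<in>carrier E. (\<lambda>x. b x (v x)) \<in> carrier E"
    using b
  proof (induction b rule: NB.AA_induct)
    case zero
    then show ?case
      using E_zero by (simp add: E_fibre)
  next
    case (gen f Y T)
    then show ?case
      using continuous_fieldD(4)[OF elementary_field_continuous_field[OF gen]] by blast
  next
    case (add a b)
    show ?case
    proof
      fix v assume v: "v \<in> carrier E"
      have "(\<lambda>x. a x (v x) \<oplus>\<^bsub>Hx x\<^esub> b x (v x)) \<in> carrier E"
        by (rule E_add) (use add(3,4) v in auto)
      then show "(\<lambda>x. (a x \<oplus>\<^bsub>Bx x\<^esub> b x) (v x)) \<in> carrier E"
        by (simp add: E_fibre[OF v])
    qed
  next
    case (smult c a)
    show ?case
    proof
      fix v assume v: "v \<in> carrier E"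
      have "(\<lambda>x. c \<odot>\<^bsub>Hx x\<^esub> a x (v x)) \<in> carrier E"
        by (rule E_smult) (use smult(2) v in auto)
      then show "(\<lambda>x. (c \<odot>\<^bsub>Bx x\<^esub> a x) (v x)) \<in> carrier E"
        by (simp add: E_fibre[OF v])
    qed
  next
    case (mult a b)
    show ?case
    proof
      fix v assume v: "v \<in> carrier E"
      have "(\<lambda>x. b x (v x)) \<in> carrier E"
        using mult(4) v by blast
      from bspec[OF mult(3) this] have "(\<lambda>x. a x (b x (v x))) \<in> carrier E" .
      then show "(\<lambda>x. (a x \<otimes>\<^bsub>Bx x\<^esub> b x) (v x)) \<in> carrier E"
        by (simp add: E_fibre[OF v])
    qed
  next
    case (lim a)
    show ?case
    proof
      fix v assume v: "v \<in> carrier E"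
      obtain B where B: "B > 0" "\<And>x. nx x (v x) \<le> B"
        using E_bounded[OF v] by blast
      have aB: "a x \<in> F.BOps x" for x
        using NB.AA_fibre[OF lim(1), of x] by simp
      show "(\<lambda>x. a x (v x)) \<in> carrier E"
      proof (rule E_uniform_limit)
        show "a x (v x) \<in> carrier (Hx x)" for x
          by (rule F.BOpsD(3)[OF aB E_fibre[OF v]])
        fix e :: real assume "e > 0"
        then have "e / B > 0"
          using B by simp
        then obtain b where b: "b \<in> carrier NB.AA" "\<forall>v\<in>carrier E. (\<lambda>x. b x (v x)) \<in> carrier E"
          "\<And>x. nrm (Bx x) (a x \<ominus>\<^bsub>Bx x\<^esub> b x) \<le> e / B"
          using lim(2) by blast
        have bB: "b x \<in> F.BOps x" for x
          using NB.AA_fibre[OF b(1), of x] by simp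
        have "nx x (b x (v x) \<ominus>\<^bsub>Hx x\<^esub> a x (v x)) \<le> e" for x
        proof -
          have d: "a x \<ominus>\<^bsub>Bx x\<^esub> b x \<in> F.BOps x"
            using F.BA.v_minus_closed[of "a x" x "b x"] aB bB by simp
          have "nx x (a x (v x) \<ominus>\<^bsub>Hx x\<^esub> b x (v x)) \<le> F.B.opn x (a x \<ominus>\<^bsub>Bx x\<^esub> b x) * nx x (v x)"
            using F.B.opn_upper[OF d E_fibre[OF v]] by (simp add: Bx_minus_apply[OF aB bB E_fibre[OF v]])
          also have "\<dots> \<le> e / B * B"
            using b(3)[of x] \<open>e / B > 0\<close> by (intro mult_mono B(2)) (auto simp: F.hnorm_nonneg E_fibre[OF v])
          finally show ?thesis
            using B(1) F.N.n_minus_commute[OF F.BOpsD(3)[OF aB E_fibre[OF v]] F.BOpsD(3)[OF bB E_fibre[OF v]]] by simp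
        qed
        then show "\<exists>w\<in>carrier E. \<forall>x. nx x (w x \<ominus>\<^bsub>Hx x\<^esub> a x (v x)) \<le> e"
          using b(2) v by (intro bexI[of _ "\<lambda>x. b x (v x)"]) auto
      qed
    qed
  qed
  then show ?thesis
    unfolding continuous_field_def using NB_bounded(1)[OF NB.AA_P[OF b]] by blast
qed

subsection \<open>Sections of the net of bounded operators\<close>

definition hat_field :: "('x set \<Rightarrow> 'h \<Rightarrow> 'h) \<Rightarrow> 'x \<Rightarrow> 'k \<Rightarrow> 'k" where
  "hat_field T x = (let Y = (SOME Y. Y \<in> omega K x) in adV H Hx V x Y (T Y))"

lemma hat_operator_eq: "hat_operator K H Hx V \<T> T = fibrewise E (hat_field T)"
  by (simp add: hat_operator_def hat_field_def[abs_def])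

lemma adU_apply: "Y \<in> K \<Longrightarrow> Y' \<in> K \<Longrightarrow> Y \<subseteq> Y' \<Longrightarrow> h \<in> carrier (H Y) \<Longrightarrow> adU H U Y' Y T (U Y' Y h) = U Y' Y (T h)"
  unfolding adU_def by (rule unitary_pair.ad_U[OF U_unitary])

text \<open>Conjugations compose, and \<open>V x Y'\<close> after \<open>U Y' Y\<close> is
  \<open>V x Y\<close>.\<close>

lemma adV_adU:
  assumes Y: "Y \<in> K" "Y' \<in> K" "Y \<subseteq> Y'" "x \<in> Y" and T: "T \<in> carrier (BH H Y)"
  shows "adV H Hx V x Y' (adU H U Y' Y T) = adV H Hx V x Y T"
proof -
  interpret HY: hilbert_space "H Y" by (rule H_hilbert[OF Y(1)])
  have x': "x \<in> Y'"
    using Y by blast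
  have "V x Y' (adU H U Y' Y T (Vi x Y' \<xi>)) = V x Y (T (Vi x Y \<xi>))" if \<xi>: "\<xi> \<in> carrier (Hx x)" for \<xi>
  proof -
    define h where "h = Vi x Y \<xi>"
    have h: "h \<in> carrier (H Y)"
      using Vi_closed[OF Y(1,4) \<xi>] by (simp add: h_def)
    have Th: "T h \<in> carrier (H Y)"
      using T h HY.BOpsD(3) by (simp add: BH_carrier[OF Y(1)])
    have Uh: "U Y' Y h \<in> carrier (H Y')"
      by (rule U_closed[OF Y(1-3) h])
    have "V x Y' (U Y' Y h) = \<xi>"
      using V_U[OF Y(1,2,4,3) h] V_Vi[OF Y(1,4) \<xi>] by (simp add: h_def)
    then have "Vi x Y' \<xi> = U Y' Y h"
      using Vi_V[OF Y(2) x' Uh] by simp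
    then show ?thesis
      using adU_apply[OF Y(1-3) h] V_U[OF Y(1,2,4,3) Th] by (simp add: h_def)
  qed
  then show ?thesis
    unfolding adV_def ad_def Vi_def[symmetric] by (intro restrict_ext) auto
qed

context
  fixes T assumes T: "net_section K (BH H) (adU H U) T"
begin

lemma section_carrier: "Y \<in> K \<Longrightarrow> T Y \<in> carrier (BH H Y)"
  using T unfolding net_section_def by (elim conjE bspec)

lemma section_closed: "Y \<in> K \<Longrightarrow> h \<in> carrier (H Y) \<Longrightarrow> T Y h \<in> carrier (H Y)"
  using section_carrier hilbert_space.BOpsD(3)[OF H_hilbert] BH_carrier by blast

text \<open>The two sets are compared through a smaller member of the base around x, contained in
  both; a common larger one need not exist in K.\<close>

lemma adV_section:
  assumes Y: "Y \<in> K" "Y' \<in> K" "x \<in> Y" "x \<in> Y'"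
  shows "adV H Hx V x Y (T Y) = adV H Hx V x Y' (T Y')"
proof -
  obtain Z where Z: "Z \<in> K" "x \<in> Z" "Z \<subseteq> Y \<inter> Y'"
    using K_nbhd[of "Y \<inter> Y'" x] assms K_open by blast
  have "\<forall>Y\<in>K. \<forall>Y'\<in>K. Y \<subseteq> Y' \<longrightarrow> T Y' = adU H U Y' Y (T Y)"
    using T unfolding net_section_def by (rule conjunct2)
  then have "T Y = adU H U Y Z (T Z)" "T Y' = adU H U Y' Z (T Z)"
    using Y Z by blast+
  then show ?thesis
    using adV_adU[OF Z(1) Y(1) _ Z(2) section_carrier[OF Z(1)]] adV_adU[OF Z(1) Y(2) _ Z(2) section_carrier[OF Z(1)]] Z(3)
    by simp
qed

lemma hat_field_eq: "Y \<in> K \<Longrightarrow> x \<in> Y \<Longrightarrow> hat_field T x = adV H Hx V x Y (T Y)"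
proof -
  assume Y: "Y \<in> K" "x \<in> Y"
  have "(SOME Y. Y \<in> omega K x) \<in> omega K x"
    by (rule someI[of _ Y]) (use Y in \<open>simp add: omega_def\<close>)
  then show ?thesis
    using adV_section[OF _ Y(1) _ Y(2)] by (simp add: hat_field_def Let_def omega_def)
qed

lemma hat_field_apply: "Y \<in> K \<Longrightarrow> x \<in> Y \<Longrightarrow> \<xi> \<in> carrier (Hx x) \<Longrightarrow> hat_field T x \<xi> = V x Y (T Y (Vi x Y \<xi>))"
  by (simp add: hat_field_eq adV_apply)

lemma hat_field_BOps: "hat_field T x \<in> F.BOps x"
proof -
  obtain Y where Y: "Y \<in> K" "x \<in> Y"
    using K_cover by blast
  show ?thesis
    using star_homD(1)[OF adV_hom[OF Y] section_carrier[OF Y(1)]] by (simp add: hat_field_eq[OF Y])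
qed

lemma hat_field_transport:
  assumes Y: "Y \<in> K" "x0 \<in> Y" "x \<in> Y" and \<xi>: "\<xi> \<in> carrier (Hx x0)"
  shows "hat_field T x (transport Y x0 x \<xi>) = transport Y x0 x (hat_field T x0 \<xi>)"
  using Vi_closed[OF Y(1,2) \<xi>] section_closed[OF Y(1) Vi_closed[OF Y(1,2) \<xi>]] transport_closed[OF Y \<xi>] Y \<xi>
  by (simp add: hat_field_apply[OF Y(1)] transport_def Vi_V)

text \<open>Inside a chart the field commutes with the isometric transport, so a bound valid at one
  point of the chart is valid at all of them. The set where a fixed bound holds is thus open and
  closed.\<close>

lemma hat_field_bounded:
  assumes conn: "connected (UNIV :: 'x set)"
  shows "bounded_field (hat_field T)"
proof -
  \<comment> \<open>An arbitrary base point, which exists because types are inhabited.\<close>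
  fix x1 :: 'x
  obtain c where c: "c \<ge> 0" "\<forall>\<xi>\<in>carrier (Hx x1). nx x1 (hat_field T x1 \<xi>) \<le> c * nx x1 \<xi>"
    using F.BOpsD(6)[OF hat_field_BOps] by blast
  define S where "S = {x. \<forall>\<xi>\<in>carrier (Hx x). nx x (hat_field T x \<xi>) \<le> c * nx x \<xi>}"
  have step: "x \<in> S" if Y: "Y \<in> K" "x0 \<in> Y" "x \<in> Y" and x0: "x0 \<in> S" for Y x0 x
    unfolding S_def
  proof (intro CollectI ballI)
    fix \<eta> assume \<eta>: "\<eta> \<in> carrier (Hx x)"
    define \<xi> where "\<xi> = transport Y x x0 \<eta>"
    have \<xi>: "\<xi> \<in> carrier (Hx x0)" "nx x0 \<xi> = nx x \<eta>"
      using transport_closed[OF Y(1,3,2) \<eta>] transport_hnorm[OF Y(1,3,2) \<eta>] by (simp_all add: \<xi>_def)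
    have "hat_field T x0 \<xi> = transport Y x x0 (hat_field T x \<eta>)"
      unfolding \<xi>_def by (rule hat_field_transport[OF Y(1,3,2) \<eta>])
    then have "nx x0 (hat_field T x0 \<xi>) = nx x (hat_field T x \<eta>)"
      using transport_hnorm[OF Y(1,3,2) F.BOpsD(3)[OF hat_field_BOps \<eta>]] by simp
    then show "nx x (hat_field T x \<eta>) \<le> c * nx x \<eta>"
      using x0 \<xi> by (auto simp: S_def)
  qed
  have "open S"
    unfolding open_subopen[of S]
  proof
    fix x assume x: "x \<in> S"
    obtain Y where Y: "Y \<in> K" "x \<in> Y"
      using K_cover by blast
    then show "\<exists>T. open T \<and> x \<in> T \<and> T \<subseteq> S"
      using step[OF Y] x K_open by blast
  qed
  moreover have "open (- S)"
    unfolding open_subopen[of "- S"]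
  proof
    fix x assume x: "x \<in> - S"
    obtain Y where Y: "Y \<in> K" "x \<in> Y"
      using K_cover by blast
    then show "\<exists>T. open T \<and> x \<in> T \<and> T \<subseteq> - S"
      using step[OF Y(1) _ Y(2)] x K_open by blast
  qed
  moreover have "x1 \<in> S"
    using c(2) by (simp add: S_def)
  ultimately have "S = UNIV"
    using connectedD[OF conn, of S "- S"] by auto
  then show ?thesis
    unfolding bounded_field_def S_def using hat_field_BOps c(1) by blast
qed

text \<open>Commutation with transport makes the deviation in the local criterion vanish identically
  near x0; only boundedness uses a global property of the base.\<close>

lemma hat_field_continuous_field:
  assumes conn: "connected (UNIV :: 'x set)"
  shows "continuous_field (hat_field T)"
proof (rule continuous_fieldI[OF hat_field_bounded[OF conn]])
  fix Y x0 \<xi> assume Y: "Y \<in> K" "x0 \<in> Y" and \<xi>: "\<xi> \<in> carrier (Hx x0)"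
  have "\<forall>\<^sub>F x in nhds x0. nx x (hat_field T x (transport Y x0 x \<xi>) \<ominus>\<^bsub>Hx x\<^esub> transport Y x0 x (hat_field T x0 \<xi>)) = 0"
    using eventually_mem[OF Y]
    by (rule eventually_mono)
      (simp add: hat_field_transport[OF Y _ \<xi>] transport_closed[OF Y _ F.BOpsD(3)[OF hat_field_BOps \<xi>]])
  then show "((\<lambda>x. nx x (hat_field T x (transport Y x0 x \<xi>) \<ominus>\<^bsub>Hx x\<^esub> transport Y x0 x (hat_field T x0 \<xi>))) \<longlongrightarrow> 0) (nhds x0)"
    by (rule tendsto_eventually)
qed

lemma hat_field_self_adjoint:
  assumes sa: "\<And>Y. Y \<in> K \<Longrightarrow> star (BH H Y) (T Y) = T Y"
    and \<xi>: "\<xi> \<in> carrier (Hx x)" and \<eta>: "\<eta> \<in> carrier (Hx x)"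
  shows "ip (Hx x) (hat_field T x \<xi>) \<eta> = ip (Hx x) \<xi> (hat_field T x \<eta>)"
proof -
  obtain Y where Y: "Y \<in> K" "x \<in> Y"
    using K_cover by blast
  have "star (Bx x) (hat_field T x) = hat_field T x"
    using star_homD(5)[OF adV_hom[OF Y] section_carrier[OF Y(1)]] sa[OF Y(1)] by (simp add: hat_field_eq[OF Y])
  then show ?thesis
    using F.adjoint_BOps(2)[OF hat_field_BOps \<xi> \<eta>] by simp
qed

end

end

section \<open>Kasparov bimodules from Fredholm modules\<close>

context operator_space
begin

lemma commutator_plain:
  assumes S: "S \<in> Ops" and T: "T \<in> Ops"
  shows "commutator Plain OA \<gamma> S T = (\<lambda>v\<in>carrier M. S (T v) \<ominus> T (S v))"
proof -
  have "commutator Plain OA \<gamma> S T = (\<lambda>v\<in>carrier M. S (T v)) \<ominus>\<^bsub>OA\<^esub> (\<lambda>v\<in>carrier M. T (S v))"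
    by simp
  also have "\<dots> = (\<lambda>v\<in>carrier M. S (T v) \<ominus> T (S v))"
    unfolding OA_minus[OF O_mult[OF S T] O_mult[OF T S]] by (rule restrict_ext) simp
  finally show ?thesis .
qed

text \<open>An even S has odd part 0, which kills the correction term.\<close>

lemma commutator_graded_even:
  assumes S: "S \<in> Ops" and T: "T \<in> Ops" "\<gamma> T \<in> Ops" and \<gamma>: "\<gamma> S = S"
  shows "commutator Graded OA \<gamma> S T = (\<lambda>v\<in>carrier M. S (T v) \<ominus> T (S v))"
proof -
  have odd: "odd_part OA \<gamma> R \<in> Ops" if "R \<in> Ops" "\<gamma> R \<in> Ops" for R
    unfolding odd_part_def using OM.v_smult[OF OM.v_minus_closed[of R "\<gamma> R"], of "1/2"] that by simp
  have "odd_part OA \<gamma> S = \<zero>\<^bsub>OA\<^esub>"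
    unfolding odd_part_def \<gamma> using S OM.v_minus_self[of S] OM.v_smult_zero by simp
  moreover have "odd_part OA \<gamma> T (\<zero>) = \<zero>"
    using O_smult_apply[OF odd[OF T], of \<zero> 0] O_closed[OF odd[OF T], of \<zero>] by simp
  ultimately have "2 \<odot>\<^bsub>OA\<^esub> (odd_part OA \<gamma> T \<otimes>\<^bsub>OA\<^esub> odd_part OA \<gamma> S) = \<zero>\<^bsub>OA\<^esub>"
    by (auto intro!: restrict_ext)
  moreover have "commutator Plain OA \<gamma> S T \<in> carrier OA"
    using OM.v_minus_closed[of "S \<otimes>\<^bsub>OA\<^esub> T" "T \<otimes>\<^bsub>OA\<^esub> S"] O_mult[OF S T(1)] O_mult[OF T(1) S] by simp
  ultimately have "commutator Graded OA \<gamma> S T = commutator Plain OA \<gamma> S T"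
    using OM.v_rzero[of "commutator Plain OA \<gamma> S T"] by (simp only: commutator.simps)
  then show ?thesis
    using commutator_plain[OF S T(1)] by simp
qed

text \<open>An odd S is its own odd part, and twice the odd part of T is T - \<gamma>(T). The
  correction is therefore (T - \<gamma>(T)) S and replaces T S by \<gamma>(T) S.\<close>

lemma commutator_graded_odd:
  assumes S: "S \<in> Ops" and T: "T \<in> Ops" "T' \<in> Ops" and \<gamma>: "\<gamma> S = \<ominus>\<^bsub>OA\<^esub> S" "\<gamma> T = T'"
  shows "commutator Graded OA \<gamma> S T = (\<lambda>v\<in>carrier M. S (T v) \<ominus> T' (S v))"
proof -
  have Sc: "S \<in> carrier OA" and Tc: "T \<in> carrier OA" "T' \<in> carrier OA"
    using S T by auto
  have "odd_part OA \<gamma> S = S"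
    unfolding odd_part_def \<gamma> OM.v_neg[OF Sc]
    by (rule OM.linear_combinations2[of S S], rule Sc, rule Sc) (use Sc OM.v_minus[OF Sc OM.v_smult[OF Sc]] OM.v_smult_add OM.v_add_smult[OF Sc, of "1/2" "1/2"] OM.v_one[OF Sc] in \<open>simp del: operator_algebra_sel\<close>)
  define R where "R = odd_part OA \<gamma> T"
  have R: "R = (1/2) \<odot>\<^bsub>OA\<^esub> (T \<ominus>\<^bsub>OA\<^esub> T')"
    by (simp add: R_def odd_part_def \<gamma>)
  have RO: "R \<in> Ops"
    using OM.v_smult[OF OM.v_minus_closed[OF Tc], of "1/2"] unfolding R by simp
  have Rv: "2 \<odot> R v = T v \<ominus> T' v" if v: "v \<in> carrier M" for v
    using v O_closed[OF T(1) v] O_closed[OF T(2) v] by (simp add: R OA_minus[OF T])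
  have P: "commutator Plain OA \<gamma> S T \<in> Ops"
    using OM.v_minus_closed[of "S \<otimes>\<^bsub>OA\<^esub> T" "T \<otimes>\<^bsub>OA\<^esub> S"] O_mult[OF S T(1)] O_mult[OF T(1) S] by simp
  have "commutator Graded OA \<gamma> S T = commutator Plain OA \<gamma> S T \<oplus>\<^bsub>OA\<^esub> 2 \<odot>\<^bsub>OA\<^esub> (R \<otimes>\<^bsub>OA\<^esub> S)"
    using \<open>odd_part OA \<gamma> S = S\<close> by (simp only: commutator.simps R_def)
  also have "\<dots> = (\<lambda>v\<in>carrier M. S (T v) \<ominus> T' (S v))"
    unfolding commutator_plain[OF S T(1)] operator_algebra_sel
  proof (rule restrict_ext)
    fix v assume v: "v \<in> carrier M"
    have c: "S (T v) \<in> carrier M" "T (S v) \<in> carrier M" "T' (S v) \<in> carrier M" "S v \<in> carrier M"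
      using v S T O_closed by auto
    have "(S (T v) \<ominus> T (S v)) \<oplus> (T (S v) \<ominus> T' (S v)) = S (T v) \<ominus> T' (S v)"
      by (rule v_minus_trans[OF c(1-3)])
    then show "(\<lambda>v\<in>carrier M. S (T v) \<ominus> T (S v)) v \<oplus> (\<lambda>v\<in>carrier M. 2 \<odot> (\<lambda>v\<in>carrier M. R (S v)) v) v
      = S (T v) \<ominus> T' (S v)"
      using v Rv[OF c(4)] by simp
  qed
  finally show ?thesis .
qed

end

section \<open>Fibre maps from the universal property\<close>

locale bundle_over_net = hilbert_bundle K H U Hx V \<T>
  for K :: "'x::topological_space set set" and H :: "'x set \<Rightarrow> (complex, 'h) ip_module"
    and U :: "'x set \<Rightarrow> 'x set \<Rightarrow> 'h \<Rightarrow> 'h" and Hx :: "'x \<Rightarrow> (complex, 'k) ip_module"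
    and V :: "'x \<Rightarrow> 'x set \<Rightarrow> 'h \<Rightarrow> 'k" and \<T> :: "('x \<times> 'k) topology" +
  fixes A :: "'x set \<Rightarrow> 'a star_alg" and j :: "'x set \<Rightarrow> 'x set \<Rightarrow> 'a \<Rightarrow> 'a"
    and Ax :: "'x \<Rightarrow> ('x set, 'a) univ_carrier star_alg" and \<epsilon> :: "'x \<Rightarrow> 'x set \<Rightarrow> 'a \<Rightarrow> ('x set, 'a) univ_carrier"
  assumes net: "cstar_net K A j"
    and universal: "\<And>x. universal_cstar_algebra (omega K x) A j (Ax x) (\<epsilon> x)"
    and conn: "connected (UNIV :: 'x set)"
begin

lemma \<epsilon>_compatible: "compatible_family (omega K x) A j (Ax x) (\<epsilon> x)"
  using universal by (simp add: universal_cstar_algebra_def)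

sublocale NA: net_fields Ax K A \<epsilon>
proof (intro net_fields.intro net_fields_axioms.intro cstar_family.intro)
  show "cstar_algebra (Ax x)" for x
    using universal by (simp add: universal_cstar_algebra_def)
  show "cstar_algebra (A Y)" if "Y \<in> K" for Y
    using net that unfolding cstar_net_def unital_cstar_algebra_def by blast
  show "star_hom (A Y) (Ax x) (\<epsilon> x Y)" if "Y \<in> K" "x \<in> Y" for Y x
    using \<epsilon>_compatible[of x] that by (simp add: compatible_family_def omega_def)
qed (simp_all add: Hausdorff K_open)

lemma \<epsilon>_j: "Y \<in> K \<Longrightarrow> Y' \<in> K \<Longrightarrow> Y \<subseteq> Y' \<Longrightarrow> x \<in> Y \<Longrightarrow> t \<in> carrier (A Y) \<Longrightarrow> \<epsilon> x Y' (j Y' Y t) = \<epsilon> x Y t"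
  using \<epsilon>_compatible[of x] subsetD[of Y Y' x] by (simp add: compatible_family_def omega_def)

lemma net_morphismD:
  assumes "net_morphism K A j B y \<phi>" "Y \<in> K"
  shows "star_hom (A Y) (B Y) (\<phi> Y)"
    "Y' \<in> K \<Longrightarrow> Y \<subseteq> Y' \<Longrightarrow> t \<in> carrier (A Y) \<Longrightarrow> \<phi> Y' (j Y' Y t) = y Y' Y (\<phi> Y t)"
  using assms by (simp_all add: net_morphism_def)

text \<open>At each point x, \<open>\<phi>\<close> followed by \<open>\<epsilon>'\<close> is a
  compatible family on the sets containing x, and the universal property, extended to targets of
  arbitrary type, yields the map on the fibre.\<close>

lemma fibre_maps:
  assumes B: "net_fields Cx K B \<epsilon>'"
    and \<phi>: "net_morphism K A j B y \<phi>"
    and comp: "\<And>x Y Y' s. Y \<in> K \<Longrightarrow> Y' \<in> K \<Longrightarrow> Y \<subseteq> Y' \<Longrightarrow> x \<in> Y \<Longrightarrow> s \<in> carrier (B Y) \<Longrightarrow> \<epsilon>' x Y' (y Y' Y s) = \<epsilon>' x Y s"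
  shows "\<exists>\<kappa>. fibrewise_morphism Ax K A \<epsilon> Cx B \<epsilon>' \<phi> \<kappa>"
proof -
  interpret B: net_fields Cx K B \<epsilon>' by (rule B)
  have "\<exists>\<kappa>. star_hom (Ax x) (Cx x) \<kappa> \<and> (\<forall>Y\<in>omega K x. \<forall>t\<in>carrier (A Y). \<kappa> (\<epsilon> x Y t) = \<epsilon>' x Y (\<phi> Y t))" for x
  proof -
    have "compatible_family (omega K x) A j (Cx x) (\<lambda>Y t. \<epsilon>' x Y (\<phi> Y t))"
      unfolding compatible_family_def
    proof (intro conjI ballI impI)
      fix Y assume "Y \<in> omega K x"
      then have Y: "Y \<in> K" "x \<in> Y"
        by (simp_all add: omega_def)
      show "star_hom (A Y) (Cx x) (\<lambda>t. \<epsilon>' x Y (\<phi> Y t))"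
        by (rule star_hom_compose[OF net_morphismD(1)[OF \<phi> Y(1)] B.\<epsilon>_hom[OF Y]])
      fix Y' t assume "Y' \<in> omega K x" "Y \<subseteq> Y'" and t: "t \<in> carrier (A Y)"
      then have Y': "Y' \<in> K" "Y \<subseteq> Y'"
        by (simp_all add: omega_def)
      show "\<epsilon>' x Y' (\<phi> Y' (j Y' Y t)) = \<epsilon>' x Y (\<phi> Y t)"
        unfolding net_morphismD(2)[OF \<phi> Y(1) Y' t]
        by (rule comp[OF Y(1) Y' Y(2) star_homD(1)[OF net_morphismD(1)[OF \<phi> Y(1)] t]])
    qed
    from universal_map[OF universal B.fibre this] show ?thesis
      by metis
  qed
  then obtain \<kappa> where \<kappa>: "\<And>x. star_hom (Ax x) (Cx x) (\<kappa> x)"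
    "\<And>x Y t. Y \<in> omega K x \<Longrightarrow> t \<in> carrier (A Y) \<Longrightarrow> \<kappa> x (\<epsilon> x Y t) = \<epsilon>' x Y (\<phi> Y t)"
    by metis
  have "fibrewise_morphism Ax K A \<epsilon> Cx B \<epsilon>' \<phi> \<kappa>"
    using \<kappa> by (intro fibrewise_morphism.intro fibrewise_morphism_axioms.intro NA.net_fields_axioms B net_morphismD(1)[OF \<phi>])
      (simp_all add: omega_def)
  then show ?thesis
    by (rule exI[of _ \<kappa>])
qed

lemma net_endomorphism_fibres:
  assumes "net_morphism K A j A j \<tau>"
  shows "\<exists>\<kappa>. fibrewise_morphism Ax K A \<epsilon> Ax A \<epsilon> \<tau> \<kappa>"
  by (rule fibre_maps[OF NA.net_fields_axioms assms]) (rule \<epsilon>_j)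

lemma net_representation_fibres:
  assumes "net_morphism K A j (BH H) (adU H U) \<pi>"
  shows "\<exists>\<kappa>. fibrewise_morphism Ax K A \<epsilon> Bx (BH H) (adV H Hx V) \<pi> \<kappa>"
  by (rule fibre_maps[OF NB.net_fields_axioms assms]) (rule adV_adU)

end

section \<open>Compactness of squares and twisted commutators as fields\<close>

locale represented_net = bundle_over_net K H U Hx V \<T> A j Ax \<epsilon> +
  M: fibrewise_morphism Ax K A \<epsilon> "\<lambda>x. bounded_operators (Hx x)" "BH H" "adV H Hx V" \<pi> \<kappa>
  for K :: "'x::topological_space set set" and H :: "'x set \<Rightarrow> (complex, 'h) ip_module"
    and U :: "'x set \<Rightarrow> 'x set \<Rightarrow> 'h \<Rightarrow> 'h" and Hx :: "'x \<Rightarrow> (complex, 'k) ip_module"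
    and V :: "'x \<Rightarrow> 'x set \<Rightarrow> 'h \<Rightarrow> 'k" and \<T> :: "('x \<times> 'k) topology"
    and A :: "'x set \<Rightarrow> 'a star_alg" and j :: "'x set \<Rightarrow> 'x set \<Rightarrow> 'a \<Rightarrow> 'a"
    and Ax :: "'x \<Rightarrow> ('x set, 'a) univ_carrier star_alg" and \<epsilon> :: "'x \<Rightarrow> 'x set \<Rightarrow> 'a \<Rightarrow> ('x set, 'a) univ_carrier"
    and \<pi> :: "'x set \<Rightarrow> 'a \<Rightarrow> 'h \<Rightarrow> 'h" and \<kappa> :: "'x \<Rightarrow> ('x set, 'a) univ_carrier \<Rightarrow> 'k \<Rightarrow> 'k"
begin

lemma \<Phi>_continuous_field: "a \<in> carrier NA.AA \<Longrightarrow> continuous_field (M.\<Phi> a)"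
  by (rule NB_continuous_field[OF M.\<Phi>_closed])

lemma \<Phi>_BOps: "a \<in> carrier NA.AA \<Longrightarrow> M.\<Phi> a x \<in> F.BOps x"
  by (rule continuous_fieldD(2)[OF \<Phi>_continuous_field])

lemma \<Phi>_fibre: "a \<in> carrier NA.AA \<Longrightarrow> \<xi> \<in> carrier (Hx x) \<Longrightarrow> M.\<Phi> a x \<xi> \<in> carrier (Hx x)"
  by (rule continuous_fieldD(3)[OF \<Phi>_continuous_field])

lemma \<Phi>_zero: "\<xi> \<in> carrier (Hx x) \<Longrightarrow> M.\<Phi> (\<lambda>x. \<zero>\<^bsub>Ax x\<^esub>) x \<xi> = \<zero>\<^bsub>Hx x\<^esub>"
  using M.\<Phi>_apply[of "\<lambda>x. \<zero>\<^bsub>Ax x\<^esub>" x] NA.AA.v_zero by (simp add: M.\<kappa>_zero)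

lemma \<Phi>_add:
  assumes "a \<in> carrier NA.AA" "b \<in> carrier NA.AA" "\<xi> \<in> carrier (Hx x)"
  shows "M.\<Phi> (\<lambda>x. a x \<oplus>\<^bsub>Ax x\<^esub> b x) x \<xi> = M.\<Phi> a x \<xi> \<oplus>\<^bsub>Hx x\<^esub> M.\<Phi> b x \<xi>"
  using fun_cong[OF fun_cong[OF star_homD(2)[OF M.\<Phi>_hom assms(1,2)]], of x \<xi>] assms(3) by simp

lemma \<Phi>_smult:
  assumes "a \<in> carrier NA.AA" "\<xi> \<in> carrier (Hx x)"
  shows "M.\<Phi> (\<lambda>x. c \<odot>\<^bsub>Ax x\<^esub> a x) x \<xi> = c \<odot>\<^bsub>Hx x\<^esub> M.\<Phi> a x \<xi>"
  using fun_cong[OF fun_cong[OF star_homD(3)[OF M.\<Phi>_hom assms(1), of c]], of x \<xi>] assms(2) by simp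

lemma \<Phi>_mult:
  assumes "a \<in> carrier NA.AA" "b \<in> carrier NA.AA" "\<xi> \<in> carrier (Hx x)"
  shows "M.\<Phi> (\<lambda>x. a x \<otimes>\<^bsub>Ax x\<^esub> b x) x \<xi> = M.\<Phi> a x (M.\<Phi> b x \<xi>)"
  using fun_cong[OF fun_cong[OF star_homD(4)[OF M.\<Phi>_hom assms(1,2)]], of x \<xi>] assms(3) by simp

text \<open>The difference is moved inside the fibre map, whose contractivity turns the distance of
  a and b in the fibre algebra into an operator bound.\<close>

lemma \<Phi>_minus_bound:
  assumes a: "a \<in> carrier NA.AA" and b: "b \<in> carrier NA.AA"
    and e: "nrm (Ax x) (a x \<ominus>\<^bsub>Ax x\<^esub> b x) \<le> e" and \<xi>: "\<xi> \<in> carrier (Hx x)"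
  shows "nx x (M.\<Phi> a x \<xi> \<ominus>\<^bsub>Hx x\<^esub> M.\<Phi> b x \<xi>) \<le> e * nx x \<xi>"
proof -
  have d: "\<kappa> x (a x) \<ominus>\<^bsub>Bx x\<^esub> \<kappa> x (b x) = \<kappa> x (a x \<ominus>\<^bsub>Ax x\<^esub> b x)"
    by (rule M.\<kappa>_minus[OF NA.AA_fibre[OF a] NA.AA_fibre[OF b], symmetric])
  have c: "a x \<ominus>\<^bsub>Ax x\<^esub> b x \<in> carrier (Ax x)"
    by (rule NA.F.v_minus_closed[OF NA.AA_fibre[OF a] NA.AA_fibre[OF b]])
  have n: "F.B.opn x (\<kappa> x (a x \<ominus>\<^bsub>Ax x\<^esub> b x)) \<le> e"
    using order_trans[OF M.\<kappa>_contractive[OF c] e] by simp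
  have kB: "\<kappa> x (a x \<ominus>\<^bsub>Ax x\<^esub> b x) \<in> F.BOps x"
    using star_homD(1)[OF M.\<kappa>_hom c] by simp
  have "M.\<Phi> a x \<xi> \<ominus>\<^bsub>Hx x\<^esub> M.\<Phi> b x \<xi> = \<kappa> x (a x \<ominus>\<^bsub>Ax x\<^esub> b x) \<xi>"
    using Bx_minus_apply[OF \<Phi>_BOps[OF a] \<Phi>_BOps[OF b] \<xi>] unfolding M.\<Phi>_apply[OF a] M.\<Phi>_apply[OF b] d by simp
  then show ?thesis
    using order_trans[OF F.B.opn_upper[OF kB \<xi>] mult_right_mono[OF n F.hnorm_nonneg[OF \<xi>]]] by simp
qed

lemma \<Phi>_star: "a \<in> carrier NA.AA \<Longrightarrow> M.\<Phi> (star NA.AA a) = (\<lambda>x. adjoint_op (Hx x) (M.\<Phi> a x))"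
  using star_homD(5)[OF M.\<Phi>_hom] by simp

lemma \<Phi>_adjoint:
  assumes "a \<in> carrier NA.AA" "\<xi> \<in> carrier (Hx x)" "\<eta> \<in> carrier (Hx x)"
  shows "ip (Hx x) (M.\<Phi> a x \<xi>) \<eta> = ip (Hx x) \<xi> (M.\<Phi> (star NA.AA a) x \<eta>)"
    "ip (Hx x) (M.\<Phi> (star NA.AA a) x \<xi>) \<eta> = ip (Hx x) \<xi> (M.\<Phi> a x \<eta>)"
  unfolding \<Phi>_star[OF assms(1)]
  by (rule F.adjoint_BOps(2)[OF \<Phi>_BOps[OF assms(1)] assms(2,3)], rule F.adjoint_swap[OF \<Phi>_BOps[OF assms(1)] assms(2,3)])

lemma compact_field_\<Phi>:
  assumes a: "a \<in> carrier NA.AA" and b: "compact_field b"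
  shows "compact_field (\<lambda>x \<xi>. b x (M.\<Phi> a x \<xi>))"
  by (rule compact_field_right[OF \<Phi>_continuous_field[OF a] \<Phi>_continuous_field[OF NA.AA.star_closed[OF a]] b \<Phi>_adjoint(2)[OF a]])

lemma compact_field_zero: "compact_field (\<lambda>x \<xi>. \<zero>\<^bsub>Hx x\<^esub>)"
  unfolding compact_field_def
proof (intro conjI allI impI)
  fix e :: real assume "e > 0"
  then show "\<exists>ps. set ps \<subseteq> carrier E \<times> carrier E \<and>
      (\<forall>x. \<forall>\<xi>\<in>carrier (Hx x). nx x (\<zero>\<^bsub>Hx x\<^esub> \<ominus>\<^bsub>Hx x\<^esub> FR ps x \<xi>) \<le> e * nx x \<xi>)"
    by (intro exI[of _ "[]"]) (simp add: F.hnorm_nonneg)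
qed simp

lemma \<Phi>_elementary_apply:
  assumes Y: "Y \<in> K" and f: "f \<in> C0 Y" and t: "t \<in> carrier (A Y)" and \<xi>: "\<xi> \<in> carrier (Hx x)"
  shows "M.\<Phi> (elementary_field Ax \<epsilon> f Y t) x \<xi> = (if x \<in> Y then f x \<odot>\<^bsub>Hx x\<^esub> V x Y (\<pi> Y t (Vi x Y \<xi>)) else \<zero>\<^bsub>Hx x\<^esub>)"
  unfolding M.\<Phi>_elementary_field[OF Y f t]
  by (rule elementary_field_apply[OF Y star_homD(1)[OF M.\<phi>_hom[OF Y] t] \<xi>])

lemma elementary_AA: "Y \<in> K \<Longrightarrow> f \<in> C0 Y \<Longrightarrow> t \<in> carrier (A Y) \<Longrightarrow> elementary_field Ax \<epsilon> f Y t \<in> carrier NA.AA"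
  using NA.gens_AA by blast

lemma \<pi>_closed: "Y \<in> K \<Longrightarrow> t \<in> carrier (A Y) \<Longrightarrow> h \<in> carrier (H Y) \<Longrightarrow> \<pi> Y t h \<in> carrier (H Y)"
  using star_homD(1)[OF M.\<phi>_hom] BH_carrier hilbert_space.BOpsD(3)[OF H_hilbert] by blast

context
  fixes F assumes F: "net_section K (BH H) (adU H U) F"
begin

abbreviation "Fh \<equiv> hat_field F"

lemma Fh_continuous_field: "continuous_field Fh"
  by (rule hat_field_continuous_field[OF F conn])

lemma Fh_BOps: "Fh x \<in> F.BOps x"
  by (rule hat_field_BOps[OF F])

lemma Fh_closed: "\<xi> \<in> carrier (Hx x) \<Longrightarrow> Fh x \<xi> \<in> carrier (Hx x)"
  by (rule F.BOpsD(3)[OF Fh_BOps])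

lemmas Fh_add = F.BOpsD(4)[OF Fh_BOps] and Fh_smult = F.BOpsD(5)[OF Fh_BOps]

lemmas Fh_minus = BOps_minus[OF Fh_BOps] and Fh_zero = BOps_zero[OF Fh_BOps]

text \<open>F^2 - 1 stands on the left, so for a product a b the claim for a is enough: \<pi>(b) is
  absorbed by composition on the right.\<close>

theorem compact_square:
  assumes sq: "\<And>Y. Y \<in> K \<Longrightarrow> (\<lambda>h\<in>carrier (H Y). F Y (F Y h) \<ominus>\<^bsub>H Y\<^esub> h) \<in> compact_operators (H Y)"
    and a: "a \<in> carrier NA.AA"
  shows "compact_field (\<lambda>x \<xi>. Fh x (Fh x (M.\<Phi> a x \<xi>)) \<ominus>\<^bsub>Hx x\<^esub> M.\<Phi> a x \<xi>)"
  using a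
proof (induction a rule: NA.AA_induct)
  case zero
  show ?case
    by (rule compact_field_cong[OF compact_field_zero]) (simp add: \<Phi>_zero Fh_zero)
next
  case (gen f Y t)
  \<comment> \<open>g goes with the compact operator F^2 - 1 over \<open>Y\<close>, and h with
    \<pi>(t), which is composed afterwards as a field. The ideal property is thus applied to compact
    fields, and not to the compact operators over \<open>Y\<close>.\<close>
  obtain g h where gh: "g \<in> C0 Y" "h \<in> C0 Y" "\<And>x. f x = g x * h x"
    using C0_factor[OF gen(2)] by metis
  let ?T = "\<lambda>h\<in>carrier (H Y). F Y (F Y h) \<ominus>\<^bsub>H Y\<^esub> h"
  let ?b = "\<lambda>x \<xi>. if x \<in> Y then g x \<odot>\<^bsub>Hx x\<^esub> V x Y (?T (Vi x Y \<xi>)) else \<zero>\<^bsub>Hx x\<^esub>"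
  let ?c = "M.\<Phi> (elementary_field Ax \<epsilon> h Y t)"
  have bT: "?b x \<zeta> = g x \<odot>\<^bsub>Hx x\<^esub> (Fh x (Fh x \<zeta>) \<ominus>\<^bsub>Hx x\<^esub> \<zeta>)" if x: "x \<in> Y" and \<zeta>: "\<zeta> \<in> carrier (Hx x)" for x \<zeta>
  proof -
    define k where "k = Vi x Y \<zeta>"
    have k: "k \<in> carrier (H Y)" "F Y k \<in> carrier (H Y)" "F Y (F Y k) \<in> carrier (H Y)"
      using Vi_closed[OF gen(1) x \<zeta>] section_closed[OF F gen(1)] by (simp_all add: k_def)
    have "Fh x \<zeta> = V x Y (F Y k)"
      using hat_field_apply[OF F gen(1) x \<zeta>] by (simp add: k_def)
    moreover have "Fh x (V x Y (F Y k)) = V x Y (F Y (F Y k))"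
      using hat_field_apply[OF F gen(1) x V_closed[OF gen(1) x k(2)]] Vi_V[OF gen(1) x k(2)] by simp
    moreover have "V x Y (F Y (F Y k) \<ominus>\<^bsub>H Y\<^esub> k) = V x Y (F Y (F Y k)) \<ominus>\<^bsub>Hx x\<^esub> \<zeta>"
      using V_minus[OF gen(1) x k(3,1)] V_Vi[OF gen(1) x \<zeta>] by (simp add: k_def)
    ultimately show ?thesis
      using x k(1) by (simp add: k_def)
  qed
  have "compact_field (\<lambda>x \<xi>. ?b x (?c x \<xi>))"
    by (rule compact_field_\<Phi>[OF elementary_AA[OF gen(1) gh(2) gen(3)]])
      (rule compact_field_generator[OF gen(1) gh(1) sq[OF gen(1)]])
  then show ?case
  proof (rule compact_field_cong)
    fix x \<xi> assume \<xi>: "\<xi> \<in> carrier (Hx x)"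
    define \<zeta> where "\<zeta> = ?c x \<xi>"
    have \<zeta>: "\<zeta> \<in> carrier (Hx x)"
      unfolding \<zeta>_def by (rule \<Phi>_fibre[OF elementary_AA[OF gen(1) gh(2) gen(3)] \<xi>])
    show "?b x (?c x \<xi>) = Fh x (Fh x (M.\<Phi> (elementary_field Ax \<epsilon> f Y t) x \<xi>)) \<ominus>\<^bsub>Hx x\<^esub> M.\<Phi> (elementary_field Ax \<epsilon> f Y t) x \<xi>"
    proof (cases "x \<in> Y")
      case True
      have VV: "V x Y (\<pi> Y t (Vi x Y \<xi>)) \<in> carrier (Hx x)"
        by (intro V_closed[OF gen(1) True] \<pi>_closed[OF gen(1,3)] Vi_closed[OF gen(1) True \<xi>])
      have "M.\<Phi> (elementary_field Ax \<epsilon> f Y t) x \<xi> = g x \<odot>\<^bsub>Hx x\<^esub> \<zeta>"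
        unfolding \<zeta>_def using True VV
        by (simp add: \<Phi>_elementary_apply[OF gen \<xi>] \<Phi>_elementary_apply[OF gen(1) gh(2) gen(3) \<xi>] gh(3))
      then show ?thesis
        unfolding \<zeta>_def[symmetric] bT[OF True \<zeta>] using \<zeta>
        by (simp add: Fh_smult Fh_closed F.v_smult_minus)
    next
      case False
      then show ?thesis
        by (simp add: \<Phi>_elementary_apply[OF gen \<xi>] Fh_zero)
    qed
  qed
next
  case (add a b)
  show ?case
    by (rule compact_field_cong[OF compact_field_add[OF add(3,4)]])
      (simp add: \<Phi>_add[OF add(1,2)] Fh_add Fh_closed \<Phi>_fibre[OF add(1)] \<Phi>_fibre[OF add(2)] F.v_add_minus_add)
next
  case (smult c a)
  show ?case
    by (rule compact_field_cong[OF compact_field_smult[OF smult(2), of c]])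
      (simp add: \<Phi>_smult[OF smult(1)] Fh_smult Fh_closed \<Phi>_fibre[OF smult(1)] F.v_smult_minus)
next
  case (mult a b)
  show ?case
    by (rule compact_field_cong[OF compact_field_\<Phi>[OF mult(2,3)]]) (simp add: \<Phi>_mult[OF mult(1,2)])
next
  case (lim a)
  obtain C where C: "C \<ge> 0" "\<And>x \<xi>. \<xi> \<in> carrier (Hx x) \<Longrightarrow> nx x (Fh x \<xi>) \<le> C * nx x \<xi>"
    using bounded_fieldD(3)[OF continuous_fieldD(1)[OF Fh_continuous_field]] by blast
  \<comment> \<open>A Lipschitz constant of p \<mapsto> F^2 p - p when F is bounded by C.\<close>
  define D where "D = C * C + 1"
  have D: "D > 0"
    using C(1) by (simp add: D_def add_nonneg_pos)
  show ?case
  proof (rule compact_field_lim)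
    show "Fh x (Fh x (M.\<Phi> a x \<xi>)) \<ominus>\<^bsub>Hx x\<^esub> M.\<Phi> a x \<xi> \<in> carrier (Hx x)" if "\<xi> \<in> carrier (Hx x)" for x \<xi>
      by (intro F.v_minus_closed Fh_closed \<Phi>_fibre[OF lim(1)] that)
    fix e :: real assume e: "e > 0"
    then obtain b where b: "b \<in> carrier NA.AA"
      "compact_field (\<lambda>x \<xi>. Fh x (Fh x (M.\<Phi> b x \<xi>)) \<ominus>\<^bsub>Hx x\<^esub> M.\<Phi> b x \<xi>)"
      "\<And>x. nrm (Ax x) (a x \<ominus>\<^bsub>Ax x\<^esub> b x) \<le> e / D"
      using lim(2)[of "e / D"] D by auto
    have "nx x ((Fh x (Fh x (M.\<Phi> a x \<xi>)) \<ominus>\<^bsub>Hx x\<^esub> M.\<Phi> a x \<xi>) \<ominus>\<^bsub>Hx x\<^esub> (Fh x (Fh x (M.\<Phi> b x \<xi>)) \<ominus>\<^bsub>Hx x\<^esub> M.\<Phi> b x \<xi>)) \<le> e * nx x \<xi>"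
      if \<xi>: "\<xi> \<in> carrier (Hx x)" for x \<xi>
    proof -
      define p q where "p = M.\<Phi> a x \<xi>" and "q = M.\<Phi> b x \<xi>"
      have pq: "p \<in> carrier (Hx x)" "q \<in> carrier (Hx x)"
        using \<Phi>_fibre[OF lim(1) \<xi>] \<Phi>_fibre[OF b(1) \<xi>] by (simp_all add: p_def q_def)
      define r where "r = p \<ominus>\<^bsub>Hx x\<^esub> q"
      have r: "r \<in> carrier (Hx x)" "nx x r \<le> e / D * nx x \<xi>"
        using pq \<Phi>_minus_bound[OF lim(1) b(1,3) \<xi>] by (simp_all add: r_def p_def q_def)
      \<comment> \<open>There are four vectors for the five places of
        \<open>linear_combinations\<close>; the last place repeats q.\<close>
      have "(Fh x (Fh x p) \<ominus>\<^bsub>Hx x\<^esub> p) \<ominus>\<^bsub>Hx x\<^esub> (Fh x (Fh x q) \<ominus>\<^bsub>Hx x\<^esub> q) = (Fh x (Fh x p) \<ominus>\<^bsub>Hx x\<^esub> Fh x (Fh x q)) \<ominus>\<^bsub>Hx x\<^esub> (p \<ominus>\<^bsub>Hx x\<^esub> q)"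
        by (rule F.linear_combinations[of "Fh x (Fh x p)" x p "Fh x (Fh x q)" q q])
          (use pq Fh_closed in \<open>simp_all add: F.v_minus F.v_smult_add F.v_assoc F.v_comm F.v_lcomm\<close>)
      also have "\<dots> = Fh x (Fh x r) \<ominus>\<^bsub>Hx x\<^esub> r"
        using pq by (simp add: r_def Fh_minus Fh_closed)
      finally have "nx x ((Fh x (Fh x p) \<ominus>\<^bsub>Hx x\<^esub> p) \<ominus>\<^bsub>Hx x\<^esub> (Fh x (Fh x q) \<ominus>\<^bsub>Hx x\<^esub> q)) \<le> nx x (Fh x (Fh x r)) + nx x r"
        using F.N.n_minus_le[OF Fh_closed[OF Fh_closed[OF r(1)]] r(1)] by simp
      also have "nx x (Fh x (Fh x r)) \<le> C * (C * nx x r)"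
        by (rule order_trans[OF C(2)[OF Fh_closed[OF r(1)]] mult_left_mono[OF C(2)[OF r(1)] C(1)]])
      also have "C * (C * nx x r) + nx x r = D * nx x r"
        by (simp add: D_def algebra_simps)
      also have "\<dots> \<le> D * (e / D * nx x \<xi>)"
        by (rule mult_left_mono[OF r(2)]) (use D in simp)
      also have "\<dots> = e * nx x \<xi>"
        using D by simp
      finally show ?thesis
        by (simp add: p_def q_def)
    qed
    then show "\<exists>c. compact_field c \<and> (\<forall>x. \<forall>\<xi>\<in>carrier (Hx x).
        nx x ((Fh x (Fh x (M.\<Phi> a x \<xi>)) \<ominus>\<^bsub>Hx x\<^esub> M.\<Phi> a x \<xi>) \<ominus>\<^bsub>Hx x\<^esub> c x \<xi>) \<le> e * nx x \<xi>)"
      using b(2) by (intro exI[of _ "\<lambda>x \<xi>. Fh x (Fh x (M.\<Phi> b x \<xi>)) \<ominus>\<^bsub>Hx x\<^esub> M.\<Phi> b x \<xi>"]) blast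
  qed
qed

text \<open>The twist \<open>\<tau>\<close> is the identity or the grading of the net, so that the different readings of the
  commutator are instances. The twisted commutator is a twisted derivation, whence the product step.\<close>

theorem compact_twisted_commutator:
  assumes \<tau>: "fibrewise_morphism Ax K A \<epsilon> Ax A \<epsilon> \<tau> \<mu>"
    and comm: "\<And>Y t. Y \<in> K \<Longrightarrow> t \<in> carrier (A Y) \<Longrightarrow>
      (\<lambda>h\<in>carrier (H Y). F Y (\<pi> Y t h) \<ominus>\<^bsub>H Y\<^esub> \<pi> Y (\<tau> Y t) (F Y h)) \<in> compact_operators (H Y)"
    and a: "a \<in> carrier NA.AA"
  shows "compact_field (\<lambda>x \<xi>. Fh x (M.\<Phi> a x \<xi>) \<ominus>\<^bsub>Hx x\<^esub> M.\<Phi> (fibrewise_morphism.\<Phi> Ax K A \<epsilon> \<mu> a) x (Fh x \<xi>))"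
proof -
  interpret T: fibrewise_morphism Ax K A \<epsilon> Ax A \<epsilon> \<tau> \<mu> by (rule \<tau>)
  have Tc: "T.\<Phi> a \<in> carrier NA.AA" if "a \<in> carrier NA.AA" for a
    by (rule T.\<Phi>_closed[OF that])
  have T_zero: "T.\<Phi> (\<lambda>x. \<zero>\<^bsub>Ax x\<^esub>) = (\<lambda>x. \<zero>\<^bsub>Ax x\<^esub>)"
    using T.\<Phi>_apply[of "\<lambda>x. \<zero>\<^bsub>Ax x\<^esub>"] NA.AA.v_zero by (simp add: fun_eq_iff T.\<kappa>_zero)
  have T_add: "T.\<Phi> (\<lambda>x. a x \<oplus>\<^bsub>Ax x\<^esub> b x) = (\<lambda>x. T.\<Phi> a x \<oplus>\<^bsub>Ax x\<^esub> T.\<Phi> b x)" if "a \<in> carrier NA.AA" "b \<in> carrier NA.AA" for a b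
    using star_homD(2)[OF T.\<Phi>_hom that] by simp
  have T_smult: "T.\<Phi> (\<lambda>x. c \<odot>\<^bsub>Ax x\<^esub> a x) = (\<lambda>x. c \<odot>\<^bsub>Ax x\<^esub> T.\<Phi> a x)" if "a \<in> carrier NA.AA" for a c
    using star_homD(3)[OF T.\<Phi>_hom that, of c] by simp
  have T_mult: "T.\<Phi> (\<lambda>x. a x \<otimes>\<^bsub>Ax x\<^esub> b x) = (\<lambda>x. T.\<Phi> a x \<otimes>\<^bsub>Ax x\<^esub> T.\<Phi> b x)" if "a \<in> carrier NA.AA" "b \<in> carrier NA.AA" for a b
    using star_homD(4)[OF T.\<Phi>_hom that] by simp
  show ?thesis
    using a
  proof (induction a rule: NA.AA_induct)
    case zero
    show ?case
      by (rule compact_field_cong[OF compact_field_zero]) (simp add: T_zero \<Phi>_zero Fh_zero Fh_closed)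
  next
    case (gen f Y t)
    have \<tau>t: "\<tau> Y t \<in> carrier (A Y)"
      by (rule star_homD(1)[OF T.\<phi>_hom[OF gen(1)] gen(3)])
    show ?case
    proof (rule compact_field_cong[OF compact_field_generator[OF gen(1,2) comm[OF gen(1,3)]]])
      fix x \<xi> assume \<xi>: "\<xi> \<in> carrier (Hx x)"
      show "(if x \<in> Y then f x \<odot>\<^bsub>Hx x\<^esub> V x Y ((\<lambda>h\<in>carrier (H Y). F Y (\<pi> Y t h) \<ominus>\<^bsub>H Y\<^esub> \<pi> Y (\<tau> Y t) (F Y h)) (Vi x Y \<xi>)) else \<zero>\<^bsub>Hx x\<^esub>)
        = Fh x (M.\<Phi> (elementary_field Ax \<epsilon> f Y t) x \<xi>) \<ominus>\<^bsub>Hx x\<^esub> M.\<Phi> (T.\<Phi> (elementary_field Ax \<epsilon> f Y t)) x (Fh x \<xi>)"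
      proof (cases "x \<in> Y")
        case True
        define k where "k = Vi x Y \<xi>"
        have k: "k \<in> carrier (H Y)" "F Y k \<in> carrier (H Y)" "\<pi> Y t k \<in> carrier (H Y)" "F Y (\<pi> Y t k) \<in> carrier (H Y)"
          "\<pi> Y (\<tau> Y t) (F Y k) \<in> carrier (H Y)"
          using Vi_closed[OF gen(1) True \<xi>] section_closed[OF F gen(1)] \<pi>_closed[OF gen(1,3)] \<pi>_closed[OF gen(1) \<tau>t]
          by (simp_all add: k_def)
        have 1: "Fh x (M.\<Phi> (elementary_field Ax \<epsilon> f Y t) x \<xi>) = f x \<odot>\<^bsub>Hx x\<^esub> V x Y (F Y (\<pi> Y t k))"
          using True V_closed[OF gen(1) True k(3)] hat_field_apply[OF F gen(1) True V_closed[OF gen(1) True k(3)]] Vi_V[OF gen(1) True k(3)]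
          by (simp add: \<Phi>_elementary_apply[OF gen \<xi>] Fh_smult k_def[symmetric])
        have Fx: "Fh x \<xi> = V x Y (F Y k)"
          using hat_field_apply[OF F gen(1) True \<xi>] by (simp add: k_def)
        have 2: "M.\<Phi> (T.\<Phi> (elementary_field Ax \<epsilon> f Y t)) x (Fh x \<xi>) = f x \<odot>\<^bsub>Hx x\<^esub> V x Y (\<pi> Y (\<tau> Y t) (F Y k))"
          unfolding T.\<Phi>_elementary_field[OF gen] \<Phi>_elementary_apply[OF gen(1,2) \<tau>t Fh_closed[OF \<xi>]]
          using True Vi_V[OF gen(1) True k(2)] by (simp add: Fx)
        show ?thesis
          unfolding 1 2 k_def[symmetric] using True k V_closed[OF gen(1) True k(4)] V_closed[OF gen(1) True k(5)]
          by (simp add: V_minus[OF gen(1) True] F.v_smult_minus)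
      next
        case False
        then show ?thesis
          unfolding T.\<Phi>_elementary_field[OF gen] \<Phi>_elementary_apply[OF gen(1,2) \<tau>t Fh_closed[OF \<xi>]] \<Phi>_elementary_apply[OF gen \<xi>]
          by (simp add: Fh_zero)
      qed
    qed
  next
    case (add a b)
    show ?case
      by (rule compact_field_cong[OF compact_field_add[OF add(3,4)]])
        (simp add: T_add[OF add(1,2)] \<Phi>_add[OF add(1,2)] \<Phi>_add[OF Tc[OF add(1)] Tc[OF add(2)]] Fh_add Fh_closed
          \<Phi>_fibre[OF add(1)] \<Phi>_fibre[OF add(2)] \<Phi>_fibre[OF Tc[OF add(1)]] \<Phi>_fibre[OF Tc[OF add(2)]] F.v_add_minus_add)
  next
    case (smult c a)
    show ?case
      by (rule compact_field_cong[OF compact_field_smult[OF smult(2), of c]])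
        (simp add: T_smult[OF smult(1)] \<Phi>_smult[OF smult(1)] \<Phi>_smult[OF Tc[OF smult(1)]] Fh_smult Fh_closed
          \<Phi>_fibre[OF smult(1)] \<Phi>_fibre[OF Tc[OF smult(1)]] F.v_smult_minus)
  next
    case (mult a b)
    have TaG: "continuous_field (M.\<Phi> (T.\<Phi> a))"
      by (rule \<Phi>_continuous_field[OF Tc[OF mult(1)]])
    \<comment> \<open>Writing a for \<pi>(a), the identity behind the two summands is F a b -
      \<tau>(a) \<tau>(b) F = (F a - \<tau>(a) F) b + \<tau>(a) (F b - \<tau>(b) F).\<close>
    show ?case
    proof (rule compact_field_cong[OF compact_field_add[OF compact_field_\<Phi>[OF mult(2,3)] compact_field_left[OF TaG mult(4)]]])
      fix x \<xi> assume \<xi>: "\<xi> \<in> carrier (Hx x)"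
      define p where "p = M.\<Phi> b x \<xi>"
      have p: "p \<in> carrier (Hx x)"
        unfolding p_def by (rule \<Phi>_fibre[OF mult(2) \<xi>])
      define q where "q = M.\<Phi> (T.\<Phi> b) x (Fh x \<xi>)"
      have q: "q \<in> carrier (Hx x)"
        unfolding q_def by (rule \<Phi>_fibre[OF Tc[OF mult(2)] Fh_closed[OF \<xi>]])
      have "M.\<Phi> (T.\<Phi> a) x (Fh x p \<ominus>\<^bsub>Hx x\<^esub> q) = M.\<Phi> (T.\<Phi> a) x (Fh x p) \<ominus>\<^bsub>Hx x\<^esub> M.\<Phi> (T.\<Phi> a) x q"
        by (rule BOps_minus[OF continuous_fieldD(2)[OF TaG] Fh_closed[OF p] q])
      then have "(Fh x (M.\<Phi> a x p) \<ominus>\<^bsub>Hx x\<^esub> M.\<Phi> (T.\<Phi> a) x (Fh x p)) \<oplus>\<^bsub>Hx x\<^esub> M.\<Phi> (T.\<Phi> a) x (Fh x p \<ominus>\<^bsub>Hx x\<^esub> q)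
        = Fh x (M.\<Phi> a x p) \<ominus>\<^bsub>Hx x\<^esub> M.\<Phi> (T.\<Phi> a) x q"
        using F.v_minus_trans[OF Fh_closed[OF \<Phi>_fibre[OF mult(1) p]] continuous_fieldD(3)[OF TaG Fh_closed[OF p]] continuous_fieldD(3)[OF TaG q]]
        by simp
      then show "(Fh x (M.\<Phi> a x (M.\<Phi> b x \<xi>)) \<ominus>\<^bsub>Hx x\<^esub> M.\<Phi> (T.\<Phi> a) x (Fh x (M.\<Phi> b x \<xi>))) \<oplus>\<^bsub>Hx x\<^esub>
          M.\<Phi> (T.\<Phi> a) x (Fh x (M.\<Phi> b x \<xi>) \<ominus>\<^bsub>Hx x\<^esub> M.\<Phi> (T.\<Phi> b) x (Fh x \<xi>))
        = Fh x (M.\<Phi> (\<lambda>x. a x \<otimes>\<^bsub>Ax x\<^esub> b x) x \<xi>) \<ominus>\<^bsub>Hx x\<^esub> M.\<Phi> (T.\<Phi> (\<lambda>x. a x \<otimes>\<^bsub>Ax x\<^esub> b x)) x (Fh x \<xi>)"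
        unfolding T_mult[OF mult(1,2)] \<Phi>_mult[OF mult(1,2) \<xi>] \<Phi>_mult[OF Tc[OF mult(1)] Tc[OF mult(2)] Fh_closed[OF \<xi>]]
        by (simp add: p_def q_def)
    qed
  next
    case (lim a)
    obtain C where C: "C \<ge> 0" "\<And>x \<xi>. \<xi> \<in> carrier (Hx x) \<Longrightarrow> nx x (Fh x \<xi>) \<le> C * nx x \<xi>"
      using bounded_fieldD(3)[OF continuous_fieldD(1)[OF Fh_continuous_field]] by blast
    \<comment> \<open>2 C accounts for the two places of F in the commutator; the summand 1 keeps
      the divisor positive.\<close>
    define D where "D = 2 * C + 1"
    have D: "D > 0"
      using C(1) by (simp add: D_def)
    show ?case
    proof (rule compact_field_lim)
      show "Fh x (M.\<Phi> a x \<xi>) \<ominus>\<^bsub>Hx x\<^esub> M.\<Phi> (T.\<Phi> a) x (Fh x \<xi>) \<in> carrier (Hx x)" if "\<xi> \<in> carrier (Hx x)" for x \<xi>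
        by (intro F.v_minus_closed Fh_closed \<Phi>_fibre[OF lim(1)] \<Phi>_fibre[OF Tc[OF lim(1)]] that)
      fix e :: real assume e: "e > 0"
      then obtain b where b: "b \<in> carrier NA.AA"
        "compact_field (\<lambda>x \<xi>. Fh x (M.\<Phi> b x \<xi>) \<ominus>\<^bsub>Hx x\<^esub> M.\<Phi> (T.\<Phi> b) x (Fh x \<xi>))"
        "\<And>x. nrm (Ax x) (a x \<ominus>\<^bsub>Ax x\<^esub> b x) \<le> e / D"
        using lim(2)[of "e / D"] D by auto
      \<comment> \<open>The twist is contractive in each fibre, so the same b approximates the
        twisted field equally well.\<close>
      have Tb: "nrm (Ax x) (T.\<Phi> a x \<ominus>\<^bsub>Ax x\<^esub> T.\<Phi> b x) \<le> e / D" for x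
        using order_trans[OF T.\<kappa>_contractive[OF NA.F.v_minus_closed[OF NA.AA_fibre[OF lim(1)] NA.AA_fibre[OF b(1)]]] b(3)[of x]]
        unfolding T.\<Phi>_apply[OF lim(1)] T.\<Phi>_apply[OF b(1)] T.\<kappa>_minus[OF NA.AA_fibre[OF lim(1)] NA.AA_fibre[OF b(1)]] .
      have "nx x ((Fh x (M.\<Phi> a x \<xi>) \<ominus>\<^bsub>Hx x\<^esub> M.\<Phi> (T.\<Phi> a) x (Fh x \<xi>)) \<ominus>\<^bsub>Hx x\<^esub> (Fh x (M.\<Phi> b x \<xi>) \<ominus>\<^bsub>Hx x\<^esub> M.\<Phi> (T.\<Phi> b) x (Fh x \<xi>))) \<le> e * nx x \<xi>"
        if \<xi>: "\<xi> \<in> carrier (Hx x)" for x \<xi>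
      proof -
        define p q where "p = M.\<Phi> a x \<xi>" and "q = M.\<Phi> b x \<xi>"
        define p' q' where "p' = M.\<Phi> (T.\<Phi> a) x (Fh x \<xi>)" and "q' = M.\<Phi> (T.\<Phi> b) x (Fh x \<xi>)"
        have pq: "p \<in> carrier (Hx x)" "q \<in> carrier (Hx x)" "p' \<in> carrier (Hx x)" "q' \<in> carrier (Hx x)"
          using \<Phi>_fibre[OF lim(1) \<xi>] \<Phi>_fibre[OF b(1) \<xi>] \<Phi>_fibre[OF Tc[OF lim(1)] Fh_closed[OF \<xi>]] \<Phi>_fibre[OF Tc[OF b(1)] Fh_closed[OF \<xi>]]
          by (simp_all add: p_def q_def p'_def q'_def)
        have r: "nx x (p \<ominus>\<^bsub>Hx x\<^esub> q) \<le> e / D * nx x \<xi>"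
          using \<Phi>_minus_bound[OF lim(1) b(1,3) \<xi>] by (simp add: p_def q_def)
        have r': "nx x (p' \<ominus>\<^bsub>Hx x\<^esub> q') \<le> e / D * nx x (Fh x \<xi>)"
          using \<Phi>_minus_bound[OF Tc[OF lim(1)] Tc[OF b(1)] Tb Fh_closed[OF \<xi>]] by (simp add: p'_def q'_def)
        have "(Fh x p \<ominus>\<^bsub>Hx x\<^esub> p') \<ominus>\<^bsub>Hx x\<^esub> (Fh x q \<ominus>\<^bsub>Hx x\<^esub> q') = (Fh x p \<ominus>\<^bsub>Hx x\<^esub> Fh x q) \<ominus>\<^bsub>Hx x\<^esub> (p' \<ominus>\<^bsub>Hx x\<^esub> q')"
          by (rule F.linear_combinations[of "Fh x p" x p' "Fh x q" q' q'])
            (use pq Fh_closed in \<open>simp_all add: F.v_minus F.v_smult_add F.v_assoc F.v_comm F.v_lcomm\<close>)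
        also have "\<dots> = Fh x (p \<ominus>\<^bsub>Hx x\<^esub> q) \<ominus>\<^bsub>Hx x\<^esub> (p' \<ominus>\<^bsub>Hx x\<^esub> q')"
          using pq by (simp add: Fh_minus)
        finally have "nx x ((Fh x p \<ominus>\<^bsub>Hx x\<^esub> p') \<ominus>\<^bsub>Hx x\<^esub> (Fh x q \<ominus>\<^bsub>Hx x\<^esub> q')) \<le> nx x (Fh x (p \<ominus>\<^bsub>Hx x\<^esub> q)) + nx x (p' \<ominus>\<^bsub>Hx x\<^esub> q')"
          using F.N.n_minus_le[OF Fh_closed[OF F.v_minus_closed[OF pq(1,2)]] F.v_minus_closed[OF pq(3,4)]] by simp
        moreover have "nx x (Fh x (p \<ominus>\<^bsub>Hx x\<^esub> q)) \<le> C * (e / D * nx x \<xi>)"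
          by (rule order_trans[OF C(2)[OF F.v_minus_closed[OF pq(1,2)]] mult_left_mono[OF r C(1)]])
        moreover have "nx x (p' \<ominus>\<^bsub>Hx x\<^esub> q') \<le> e / D * (C * nx x \<xi>)"
          by (rule order_trans[OF r' mult_left_mono[OF C(2)[OF \<xi>]]]) (use e D in simp)
        moreover have "C * (e / D * nx x \<xi>) + e / D * (C * nx x \<xi>) = (2 * C) * (e / D * nx x \<xi>)"
          by (simp add: algebra_simps)
        moreover have "(2 * C) * (e / D * nx x \<xi>) \<le> D * (e / D * nx x \<xi>)"
          by (rule mult_right_mono) (use e D F.hnorm_nonneg[OF \<xi>] in \<open>auto simp: D_def\<close>)
        moreover have "D * (e / D * nx x \<xi>) = e * nx x \<xi>"
          using D by simp
        ultimately show ?thesis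
          unfolding p_def q_def p'_def q'_def by linarith
      qed
      then show "\<exists>c. compact_field c \<and> (\<forall>x. \<forall>\<xi>\<in>carrier (Hx x).
          nx x ((Fh x (M.\<Phi> a x \<xi>) \<ominus>\<^bsub>Hx x\<^esub> M.\<Phi> (T.\<Phi> a) x (Fh x \<xi>)) \<ominus>\<^bsub>Hx x\<^esub> c x \<xi>) \<le> e * nx x \<xi>)"
        using b(2) by (intro exI[of _ "\<lambda>x \<xi>. Fh x (M.\<Phi> b x \<xi>) \<ominus>\<^bsub>Hx x\<^esub> M.\<Phi> (T.\<Phi> b) x (Fh x \<xi>)"]) blast
    qed
  qed
qed

end

end

section \<open>From fields to module operators, and the odd bimodule\<close>

context represented_net
begin

abbreviation "rep \<equiv> \<lambda>a. fibrewise E (M.\<Phi> a)"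
abbreviation "KE \<equiv> compact_module_operators C0_alg E"

lemma induced_representation_eq:
  "induced_representation K A Ax \<epsilon> H Hx V \<T> \<pi> = (\<lambda>a\<in>carrier NA.AA. rep a)"
  by (simp add: induced_representation_def M.induced_morphism_eq)

lemma rep_AOps:
  assumes a: "a \<in> carrier NA.AA"
  shows "rep a \<in> AOps" "adjoint_op E (rep a) = rep (star NA.AA a)"
proof -
  note s = NA.AA.star_closed[OF a]
  show "rep a \<in> AOps" "adjoint_op E (rep a) = rep (star NA.AA a)"
    by (rule fibrewise_AOps[OF \<Phi>_continuous_field[OF a] \<Phi>_continuous_field[OF s] \<Phi>_adjoint(1)[OF a]], assumption+)+
qed

lemma rep_apply: "v \<in> carrier E \<Longrightarrow> rep a v = (\<lambda>x. M.\<Phi> a x (v x))"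
  by (rule fibrewise_apply)

lemma rep_hom: "star_hom NA.AA A.OA (\<lambda>a\<in>carrier NA.AA. rep a)"
proof (rule star_homI)
  fix a assume a: "a \<in> carrier NA.AA"
  show "(\<lambda>a\<in>carrier NA.AA. rep a) a \<in> carrier A.OA"
    using a rep_AOps(1)[OF a] by simp
  show "(\<lambda>a\<in>carrier NA.AA. rep a) (star NA.AA a) = star A.OA ((\<lambda>a\<in>carrier NA.AA. rep a) a)"
    using rep_AOps(2)[OF a] a NA.AA.star_closed[OF a] by (simp del: NA.AA_sel)
  have "rep (c \<odot>\<^bsub>NA.AA\<^esub> a) = c \<odot>\<^bsub>A.OA\<^esub> rep a" for c
    unfolding operator_algebra_sel fibrewise_def
    by (rule restrict_ext, rule ext) (simp add: \<Phi>_smult[OF a] E_fibre)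
  then show "(\<lambda>a\<in>carrier NA.AA. rep a) (c \<odot>\<^bsub>NA.AA\<^esub> a) = c \<odot>\<^bsub>A.OA\<^esub> (\<lambda>a\<in>carrier NA.AA. rep a) a" for c
    using a NA.AA.v_smult[OF a, of c] by (simp del: NA.AA_sel operator_algebra_sel)
  fix b assume b: "b \<in> carrier NA.AA"
  have "rep (a \<oplus>\<^bsub>NA.AA\<^esub> b) = rep a \<oplus>\<^bsub>A.OA\<^esub> rep b"
    unfolding operator_algebra_sel fibrewise_def
    by (rule restrict_ext, rule ext) (simp add: \<Phi>_add[OF a b] E_fibre)
  then show "(\<lambda>a\<in>carrier NA.AA. rep a) (a \<oplus>\<^bsub>NA.AA\<^esub> b) = (\<lambda>a\<in>carrier NA.AA. rep a) a \<oplus>\<^bsub>A.OA\<^esub> (\<lambda>a\<in>carrier NA.AA. rep a) b"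
    using a b NA.AA.v_add[OF a b] by (simp del: NA.AA_sel operator_algebra_sel)
  have "rep (a \<otimes>\<^bsub>NA.AA\<^esub> b) = rep a \<otimes>\<^bsub>A.OA\<^esub> rep b"
    unfolding operator_algebra_sel fibrewise_def
    by (rule restrict_ext, rule ext) (simp add: \<Phi>_mult[OF a b] E_fibre continuous_fieldD(4)[OF \<Phi>_continuous_field[OF b]])
  then show "(\<lambda>a\<in>carrier NA.AA. rep a) (a \<otimes>\<^bsub>NA.AA\<^esub> b) = (\<lambda>a\<in>carrier NA.AA. rep a) a \<otimes>\<^bsub>A.OA\<^esub> (\<lambda>a\<in>carrier NA.AA. rep a) b"
    using a b NA.AA.mult_closed[OF a b] by (simp del: NA.AA_sel operator_algebra_sel)
qed

lemma one_AOps: "(\<lambda>v\<in>carrier E. v) \<in> AOps"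
  by (rule AOpsI[of _ "\<lambda>v. v"]) simp_all

context
  fixes F
  assumes F: "net_section K (BH H) (adU H U) F"
    and sa: "\<And>Y. Y \<in> K \<Longrightarrow> star (BH H Y) (F Y) = F Y"
begin

abbreviation "\<phi>F \<equiv> fibrewise E (hat_field F)"

lemma \<phi>F_AOps: "\<phi>F \<in> AOps" "adjoint_op E \<phi>F = \<phi>F"
  by (rule fibrewise_AOps[OF Fh_continuous_field[OF F] Fh_continuous_field[OF F] hat_field_self_adjoint[OF F sa]], assumption+)+

lemma \<phi>F_apply: "v \<in> carrier E \<Longrightarrow> \<phi>F v = (\<lambda>x. hat_field F x (v x))"
  by (rule fibrewise_apply)

text \<open>Translation to the module: the commutator of the operators on sections acts by the field
  of fibrewise commutators. \<open>a'\<close> is kept as a variable so that an untwisted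
  \<open>a\<close> can be substituted directly.\<close>

lemma twisted_commutator_compact:
  assumes \<tau>: "fibrewise_morphism Ax K A \<epsilon> Ax A \<epsilon> \<tau> \<mu>"
    and comm: "\<And>Y t. Y \<in> K \<Longrightarrow> t \<in> carrier (A Y) \<Longrightarrow>
      (\<lambda>h\<in>carrier (H Y). F Y (\<pi> Y t h) \<ominus>\<^bsub>H Y\<^esub> \<pi> Y (\<tau> Y t) (F Y h)) \<in> compact_operators (H Y)"
    and a: "a \<in> carrier NA.AA" and a': "a' = fibrewise_morphism.\<Phi> Ax K A \<epsilon> \<mu> a"
  shows "(\<lambda>v\<in>carrier E. \<phi>F (rep a v) \<ominus>\<^bsub>E\<^esub> rep a' (\<phi>F v)) \<in> KE"
proof -
  have a'A: "a' \<in> carrier NA.AA"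
    unfolding a' by (rule fibrewise_morphism.\<Phi>_closed[OF \<tau> a])
  let ?L = "\<lambda>v\<in>carrier E. \<phi>F (rep a v) \<ominus>\<^bsub>E\<^esub> rep a' (\<phi>F v)"
  note m = A.O_mult[OF \<phi>F_AOps(1) rep_AOps(1)[OF a]] A.O_mult[OF rep_AOps(1)[OF a'A] \<phi>F_AOps(1)]
  have "?L = (\<lambda>v\<in>carrier E. \<phi>F (rep a v)) \<ominus>\<^bsub>A.OA\<^esub> (\<lambda>v\<in>carrier E. rep a' (\<phi>F v))"
    unfolding A.OA_minus[OF m] by (rule restrict_ext) simp
  then have mem: "?L \<in> AOps"
    using A.OM.v_minus_closed[of "\<lambda>v\<in>carrier E. \<phi>F (rep a v)" "\<lambda>v\<in>carrier E. rep a' (\<phi>F v)"] m by simp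
  have eq: "?L = fibrewise E (\<lambda>x \<xi>. hat_field F x (M.\<Phi> a x \<xi>) \<ominus>\<^bsub>Hx x\<^esub> M.\<Phi> a' x (hat_field F x \<xi>))"
    unfolding fibrewise_def[of E "\<lambda>x \<xi>. hat_field F x (M.\<Phi> a x \<xi>) \<ominus>\<^bsub>Hx x\<^esub> M.\<Phi> a' x (hat_field F x \<xi>)"]
  proof (rule restrict_ext, rule ext)
    fix v x assume v: "v \<in> carrier E"
    have c: "rep a v \<in> carrier E" "\<phi>F v \<in> carrier E"
      using A.O_closed[OF rep_AOps(1)[OF a] v] A.O_closed[OF \<phi>F_AOps(1) v] by auto
    show "(\<phi>F (rep a v) \<ominus>\<^bsub>E\<^esub> rep a' (\<phi>F v)) x = hat_field F x (M.\<Phi> a x (v x)) \<ominus>\<^bsub>Hx x\<^esub> M.\<Phi> a' x (hat_field F x (v x))"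
      unfolding E_minus[OF A.O_closed[OF \<phi>F_AOps(1) c(1)] A.O_closed[OF rep_AOps(1)[OF a'A] c(2)]]
      using fun_cong[OF \<phi>F_apply[OF c(1)], of x] fun_cong[OF rep_apply[OF c(2), of a'], of x]
        fun_cong[OF rep_apply[OF v, of a], of x] fun_cong[OF \<phi>F_apply[OF v], of x] by (simp only:)
  qed
  show ?thesis
    unfolding eq
    by (rule compact_field_compact_operator[OF mem[unfolded eq]])
      (unfold a', rule compact_twisted_commutator[OF F \<tau> comm a])
qed

text \<open>Collects what does not depend on the parity. The gradings, their compatibility with the
  representation and the commutator condition enter as hypotheses, to be supplied separately in the
  even and the odd case.\<close>

theorem kasparov_bimoduleI:
  assumes sq: "\<And>Y. Y \<in> K \<Longrightarrow> (\<lambda>h\<in>carrier (H Y). F Y (F Y h) \<ominus>\<^bsub>H Y\<^esub> h) \<in> compact_operators (H Y)"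
    and \<alpha>: "C0_grading NA.AA (pointwise_action Ax NA.AA) \<alpha>"
    and \<Gamma>: "module_grading C0_alg E \<Gamma>'"
    and \<gamma>: "\<And>a. a \<in> carrier NA.AA \<Longrightarrow> ad (carrier E) (carrier E) \<Gamma>' (rep a) = rep (\<alpha> a)"
    and comm: "\<And>a. a \<in> carrier NA.AA \<Longrightarrow> commutator cv A.OA (ad (carrier E) (carrier E) \<Gamma>') \<phi>F (rep a) \<in> KE"
  shows "kasparov_bimodule cv NA.AA (pointwise_action Ax NA.AA) \<alpha> E \<Gamma>'
    (induced_representation K A Ax \<epsilon> H Hx V \<T> \<pi>) (hat_operator K H Hx V \<T> F)"
  unfolding kasparov_bimodule_def Let_def induced_representation_eq hat_operator_eq adjointable_operators_eq
proof (intro conjI ballI NA.AA_C0_algebra \<alpha> E_hilbert_bimodule \<Gamma> rep_hom)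
  have \<alpha>c: "\<alpha> a \<in> carrier NA.AA" if "a \<in> carrier NA.AA" for a
    using \<alpha> that bij_betw_apply[of \<alpha>] unfolding C0_grading_def by blast
  fix a assume a: "a \<in> carrier NA.AA"
  show "ad (carrier E) (carrier E) \<Gamma>' ((\<lambda>a\<in>carrier NA.AA. rep a) a) = (\<lambda>a\<in>carrier NA.AA. rep a) (\<alpha> a)"
    using a \<alpha>c[OF a] \<gamma>[OF a] by simp
  show "commutator cv A.OA (ad (carrier E) (carrier E) \<Gamma>') \<phi>F ((\<lambda>a\<in>carrier NA.AA. rep a) a) \<in> KE"
    using a comm[OF a] by simp
  have zero: "(\<lambda>v\<in>carrier E. \<zero>\<^bsub>E\<^esub>) \<in> KE"
  proof -
    have "(\<lambda>v\<in>carrier E. \<zero>\<^bsub>E\<^esub>) = fibrewise E (\<lambda>x \<xi>. \<zero>\<^bsub>Hx x\<^esub>)"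
      by (simp add: fibrewise_def)
    then show ?thesis
      using compact_field_compact_operator[OF _ compact_field_zero] A.O_zero by simp
  qed
  have "(\<phi>F \<ominus>\<^bsub>A.OA\<^esub> star A.OA \<phi>F) \<otimes>\<^bsub>A.OA\<^esub> rep a = (\<lambda>v\<in>carrier E. \<zero>\<^bsub>E\<^esub>)"
  proof -
    have "\<phi>F \<ominus>\<^bsub>A.OA\<^esub> star A.OA \<phi>F = (\<lambda>v\<in>carrier E. \<zero>\<^bsub>E\<^esub>)"
      using A.OM.v_minus_self[of \<phi>F] \<phi>F_AOps by simp
    then show ?thesis
      unfolding operator_algebra_sel by (intro restrict_ext) (simp add: A.O_closed[OF rep_AOps(1)[OF a]] del: E_sel)
  qed
  then show "(\<phi>F \<ominus>\<^bsub>A.OA\<^esub> star A.OA \<phi>F) \<otimes>\<^bsub>A.OA\<^esub> (\<lambda>a\<in>carrier NA.AA. rep a) a \<in> KE"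
    using zero a by (simp del: operator_algebra_sel E_sel)
  note ff = A.O_mult[OF \<phi>F_AOps(1) \<phi>F_AOps(1)]
  let ?S = "(\<phi>F \<otimes>\<^bsub>A.OA\<^esub> \<phi>F \<ominus>\<^bsub>A.OA\<^esub> \<one>\<^bsub>A.OA\<^esub>) \<otimes>\<^bsub>A.OA\<^esub> rep a"
  have S: "\<phi>F \<otimes>\<^bsub>A.OA\<^esub> \<phi>F \<ominus>\<^bsub>A.OA\<^esub> \<one>\<^bsub>A.OA\<^esub> \<in> AOps"
    using A.OM.v_minus_closed[of "\<phi>F \<otimes>\<^bsub>A.OA\<^esub> \<phi>F" "\<one>\<^bsub>A.OA\<^esub>"] ff one_AOps by simp
  have mem: "?S \<in> AOps"
    using A.O_mult[OF S rep_AOps(1)[OF a]] by simp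
  have eq: "?S = fibrewise E (\<lambda>x \<xi>. hat_field F x (hat_field F x (M.\<Phi> a x \<xi>)) \<ominus>\<^bsub>Hx x\<^esub> M.\<Phi> a x \<xi>)"
    unfolding operator_algebra_sel(2)[of _ _ AOps] fibrewise_def[of E "\<lambda>x \<xi>. hat_field F x (hat_field F x (M.\<Phi> a x \<xi>)) \<ominus>\<^bsub>Hx x\<^esub> M.\<Phi> a x \<xi>"]
  proof (rule restrict_ext, rule ext)
    fix v x assume v: "v \<in> carrier E"
    have w: "rep a v \<in> carrier E"
      by (rule A.O_closed[OF rep_AOps(1)[OF a] v])
    have fw: "\<phi>F (rep a v) \<in> carrier E" "\<phi>F (\<phi>F (rep a v)) \<in> carrier E"
      using A.O_closed[OF \<phi>F_AOps(1)] w by auto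
    have "((\<lambda>v\<in>carrier E. \<phi>F (\<phi>F v)) \<ominus>\<^bsub>A.OA\<^esub> \<one>\<^bsub>A.OA\<^esub>) (rep a v) = \<phi>F (\<phi>F (rep a v)) \<ominus>\<^bsub>E\<^esub> rep a v"
      using A.OA_minus_apply[OF ff one_AOps w] w by simp
    then show "((\<lambda>v\<in>carrier E. \<phi>F (\<phi>F v)) \<ominus>\<^bsub>A.OA\<^esub> \<one>\<^bsub>A.OA\<^esub>) (rep a v) x
      = hat_field F x (hat_field F x (M.\<Phi> a x (v x))) \<ominus>\<^bsub>Hx x\<^esub> M.\<Phi> a x (v x)"
      using fun_cong[OF \<phi>F_apply[OF fw(1)], of x] fun_cong[OF \<phi>F_apply[OF w], of x] fun_cong[OF rep_apply[OF v, of a], of x]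
      by (simp only: E_minus[OF fw(2) w])
  qed
  have "?S \<in> KE"
    unfolding eq
    by (rule compact_field_compact_operator[OF mem[unfolded eq] compact_square[OF F sq a]])
  then show "(\<phi>F \<otimes>\<^bsub>A.OA\<^esub> \<phi>F \<ominus>\<^bsub>A.OA\<^esub> \<one>\<^bsub>A.OA\<^esub>) \<otimes>\<^bsub>A.OA\<^esub> (\<lambda>a\<in>carrier NA.AA. rep a) a \<in> KE"
    using a by (simp del: operator_algebra_sel)
next
  show "\<phi>F \<in> carrier A.OA"
    using \<phi>F_AOps by simp
next
  fix f b :: "'x \<Rightarrow> complex" and a v
  assume f: "f \<in> C0 UNIV" and a: "a \<in> carrier NA.AA" and v: "v \<in> carrier E"
  have fa: "fst (pointwise_action Ax NA.AA f) a \<in> carrier NA.AA"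
    using NA.C0_action_closed[OF f a] a by (simp add: pointwise_action_def)
  have "M.\<Phi> (fst (pointwise_action Ax NA.AA f) a) x (v x) = f x \<odot>\<^bsub>Hx x\<^esub> M.\<Phi> a x (v x)" for x
    using M.\<Phi>_C0_morphism f a M.\<Phi>_closed[OF a] E_fibre[OF v]
    by (simp add: C0_morphism_def pointwise_action_def)
  then show "ract E ((\<lambda>a\<in>carrier NA.AA. rep a) (fst (pointwise_action Ax NA.AA f) a) v) b
    = ract E ((\<lambda>a\<in>carrier NA.AA. rep a) a v) (f \<otimes>\<^bsub>C0_alg\<^esub> b)"
    using a fa \<Phi>_fibre[OF a E_fibre[OF v]] by (simp add: rep_apply[OF v] fun_eq_iff mult.commute)
qed

end

lemma net_operators:
  assumes "Y \<in> K" shows "BH H Y = operator_algebra (H Y) (hnorm (H Y)) (hilbert_space.BOps (H Y))"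
  unfolding BH_def by (rule hilbert_space.bounded_operators_eq[OF H_hilbert[OF assms]])

lemma \<pi>_BOps: "Y \<in> K \<Longrightarrow> t \<in> carrier (A Y) \<Longrightarrow> \<pi> Y t \<in> hilbert_space.BOps (H Y)"
  using star_homD(1)[OF M.\<phi>_hom, of Y t] BH_carrier[of Y] by simp

lemma fredholm_square:
  assumes "fredholm_conditions cv K A j H U \<gamma> \<pi> F" and Y: "Y \<in> K"
  shows "(\<lambda>h\<in>carrier (H Y). F Y (F Y h) \<ominus>\<^bsub>H Y\<^esub> h) \<in> compact_operators (H Y)"
proof -
  interpret HY: hilbert_space "H Y" by (rule H_hilbert[OF Y])
  have F: "net_section K (BH H) (adU H U) F"
    and c: "F Y \<otimes>\<^bsub>BH H Y\<^esub> F Y \<ominus>\<^bsub>BH H Y\<^esub> \<one>\<^bsub>BH H Y\<^esub> \<in> compact_operators (H Y)"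
    using assms unfolding fredholm_conditions_def by blast+
  have FB: "F Y \<in> HY.BOps"
    using section_carrier[OF F Y] BH_carrier[OF Y] by blast
  have one: "(\<lambda>h\<in>carrier (H Y). h) \<in> HY.BOps"
    by (rule HY.BOpsI[of _ 1]) auto
  have "F Y \<otimes>\<^bsub>BH H Y\<^esub> F Y \<ominus>\<^bsub>BH H Y\<^esub> \<one>\<^bsub>BH H Y\<^esub> = (\<lambda>h\<in>carrier (H Y). F Y (F Y h)) \<ominus>\<^bsub>HY.B.OA\<^esub> (\<lambda>h\<in>carrier (H Y). h)"
    unfolding net_operators[OF Y] by simp
  also have "\<dots> = (\<lambda>h\<in>carrier (H Y). F Y (F Y h) \<ominus>\<^bsub>H Y\<^esub> h)"
    unfolding HY.B.OA_minus[OF HY.B.O_mult[OF FB FB] one] by (rule restrict_ext) simp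
  finally show ?thesis
    using c by simp
qed

text \<open>Twisting by the identity makes the plain commutator an instance of the twisted one; the
  same family is the term of comparison for the square of the grading.\<close>

lemma id_fibres: "fibrewise_morphism Ax K A \<epsilon> Ax A \<epsilon> (\<lambda>Y t. t) (\<lambda>x c. c)"
  by (intro fibrewise_morphism.intro fibrewise_morphism_axioms.intro NA.net_fields_axioms star_homI) auto

lemma id_fibres_\<Phi>: "a \<in> carrier NA.AA \<Longrightarrow> fibrewise_morphism.\<Phi> Ax K A \<epsilon> (\<lambda>x c. c) a = a"
  by (rule ext) (rule fibrewise_morphism.\<Phi>_apply[OF id_fibres])

lemma ad_id: "T \<in> S \<rightarrow>\<^sub>E S \<Longrightarrow> ad S S id T = T"
proof (rule ext)
  fix v assume T: "T \<in> S \<rightarrow>\<^sub>E S"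
  have "inv_into S id v = v" if "v \<in> S"
    using that by (intro inv_into_f_eq) simp_all
  then show "ad S S id T v = T v"
    using PiE_arb[OF T, of v] by (cases "v \<in> S") (simp_all add: ad_def)
qed

text \<open>With trivial gradings every operator is even, so both conventions reduce to the plain
  commutator, over the net as well as on the module.\<close>

theorem odd_kasparov_bimodule:
  assumes fr: "odd_fredholm_module cv K A j H U \<pi> F"
  shows "kasparov_bimodule cv NA.AA (pointwise_action Ax NA.AA) id E id
    (induced_representation K A Ax \<epsilon> H Hx V \<T> \<pi>) (hat_operator K H Hx V \<T> F)"
proof -
  have fr': "fredholm_conditions cv K A j H U (\<lambda>Y. id) \<pi> F"
    using fr by (simp add: odd_fredholm_module_def)
  have F: "net_section K (BH H) (adU H U) F" and sa: "\<And>Y. Y \<in> K \<Longrightarrow> star (BH H Y) (F Y) = F Y"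
    and c: "\<And>Y t. Y \<in> K \<Longrightarrow> t \<in> carrier (A Y) \<Longrightarrow> commutator cv (BH H Y) id (F Y) (\<pi> Y t) \<in> compact_operators (H Y)"
    using fr' unfolding fredholm_conditions_def by blast+
  have comm: "(\<lambda>h\<in>carrier (H Y). F Y (\<pi> Y t h) \<ominus>\<^bsub>H Y\<^esub> \<pi> Y t (F Y h)) \<in> compact_operators (H Y)"
    if Y: "Y \<in> K" and t: "t \<in> carrier (A Y)" for Y t
  proof -
    interpret HY: hilbert_space "H Y" by (rule H_hilbert[OF Y])
    have FB: "F Y \<in> HY.BOps"
      using section_carrier[OF F Y] BH_carrier[OF Y] by blast
    have "commutator cv (BH H Y) id (F Y) (\<pi> Y t) = (\<lambda>h\<in>carrier (H Y). F Y (\<pi> Y t h) \<ominus>\<^bsub>H Y\<^esub> \<pi> Y t (F Y h))"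
      unfolding net_operators[OF Y]
      by (cases cv) (use HY.B.commutator_plain[OF FB \<pi>_BOps[OF Y t], of id]
        HY.B.commutator_graded_even[OF FB \<pi>_BOps[OF Y t], of id] \<pi>_BOps[OF Y t] in \<open>simp_all del: commutator.simps\<close>)
    then show ?thesis
      using c[OF Y t] by simp
  qed
  have adE: "ad (carrier E) (carrier E) id T = T" if "T \<in> AOps" for T
    by (rule ad_id[OF AOpsD(1)[OF that]])
  show ?thesis
  proof (rule kasparov_bimoduleI[OF F sa fredholm_square[OF fr']])
    have "star_hom NA.AA NA.AA id"
      by (rule star_homI) simp_all
    then show "C0_grading NA.AA (pointwise_action Ax NA.AA) id"
      by (simp add: C0_grading_def C0_morphism_def)
    show "module_grading C0_alg E id"
      by (simp add: module_grading_def linear_map_def)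
    fix a assume a: "a \<in> carrier NA.AA"
    note ra = rep_AOps(1)[OF a]
    have fA: "fibrewise E (hat_field F) \<in> AOps"
      by (rule \<phi>F_AOps(1)[OF F sa])
    show "ad (carrier E) (carrier E) id (rep a) = rep (id a)"
      using adE[OF ra] by simp
    have "commutator cv A.OA (ad (carrier E) (carrier E) id) (fibrewise E (hat_field F)) (rep a)
      = (\<lambda>v\<in>carrier E. fibrewise E (hat_field F) (rep a v) \<ominus>\<^bsub>E\<^esub> rep a (fibrewise E (hat_field F) v))"
    proof (cases cv)
      case Plain
      show ?thesis
        unfolding Plain by (rule A.commutator_plain[OF fA ra])
    next
      case Graded
      show ?thesis
        unfolding Graded by (rule A.commutator_graded_even[where \<gamma> = "ad (carrier E) (carrier E) id", OF fA ra _ adE[OF fA]]) (simp only: adE[OF ra] ra)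
    qed
    also have "\<dots> \<in> KE"
      by (rule twisted_commutator_compact[OF F sa id_fibres comm a id_fibres_\<Phi>[OF a, symmetric]])
    finally show "commutator cv A.OA (ad (carrier E) (carrier E) id) (fibrewise E (hat_field F)) (rep a) \<in> KE" .
  qed
qed

end

section \<open>Gradings in the even case\<close>

lemma ad_involution:
  assumes "\<And>w. w \<in> S \<Longrightarrow> G w \<in> S" "\<And>w. w \<in> S \<Longrightarrow> G (G w) = w" and v: "v \<in> S"
  shows "ad S S G T v = G (T (G v))"
proof -
  have "inj_on G S"
    by (rule inj_on_inverseI[of S G]) (rule assms(2))
  then have "inv_into S G v = G v"
    by (rule inv_into_f_eq) (use assms in auto)
  then show ?thesis
    using v by (simp add: ad_def)
qed

text \<open>Self-adjointness moves one G to the other side of the inner product, and unitarity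
  cancels the pair.\<close>

lemma (in hilbert_space) self_adjoint_unitary_involution:
  assumes u: "unitary_map H H G" and B: "G \<in> BOps" and sa: "adjoint_op H G = G" and x: "x \<in> carrier H"
  shows "G (G x) = x"
proof (rule ip_eqI)
  show "G (G x) \<in> carrier H" "x \<in> carrier H"
    using BOpsD(3)[OF B] x by auto
  fix v assume v: "v \<in> carrier H"
  have "ip H v (G (G x)) = ip H (G v) (G x)"
    using adjoint_BOps(2)[OF B v, of "G x"] BOpsD(3)[OF B x] sa by simp
  also have "\<dots> = ip H v x"
    using u v x by (simp add: unitary_map_def)
  finally show "ip H v (G (G x)) = ip H v x" .
qed

text \<open>Both families realise the same definite description. Equality is asserted at values of
  fields of the algebra, which suffices for identities between induced morphisms.\<close>

lemma (in fibrewise_morphism) \<kappa>_unique: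
  assumes "fibrewise_morphism Ax K A \<epsilon> Bx B \<epsilon>' \<phi> \<kappa>'" and a: "a \<in> carrier A.AA"
  shows "\<kappa> x (a x) = \<kappa>' x (a x)"
  using fibrewise_morphism.\<Phi>_apply[OF assms, of x] \<Phi>_apply[OF a, of x]
  unfolding fibrewise_morphism.induced_morphism_eq[OF assms(1), symmetric] induced_morphism_eq by simp

context represented_net
begin

context
  fixes cv \<beta> \<Gamma> F
  assumes ev: "even_fredholm_module cv K A j \<beta> H U \<Gamma> \<pi> F"
begin

abbreviation "\<gamma> \<equiv> \<lambda>Y. ad (carrier (H Y)) (carrier (H Y)) (\<Gamma> Y)"

lemma even_fredholmD:
  shows "net_grading K A j \<beta>"
    and "net_section K (BH H) (adU H U) \<Gamma>"
    and "fredholm_conditions cv K A j H U \<gamma> \<pi> F"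
    and "Y \<in> K \<Longrightarrow> star (BH H Y) (\<Gamma> Y) = \<Gamma> Y"
    and "Y \<in> K \<Longrightarrow> unitary_map (H Y) (H Y) (\<Gamma> Y)"
    and "Y \<in> K \<Longrightarrow> t \<in> carrier (A Y) \<Longrightarrow> \<gamma> Y (\<pi> Y t) = \<pi> Y (\<beta> Y t)"
    and "Y \<in> K \<Longrightarrow> \<gamma> Y (F Y) = \<ominus>\<^bsub>BH H Y\<^esub> F Y"
  using ev unfolding even_fredholm_module_def Let_def by simp_all

lemma even_fredholm_section: "net_section K (BH H) (adU H U) F"
  and even_fredholm_self_adjoint: "Y \<in> K \<Longrightarrow> star (BH H Y) (F Y) = F Y"
  and even_fredholm_commutator: "Y \<in> K \<Longrightarrow> t \<in> carrier (A Y) \<Longrightarrow> commutator cv (BH H Y) (\<gamma> Y) (F Y) (\<pi> Y t) \<in> compact_operators (H Y)"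
  using even_fredholmD(3) unfolding fredholm_conditions_def by blast+

lemmas \<Gamma>_closed = section_closed[OF even_fredholmD(2)]

lemma \<Gamma>_\<Gamma>:
  assumes Y: "Y \<in> K" and h: "h \<in> carrier (H Y)"
  shows "\<Gamma> Y (\<Gamma> Y h) = h"
proof (rule hilbert_space.self_adjoint_unitary_involution[OF H_hilbert[OF Y] even_fredholmD(5)[OF Y] _ _ h])
  show "\<Gamma> Y \<in> hilbert_space.BOps (H Y)"
    using section_carrier[OF even_fredholmD(2) Y] unfolding BH_carrier[OF Y] .
  show "adjoint_op (H Y) (\<Gamma> Y) = \<Gamma> Y"
    using even_fredholmD(4)[OF Y] unfolding net_operators[OF Y] operator_algebra_sel .
qed

lemma \<gamma>_apply: "Y \<in> K \<Longrightarrow> h \<in> carrier (H Y) \<Longrightarrow> \<gamma> Y T h = \<Gamma> Y (T (\<Gamma> Y h))"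
  by (rule ad_involution) (simp_all add: \<Gamma>_\<Gamma> \<Gamma>_closed)

lemma \<Gamma>_F:
  assumes Y: "Y \<in> K" and h: "h \<in> carrier (H Y)"
  shows "\<Gamma> Y (F Y (\<Gamma> Y h)) = (-1) \<odot>\<^bsub>H Y\<^esub> F Y h"
proof -
  interpret HY: hilbert_space "H Y" by (rule H_hilbert[OF Y])
  have "F Y \<in> carrier HY.B.OA"
    using section_carrier[OF even_fredholm_section Y] unfolding BH_carrier[OF Y] by simp
  from HY.B.OM.v_neg[OF this] have "\<gamma> Y (F Y) = (-1) \<odot>\<^bsub>HY.B.OA\<^esub> F Y"
    unfolding even_fredholmD(7)[OF Y] net_operators[OF Y] .
  then show ?thesis
    using \<gamma>_apply[OF Y h, of "F Y"] h by simp
qed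

abbreviation "\<Gamma>h \<equiv> hat_field \<Gamma>"

lemmas \<Gamma>h_closed = F.BOpsD(3)[OF hat_field_BOps[OF even_fredholmD(2)]]

lemma hat_field_involution: "\<xi> \<in> carrier (Hx x) \<Longrightarrow> \<Gamma>h x (\<Gamma>h x \<xi>) = \<xi>"
proof -
  assume \<xi>: "\<xi> \<in> carrier (Hx x)"
  obtain Y where Y: "Y \<in> K" "x \<in> Y"
    using K_cover by blast
  show ?thesis
    using \<xi> Vi_closed[OF Y \<xi>]
    by (simp add: hat_field_apply[OF even_fredholmD(2) Y] V_closed[OF Y] Vi_V[OF Y] V_Vi[OF Y] \<Gamma>_closed[OF Y(1)] \<Gamma>_\<Gamma>[OF Y(1)])
qed

lemma hat_field_ip: "\<xi> \<in> carrier (Hx x) \<Longrightarrow> \<eta> \<in> carrier (Hx x) \<Longrightarrow> ip (Hx x) (\<Gamma>h x \<xi>) (\<Gamma>h x \<eta>) = ip (Hx x) \<xi> \<eta>"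
  using hat_field_self_adjoint[OF even_fredholmD(2) even_fredholmD(4), of \<xi> x "\<Gamma>h x \<eta>"]
  by (simp add: \<Gamma>h_closed hat_field_involution)

lemma hat_field_odd: "\<xi> \<in> carrier (Hx x) \<Longrightarrow> \<Gamma>h x (hat_field F x (\<Gamma>h x \<xi>)) = (-1) \<odot>\<^bsub>Hx x\<^esub> hat_field F x \<xi>"
proof -
  assume \<xi>: "\<xi> \<in> carrier (Hx x)"
  obtain Y where Y: "Y \<in> K" "x \<in> Y"
    using K_cover by blast
  note c = Vi_closed[OF Y \<xi>] section_closed[OF even_fredholm_section Y(1)]
  show ?thesis
    using \<xi> c unitary_pair.U_smult[OF V_unitary[OF Y], of "F Y (Vi x Y \<xi>)" "-1"]
    by (simp add: hat_field_apply[OF even_fredholmD(2) Y] hat_field_apply[OF even_fredholm_section Y]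
        V_closed[OF Y] Vi_V[OF Y] \<Gamma>_closed[OF Y(1)] \<Gamma>_F[OF Y(1)])
qed

lemma hat_field_unitary: "unitary_pair (Hx x) (Hx x) (\<Gamma>h x)"
proof (intro unitary_pair.intro unitary_pair_axioms.intro F.hilbert_space_axioms)
  have "\<Gamma>h x ` carrier (Hx x) = carrier (Hx x)"
  proof (intro equalityI subsetI)
    fix \<xi> assume \<xi>: "\<xi> \<in> carrier (Hx x)"
    show "\<xi> \<in> \<Gamma>h x ` carrier (Hx x)"
      by (rule image_eqI[of _ _ "\<Gamma>h x \<xi>"]) (simp_all add: \<xi> \<Gamma>h_closed hat_field_involution)
  qed (auto simp: \<Gamma>h_closed)
  then show "unitary_map (Hx x) (Hx x) (\<Gamma>h x)"
    using F.BOpsD(4,5)[OF hat_field_BOps[OF even_fredholmD(2)]]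
    by (simp add: unitary_map_def linear_map_def hat_field_ip \<Gamma>h_closed)
qed

context
  fixes \<mu> assumes \<mu>: "fibrewise_morphism Ax K A \<epsilon> Ax A \<epsilon> \<beta> \<mu>"
begin

interpretation T: fibrewise_morphism Ax K A \<epsilon> Ax A \<epsilon> \<beta> \<mu> by (rule \<mu>)

text \<open>Since \<beta> squares to the identity, the squared fibre maps and the identity maps are
  families over the same net morphism, and uniqueness applies.\<close>

lemma grading_involution:
  assumes a: "a \<in> carrier NA.AA"
  shows "T.\<Phi> (T.\<Phi> a) = a"
proof (rule ext)
  fix x
  have \<beta>\<beta>: "\<beta> Y (\<beta> Y t) = t" "\<beta> Y t \<in> carrier (A Y)" if "Y \<in> K" "t \<in> carrier (A Y)" for Y t
    using even_fredholmD(1) that star_homD(1)[OF T.\<phi>_hom[OF that(1)] that(2)] by (simp_all add: net_grading_def)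
  have "fibrewise_morphism Ax K A \<epsilon> Ax A \<epsilon> (\<lambda>Y t. t) (\<lambda>x c. \<mu> x (\<mu> x c))"
  proof (intro fibrewise_morphism.intro fibrewise_morphism_axioms.intro NA.net_fields_axioms)
    show "star_hom (A Y) (A Y) (\<lambda>t. t)" if "Y \<in> K" for Y
      by (rule fibrewise_morphism.\<phi>_hom[OF id_fibres that])
    show "star_hom (Ax x) (Ax x) (\<lambda>c. \<mu> x (\<mu> x c))" for x
      by (rule star_hom_compose[OF T.\<kappa>_hom T.\<kappa>_hom])
    show "\<mu> x (\<mu> x (\<epsilon> x Y t)) = \<epsilon> x Y t" if "Y \<in> K" "x \<in> Y" "t \<in> carrier (A Y)" for x Y t
      using that by (simp add: T.\<kappa>_\<epsilon> \<beta>\<beta>)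
  qed
  from fibrewise_morphism.\<kappa>_unique[OF id_fibres this a, of x]
  show "T.\<Phi> (T.\<Phi> a) x = a x"
    unfolding T.\<Phi>_apply[OF T.\<Phi>_closed[OF a]] T.\<Phi>_apply[OF a] by (rule sym)
qed

lemma grading_C0_grading: "C0_grading NA.AA (pointwise_action Ax NA.AA) T.\<Phi>"
  unfolding C0_grading_def
  by (intro conjI T.\<Phi>_C0_morphism bij_betw_byWitness[of _ T.\<Phi>]) (auto simp: grading_involution T.\<Phi>_closed simp del: NA.AA_sel)

text \<open>Two families over the net morphism \<pi> \<circ> \<beta> are compared: the fibre grading
  followed by \<open>\<kappa>\<close>, and \<open>\<kappa>\<close> followed by conjugation with the
  operators of \<Gamma>. On the images of the algebras of the net both have the prescribed values,
  the second because \<pi> is graded, so they agree on all fields.\<close>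

lemma hat_field_\<Phi>:
  assumes a: "a \<in> carrier NA.AA" and \<xi>: "\<xi> \<in> carrier (Hx x)"
  shows "\<Gamma>h x (M.\<Phi> a x (\<Gamma>h x \<xi>)) = M.\<Phi> (T.\<Phi> a) x \<xi>"
proof -
  let ?G = "\<lambda>x. ad (carrier (Hx x)) (carrier (Hx x)) (\<Gamma>h x)"
  have G: "?G x S \<xi> = \<Gamma>h x (S (\<Gamma>h x \<xi>))" if "\<xi> \<in> carrier (Hx x)" for x S \<xi>
    by (rule ad_involution) (simp_all add: that \<Gamma>h_closed hat_field_involution)
  have 1: "fibrewise_morphism Ax K A \<epsilon> Bx (BH H) (adV H Hx V) (\<lambda>Y t. \<pi> Y (\<beta> Y t)) (\<lambda>x c. \<kappa> x (\<mu> x c))"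
  proof (intro fibrewise_morphism.intro fibrewise_morphism_axioms.intro NA.net_fields_axioms NB.net_fields_axioms)
    show "star_hom (A Y) (BH H Y) (\<lambda>t. \<pi> Y (\<beta> Y t))" if "Y \<in> K" for Y
      by (rule star_hom_compose[OF T.\<phi>_hom[OF that] M.\<phi>_hom[OF that]])
    show "star_hom (Ax x) (Bx x) (\<lambda>c. \<kappa> x (\<mu> x c))" for x
      by (rule star_hom_compose[OF T.\<kappa>_hom M.\<kappa>_hom])
    show "\<kappa> x (\<mu> x (\<epsilon> x Y t)) = adV H Hx V x Y (\<pi> Y (\<beta> Y t))" if "Y \<in> K" "x \<in> Y" "t \<in> carrier (A Y)" for x Y t
      using that star_homD(1)[OF T.\<phi>_hom[OF that(1)] that(3)] by (simp add: T.\<kappa>_\<epsilon> M.\<kappa>_\<epsilon>)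
  qed
  have 2: "fibrewise_morphism Ax K A \<epsilon> Bx (BH H) (adV H Hx V) (\<lambda>Y t. \<pi> Y (\<beta> Y t)) (\<lambda>x c. ?G x (\<kappa> x c))"
  proof (intro fibrewise_morphism.intro fibrewise_morphism_axioms.intro NA.net_fields_axioms NB.net_fields_axioms)
    show "star_hom (A Y) (BH H Y) (\<lambda>t. \<pi> Y (\<beta> Y t))" if "Y \<in> K" for Y
      by (rule star_hom_compose[OF T.\<phi>_hom[OF that] M.\<phi>_hom[OF that]])
    show "star_hom (Ax x) (Bx x) (\<lambda>c. ?G x (\<kappa> x c))" for x
      by (rule star_hom_compose[OF M.\<kappa>_hom unitary_pair.ad_star_hom[OF hat_field_unitary]])
    fix x Y t assume Y: "Y \<in> K" "x \<in> Y" and t: "t \<in> carrier (A Y)"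
    show "?G x (\<kappa> x (\<epsilon> x Y t)) = adV H Hx V x Y (\<pi> Y (\<beta> Y t))"
      unfolding M.\<kappa>_\<epsilon>[OF Y t] adV_def[of H Hx V x Y] ad_def[of "carrier (Hx x)"] ad_def[of "carrier (H Y)"]
    proof (rule restrict_ext)
      fix \<xi> assume \<xi>: "\<xi> \<in> carrier (Hx x)"
      define k where "k = Vi x Y \<xi>"
      have k: "k \<in> carrier (H Y)"
        unfolding k_def by (rule Vi_closed[OF Y \<xi>])
      note c = k \<Gamma>_closed[OF Y(1)] \<pi>_closed[OF Y(1) t] V_closed[OF Y]
      have "?G x (adV H Hx V x Y (\<pi> Y t)) \<xi> = V x Y (\<Gamma> Y (\<pi> Y t (\<Gamma> Y k)))"
        unfolding G[OF \<xi>]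
        using \<xi> c by (simp add: adV_apply[OF Y] hat_field_apply[OF even_fredholmD(2) Y] Vi_V[OF Y] k_def)
      also have "\<dots> = V x Y (\<pi> Y (\<beta> Y t) k)"
        using \<gamma>_apply[OF Y(1) k, of "\<pi> Y t"] even_fredholmD(6)[OF Y(1) t] by simp
      finally show "\<Gamma>h x ((\<lambda>v\<in>carrier (Hx x). V x Y (\<pi> Y t (inv_into (carrier (H Y)) (V x Y) v)))
          (inv_into (carrier (Hx x)) (\<Gamma>h x) \<xi>)) = V x Y (\<pi> Y (\<beta> Y t) (inv_into (carrier (H Y)) (V x Y) \<xi>))"
        using \<xi> by (simp add: k_def Vi_def adV_def ad_def)
    qed
  qed
  have "\<kappa> x (\<mu> x (a x)) = ?G x (\<kappa> x (a x))"
    by (rule fibrewise_morphism.\<kappa>_unique[OF 1 2 a])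
  then show ?thesis
    unfolding M.\<Phi>_apply[OF T.\<Phi>_closed[OF a]] M.\<Phi>_apply[OF a] T.\<Phi>_apply[OF a] using G[OF \<xi>] by simp
qed

end

end

end

section \<open>The even bimodule under both commutator conventions\<close>

context represented_net
begin

text \<open>The plain commutator is twisted by the identity. The graded one is twisted by \<beta>,
  because F is odd and conjugation by \<Gamma> sends \<pi>(t) to \<pi>(\<beta> t); the corresponding
  two facts on the module, \<open>ad_f\<close> and \<open>ad_rep\<close>, make the same reading of
  the commutator available there.\<close>

theorem even_kasparov_bimodule:
  assumes ev: "even_fredholm_module cv K A j \<beta> H U \<Gamma> \<pi> F"
  shows "kasparov_bimodule cv NA.AA (pointwise_action Ax NA.AA) (induced_morphism K A Ax \<epsilon> A Ax \<epsilon> \<beta>)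
    E (hat_operator K H Hx V \<T> \<Gamma>) (induced_representation K A Ax \<epsilon> H Hx V \<T> \<pi>) (hat_operator K H Hx V \<T> F)"
proof -
  have sF: "net_section K (BH H) (adU H U) F" and s\<Gamma>: "net_section K (BH H) (adU H U) \<Gamma>"
    and sa: "\<And>Y. Y \<in> K \<Longrightarrow> star (BH H Y) (F Y) = F Y"
    by (rule even_fredholm_section[OF ev], rule even_fredholmD(2)[OF ev], rule even_fredholm_self_adjoint[OF ev])
  have \<beta>: "net_morphism K A j A j \<beta>"
    using even_fredholmD(1)[OF ev] by (simp add: net_grading_def)
  obtain \<mu> where \<mu>: "fibrewise_morphism Ax K A \<epsilon> Ax A \<epsilon> \<beta> \<mu>"
    using net_endomorphism_fibres[OF \<beta>] by blast
  interpret T: fibrewise_morphism Ax K A \<epsilon> Ax A \<epsilon> \<beta> \<mu> by (rule \<mu>)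
  define G where "G = fibrewise E (hat_field \<Gamma>)"
  define f where "f = fibrewise E (hat_field F)"
  have GA: "G \<in> AOps"
    unfolding G_def by (rule \<phi>F_AOps(1)[OF s\<Gamma> even_fredholmD(4)[OF ev]])
  have fA: "f \<in> AOps"
    unfolding f_def by (rule \<phi>F_AOps(1)[OF sF sa])
  have G: "G v x = hat_field \<Gamma> x (v x)" if "v \<in> carrier E" for v x
    unfolding G_def fibrewise_apply[OF that] by (rule refl)
  have f: "f v x = hat_field F x (v x)" if "v \<in> carrier E" for v x
    unfolding f_def fibrewise_apply[OF that] by (rule refl)
  have r: "rep a v x = M.\<Phi> a x (v x)" if "v \<in> carrier E" for a v x
    unfolding rep_apply[OF that] by (rule refl)
  have Gc: "G v \<in> carrier E" if "v \<in> carrier E" for v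
    by (rule A.O_closed[OF GA that])
  have GG: "G (G v) = v" if v: "v \<in> carrier E" for v
    by (rule ext) (simp add: G[OF Gc[OF v]] G[OF v] hat_field_involution[OF ev E_fibre[OF v]])
  have adG: "ad (carrier E) (carrier E) G S v = G (S (G v))" if "v \<in> carrier E" for S v
    by (rule ad_involution[OF Gc GG that])
  have ad_rep: "ad (carrier E) (carrier E) G (rep a) = rep (T.\<Phi> a)" if a: "a \<in> carrier NA.AA" for a
    unfolding fibrewise_def[of E "M.\<Phi> (T.\<Phi> a)"] ad_def
  proof (rule restrict_ext, rule ext)
    fix v x assume v: "v \<in> carrier E"
    have "ad (carrier E) (carrier E) G (rep a) v x = M.\<Phi> (T.\<Phi> a) x (v x)"
      unfolding adG[OF v] G[OF A.O_closed[OF rep_AOps(1)[OF a] Gc[OF v]]] r[OF Gc[OF v]] G[OF v]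
      by (rule hat_field_\<Phi>[OF ev \<mu> a E_fibre[OF v]])
    then show "G (rep a (inv_into (carrier E) G v)) x = M.\<Phi> (T.\<Phi> a) x (v x)"
      using v by (simp add: ad_def)
  qed
  have ad_f: "ad (carrier E) (carrier E) G f = \<ominus>\<^bsub>A.OA\<^esub> f"
  proof -
    have "ad (carrier E) (carrier E) G f v = (-1) \<odot>\<^bsub>E\<^esub> f v" if v: "v \<in> carrier E" for v
      unfolding adG[OF v]
    proof (rule ext)
      fix x
      show "G (f (G v)) x = ((-1) \<odot>\<^bsub>E\<^esub> f v) x"
        unfolding G[OF A.O_closed[OF fA Gc[OF v]]] f[OF Gc[OF v]] G[OF v] E_sel f[OF v]
        by (rule hat_field_odd[OF ev E_fibre[OF v]])
    qed
    then have "ad (carrier E) (carrier E) G f = (\<lambda>v\<in>carrier E. (-1) \<odot>\<^bsub>E\<^esub> f v)"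
      by (intro ext) (simp add: ad_def restrict_def del: E_sel)
    also have "\<dots> = (-1) \<odot>\<^bsub>A.OA\<^esub> f"
      unfolding operator_algebra_sel ..
    also have "\<dots> = \<ominus>\<^bsub>A.OA\<^esub> f"
      by (rule A.OM.v_neg[symmetric]) (use fA in simp)
    finally show ?thesis .
  qed
  have mg: "module_grading C0_alg E G"
    unfolding module_grading_def
  proof (intro conjI ballI)
    show "linear_map E E G"
      by (rule A.O_linear[OF GA])
    fix v w assume v: "v \<in> carrier E" and w: "w \<in> carrier E"
    show "ip E (G v) (G w) = ip E v w"
      unfolding E_sel G[OF v] G[OF w] hat_field_ip[OF ev E_fibre[OF v] E_fibre[OF w]] ..
  next
    fix v b assume v: "v \<in> carrier E" and b: "b \<in> carrier (C0_alg :: ('x \<Rightarrow> complex) star_alg)"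
    have bv: "ract E v b \<in> carrier E"
      using E_C0_smult[OF _ v, of b] b by (simp add: C0_alg_def)
    show "G (ract E v b) = ract E (G v) b"
    proof (rule ext)
      fix x
      show "G (ract E v b) x = ract E (G v) b x"
        using Fh_smult[OF s\<Gamma> E_fibre[OF v], of x "b x"] G[OF bv, of x] G[OF v, of x] by simp
    qed
  qed (rule GG)
  have comm: "commutator cv A.OA (ad (carrier E) (carrier E) G) f (rep a) \<in> KE" if a: "a \<in> carrier NA.AA" for a
  proof -
    note ra = rep_AOps(1)[OF a] and rT = rep_AOps(1)[OF T.\<Phi>_closed[OF a]]
    have FB: "F Y \<in> hilbert_space.BOps (H Y)" if "Y \<in> K" for Y
      using section_carrier[OF sF that] unfolding BH_carrier[OF that] .
    show ?thesis
    proof (cases cv)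
      case Plain
      have c: "(\<lambda>h\<in>carrier (H Y). F Y (\<pi> Y t h) \<ominus>\<^bsub>H Y\<^esub> \<pi> Y t (F Y h)) \<in> compact_operators (H Y)"
        if Y: "Y \<in> K" and t: "t \<in> carrier (A Y)" for Y t
      proof -
        interpret HY: hilbert_space "H Y" by (rule H_hilbert[OF Y])
        show ?thesis
          using even_fredholm_commutator[OF ev Y t]
          unfolding Plain net_operators[OF Y] HY.B.commutator_plain[OF FB[OF Y] \<pi>_BOps[OF Y t]] .
      qed
      show ?thesis
        unfolding Plain A.commutator_plain[OF fA ra]
        unfolding f_def
        by (rule twisted_commutator_compact[OF sF sa id_fibres c a id_fibres_\<Phi>[OF a, symmetric]])
    next
      case Graded
      have c: "(\<lambda>h\<in>carrier (H Y). F Y (\<pi> Y t h) \<ominus>\<^bsub>H Y\<^esub> \<pi> Y (\<beta> Y t) (F Y h)) \<in> compact_operators (H Y)"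
        if Y: "Y \<in> K" and t: "t \<in> carrier (A Y)" for Y t
      proof -
        interpret HY: hilbert_space "H Y" by (rule H_hilbert[OF Y])
        note \<beta>t = star_homD(1)[OF T.\<phi>_hom[OF Y] t]
        show ?thesis
          using even_fredholm_commutator[OF ev Y t]
          unfolding Graded net_operators[OF Y] HY.B.commutator_graded_odd[where \<gamma> = "ad (carrier (H Y)) (carrier (H Y)) (\<Gamma> Y)",
            OF FB[OF Y] \<pi>_BOps[OF Y t] \<pi>_BOps[OF Y \<beta>t] even_fredholmD(7)[OF ev Y, unfolded net_operators[OF Y]] even_fredholmD(6)[OF ev Y t]] .
      qed
      show ?thesis
        unfolding Graded A.commutator_graded_odd[where \<gamma> = "ad (carrier E) (carrier E) G", OF fA ra rT ad_f ad_rep[OF a]]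
        unfolding f_def
        by (rule twisted_commutator_compact[OF sF sa \<mu> c a refl])
    qed
  qed
  show ?thesis
    unfolding T.induced_morphism_eq hat_operator_eq[of \<Gamma>] G_def[symmetric]
    by (rule kasparov_bimoduleI[OF sF sa fredholm_square[OF even_fredholmD(3)[OF ev]]
        grading_C0_grading[OF ev \<mu>] mg ad_rep comm[unfolded f_def]])
qed

end

theorem theorem5p3:
  fixes K :: "'x::topological_space set set"
    and A :: "'x set \<Rightarrow> 'a star_alg"
    and j :: "'x set \<Rightarrow> 'x set \<Rightarrow> 'a \<Rightarrow> 'a"
    and Ax :: "'x \<Rightarrow> ('x set, 'a) univ_carrier star_alg"
    and \<epsilon> :: "'x \<Rightarrow> 'x set \<Rightarrow> 'a \<Rightarrow> ('x set, 'a) univ_carrier"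
    and H :: "'x set \<Rightarrow> (complex, 'h) ip_module"
    and U :: "'x set \<Rightarrow> 'x set \<Rightarrow> 'h \<Rightarrow> 'h"
    and \<pi> :: "'x set \<Rightarrow> 'a \<Rightarrow> 'h \<Rightarrow> 'h"
    and F :: "'x set \<Rightarrow> 'h \<Rightarrow> 'h"
    and Hx :: "'x \<Rightarrow> (complex, 'k) ip_module"
    and V :: "'x \<Rightarrow> 'x set \<Rightarrow> 'h \<Rightarrow> 'k"
    and \<T> :: "('x \<times> 'k) topology"
    and cv :: commutator_convention
  assumes "connected (UNIV :: 'x set)"
    and "locally_compact_space (euclidean :: 'x topology)"
    and "sigma_compact (UNIV :: 'x set)"
    and "metrizable_space (euclidean :: 'x topology)"
    and "good_base K"
    and "cstar_net K A j"
    and "\<And>x. universal_cstar_algebra (omega K x) A j (Ax x) (\<epsilon> x)"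
    and "associated_hilbert_bundle K H U Hx V \<T>"
  shows "(\<forall>\<beta> \<Gamma>. even_fredholm_module cv K A j \<beta> H U \<Gamma> \<pi> F \<longrightarrow>
            kasparov_bimodule cv (net_algebra K A Ax \<epsilon>)
              (pointwise_action Ax (net_algebra K A Ax \<epsilon>))
              (induced_morphism K A Ax \<epsilon> A Ax \<epsilon> \<beta>)
              (section_module Hx \<T>) (hat_operator K H Hx V \<T> \<Gamma>)
              (induced_representation K A Ax \<epsilon> H Hx V \<T> \<pi>)
              (hat_operator K H Hx V \<T> F)) \<and>
         (odd_fredholm_module cv K A j H U \<pi> F \<longrightarrow>
            kasparov_bimodule cv (net_algebra K A Ax \<epsilon>)
              (pointwise_action Ax (net_algebra K A Ax \<epsilon>)) id
              (section_module Hx \<T>) id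
              (induced_representation K A Ax \<epsilon> H Hx V \<T> \<pi>)
              (hat_operator K H Hx V \<T> F))"
proof -
  have Hausdorff: "Hausdorff_space (euclidean :: 'x topology)"
    by (rule metrizable_imp_Hausdorff_space) fact
  \<comment> \<open>The conditions shared by both parities already contain the Hilbert net bundle
    and the representation, and hence give the fibre maps.\<close>
  have rep: "\<exists>\<kappa>. represented_net K H U Hx V \<T> A j Ax \<epsilon> \<pi> \<kappa>"
    if "fredholm_conditions cv K A j H U \<gamma> \<pi> F" for \<gamma>
  proof -
    have nb: "hilbert_net_bundle K H U" and \<pi>: "net_morphism K A j (BH H) (adU H U) \<pi>"
      using that by (simp_all add: fredholm_conditions_def)
    have "bundle_over_net K H U Hx V \<T> A j Ax \<epsilon>"
      using assms Hausdorff nb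
      by (intro bundle_over_net.intro hilbert_bundle.intro bundle_over_net_axioms.intro) (simp_all add: good_base_def)
    then show ?thesis
      using bundle_over_net.net_representation_fibres[OF _ \<pi>] by (blast intro: represented_net.intro)
  qed
  show ?thesis
  proof (intro conjI allI impI)
    fix \<beta> \<Gamma> assume ev: "even_fredholm_module cv K A j \<beta> H U \<Gamma> \<pi> F"
    then obtain \<kappa> where "represented_net K H U Hx V \<T> A j Ax \<epsilon> \<pi> \<kappa>"
      using rep unfolding even_fredholm_module_def Let_def by blast
    then show "kasparov_bimodule cv (net_algebra K A Ax \<epsilon>)
        (pointwise_action Ax (net_algebra K A Ax \<epsilon>)) (induced_morphism K A Ax \<epsilon> A Ax \<epsilon> \<beta>)
        (section_module Hx \<T>) (hat_operator K H Hx V \<T> \<Gamma>)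
        (induced_representation K A Ax \<epsilon> H Hx V \<T> \<pi>) (hat_operator K H Hx V \<T> F)"
      by (rule represented_net.even_kasparov_bimodule[OF _ ev])
  next
    assume odd: "odd_fredholm_module cv K A j H U \<pi> F"
    then obtain \<kappa> where "represented_net K H U Hx V \<T> A j Ax \<epsilon> \<pi> \<kappa>"
      using rep unfolding odd_fredholm_module_def by blast
    then show "kasparov_bimodule cv (net_algebra K A Ax \<epsilon>)
        (pointwise_action Ax (net_algebra K A Ax \<epsilon>)) id (section_module Hx \<T>) id
        (induced_representation K A Ax \<epsilon> H Hx V \<T> \<pi>) (hat_operator K H Hx V \<T> F)"
      by (rule represented_net.odd_kasparov_bimodule[OF _ odd])
  qed
qed

end
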